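(* Let $\alpha, \beta, \epsilon \in \mathbb{N}$ with $\alpha < \beta < \epsilon$. Let $K$ be a (possibly infinite) field of prime characteristic $p$ with $|K| > 1+ 2(p^\epsilon + p^\beta)(p^\alpha + p^\beta + 1) - p^\alpha(p^\alpha + 1)$, and let $E$ be the natural $2$-dimensional representation of $\mathrm{SL}_2(K)$. Then the eight representations of $\mathrm{SL}_2(K)$ obtained from $\Delta^{(p^{\alpha}+1, 1^{p^\beta})} \mathrm{Sym}^{p^\epsilon + p^\beta} E$ by any combination of (i) replacing $\Delta$ with $\nabla$, (ii) replacing the upper symmetric power $\mathrm{Sym}^{p^\epsilon+p^\beta}$ with the lower symmetric power $\mathrm{Sym}_{p^\epsilon+p^\beta}$, (iii) swapping $\alpha$ and $\beta$ (throughout, so that the partition becomes $(p^\beta+1,1^{p^\alpha})$ and the symmetric power exponent becomes $p^\epsilon+p^\alpha$), are pairwise non-isomorphic.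
   Context: $\mathbb{N}$ denotes the positive integers. $(a+1,1^b)$ denotes the hook partition with one part $a+1$ followed by $b$ parts equal to $1$. For a $K$-vector space $V$, $S_r$ acts on $V^{\otimes r}$ by place permutation; $\mathrm{Sym}_r V=(V^{\otimes r})^{S_r}$ is the space of invariants and $\mathrm{Sym}^r V$ is the usual symmetric power (coinvariants: the quotient of $V^{\otimes r}$ by the span of all $w\cdot\sigma-w$). Schur functor $\nabla^\lambda$ for a partition $\lambda$ with $\ell(\lambda)$ parts: let $V$ be a $KG$-module with basis $\{v_i : i\in\mathcal{B}\}$, $\mathcal{B}\subseteq \mathbb{N}_0$. The Young diagram is $[\lambda]=\{(i,j): 1\le i\le \ell(\lambda), 1\le j\le\lambda_i\}$; a $\lambda$-tableau is a function $t:[\lambda]\to\mathcal{B}$. Permutations $\sigma$ of $[\lambda]$ act on the right on tableaux by $(t\cdot\sigma)(i,j)=t((i,j)\sigma^{-1})$. Let $\mathrm{CPP}(\lambda)$ be the group of permutations of $[\lambda]$ preserving each column setwise. Let $\mathrm{Sym}^\lambda V=\mathrm{Sym}^{\lambda_1}V\otimes\cdots\otimes\mathrm{Sym}^{\lambda_{\ell(\lambda)}}V$, let $\mathbf{s}(t)=\bigotimes_{i}\prod_{j}v_{t(i,j)}\in\mathrm{Sym}^\lambda V$, and let $\mathbf{e}(t)=\sum_{\sigma\in\mathrm{CPP}(\lambda)}\mathrm{sgn}(\sigma)\,\mathbf{s}(t\cdot\sigma)$. Then $\nabla^\lambda V$ is the subspace of $\mathrm{Sym}^\lambda V$ spanned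 by all $\mathbf{e}(t)$; it is a $KG$-submodule. The dual functor is $\Delta^\lambda V=(\nabla^\lambda(V^\star))^\star$, where $\star$ denotes the usual dual representation. *)

theory Defs
  imports
    "HOL-Analysis.Determinants"
    "HOL-Algebra.Algebraic_Closure_Type"
    "HOL-Combinatorics.Permutations"
    "HOL-Library.Poly_Mapping"
begin

text \<open>
  The field is the type \<^typ>\<open>'k\<close>; its ring record is \<^const>\<open>ring_of_type_algebra\<close>. A
  representation is a module record together with an action. As usual for module records,
  the fields \<^const>\<open>mult\<close> and \<^const>\<open>one\<close> carry no meaning.
\<close>

record ('g, 'k, 'v) rep = "('k, 'v) module" +
  act :: "'g \<Rightarrow> 'v \<Rightarrow> 'v"

definition rep_iso :: "('g, 'm) monoid_scheme \<Rightarrow> ('g, 'k, 'v) rep \<Rightarrow> ('g, 'k, 'w) rep \<Rightarrow> ('v \<Rightarrow> 'w) set" where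
  "rep_iso G V W = {f. bij_betw f (carrier V) (carrier W) \<and>
     (\<forall>x\<in>carrier V. \<forall>y\<in>carrier V. f (x \<oplus>\<^bsub>V\<^esub> y) = f x \<oplus>\<^bsub>W\<^esub> f y) \<and>
     (\<forall>c. \<forall>x\<in>carrier V. f (c \<odot>\<^bsub>V\<^esub> x) = c \<odot>\<^bsub>W\<^esub> f x) \<and>
     (\<forall>g\<in>carrier G. \<forall>x\<in>carrier V. f (act V g x) = act W g (f x))}"

definition rep_isomorphic :: "('g, 'm) monoid_scheme \<Rightarrow> ('g, 'k, 'v) rep \<Rightarrow> ('g, 'k, 'w) rep \<Rightarrow> bool" where
  "rep_isomorphic G V W \<longleftrightarrow> rep_iso G V W \<noteq> {}"

definition rep_span :: "('g, 'k::field, 'v) rep \<Rightarrow> 'v set \<Rightarrow> 'v set" where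
  "rep_span V S = \<Inter>{N. submodule N (ring_of_type_algebra :: 'k ring) V \<and> S \<subseteq> N}"

definition is_basis :: "('g, 'k::field, 'v) rep \<Rightarrow> 'v set \<Rightarrow> bool" where
  "is_basis V B \<longleftrightarrow> B \<subseteq> carrier V \<and>
     (\<forall>v\<in>carrier V. \<exists>!c :: 'v \<Rightarrow>\<^sub>0 'k. Poly_Mapping.keys c \<subseteq> B \<and>
        v = (\<Oplus>\<^bsub>V\<^esub>b\<in>Poly_Mapping.keys c. Poly_Mapping.lookup c b \<odot>\<^bsub>V\<^esub> b))"

text \<open>
  The map on cosets of \<^term>\<open>N\<close> induced by a map \<^term>\<open>h\<close> that sends cosets into cosets:
  for such \<^term>\<open>h\<close> all members of the union coincide.
\<close>

definition coset_map :: "('g, 'k, 'v) rep \<Rightarrow> 'v set \<Rightarrow> ('v \<Rightarrow> 'v) \<Rightarrow> 'v set \<Rightarrow> 'v set" where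
  "coset_map V N h A = (\<Union>a\<in>A. N +>\<^bsub>V\<^esub> h a)"

definition quot_rep :: "('g, 'k, 'v) rep \<Rightarrow> 'v set \<Rightarrow> ('g, 'k, 'v set) rep" where
  "quot_rep V N = \<lparr>carrier = a_rcosets\<^bsub>V\<^esub> N, mult = undefined, one = undefined,
     zero = N, add = (\<lambda>A B. A <+>\<^bsub>V\<^esub> B),
     module.smult = (\<lambda>c. coset_map V N (\<lambda>x. c \<odot>\<^bsub>V\<^esub> x)),
     act = (\<lambda>g. coset_map V N (act V g))\<rparr>"

definition dual_rep :: "('g, 'm) monoid_scheme \<Rightarrow> ('g, 'k::field, 'v) rep \<Rightarrow> ('g, 'k, 'v \<Rightarrow> 'k) rep" where
  "dual_rep G V = \<lparr>carrier = {\<phi> \<in> carrier V \<rightarrow>\<^sub>E UNIV.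
       (\<forall>x\<in>carrier V. \<forall>y\<in>carrier V. \<phi> (x \<oplus>\<^bsub>V\<^esub> y) = \<phi> x + \<phi> y) \<and>
       (\<forall>c. \<forall>x\<in>carrier V. \<phi> (c \<odot>\<^bsub>V\<^esub> x) = c * \<phi> x)},
     mult = undefined, one = undefined,
     zero = (\<lambda>x\<in>carrier V. 0),
     add = (\<lambda>\<phi> \<psi>. \<lambda>x\<in>carrier V. \<phi> x + \<psi> x),
     module.smult = (\<lambda>c \<phi>. \<lambda>x\<in>carrier V. c * \<phi> x),
     act = (\<lambda>g \<phi>. \<lambda>x\<in>carrier V. \<phi> (act V (inv\<^bsub>G\<^esub> g) x))\<rparr>"

definition free_map :: "('a \<Rightarrow> 'b) \<Rightarrow> ('a \<Rightarrow>\<^sub>0 'k::field) \<Rightarrow> ('b \<Rightarrow>\<^sub>0 'k)" where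
  "free_map h f = (\<Sum>x\<in>Poly_Mapping.keys f. Poly_Mapping.single (h x) (Poly_Mapping.lookup f x))"

text \<open>
  The tensor product of a list of representations is the free representation on the lists
  \<open>[x\<^sub>1, \<dots>, x\<^sub>n]\<close> with \<open>x\<^sub>i\<close> in the \<open>i\<close>th factor, modulo multilinearity.
\<close>

definition free_tensor :: "('g, 'k::field, 'v) rep list \<Rightarrow> ('g, 'k, 'v list \<Rightarrow>\<^sub>0 'k) rep" where
  "free_tensor Vs = \<lparr>carrier = {f. Poly_Mapping.keys f \<subseteq> listset (map carrier Vs)},
     mult = undefined, one = undefined,
     zero = 0, add = (+), module.smult = (\<lambda>c. Poly_Mapping.map ((*) c)),
     act = (\<lambda>g. free_map (map2 (\<lambda>V. act V g) Vs))\<rparr>"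

definition multilinear_rels :: "('g, 'k::field, 'v) rep list \<Rightarrow> ('v list \<Rightarrow>\<^sub>0 'k) set" where
  "multilinear_rels Vs =
     {Poly_Mapping.single (xs[i := x \<oplus>\<^bsub>Vs ! i\<^esub> y]) 1
        - Poly_Mapping.single (xs[i := x]) 1 - Poly_Mapping.single (xs[i := y]) 1 | xs i x y.
        xs \<in> listset (map carrier Vs) \<and> i < length Vs \<and> x \<in> carrier (Vs ! i) \<and> y \<in> carrier (Vs ! i)} \<union>
     {Poly_Mapping.single (xs[i := c \<odot>\<^bsub>Vs ! i\<^esub> x]) 1 - Poly_Mapping.single (xs[i := x]) c | xs i c x.
        xs \<in> listset (map carrier Vs) \<and> i < length Vs \<and> x \<in> carrier (Vs ! i)}"

definition tensor_ker :: "('g, 'k::field, 'v) rep list \<Rightarrow> ('v list \<Rightarrow>\<^sub>0 'k) set" where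
  "tensor_ker Vs = rep_span (free_tensor Vs) (multilinear_rels Vs)"

definition tensor :: "('g, 'k::field, 'v) rep list \<Rightarrow> ('g, 'k, ('v list \<Rightarrow>\<^sub>0 'k) set) rep" where
  "tensor Vs = quot_rep (free_tensor Vs) (tensor_ker Vs)"

definition pure_tensor :: "('g, 'k::field, 'v) rep list \<Rightarrow> 'v list \<Rightarrow> ('v list \<Rightarrow>\<^sub>0 'k) set" where
  "pure_tensor Vs xs = tensor_ker Vs +>\<^bsub>free_tensor Vs\<^esub> Poly_Mapping.single xs 1"

abbreviation tensor_power :: "nat \<Rightarrow> ('g, 'k::field, 'v) rep \<Rightarrow> ('g, 'k, ('v list \<Rightarrow>\<^sub>0 'k) set) rep" where
  "tensor_power r V \<equiv> tensor (replicate r V)"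

text \<open>
  Place permutation \<open>(x\<^sub>0 \<otimes> \<dots> \<otimes> x\<^bsub>r-1\<^esub>)\<sigma> = x\<^bsub>\<sigma>(0)\<^esub> \<otimes> \<dots> \<otimes> x\<^bsub>\<sigma>(r-1)\<^esub>\<close>. The
  invariants and the coinvariants do not change if \<open>\<sigma>\<close> is replaced by its inverse.
\<close>

definition place_perm :: "nat \<Rightarrow> ('g, 'k::field, 'v) rep \<Rightarrow> (nat \<Rightarrow> nat) \<Rightarrow>
    ('v list \<Rightarrow>\<^sub>0 'k) set \<Rightarrow> ('v list \<Rightarrow>\<^sub>0 'k) set" where
  "place_perm r V \<sigma> = coset_map (free_tensor (replicate r V)) (tensor_ker (replicate r V))
     (free_map (permute_list \<sigma>))"

definition sym_lower :: "nat \<Rightarrow> ('g, 'k::field, 'v) rep \<Rightarrow> ('g, 'k, ('v list \<Rightarrow>\<^sub>0 'k) set) rep" where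
  "sym_lower r V = (tensor_power r V)\<lparr>carrier :=
     {w \<in> carrier (tensor_power r V). \<forall>\<sigma>. \<sigma> permutes {..<r} \<longrightarrow> place_perm r V \<sigma> w = w}\<rparr>"

definition sym_ker :: "nat \<Rightarrow> ('g, 'k::field, 'v) rep \<Rightarrow> ('v list \<Rightarrow>\<^sub>0 'k) set set" where
  "sym_ker r V = rep_span (tensor_power r V)
     {place_perm r V \<sigma> w \<ominus>\<^bsub>tensor_power r V\<^esub> w | \<sigma> w.
        \<sigma> permutes {..<r} \<and> w \<in> carrier (tensor_power r V)}"

definition sym_upper :: "nat \<Rightarrow> ('g, 'k::field, 'v) rep \<Rightarrow> ('g, 'k, ('v list \<Rightarrow>\<^sub>0 'k) set set) rep" where
  "sym_upper r V = quot_rep (tensor_power r V) (sym_ker r V)"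

definition sym_prod :: "('g, 'k::field, 'v) rep \<Rightarrow> 'v list \<Rightarrow> ('v list \<Rightarrow>\<^sub>0 'k) set set" where
  "sym_prod V xs = sym_ker (length xs) V +>\<^bsub>tensor_power (length xs) V\<^esub>
     pure_tensor (replicate (length xs) V) xs"

text \<open>Partitions are lists of parts; the \<open>i\<close>th part (from 1) of \<open>\<lambda>\<close> is \<open>\<lambda> ! (i - 1)\<close>.\<close>

definition diagram :: "nat list \<Rightarrow> (nat \<times> nat) set" where
  "diagram lam = {(i, j). 1 \<le> i \<and> i \<le> length lam \<and> 1 \<le> j \<and> j \<le> lam ! (i - 1)}"

definition col_perms :: "nat list \<Rightarrow> (nat \<times> nat \<Rightarrow> nat \<times> nat) set" where
  "col_perms lam = {\<sigma>. \<sigma> permutes diagram lam \<and> (\<forall>x\<in>diagram lam. snd (\<sigma> x) = snd x)}"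

definition sym_lam :: "nat list \<Rightarrow> ('g, 'k::field, 'v) rep \<Rightarrow>
    ('g, 'k, (('v list \<Rightarrow>\<^sub>0 'k) set set list \<Rightarrow>\<^sub>0 'k) set) rep" where
  "sym_lam lam V = tensor (map (\<lambda>r. sym_upper r V) lam)"

definition row_tensor :: "nat list \<Rightarrow> ('g, 'k::field, 'v) rep \<Rightarrow> (nat \<times> nat \<Rightarrow> 'v) \<Rightarrow>
    (('v list \<Rightarrow>\<^sub>0 'k) set set list \<Rightarrow>\<^sub>0 'k) set" where
  "row_tensor lam V t = pure_tensor (map (\<lambda>r. sym_upper r V) lam)
     (map (\<lambda>i. sym_prod V (map (\<lambda>j. t (i, j)) [1..<Suc (lam ! (i - 1))])) [1..<Suc (length lam)])"

definition polytabloid :: "nat list \<Rightarrow> ('g, 'k::field, 'v) rep \<Rightarrow> (nat \<times> nat \<Rightarrow> 'v) \<Rightarrow>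
    (('v list \<Rightarrow>\<^sub>0 'k) set set list \<Rightarrow>\<^sub>0 'k) set" where
  "polytabloid lam V t = (\<Oplus>\<^bsub>sym_lam lam V\<^esub>\<sigma>\<in>col_perms lam.
     of_int (sign \<sigma>) \<odot>\<^bsub>sym_lam lam V\<^esub> row_tensor lam V (t \<circ> inv_into UNIV \<sigma>))"

text \<open>
  The basis from which tableau entries are taken is arbitrary; by multilinearity of \<open>\<^bold>e\<close> the
  span does not depend on the choice. Entries are basis vectors rather than their indices.
\<close>

definition nabla :: "nat list \<Rightarrow> ('g, 'k::field, 'v) rep \<Rightarrow>
    ('g, 'k, (('v list \<Rightarrow>\<^sub>0 'k) set set list \<Rightarrow>\<^sub>0 'k) set) rep" where
  "nabla lam V = (sym_lam lam V)\<lparr>carrier := rep_span (sym_lam lam V)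
     {polytabloid lam V t | t. t \<in> diagram lam \<rightarrow>\<^sub>E (SOME B. is_basis V B)}\<rparr>"

definition Delta :: "('g, 'm) monoid_scheme \<Rightarrow> nat list \<Rightarrow> ('g, 'k::field, 'v) rep \<Rightarrow>
    ('g, 'k, ((('v \<Rightarrow> 'k) list \<Rightarrow>\<^sub>0 'k) set set list \<Rightarrow>\<^sub>0 'k) set \<Rightarrow> 'k) rep" where
  "Delta G lam V = dual_rep G (nabla lam (dual_rep G V))"

definition hook :: "nat \<Rightarrow> nat \<Rightarrow> nat list" where
  "hook a b = (a + 1) # replicate b 1"

definition SL2 :: "('k::field ^ 2 ^ 2) monoid" where
  "SL2 = \<lparr>carrier = {A. det A = 1}, mult = (**), one = mat 1\<rparr>"

definition natural_rep :: "('k::field ^ 2 ^ 2, 'k, 'k ^ 2) rep" where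
  "natural_rep = \<lparr>carrier = UNIV, mult = undefined, one = undefined,
     zero = 0, add = (+), module.smult = (*s), act = (*v)\<rparr>"

end

(*
Write A = p^alpha, B = p^beta, Q = p^epsilon for a hook with A arm boxes and B leg boxes. In weight
bases of the symmetric powers the lower unipotent element f(z) acts by binomial coefficients times
powers of z. Modulo p one has C(Q+m, k) = C(m, k) + C(m, k-Q), so on a top weight vector the
leg determinant becomes a polynomial in z^Q after unimodular column operations, and the arm factor
is an A-th power, which is computed by Frobenius.

All eight representations have highest weight h = Q(A+B+1) + AB, which is symmetric in A and B.
For a vector v of weight h and a functional psi, the exponents of z which can occur in psi(f(z)v)
are an isomorphism invariant, since |K| is large. The exponent 1 occurs exactly for the lower
symmetric powers. For Delta of the upper powers, all exponents are multiples of the leg length B, and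
B occurs, whereas for Nabla no exponent strictly between 0 and min(AB, Q) occurs. If p is odd, the
exponent (B-1)Q separates the Nabla of the two upper powers. If p = 2, one looks at weight h-4
instead: exactly for the shorter leg, of length A, there is a nonzero vector v such that z^(2A-2)
never occurs in psi(f(z)v). Duality reduces the remaining pairs, with lower powers, to these cases.
*)

theory Submission
  imports Defs "Jordan_Normal_Form.Determinant" "HOL-Library.Function_Algebras"
begin

text \<open>The obstacle before any computation is that the representations are nested quotients of
  free modules, with a chosen basis inside \<open>nabla\<close>. So each construction first receives
  coordinates, until a hook tensor is a function from leg indices to polynomials: a determinant from
  the leg times a product of linear forms from the arm. Only two matrices of binomial coefficients
  then remain, exchanged by duality. The bound on the field enters twice. Over a finite field
  \<open>t ^ i\<close> only knows \<open>i\<close> modulo \<open>|K| - 1\<close>, so an eigenvector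
  of the torus need not be a weight vector. The weights fill a window from \<open>-h\<close> to
  \<open>h\<close>, and \<open>2 h + 1 < |K|\<close> separates them. Matrix coefficients have degree
  at most \<open>n = (Q + B)(A + B + 1)\<close>, so \<open>n < |K|\<close> makes their exponents
  well defined. Both follow from the stated bound because \<open>n = h + B (B + 1)\<close>.
  Characteristic 2 is exceptional because for \<open>A = 2\<close>, \<open>B = 4\<close> one has
  \<open>B - 1 = A + 1\<close>, and the exponent \<open>(B - 1) Q\<close> is then not excluded for
  the shorter leg. Weight \<open>h - 4\<close> is the second weight below the top; its space is
  spanned by five tableaux, few enough to be treated one by one.\<close>

abbreviation "lookup \<equiv> Poly_Mapping.lookup"
abbreviation "single \<equiv> Poly_Mapping.single"
abbreviation "keys \<equiv> Poly_Mapping.keys"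
abbreviation coeff :: "'a::zero poly \<Rightarrow> nat \<Rightarrow> 'a" where "coeff \<equiv> Polynomial.coeff"
abbreviation degree :: "'a::zero poly \<Rightarrow> nat" where "degree \<equiv> Polynomial.degree"
abbreviation monom :: "'a::zero \<Rightarrow> nat \<Rightarrow> 'a poly" where "monom \<equiv> Polynomial.monom"
abbreviation poly :: "'a::comm_semiring_0 poly \<Rightarrow> 'a \<Rightarrow> 'a" where "poly \<equiv> Polynomial.poly"

type_synonym 'k mpol = "nat multiset \<Rightarrow>\<^sub>0 'k"
type_synonym 'k mfun = "nat list \<Rightarrow> 'k mpol"

section \<open>Modules over a field given by records, and coordinates on them\<close>

abbreviation KR :: "'k::field ring" where "KR \<equiv> ring_of_type_algebra"

lemma KR_simps [simp]:
  "carrier (KR :: 'k::field ring) = UNIV" "mult KR = (\<lambda>x y. x * y :: 'k)" "one KR = (1::'k)"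
  "zero KR = (0::'k)" "add KR = (\<lambda>x y. x + y :: 'k)"
  by (simp_all add: ring_of_type_algebra_def)

lemma cring_KR: "cring (KR :: 'k::field ring)"
  by (rule comm_ring_1_class.cring_from_type_algebra)

text \<open>Negatives come for free: by \<open>null\<close>, \<open>l_distr\<close> and
  \<open>one\<close>, the multiple of \<open>x\<close> by -1 is an inverse of
  \<open>x\<close>.\<close>

lemma module_KR_I:
  fixes V :: "('g, 'k::field, 'v) rep"
  assumes zero: "\<zero>\<^bsub>V\<^esub> \<in> carrier V"
    and add: "\<And>x y. x \<in> carrier V \<Longrightarrow> y \<in> carrier V \<Longrightarrow> x \<oplus>\<^bsub>V\<^esub> y \<in> carrier V"
    and smult: "\<And>c x. x \<in> carrier V \<Longrightarrow> c \<odot>\<^bsub>V\<^esub> x \<in> carrier V"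
    and assoc: "\<And>x y z. x \<in> carrier V \<Longrightarrow> y \<in> carrier V \<Longrightarrow> z \<in> carrier V \<Longrightarrow>
      (x \<oplus>\<^bsub>V\<^esub> y) \<oplus>\<^bsub>V\<^esub> z = x \<oplus>\<^bsub>V\<^esub> (y \<oplus>\<^bsub>V\<^esub> z)"
    and comm: "\<And>x y. x \<in> carrier V \<Longrightarrow> y \<in> carrier V \<Longrightarrow> x \<oplus>\<^bsub>V\<^esub> y = y \<oplus>\<^bsub>V\<^esub> x"
    and l_zero: "\<And>x. x \<in> carrier V \<Longrightarrow> \<zero>\<^bsub>V\<^esub> \<oplus>\<^bsub>V\<^esub> x = x"
    and null: "\<And>x. x \<in> carrier V \<Longrightarrow> 0 \<odot>\<^bsub>V\<^esub> x = \<zero>\<^bsub>V\<^esub>"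
    and l_distr: "\<And>a b x. x \<in> carrier V \<Longrightarrow> (a + b) \<odot>\<^bsub>V\<^esub> x = a \<odot>\<^bsub>V\<^esub> x \<oplus>\<^bsub>V\<^esub> b \<odot>\<^bsub>V\<^esub> x"
    and r_distr: "\<And>a x y. x \<in> carrier V \<Longrightarrow> y \<in> carrier V \<Longrightarrow>
      a \<odot>\<^bsub>V\<^esub> (x \<oplus>\<^bsub>V\<^esub> y) = a \<odot>\<^bsub>V\<^esub> x \<oplus>\<^bsub>V\<^esub> a \<odot>\<^bsub>V\<^esub> y"
    and assoc1: "\<And>a b x. x \<in> carrier V \<Longrightarrow> (a * b) \<odot>\<^bsub>V\<^esub> x = a \<odot>\<^bsub>V\<^esub> (b \<odot>\<^bsub>V\<^esub> x)"
    and one: "\<And>x. x \<in> carrier V \<Longrightarrow> 1 \<odot>\<^bsub>V\<^esub> x = x"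
  shows "module KR V"
proof (rule moduleI)
  show "abelian_group V"
  proof (rule abelian_groupI)
    fix x assume x: "x \<in> carrier V"
    have "(-1) \<odot>\<^bsub>V\<^esub> x \<oplus>\<^bsub>V\<^esub> x = ((-1) + 1) \<odot>\<^bsub>V\<^esub> x"
      using x by (simp only: l_distr one)
    then show "\<exists>y\<in>carrier V. y \<oplus>\<^bsub>V\<^esub> x = \<zero>\<^bsub>V\<^esub>"
      using smult[OF x, of "-1"] null[OF x] by auto
  qed (use assms in auto)
qed (use assms cring_KR in auto)

text \<open>Closure under scalars contains closure under negation, which is all that separates the
  right-hand side from being a subgroup.\<close>

lemma submodule_KR_iff:
  fixes V :: "('g, 'k::field, 'v) rep"
  assumes "module KR V"
  shows "submodule N KR V \<longleftrightarrow> N \<subseteq> carrier V \<and> \<zero>\<^bsub>V\<^esub> \<in> N \<and> (\<forall>x\<in>N. \<forall>y\<in>N. x \<oplus>\<^bsub>V\<^esub> y \<in> N) \<and>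
    (\<forall>c. \<forall>x\<in>N. c \<odot>\<^bsub>V\<^esub> x \<in> N)" (is "_ \<longleftrightarrow> ?R")
proof
  interpret module KR V by fact
  {
    assume s: "submodule N KR V"
    then have "subgroup N (add_monoid V)"
      by (simp add: submodule_def)
    then show ?R
      using s subgroup.one_closed[of N "add_monoid V"] subgroup.m_closed[of N "add_monoid V"]
      using subgroup.subset[of N "add_monoid V"]
      by (auto simp: submodule_def submodule_axioms_def)
  }
  {
    assume r: ?R
    have "inv\<^bsub>add_monoid V\<^esub> x \<in> N" if "x \<in> N" for x
    proof -
      have "\<ominus>\<^bsub>V\<^esub> x = (-1) \<odot>\<^bsub>V\<^esub> x"
        using smult_l_minus[of 1 x] r that smult_one[of x]
        by (metis (no_types, lifting) KR_simps(1-5) R.minus_equality UNIV_I add.commute in_mono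
            add.left_inverse)
      then show ?thesis
        using r that by (metis a_inv_def)
    qed
    then have "subgroup N (add_monoid V)"
      using r by (intro add.subgroupI) (auto simp: a_inv_def)
    then show "submodule N KR V"
      using r by (simp add: submodule_def submodule_axioms_def)
  }
qed

lemma rep_span_least:
  assumes "submodule P KR V" "S \<subseteq> P" "x \<in> rep_span V S"
  shows "x \<in> P"
  using assms by (auto simp: rep_span_def)

lemma submodule_carrier:
  fixes V :: "('g, 'k::field, 'v) rep"
  assumes "module KR V"
  shows "submodule (carrier V) KR V"
proof -
  interpret module KR V by fact
  show ?thesis by (simp add: submodule_KR_iff[OF assms])
qed

lemma submodule_rep_span:
  assumes "module KR V" "S \<subseteq> carrier V"
  shows "submodule (rep_span V S) KR V"
  using rep_span_least[OF submodule_carrier[OF assms(1)] assms(2)]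
  unfolding submodule_KR_iff[OF assms(1)] rep_span_def
  by (auto simp: submodule_KR_iff[OF assms(1)])

lemma rep_span_superset: "S \<subseteq> rep_span V S"
  by (auto simp: rep_span_def)

text \<open>The vectors of the carrier that satisfy \<open>P\<close> form a submodule containing
  \<open>S\<close>, so the span lies inside it.\<close>

lemma rep_span_induct [consumes 3, case_names base zero add smult]:
  fixes V :: "('g, 'k::field, 'v) rep"
  assumes V: "module KR V" and S: "S \<subseteq> carrier V" and x: "x \<in> rep_span V S"
    and base: "\<And>x. x \<in> S \<Longrightarrow> P x" and P_zero: "P \<zero>\<^bsub>V\<^esub>"
    and P_add: "\<And>x y. x \<in> carrier V \<Longrightarrow> y \<in> carrier V \<Longrightarrow> P x \<Longrightarrow> P y \<Longrightarrow> P (x \<oplus>\<^bsub>V\<^esub> y)"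
    and P_smult: "\<And>c x. x \<in> carrier V \<Longrightarrow> P x \<Longrightarrow> P (c \<odot>\<^bsub>V\<^esub> x)"
  shows "P x"
proof -
  interpret module KR V by fact
  have "submodule {x \<in> carrier V. P x} KR V"
    unfolding submodule_KR_iff[OF V] using P_zero P_add P_smult by auto
  from rep_span_least[OF this _ x] show ?thesis
    using S base by auto
qed

definition act_linear :: "('g, 'm) monoid_scheme \<Rightarrow> ('g, 'k::field, 'v) rep \<Rightarrow> bool" where
  "act_linear G V \<longleftrightarrow> (\<forall>g\<in>carrier G. \<forall>x\<in>carrier V. act V g x \<in> carrier V \<and>
     (\<forall>y\<in>carrier V. act V g (x \<oplus>\<^bsub>V\<^esub> y) = act V g x \<oplus>\<^bsub>V\<^esub> act V g y) \<and>
     (\<forall>c. act V g (c \<odot>\<^bsub>V\<^esub> x) = c \<odot>\<^bsub>V\<^esub> act V g x))"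

text \<open>Encodes a linear isomorphism with the functions on the finite set \<open>I\<close>,
  extended by 0 so that vectors can be compared as total functions. The module axioms are pulled
  back along \<open>\<phi>\<close> in the lemma \<open>module\<close>.\<close>

locale coord_rep =
  fixes G :: "('g, 'm) monoid_scheme" and V :: "('g, 'k::field, 'v) rep"
    and I :: "'i set" and \<phi> :: "'v \<Rightarrow> 'i \<Rightarrow> 'k"
  assumes fin: "finite I"
    and zero_mem: "\<zero>\<^bsub>V\<^esub> \<in> carrier V"
    and add_mem: "x \<in> carrier V \<Longrightarrow> y \<in> carrier V \<Longrightarrow> x \<oplus>\<^bsub>V\<^esub> y \<in> carrier V"
    and smult_mem: "x \<in> carrier V \<Longrightarrow> c \<odot>\<^bsub>V\<^esub> x \<in> carrier V"
    and crd_zero: "\<phi> \<zero>\<^bsub>V\<^esub> i = 0"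
    and crd_add: "x \<in> carrier V \<Longrightarrow> y \<in> carrier V \<Longrightarrow> \<phi> (x \<oplus>\<^bsub>V\<^esub> y) i = \<phi> x i + \<phi> y i"
    and crd_smult: "x \<in> carrier V \<Longrightarrow> \<phi> (c \<odot>\<^bsub>V\<^esub> x) i = c * \<phi> x i"
    and crd_off: "x \<in> carrier V \<Longrightarrow> i \<notin> I \<Longrightarrow> \<phi> x i = 0"
    and crd_inj: "x \<in> carrier V \<Longrightarrow> y \<in> carrier V \<Longrightarrow> (\<And>i. i \<in> I \<Longrightarrow> \<phi> x i = \<phi> y i) \<Longrightarrow> x = y"
    and crd_surj: "(\<And>i. i \<notin> I \<Longrightarrow> F i = 0) \<Longrightarrow> \<exists>x\<in>carrier V. \<phi> x = F"
    and act_lin: "act_linear G V"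
begin

lemma crd_eqI: "x \<in> carrier V \<Longrightarrow> y \<in> carrier V \<Longrightarrow> (\<And>i. \<phi> x i = \<phi> y i) \<Longrightarrow> x = y"
  using crd_inj by blast

lemma module: "module KR V"
  by (rule module_KR_I)
    (auto intro!: crd_eqI zero_mem add_mem smult_mem simp: crd_add crd_smult crd_zero
      add_mem smult_mem zero_mem algebra_simps)

lemma act_mem: "g \<in> carrier G \<Longrightarrow> x \<in> carrier V \<Longrightarrow> act V g x \<in> carrier V"
  and act_add: "g \<in> carrier G \<Longrightarrow> x \<in> carrier V \<Longrightarrow> y \<in> carrier V \<Longrightarrow>
    act V g (x \<oplus>\<^bsub>V\<^esub> y) = act V g x \<oplus>\<^bsub>V\<^esub> act V g y"
  and act_smult: "g \<in> carrier G \<Longrightarrow> x \<in> carrier V \<Longrightarrow> act V g (c \<odot>\<^bsub>V\<^esub> x) = c \<odot>\<^bsub>V\<^esub> act V g x"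
  using act_lin by (auto simp: act_linear_def)

lemma null: "x \<in> carrier V \<Longrightarrow> 0 \<odot>\<^bsub>V\<^esub> x = \<zero>\<^bsub>V\<^esub>"
  by (auto intro!: crd_eqI zero_mem smult_mem simp: crd_smult crd_zero)

lemma act_zero: "g \<in> carrier G \<Longrightarrow> act V g \<zero>\<^bsub>V\<^esub> = \<zero>\<^bsub>V\<^esub>"
  using act_smult[of g "\<zero>\<^bsub>V\<^esub>" 0] null[of "\<zero>\<^bsub>V\<^esub>"] null[of "act V g \<zero>\<^bsub>V\<^esub>"] by (simp add: zero_mem act_mem)

definition bas :: "'i \<Rightarrow> 'v" where
  "bas i = (SOME x. x \<in> carrier V \<and> \<phi> x = (\<lambda>j. if j = i then 1 else 0))"

lemma bas:
  assumes "i \<in> I"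
  shows bas_mem: "bas i \<in> carrier V" and crd_bas: "\<phi> (bas i) j = (if j = i then 1 else 0)"
proof -
  have "\<exists>x\<in>carrier V. \<phi> x = (\<lambda>j. if j = i then 1 else 0)"
    by (rule crd_surj) (use assms in auto)
  then have "\<exists>x. x \<in> carrier V \<and> \<phi> x = (\<lambda>j. if j = i then 1 else 0)"
    by blast
  from someI_ex[OF this] show "bas i \<in> carrier V" "\<phi> (bas i) j = (if j = i then 1 else 0)"
    by (auto simp: bas_def)
qed

lemma induct_bas [consumes 1, case_names zero add smult bas]:
  assumes x: "x \<in> carrier V" and zero: "P \<zero>\<^bsub>V\<^esub>"
    and add: "\<And>x y. x \<in> carrier V \<Longrightarrow> y \<in> carrier V \<Longrightarrow> P x \<Longrightarrow> P y \<Longrightarrow> P (x \<oplus>\<^bsub>V\<^esub> y)"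
    and smult: "\<And>c x. x \<in> carrier V \<Longrightarrow> P x \<Longrightarrow> P (c \<odot>\<^bsub>V\<^esub> x)"
    and bas: "\<And>i. i \<in> I \<Longrightarrow> P (bas i)"
  shows "P x"
proof -
  \<comment> \<open>Induction over a set \<open>A\<close> that supports the coordinates: subtracting
    a multiple of one basis vector removes one index.\<close>
  have "\<forall>x\<in>carrier V. (\<forall>i. i \<notin> A \<longrightarrow> \<phi> x i = 0) \<longrightarrow> P x" if "A \<subseteq> I" for A
    using finite_subset[OF that fin] that
  proof (induction A)
    case empty
    show ?case
    proof (intro ballI impI)
      fix x assume "x \<in> carrier V" "\<forall>i. i \<notin> {} \<longrightarrow> \<phi> x i = 0"
      then have "x = \<zero>\<^bsub>V\<^esub>" by (intro crd_eqI) (auto simp: zero_mem crd_zero)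
      with zero show "P x" by simp
    qed
  next
    case (insert a A)
    show ?case
    proof (intro ballI impI)
      fix x assume x: "x \<in> carrier V" and off: "\<forall>i. i \<notin> insert a A \<longrightarrow> \<phi> x i = 0"
      have a: "a \<in> I" using insert by auto
      define y where "y = x \<oplus>\<^bsub>V\<^esub> (- \<phi> x a) \<odot>\<^bsub>V\<^esub> bas a"
      have y: "y \<in> carrier V" by (simp add: y_def add_mem x smult_mem bas_mem a)
      have "P y"
        using insert y off by (auto simp: y_def crd_add crd_smult crd_bas x smult_mem bas_mem a)
      moreover have "x = y \<oplus>\<^bsub>V\<^esub> \<phi> x a \<odot>\<^bsub>V\<^esub> bas a"
        using x y by (intro crd_eqI)
          (auto simp: y_def crd_add crd_smult crd_bas smult_mem bas_mem a add_mem)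
      ultimately show "P x"
        using add[OF y smult_mem[OF bas_mem[OF a]]] smult[OF bas_mem[OF a] bas[OF a]] by metis
    qed
  qed
  from this[of I] show ?thesis using x crd_off by auto
qed

lemma crd_finsum:
  assumes "f \<in> A \<rightarrow> carrier V"
  shows "\<phi> (\<Oplus>\<^bsub>V\<^esub>a\<in>A. f a) i = (\<Sum>a\<in>A. \<phi> (f a) i)"
proof (cases "finite A")
  case True
  interpret module KR V by (rule module)
  show ?thesis using True assms
    by (induction A) (auto simp: crd_zero crd_add)
next
  case False
  interpret module KR V by (rule module)
  show ?thesis using False by (simp add: finsum_infinite crd_zero)
qed

end

subsection \<open>Quotients\<close>

locale quot_setup =
  fixes V :: "('g, 'k::field, 'v) rep" and N :: "'v set"
  assumes module: "module KR V" and sub: "submodule N KR V"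
begin

sublocale module KR V by (rule module)

lemma additive: "abelian_subgroup N V"
  using sub by (intro abelian_subgroupI3 additive_subgroup.intro abelian_group_axioms)
    (simp add: submodule_def)

sublocale N: abelian_subgroup N V by (rule additive)

lemma N_smult: "x \<in> N \<Longrightarrow> c \<odot>\<^bsub>V\<^esub> x \<in> N"
  using sub by (auto simp: submodule_KR_iff[OF module])

lemma coset_eq_iff:
  assumes "x \<in> carrier V" "y \<in> carrier V"
  shows "N +>\<^bsub>V\<^esub> x = N +>\<^bsub>V\<^esub> y \<longleftrightarrow> x \<ominus>\<^bsub>V\<^esub> y \<in> N"
proof
  assume "N +>\<^bsub>V\<^esub> x = N +>\<^bsub>V\<^esub> y"
  then have "N +>\<^bsub>V\<^esub> (x \<oplus>\<^bsub>V\<^esub> \<ominus>\<^bsub>V\<^esub> y) = N"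
    using a_coset_add_inv2 assms N.a_subset by blast
  then show "x \<ominus>\<^bsub>V\<^esub> y \<in> N"
    using N.a_rcos_self[of "x \<oplus>\<^bsub>V\<^esub> \<ominus>\<^bsub>V\<^esub> y"] assms by (simp add: a_minus_def)
next
  assume "x \<ominus>\<^bsub>V\<^esub> y \<in> N"
  then have "N +>\<^bsub>V\<^esub> (x \<oplus>\<^bsub>V\<^esub> \<ominus>\<^bsub>V\<^esub> y) = N"
    using a_coset_join2[OF _ N.a_subgroup] assms by (simp add: a_minus_def)
  then show "N +>\<^bsub>V\<^esub> x = N +>\<^bsub>V\<^esub> y"
    using a_coset_add_inv1 assms N.a_subset by blast
qed

lemma mem_coset:
  assumes "x \<in> carrier V" "y \<in> N +>\<^bsub>V\<^esub> x"
  shows "y \<in> carrier V" "N +>\<^bsub>V\<^esub> y = N +>\<^bsub>V\<^esub> x"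
  using a_r_coset_subset_G[OF N.a_subset assms(1)] assms(2)
    a_repr_independence[OF assms(2,1) N.a_subgroup] by auto

text \<open>Every member of the coset contributes the same coset, so the union in
  \<open>coset_map\<close> collapses; \<open>diff\<close> says that \<open>h\<close> respects
  congruence modulo \<open>N\<close>.\<close>

lemma coset_map_coset:
  assumes x: "x \<in> carrier V"
    and h: "\<And>a. a \<in> carrier V \<Longrightarrow> h a \<in> carrier V"
    and diff: "\<And>a b. a \<in> carrier V \<Longrightarrow> b \<in> carrier V \<Longrightarrow> a \<ominus>\<^bsub>V\<^esub> b \<in> N \<Longrightarrow> h a \<ominus>\<^bsub>V\<^esub> h b \<in> N"
  shows "coset_map V N h (N +>\<^bsub>V\<^esub> x) = N +>\<^bsub>V\<^esub> h x"
proof -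
  have "N +>\<^bsub>V\<^esub> h a = N +>\<^bsub>V\<^esub> h x" if "a \<in> N +>\<^bsub>V\<^esub> x" for a
  proof -
    note a = mem_coset[OF x that]
    have "a \<ominus>\<^bsub>V\<^esub> x \<in> N" using a coset_eq_iff[OF a(1) x] by simp
    from diff[OF a(1) x this] show ?thesis by (simp add: coset_eq_iff h a(1) x)
  qed
  moreover have "x \<in> N +>\<^bsub>V\<^esub> x" by (rule N.a_rcos_self[OF x])
  ultimately show ?thesis unfolding coset_map_def by blast
qed

lemma quot_carrier: "carrier (quot_rep V N) = (\<lambda>x. N +>\<^bsub>V\<^esub> x) ` carrier V"
  by (auto simp: quot_rep_def A_RCOSETS_def')

lemma quot_zero: "\<zero>\<^bsub>quot_rep V N\<^esub> = N +>\<^bsub>V\<^esub> \<zero>\<^bsub>V\<^esub>"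
  by (simp add: quot_rep_def N.a_subset)

lemma quot_add: "x \<in> carrier V \<Longrightarrow> y \<in> carrier V \<Longrightarrow>
    (N +>\<^bsub>V\<^esub> x) \<oplus>\<^bsub>quot_rep V N\<^esub> (N +>\<^bsub>V\<^esub> y) = N +>\<^bsub>V\<^esub> (x \<oplus>\<^bsub>V\<^esub> y)"
  by (simp add: quot_rep_def N.a_rcos_sum)

lemma diff_linear:
  assumes h: "\<And>a. a \<in> carrier V \<Longrightarrow> h a \<in> carrier V"
    and h_add: "\<And>a b. a \<in> carrier V \<Longrightarrow> b \<in> carrier V \<Longrightarrow> h (a \<oplus>\<^bsub>V\<^esub> b) = h a \<oplus>\<^bsub>V\<^esub> h b"
    and h_N: "\<And>a. a \<in> N \<Longrightarrow> h a \<in> N"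
    and a: "a \<in> carrier V" and b: "b \<in> carrier V" and d: "a \<ominus>\<^bsub>V\<^esub> b \<in> N"
  shows "h a \<ominus>\<^bsub>V\<^esub> h b \<in> N"
proof -
  have "h a = h ((a \<ominus>\<^bsub>V\<^esub> b) \<oplus>\<^bsub>V\<^esub> b)" using a b by (simp add: a_minus_def a_assoc l_neg)
  also have "\<dots> = h (a \<ominus>\<^bsub>V\<^esub> b) \<oplus>\<^bsub>V\<^esub> h b" using a b by (simp add: h_add)
  finally have "h a \<ominus>\<^bsub>V\<^esub> h b = h (a \<ominus>\<^bsub>V\<^esub> b)"
    using a b h by (simp add: a_minus_def a_assoc r_neg)
  then show ?thesis using h_N d by simp
qed

lemma coset_map_linear:
  assumes "x \<in> carrier V" "\<And>a. a \<in> carrier V \<Longrightarrow> h a \<in> carrier V"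
    "\<And>a b. a \<in> carrier V \<Longrightarrow> b \<in> carrier V \<Longrightarrow> h (a \<oplus>\<^bsub>V\<^esub> b) = h a \<oplus>\<^bsub>V\<^esub> h b"
    "\<And>a. a \<in> N \<Longrightarrow> h a \<in> N"
  shows "coset_map V N h (N +>\<^bsub>V\<^esub> x) = N +>\<^bsub>V\<^esub> h x"
  by (rule coset_map_coset) (use assms diff_linear in auto)

lemma quot_smult: "x \<in> carrier V \<Longrightarrow> c \<odot>\<^bsub>quot_rep V N\<^esub> (N +>\<^bsub>V\<^esub> x) = N +>\<^bsub>V\<^esub> (c \<odot>\<^bsub>V\<^esub> x)"
  using coset_map_linear[of x "\<lambda>x. c \<odot>\<^bsub>V\<^esub> x"] N_smult
  by (simp add: quot_rep_def smult_r_distr)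

lemma quot_act:
  assumes "act_linear G V" "g \<in> carrier G" "\<And>a. a \<in> N \<Longrightarrow> act V g a \<in> N" "x \<in> carrier V"
  shows "act (quot_rep V N) g (N +>\<^bsub>V\<^esub> x) = N +>\<^bsub>V\<^esub> act V g x"
  using assms coset_map_linear[of x "act V g"] by (simp add: quot_rep_def act_linear_def)

text \<open>The first isomorphism theorem in coordinates: a linear map \<open>L\<close> onto the
  functions on \<open>J\<close> with kernel \<open>N\<close> descends to the quotient, where it is
  read off at any representative. Tensor products and coinvariants both receive their coordinates
  from here.\<close>

lemma coord_rep_quot:
  fixes J :: "'j set" and L :: "'v \<Rightarrow> 'j \<Rightarrow> 'k"
  assumes fin: "finite J"
    and L_add: "\<And>x y j. x \<in> carrier V \<Longrightarrow> y \<in> carrier V \<Longrightarrow> L (x \<oplus>\<^bsub>V\<^esub> y) j = L x j + L y j"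
    and L_smult: "\<And>c x j. x \<in> carrier V \<Longrightarrow> L (c \<odot>\<^bsub>V\<^esub> x) j = c * L x j"
    and L_off: "\<And>x j. x \<in> carrier V \<Longrightarrow> j \<notin> J \<Longrightarrow> L x j = 0"
    and L_surj: "\<And>F. (\<And>j. j \<notin> J \<Longrightarrow> F j = 0) \<Longrightarrow> \<exists>x\<in>carrier V. L x = F"
    and L_N: "\<And>x j. x \<in> N \<Longrightarrow> L x j = 0"
    and L_ker: "\<And>x. x \<in> carrier V \<Longrightarrow> (\<And>j. L x j = 0) \<Longrightarrow> x \<in> N"
    and act: "act_linear G V" and act_N: "\<And>g a. g \<in> carrier G \<Longrightarrow> a \<in> N \<Longrightarrow> act V g a \<in> N"
  defines "\<psi> \<equiv> \<lambda>A. L (SOME a. a \<in> A)"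
  shows "coord_rep G (quot_rep V N) J \<psi>"
    and "\<And>x. x \<in> carrier V \<Longrightarrow> \<psi> (N +>\<^bsub>V\<^esub> x) = L x"
proof -
  have L_zero: "L \<zero>\<^bsub>V\<^esub> j = 0" for j using L_N N.zero_closed by blast
  have L_diff: "L (x \<ominus>\<^bsub>V\<^esub> y) j = L x j - L y j" if "x \<in> carrier V" "y \<in> carrier V" for x y j
  proof -
    have "L x j = L ((x \<ominus>\<^bsub>V\<^esub> y) \<oplus>\<^bsub>V\<^esub> y) j"
      using that by (simp add: a_minus_def a_assoc l_neg)
    then show ?thesis using that by (simp add: L_add)
  qed
  show psi: "\<psi> (N +>\<^bsub>V\<^esub> x) = L x" if "x \<in> carrier V" for x
  proof -
    have "(SOME a. a \<in> N +>\<^bsub>V\<^esub> x) \<in> N +>\<^bsub>V\<^esub> x"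
      using N.a_rcos_self[OF that] by (rule someI)
    note mem = mem_coset[OF that this]
    then have "(SOME a. a \<in> N +>\<^bsub>V\<^esub> x) \<ominus>\<^bsub>V\<^esub> x \<in> N"
      by (simp add: coset_eq_iff that)
    from L_N[OF this] have "L (SOME a. a \<in> N +>\<^bsub>V\<^esub> x) j = L x j" for j
      using L_diff[OF mem(1) that] by simp
    then show ?thesis by (simp add: \<psi>_def fun_eq_iff)
  qed
  show "coord_rep G (quot_rep V N) J \<psi>"
  proof
    fix x y assume xy: "x \<in> carrier (quot_rep V N)" "y \<in> carrier (quot_rep V N)"
      and eq: "\<And>i. i \<in> J \<Longrightarrow> \<psi> x i = \<psi> y i"
    obtain a b where ab: "a \<in> carrier V" "b \<in> carrier V" "x = N +>\<^bsub>V\<^esub> a" "y = N +>\<^bsub>V\<^esub> b"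
      using xy by (auto simp: quot_carrier)
    have "L (a \<ominus>\<^bsub>V\<^esub> b) j = 0" for j
    proof (cases "j \<in> J")
      case True
      from eq[OF this] show ?thesis by (simp add: ab(3,4) psi ab(1,2) L_diff)
    qed (simp add: L_diff L_off ab(1,2))
    then have "a \<ominus>\<^bsub>V\<^esub> b \<in> N" by (intro L_ker) (auto simp: ab(1,2))
    then show "x = y" by (simp only: ab(3,4) coset_eq_iff[OF ab(1,2)])
  next
    fix F :: "'j \<Rightarrow> 'k" assume "\<And>i. i \<notin> J \<Longrightarrow> F i = 0"
    then obtain x where "x \<in> carrier V" "L x = F" using L_surj by blast
    then show "\<exists>x\<in>carrier (quot_rep V N). \<psi> x = F"
      unfolding quot_carrier by (intro bexI[of _ "N +>\<^bsub>V\<^esub> x"]) (simp_all add: psi)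
  next
    show "act_linear G (quot_rep V N)"
      unfolding act_linear_def quot_carrier
    proof (intro ballI)
      fix g A assume g: "g \<in> carrier G" and "A \<in> (+>\<^bsub>V\<^esub>) N ` carrier V"
      then obtain x where x: "x \<in> carrier V" and A: "A = N +>\<^bsub>V\<^esub> x" by auto
      note gx = quot_act[OF act g act_N[OF g]]
      have m: "act V g y \<in> carrier V" if "y \<in> carrier V" for y
        using act g that by (simp add: act_linear_def)
      show "act (quot_rep V N) g A \<in> (+>\<^bsub>V\<^esub>) N ` carrier V \<and>
          (\<forall>B\<in>(+>\<^bsub>V\<^esub>) N ` carrier V. act (quot_rep V N) g (A \<oplus>\<^bsub>quot_rep V N\<^esub> B) =
            act (quot_rep V N) g A \<oplus>\<^bsub>quot_rep V N\<^esub> act (quot_rep V N) g B) \<and>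
          (\<forall>c. act (quot_rep V N) g (c \<odot>\<^bsub>quot_rep V N\<^esub> A) = c \<odot>\<^bsub>quot_rep V N\<^esub> act (quot_rep V N) g A)"
        unfolding A using x g act
        by (auto simp: gx m quot_add quot_smult act_linear_def)
    qed
  next
    show "\<And>x j. x \<in> carrier (quot_rep V N) \<Longrightarrow> j \<notin> J \<Longrightarrow> \<psi> x j = 0"
      unfolding quot_carrier by (auto simp: psi L_off)
    show "\<psi> \<zero>\<^bsub>quot_rep V N\<^esub> j = 0" for j
      by (simp add: quot_zero psi L_zero)
    show "\<And>x y j. x \<in> carrier (quot_rep V N) \<Longrightarrow> y \<in> carrier (quot_rep V N) \<Longrightarrow>
        \<psi> (x \<oplus>\<^bsub>quot_rep V N\<^esub> y) j = \<psi> x j + \<psi> y j"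
      unfolding quot_carrier by (auto simp: psi quot_add L_add)
    show "\<And>x c j. x \<in> carrier (quot_rep V N) \<Longrightarrow> \<psi> (c \<odot>\<^bsub>quot_rep V N\<^esub> x) j = c * \<psi> x j"
      unfolding quot_carrier by (auto simp: psi quot_smult L_smult)
    show "finite J" by (rule fin)
    show "\<zero>\<^bsub>quot_rep V N\<^esub> \<in> carrier (quot_rep V N)"
      unfolding quot_zero quot_carrier by simp
    show "\<And>x y. x \<in> carrier (quot_rep V N) \<Longrightarrow> y \<in> carrier (quot_rep V N) \<Longrightarrow>
        x \<oplus>\<^bsub>quot_rep V N\<^esub> y \<in> carrier (quot_rep V N)"
      unfolding quot_carrier by (auto simp: quot_add)
    show "\<And>x c. x \<in> carrier (quot_rep V N) \<Longrightarrow> c \<odot>\<^bsub>quot_rep V N\<^esub> x \<in> carrier (quot_rep V N)"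
      unfolding quot_carrier by (auto simp: quot_smult)
  qed
qed

end

subsection \<open>Linear extension on free modules\<close>

definition lext :: "('a \<Rightarrow> 'k::field) \<Rightarrow> ('a \<Rightarrow>\<^sub>0 'k) \<Rightarrow> 'k" where
  "lext h f = (\<Sum>x\<in>keys f. lookup f x * h x)"

lemma lookup_map_mult [simp]: "lookup (Poly_Mapping.map ((*) c) f) x = c * lookup (f :: 'a \<Rightarrow>\<^sub>0 'k::field) x"
  by (simp add: Poly_Mapping.map.rep_eq when_def)

lemma keys_map_mult: "keys (Poly_Mapping.map ((*) c) (f :: 'a \<Rightarrow>\<^sub>0 'k::field)) \<subseteq> keys f"
  by (auto simp: in_keys_iff)

lemma lext_superset:
  "finite A \<Longrightarrow> keys f \<subseteq> A \<Longrightarrow> lext h f = (\<Sum>x\<in>A. lookup f x * h x)"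
  unfolding lext_def by (rule sum.mono_neutral_left) (auto simp: in_keys_iff)

lemma lext_zero [simp]: "lext h 0 = 0"
  by (simp add: lext_def)

lemma lext_add: "lext h (f + g) = lext h f + lext h g"
proof -
  let ?A = "keys f \<union> keys g"
  have "lext h (f + g) = (\<Sum>x\<in>?A. lookup (f + g) x * h x)"
    by (rule lext_superset) (use Poly_Mapping.keys_add[of f g] in auto)
  also have "\<dots> = (\<Sum>x\<in>?A. lookup f x * h x) + (\<Sum>x\<in>?A. lookup g x * h x)"
    by (simp add: lookup_add algebra_simps sum.distrib)
  also have "\<dots> = lext h f + lext h g"
    by (subst (1 2) lext_superset[where A = ?A]) auto
  finally show ?thesis .
qed

lemma lext_scale: "lext h (Poly_Mapping.map ((*) c) f) = c * lext h f"
  by (subst lext_superset[where A = "keys f"])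
    (auto simp: lext_def sum_distrib_left mult.assoc dest: subsetD[OF keys_map_mult])

lemma lext_single [simp]: "lext h (single x c) = c * h x"
  by (subst lext_superset[where A = "{x}"]) auto

lemma lext_diff: "lext h (f - g) = lext h f - lext h g"
  using lext_add[of h "f - g" g] by simp

lemma lext_sum: "lext h (sum f A) = (\<Sum>a\<in>A. lext h (f a))"
  by (induction A rule: infinite_finite_induct) (simp_all add: lext_add)

lemma lookup_free_map: "lookup (free_map h f) y = lext (\<lambda>x. if h x = y then 1 else 0) f"
  by (auto simp: free_map_def lext_def lookup_sum lookup_single when_def intro!: sum.cong)

lemma free_map_add: "free_map h (f + g) = free_map h f + free_map h g"
  by (intro poly_mapping_eqI) (simp add: lookup_free_map lext_add lookup_add)

lemma free_map_diff: "free_map h (f - g) = free_map h f - free_map h g"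
  by (intro poly_mapping_eqI) (simp add: lookup_free_map lext_diff lookup_minus)

lemma free_map_scale: "free_map h (Poly_Mapping.map ((*) c) f) = Poly_Mapping.map ((*) c) (free_map h f)"
  by (intro poly_mapping_eqI) (simp add: lookup_free_map lext_scale)

lemma free_map_zero [simp]: "free_map h 0 = 0"
  by (simp add: free_map_def)

lemma free_map_single [simp]: "free_map h (single x c) = single (h x) c"
  by (intro poly_mapping_eqI) (simp add: lookup_free_map lookup_single when_def)

lemma keys_free_map: "keys (free_map h f) \<subseteq> h ` keys f"
  using Poly_Mapping.keys_sum[of "\<lambda>x. single (h x) (lookup f x)"
      "keys f"] by (auto simp: free_map_def split: if_splits)

lemma lext_free_map: "lext k (free_map h f) = lext (k \<circ> h) f"
  by (simp add: free_map_def lext_sum) (simp add: lext_def)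

lemma sum_singles: "(\<Sum>x\<in>keys f. single x (lookup f x)) = (f :: 'a \<Rightarrow>\<^sub>0 'k::field)"
proof (rule poly_mapping_eqI)
  fix y
  have "lookup (\<Sum>x\<in>keys f. single x (lookup f x)) y
    = (\<Sum>x\<in>keys f. if x = y then lookup f y else 0)"
    unfolding lookup_sum by (rule sum.cong) (auto simp: lookup_single when_def)
  also have "\<dots> = lookup f y"
    by (simp add: in_keys_iff)
  finally show "lookup (\<Sum>x\<in>keys f. single x (lookup f x)) y
    = lookup f y" .
qed

lemma in_listset_iff: "xs \<in> listset As \<longleftrightarrow> list_all2 (\<in>) xs As"
proof (induction As arbitrary: xs)
  case (Cons A As)
  then show ?case by (cases xs) (auto simp: set_Cons_def)
qed simp

lemma in_listset_nth: "xs \<in> listset As \<longleftrightarrow> length xs = length As \<and> (\<forall>i<length As. xs ! i \<in> As ! i)"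
  by (auto simp: in_listset_iff list_all2_conv_all_nth)

subsection \<open>Tensor products in coordinates\<close>

lemma free_tensor_simps:
  "carrier (free_tensor Vs) = {f. keys f \<subseteq> listset (map carrier Vs)}"
  "zero (free_tensor Vs) = 0" "add (free_tensor Vs) = (+)"
  "module.smult (free_tensor Vs) = (\<lambda>c. Poly_Mapping.map ((*) c))"
  "act (free_tensor Vs) = (\<lambda>g. free_map (map2 (\<lambda>V. act V g) Vs))"
  by (simp_all add: free_tensor_def)

lemma module_free_tensor: "module KR (free_tensor (Vs :: ('g, 'k::field, 'v) rep list))"
proof (rule module_KR_I, unfold free_tensor_simps)
  fix f g :: "'v list \<Rightarrow>\<^sub>0 'k" and c :: 'k
  assume f: "f \<in> {f. keys f \<subseteq> listset (map carrier Vs)}"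
  then show "Poly_Mapping.map ((*) c) f \<in> {f. keys f \<subseteq> listset (map carrier Vs)}"
    using keys_map_mult[of c f] by blast
  assume "g \<in> {f. keys f \<subseteq> listset (map carrier Vs)}"
  with f show "f + g \<in> {f. keys f \<subseteq> listset (map carrier Vs)}"
    using Poly_Mapping.keys_add[of f g] by blast
qed (simp_all add: poly_mapping_eq_iff fun_eq_iff lookup_add algebra_simps)

text \<open>Every factor brings its own index set and coordinates, since the rows of a partition
  give symmetric powers of different degrees.\<close>

locale tensor_coords =
  fixes G :: "('g, 'm) monoid_scheme" and Vs :: "('g, 'k::field, 'v) rep list"
    and I :: "nat \<Rightarrow> 'i set" and \<phi> :: "nat \<Rightarrow> 'v \<Rightarrow> 'i \<Rightarrow> 'k"
  assumes coord: "i < length Vs \<Longrightarrow> coord_rep G (Vs ! i) (I i) (\<phi> i)"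
begin

abbreviation "F \<equiv> free_tensor Vs"

definition J :: "'i list set" where
  "J = {ms. length ms = length Vs \<and> (\<forall>i<length Vs. ms ! i \<in> I i)}"

definition tc :: "'v list \<Rightarrow> 'i list \<Rightarrow> 'k" where
  "tc xs ms = (if length ms = length Vs then \<Prod>i<length Vs. \<phi> i (xs ! i) (ms ! i) else 0)"

definition L :: "('v list \<Rightarrow>\<^sub>0 'k) \<Rightarrow> 'i list \<Rightarrow> 'k" where
  "L f ms = lext (\<lambda>xs. tc xs ms) f"

definition crd :: "('v list \<Rightarrow>\<^sub>0 'k) set \<Rightarrow> 'i list \<Rightarrow> 'k" where
  "crd A = L (SOME a. a \<in> A)"

definition bs :: "'i list \<Rightarrow> 'v list" where
  "bs ms = map (\<lambda>i. coord_rep.bas (Vs ! i) (\<phi> i) (ms ! i)) [0..<length Vs]"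

abbreviation "mem xs \<equiv> xs \<in> listset (map carrier Vs)"

lemma memD: "mem xs \<Longrightarrow> length xs = length Vs" "mem xs \<Longrightarrow> i < length Vs \<Longrightarrow> xs ! i \<in> carrier (Vs ! i)"
  by (auto simp: in_listset_nth)

lemma mem_upd: "mem xs \<Longrightarrow> i < length Vs \<Longrightarrow> x \<in> carrier (Vs ! i) \<Longrightarrow> mem (xs[i := x])"
  by (auto simp: in_listset_nth nth_list_update)

lemma single_mem: "mem xs \<Longrightarrow> single xs c \<in> carrier F"
  by (auto simp: free_tensor_simps)

lemma F_add: "f \<in> carrier F \<Longrightarrow> g \<in> carrier F \<Longrightarrow> f + g \<in> carrier F"
  using Poly_Mapping.keys_add[of f g] by (auto simp: free_tensor_simps)

lemma F_diff: "f \<in> carrier F \<Longrightarrow> g \<in> carrier F \<Longrightarrow> f - g \<in> carrier F"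
  using Poly_Mapping.keys_diff[of f g] by (auto simp: free_tensor_simps)

lemma F_sum: "(\<And>a. a \<in> A \<Longrightarrow> f a \<in> carrier F) \<Longrightarrow> sum f A \<in> carrier F"
  by (induction A rule: infinite_finite_induct) (auto simp: F_add, auto simp: free_tensor_simps)

lemma finite_J: "finite J"
proof (rule finite_subset)
  show "J \<subseteq> {ms. set ms \<subseteq> (\<Union>i<length Vs. I i) \<and> length ms = length Vs}"
    by (force simp: J_def in_set_conv_nth)
  show "finite {ms. set ms \<subseteq> (\<Union>i<length Vs. I i) \<and> length ms = length Vs}"
    using coord by (intro finite_lists_length_eq) (auto simp: coord_rep_def)
qed

lemma tc_upd:
  assumes "length xs = length Vs" "i < length Vs"
  shows "tc (xs[i := x]) ms = (if length ms = length Vs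
    then \<phi> i x (ms ! i) * (\<Prod>j\<in>{..<length Vs} - {i}. \<phi> j (xs ! j) (ms ! j)) else 0)"
proof -
  have "(\<Prod>j<length Vs. \<phi> j (xs[i := x] ! j) (ms ! j))
    = \<phi> i (xs[i := x] ! i) (ms ! i) * (\<Prod>j\<in>{..<length Vs} - {i}. \<phi> j (xs[i := x] ! j) (ms ! j))"
    using assms by (subst prod.remove[of _ i]) auto
  then show ?thesis using assms by (auto simp: tc_def intro!: prod.cong)
qed

lemma rels_sub: "multilinear_rels Vs \<subseteq> carrier F"
proof -
  have *: "x \<oplus>\<^bsub>Vs ! i\<^esub> y \<in> carrier (Vs ! i)" "c \<odot>\<^bsub>Vs ! i\<^esub> x \<in> carrier (Vs ! i)"
    if "i < length Vs" "x \<in> carrier (Vs ! i)" "y \<in> carrier (Vs ! i)" for x y c i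
    using coord_rep.add_mem[OF coord[OF that(1)] that(2,3)] coord_rep.smult_mem[OF coord[OF that(1)] that(2)]
    by blast+
  show ?thesis
    unfolding multilinear_rels_def
    by (safe; intro F_diff single_mem mem_upd; (rule * | assumption); assumption)
qed

abbreviation "N \<equiv> tensor_ker Vs"

lemma quot: "quot_setup F N"
  by (rule quot_setup.intro) (auto simp: module_free_tensor tensor_ker_def intro!: submodule_rep_span rels_sub)

lemma N_closed: "N \<subseteq> carrier F" "0 \<in> N" "\<forall>x\<in>N. \<forall>y\<in>N. x + y \<in> N"
    "\<forall>c. \<forall>x\<in>N. Poly_Mapping.map ((*) c) x \<in> N"
  using quot_setup.sub[OF quot] unfolding submodule_KR_iff[OF module_free_tensor] free_tensor_simps
  by blast+

lemma N_add: "f \<in> N \<Longrightarrow> g \<in> N \<Longrightarrow> f + g \<in> N"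
  using N_closed(3) by blast

lemma N_scale: "f \<in> N \<Longrightarrow> Poly_Mapping.map ((*) c) f \<in> N"
  using N_closed(4) by blast

lemmas N_zero = N_closed(2)

lemma rel_add:
  assumes "mem xs" "i < length Vs" "x \<in> carrier (Vs ! i)" "y \<in> carrier (Vs ! i)"
  shows "single (xs[i := x \<oplus>\<^bsub>Vs ! i\<^esub> y]) 1
        - single (xs[i := x]) 1 - single (xs[i := y]) 1 \<in> multilinear_rels Vs"
  using assms unfolding multilinear_rels_def by blast

lemma rel_smult:
  assumes "mem xs" "i < length Vs" "x \<in> carrier (Vs ! i)"
  shows "single (xs[i := c \<odot>\<^bsub>Vs ! i\<^esub> x]) 1 - single (xs[i := x]) c \<in> multilinear_rels Vs"
  using assms unfolding multilinear_rels_def by blast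

lemma N_induct [consumes 1, case_names add_rel smult_rel zero add smult]:
  assumes "f \<in> N"
    and "\<And>xs i x y. mem xs \<Longrightarrow> i < length Vs \<Longrightarrow> x \<in> carrier (Vs ! i) \<Longrightarrow> y \<in> carrier (Vs ! i) \<Longrightarrow>
      P (single (xs[i := x \<oplus>\<^bsub>Vs ! i\<^esub> y]) 1
        - single (xs[i := x]) 1 - single (xs[i := y]) 1)"
    and "\<And>xs i c x. mem xs \<Longrightarrow> i < length Vs \<Longrightarrow> x \<in> carrier (Vs ! i) \<Longrightarrow>
      P (single (xs[i := c \<odot>\<^bsub>Vs ! i\<^esub> x]) 1 - single (xs[i := x]) c)"
    and "P 0" and "\<And>f g. P f \<Longrightarrow> P g \<Longrightarrow> P (f + g)" and "\<And>c f. P f \<Longrightarrow> P (Poly_Mapping.map ((*) c) f)"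
  shows "P f"
  using module_free_tensor rels_sub assms(1)[unfolded tensor_ker_def]
proof (induction rule: rep_span_induct)
  case (base f)
  then consider (1) xs i x y where "mem xs" "i < length Vs" "x \<in> carrier (Vs ! i)" "y \<in> carrier (Vs ! i)"
      "f = single (xs[i := x \<oplus>\<^bsub>Vs ! i\<^esub> y]) 1
        - single (xs[i := x]) 1 - single (xs[i := y]) 1"
    | (2) xs i c x where "mem xs" "i < length Vs" "x \<in> carrier (Vs ! i)"
      "f = single (xs[i := c \<odot>\<^bsub>Vs ! i\<^esub> x]) 1 - single (xs[i := x]) c"
    unfolding multilinear_rels_def Un_iff mem_Collect_eq by metis
  then show ?case
  proof cases
    case 1
    then show ?thesis using assms(2)[of xs i x y] by simp
  next
    case 2
    then show ?thesis using assms(3)[of xs i x c] by simp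
  qed
qed (use assms(4-) in \<open>simp_all add: free_tensor_simps\<close>)

text \<open>A coordinate of a pure tensor is linear in each slot separately, so it annihilates the
  defining relations.\<close>

lemma L_N: "f \<in> N \<Longrightarrow> L f ms = 0"
proof (induction rule: N_induct)
  case (add_rel xs i x y)
  note c = coord[OF add_rel(2)]
  show ?case
    unfolding L_def lext_diff lext_single tc_upd[OF memD(1)[OF add_rel(1)] add_rel(2)]
      coord_rep.crd_add[OF c add_rel(3,4)]
    by (simp add: distrib_right)
next
  case (smult_rel xs i c x)
  note c = coord[OF smult_rel(2)]
  show ?case
    unfolding L_def lext_diff lext_single tc_upd[OF memD(1)[OF smult_rel(1)] smult_rel(2)]
      coord_rep.crd_smult[OF c smult_rel(3)]
    by simp
qed (simp_all add: L_def lext_add lext_scale)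

lemma act_map2_upd:
  "length xs = length Vs \<Longrightarrow> i < length Vs \<Longrightarrow>
    map2 (\<lambda>V. act V g) Vs (xs[i := x]) = (map2 (\<lambda>V. act V g) Vs xs)[i := act (Vs ! i) g x]"
  by (rule nth_equalityI) (auto simp: nth_list_update)

lemma act_map2_mem:
  assumes "mem xs" "g \<in> carrier G"
  shows "mem (map2 (\<lambda>V. act V g) Vs xs)"
  unfolding in_listset_nth
proof (intro conjI allI impI)
  show "length (map2 (\<lambda>V. act V g) Vs xs) = length (map carrier Vs)"
    by (simp add: memD(1)[OF assms(1)])
  fix i assume "i < length (map carrier Vs)"
  then have i: "i < length Vs" by simp
  show "map2 (\<lambda>V. act V g) Vs xs ! i \<in> map carrier Vs ! i"
    using coord_rep.act_mem[OF coord[OF i] assms(2) memD(2)[OF assms(1) i]] i memD(1)[OF assms(1)]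
    by simp
qed

lemma rels_N: "r \<in> multilinear_rels Vs \<Longrightarrow> r \<in> N"
  using rep_span_superset[of "multilinear_rels Vs" F] by (auto simp: tensor_ker_def)

lemma act_N:
  assumes g: "g \<in> carrier G" and f: "f \<in> N"
  shows "act F g f \<in> N"
  using f unfolding free_tensor_simps
proof (induction rule: N_induct)
  case (add_rel xs i x y)
  note c = coord[OF add_rel(2)]
  note u = act_map2_upd[OF memD(1)[OF add_rel(1)] add_rel(2)]
  show ?case
    unfolding free_map_diff free_map_single u coord_rep.act_add[OF c g add_rel(3,4)]
    by (intro rels_N rel_add act_map2_mem add_rel g coord_rep.act_mem[OF c g])
next
  case (smult_rel xs i a x)
  note c = coord[OF smult_rel(2)]
  note u = act_map2_upd[OF memD(1)[OF smult_rel(1)] smult_rel(2)]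
  show ?case
    unfolding free_map_diff free_map_single u coord_rep.act_smult[OF c g smult_rel(3)]
    by (intro rels_N rel_smult act_map2_mem smult_rel g coord_rep.act_mem[OF c g])
qed (simp_all only: free_map_add free_map_scale free_map_zero N_add N_scale N_zero)

lemma act_linear_F: "act_linear G F"
  unfolding act_linear_def
proof (intro ballI conjI allI)
  fix g f assume "g \<in> carrier G" "f \<in> carrier F"
  then show "act F g f \<in> carrier F"
    using keys_free_map[of "map2 (\<lambda>V. act V g) Vs" f] act_map2_mem[of _ g]
    unfolding free_tensor_simps by blast
qed (simp_all add: free_tensor_simps free_map_add free_map_scale)

lemma bs_mem: "ms \<in> J \<Longrightarrow> mem (bs ms)"
  unfolding in_listset_nth
proof (intro conjI allI impI)
  fix i assume ms: "ms \<in> J" and "i < length (map carrier Vs)"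
  then have i: "i < length Vs" "ms ! i \<in> I i" by (simp_all add: J_def)
  show "bs ms ! i \<in> map carrier Vs ! i"
    using coord_rep.bas_mem[OF coord[OF i(1)] i(2)] i(1) by (simp add: bs_def)
qed (simp add: bs_def)

lemma tc_bs:
  assumes "ms \<in> J"
  shows "tc (bs ms) ms' = (if ms' = ms then 1 else 0)"
proof (cases "length ms' = length Vs \<and> ms' \<noteq> ms")
  case True
  then obtain i where i: "i < length Vs" "ms' ! i \<noteq> ms ! i"
  proof -
    have "length ms = length Vs" using assms by (simp add: J_def)
    with nth_equalityI[of ms' ms] True that show ?thesis by metis
  qed
  then have "\<phi> i (bs ms ! i) (ms' ! i) = 0"
    using assms coord_rep.crd_bas[OF coord[OF i(1)]] by (simp add: bs_def J_def)
  then have "(\<Prod>i<length Vs. \<phi> i (bs ms ! i) (ms' ! i)) = 0"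
    using i(1) by auto
  then show ?thesis using True by (simp add: tc_def)
next
  case False
  have one: "\<phi> i (bs ms ! i) (ms ! i) = 1" if "i < length Vs" for i
    using assms that coord_rep.crd_bas[OF coord[OF that]] by (simp add: bs_def J_def)
  have "length ms = length Vs" using assms by (simp add: J_def)
  then have "tc (bs ms) ms = 1" by (simp add: tc_def one)
  moreover have "ms' = ms \<or> ms' \<noteq> ms \<and> tc (bs ms) ms' = 0"
    using False by (cases "ms' = ms") (simp_all add: tc_def)
  ultimately show ?thesis by (elim disjE conjE) simp_all
qed

text \<open>The elements congruent, modulo the relations, to a combination of basis tensors. That
  this is everything is the spanning half of the basis theorem; \<open>L_N\<close> with
  \<open>L_bs_sum\<close> gives independence.\<close>

definition U :: "('v list \<Rightarrow>\<^sub>0 'k) set" where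
  "U = {f. \<exists>a. f - (\<Sum>ms\<in>J. single (bs ms) (a ms)) \<in> N}"

lemma U_N: "f \<in> N \<Longrightarrow> f \<in> U"
  unfolding U_def by (auto intro!: exI[of _ "\<lambda>_. 0"])

lemma U_add: "f \<in> U \<Longrightarrow> g \<in> U \<Longrightarrow> f + g \<in> U"
proof -
  assume "f \<in> U" "g \<in> U"
  then obtain a b where "f - (\<Sum>ms\<in>J. single (bs ms) (a ms)) \<in> N"
    "g - (\<Sum>ms\<in>J. single (bs ms) (b ms)) \<in> N"
    by (auto simp: U_def)
  from N_add[OF this] show ?thesis
    unfolding U_def
    by (auto intro!: exI[of _ "\<lambda>ms. a ms + b ms"] simp: single_add sum.distrib algebra_simps)
qed

lemma map_mult_diff: "Poly_Mapping.map ((*) c) (f - g) = Poly_Mapping.map ((*) c) f - Poly_Mapping.map ((*) (c :: 'k)) g"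
  by (intro poly_mapping_eqI) (simp add: lookup_minus algebra_simps)

lemma map_mult_sum: "Poly_Mapping.map ((*) c) (sum h A) = (\<Sum>a\<in>A. Poly_Mapping.map ((*) (c :: 'k)) (h a))"
  by (intro poly_mapping_eqI) (simp add: lookup_sum sum_distrib_left)

lemma U_scale: "f \<in> U \<Longrightarrow> Poly_Mapping.map ((*) c) f \<in> U"
proof -
  assume "f \<in> U"
  then obtain a where "f - (\<Sum>ms\<in>J. single (bs ms) (a ms)) \<in> N"
    by (auto simp: U_def)
  from N_scale[OF this, of c] show ?thesis
    unfolding U_def
    by (auto intro!: exI[of _ "\<lambda>ms. c * a ms"] simp: map_mult_diff map_mult_sum)
qed

lemma U_bs: "ms \<in> J \<Longrightarrow> single (bs ms) 1 \<in> U"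
proof -
  assume ms: "ms \<in> J"
  have "(\<Sum>ms'\<in>J. single (bs ms') (if ms' = ms then 1 else 0))
    = (\<Sum>ms'\<in>J. if ms' = ms then single (bs ms) (1::'k) else 0)"
    by (intro sum.cong) auto
  then show ?thesis
    unfolding U_def using ms finite_J N_zero
    by (auto intro!: exI[of _ "\<lambda>ms'. if ms' = ms then 1 else 0"])
qed

lemma single_U: "mem xs \<Longrightarrow> single xs 1 \<in> U"
proof -
  \<comment> \<open>Slots from position \<open>k\<close> on hold basis vectors. The inductive step
    frees slot \<open>k\<close>, whose entry is expanded by means of the multilinear
    relations.\<close>
  have "\<forall>xs. mem xs \<longrightarrow> (\<forall>i<length Vs. k \<le> i \<longrightarrow> xs ! i \<in> coord_rep.bas (Vs ! i) (\<phi> i) ` I i) \<longrightarrow>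
      single xs 1 \<in> U" for k
  proof (induction k)
    case 0
    show ?case
    proof (intro allI impI)
      fix xs assume xs: "mem xs" "\<forall>i<length Vs. 0 \<le> i \<longrightarrow> xs ! i \<in> coord_rep.bas (Vs ! i) (\<phi> i) ` I i"
      then have "\<forall>i<length Vs. \<exists>j. j \<in> I i \<and> xs ! i = coord_rep.bas (Vs ! i) (\<phi> i) j" by auto
      then obtain h where h: "\<And>i. i < length Vs \<Longrightarrow> h i \<in> I i \<and> xs ! i = coord_rep.bas (Vs ! i) (\<phi> i) (h i)"
        by metis
      have "bs (map h [0..<length Vs]) = xs"
        using h memD(1)[OF xs(1)] by (intro nth_equalityI) (auto simp: bs_def)
      moreover have "map h [0..<length Vs] \<in> J" using h by (auto simp: J_def)
      ultimately show "single xs 1 \<in> U" using U_bs by metis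
    qed
  next
    case (Suc k)
    show ?case
    proof (intro allI impI)
      fix xs assume xs: "mem xs" "\<forall>i<length Vs. Suc k \<le> i \<longrightarrow> xs ! i \<in> coord_rep.bas (Vs ! i) (\<phi> i) ` I i"
      show "single xs 1 \<in> U"
      proof (cases "k < length Vs")
        case False
        then show ?thesis using Suc xs by auto
      next
        case k: True
        interpret c: coord_rep G "Vs ! k" "I k" "\<phi> k" by (rule coord[OF k])
        have relN: "r \<in> multilinear_rels Vs \<Longrightarrow> r \<in> U" for r
          using rep_span_superset[of "multilinear_rels Vs" F] U_N by (auto simp: tensor_ker_def)
        have "single (xs[k := x]) 1 \<in> U" if "x \<in> carrier (Vs ! k)" for x
          using that
        proof (induction rule: c.induct_bas)
          case zero
          show ?case using relN[OF rel_smult[OF xs(1) k c.zero_mem, of 0]] c.null[OF c.zero_mem] by simp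
        next
          case (add x y)
          have "single (xs[k := x \<oplus>\<^bsub>Vs ! k\<^esub> y]) 1 =
            (single (xs[k := x \<oplus>\<^bsub>Vs ! k\<^esub> y]) 1
              - single (xs[k := x]) 1 - single (xs[k := y]) (1::'k))
            + single (xs[k := x]) 1 + single (xs[k := y]) 1"
            by simp
          then show ?case
            using U_add[OF U_add[OF relN[OF rel_add[OF xs(1) k add(1,2)]] add(3)] add(4)] by metis
        next
          case (smult a x)
          have "single (xs[k := a \<odot>\<^bsub>Vs ! k\<^esub> x]) 1 =
            (single (xs[k := a \<odot>\<^bsub>Vs ! k\<^esub> x]) 1 - single (xs[k := x]) a)
            + Poly_Mapping.map ((*) a) (single (xs[k := x]) 1)"
            by simp
          then show ?case
            using U_add[OF relN[OF rel_smult[OF xs(1) k smult(1), of a]] U_scale[OF smult(2), of a]] by metis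
        next
          case (bas j)
          have "xs[k := c.bas j] ! i \<in> coord_rep.bas (Vs ! i) (\<phi> i) ` I i" if "i < length Vs" "k \<le> i" for i
            using that xs(2) bas memD(1)[OF xs(1)] by (cases "i = k") auto
          then show ?case
            using Suc mem_upd[OF xs(1) k c.bas_mem[OF bas]] by blast
        qed
        from this[of "xs ! k"] show ?thesis using memD(2)[OF xs(1) k] by simp
      qed
    qed
  qed
  from this[of "length Vs"] show "mem xs \<Longrightarrow> single xs 1 \<in> U" by auto
qed

lemma F_sub_U: "f \<in> carrier F \<Longrightarrow> f \<in> U"
proof -
  assume f: "f \<in> carrier F"
  have "(\<Sum>x\<in>A. single x (lookup f x)) \<in> U"
    if "finite A" "A \<subseteq> keys f" for A
    using that
  proof (induction A)
    case empty
    show ?case using U_N[OF N_zero] by simp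
  next
    case (insert x A)
    then have "mem x" using f by (auto simp: free_tensor_simps)
    from U_scale[OF single_U[OF this], of "lookup f x"]
    show ?case using insert U_add by simp
  qed
  from this[of "keys f"] show "f \<in> U" by (simp add: sum_singles)
qed

lemma L_bs_sum: "L (\<Sum>ms\<in>J. single (bs ms) (a ms)) ms' = (if ms' \<in> J then a ms' else 0)"
proof -
  have "L (\<Sum>ms\<in>J. single (bs ms) (a ms)) ms' = (\<Sum>ms\<in>J. if ms' = ms then a ms else 0)"
    unfolding L_def lext_sum by (intro sum.cong) (auto simp: tc_bs)
  then show ?thesis using finite_J by simp
qed

lemma L_off: "f \<in> carrier F \<Longrightarrow> ms \<notin> J \<Longrightarrow> L f ms = 0"
proof -
  assume f: "f \<in> carrier F" and ms: "ms \<notin> J"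
  have "tc xs ms = 0" if "mem xs" for xs
  proof (cases "length ms = length Vs")
    case True
    then obtain i where "i < length Vs" "ms ! i \<notin> I i" using ms by (auto simp: J_def)
    then have "\<phi> i (xs ! i) (ms ! i) = 0"
      using coord_rep.crd_off[OF coord[OF \<open>i < length Vs\<close>]] memD(2)[OF that \<open>i < length Vs\<close>] by blast
    then show ?thesis using \<open>i < length Vs\<close> by (auto simp: tc_def)
  qed (simp add: tc_def)
  then show "L f ms = 0"
    using f unfolding L_def lext_def by (intro sum.neutral) (auto simp: free_tensor_simps)
qed

text \<open>Modulo \<open>N\<close> the element is a combination of basis tensors, and
  \<open>L\<close> returns the coefficients of that combination; if they all vanish, nothing
  remains.\<close>

lemma L_ker:
  assumes f: "f \<in> carrier F" and "\<And>ms. L f ms = 0"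
  shows "f \<in> N"
proof -
  obtain a where a: "f - (\<Sum>ms\<in>J. single (bs ms) (a ms)) \<in> N" (is "f - ?s \<in> N")
    using F_sub_U[OF f] by (auto simp: U_def)
  have "L (f - ?s) ms = L f ms - L ?s ms" for ms
    by (simp add: L_def lext_diff)
  then have "a ms = 0" if "ms \<in> J" for ms
    using L_N[OF a, of ms] that assms(2) by (simp add: L_bs_sum)
  then show ?thesis using a by simp
qed

theorem coord_rep_tensor: "coord_rep G (tensor Vs) J crd"
  and crd_coset: "\<And>f. f \<in> carrier F \<Longrightarrow> crd (N +>\<^bsub>F\<^esub> f) = L f"
proof -
  have surj: "\<exists>x\<in>carrier F. L x = H" if "\<And>j. j \<notin> J \<Longrightarrow> H j = 0" for H
  proof
    show "L (\<Sum>ms\<in>J. single (bs ms) (H ms)) = H"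
      using that by (auto simp: L_bs_sum fun_eq_iff)
    show "(\<Sum>ms\<in>J. single (bs ms) (H ms)) \<in> carrier F"
      by (intro F_sum single_mem bs_mem)
  qed
  have lin: "L (x \<oplus>\<^bsub>F\<^esub> y) j = L x j + L y j" "L (c \<odot>\<^bsub>F\<^esub> x) j = c * L x j" for x y c j
    by (simp_all add: L_def free_tensor_simps lext_add lext_scale)
  have crd: "crd = (\<lambda>A. L (SOME a. a \<in> A))" by (simp add: crd_def fun_eq_iff)
  note q = quot_setup.coord_rep_quot[OF quot, where L = L and J = J and G = G,
      OF finite_J lin L_off surj L_N L_ker act_linear_F act_N]
  show "coord_rep G (tensor Vs) J crd"
    unfolding crd tensor_def by (rule q(1))
  show "\<And>f. f \<in> carrier F \<Longrightarrow> crd (N +>\<^bsub>F\<^esub> f) = L f"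
    unfolding crd by (rule q(2))
qed

sublocale T: coord_rep G "tensor Vs" J crd
  by (rule coord_rep_tensor)

lemma tensor_carrier: "carrier (tensor Vs) = (\<lambda>f. N +>\<^bsub>F\<^esub> f) ` carrier F"
  by (simp add: tensor_def quot_setup.quot_carrier[OF quot])

lemma pure_tensor_mem: "mem xs \<Longrightarrow> pure_tensor Vs xs \<in> carrier (tensor Vs)"
  by (simp add: tensor_carrier pure_tensor_def single_mem)

lemma crd_pure_tensor: "mem xs \<Longrightarrow> crd (pure_tensor Vs xs) ms = tc xs ms"
  by (simp add: pure_tensor_def crd_coset single_mem) (simp add: L_def)

lemma act_pure_tensor:
  "mem xs \<Longrightarrow> g \<in> carrier G \<Longrightarrow> act (tensor Vs) g (pure_tensor Vs xs) = pure_tensor Vs (map2 (\<lambda>V. act V g) Vs xs)"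
  using quot_setup.quot_act[OF quot act_linear_F _ act_N single_mem]
  by (simp add: pure_tensor_def tensor_def) (simp add: free_tensor_simps)

end

subsection \<open>Symmetric powers in coordinates\<close>

lemma (in coord_rep) crd_minus:
  assumes "x \<in> carrier V" "y \<in> carrier V"
  shows "\<phi> (x \<ominus>\<^bsub>V\<^esub> y) i = \<phi> x i - \<phi> y i" and "x \<ominus>\<^bsub>V\<^esub> y \<in> carrier V"
proof -
  interpret M: module KR V by (rule module)
  show "x \<ominus>\<^bsub>V\<^esub> y \<in> carrier V" using assms by (rule M.minus_closed)
  moreover have "(x \<ominus>\<^bsub>V\<^esub> y) \<oplus>\<^bsub>V\<^esub> y = x"
    using assms by (simp add: a_minus_def M.a_assoc M.l_neg)
  ultimately show "\<phi> (x \<ominus>\<^bsub>V\<^esub> y) i = \<phi> x i - \<phi> y i"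
    using crd_add[of "x \<ominus>\<^bsub>V\<^esub> y" y i] assms(2) by simp
qed

text \<open>A vector read as a linear form in commuting variables \<open>x_i\<close>; a multiset of
  indices plays the role of a monomial.\<close>

definition lin_form :: "nat set \<Rightarrow> (nat \<Rightarrow> 'k::field) \<Rightarrow> 'k mpol" where
  "lin_form I v = (\<Sum>i\<in>I. single {#i#} (v i))"

text \<open>Expanding picks one variable from each factor, which gives a word \<open>l\<close>; the
  commutative product remembers only \<open>mset l\<close>. This sum over words serves the upper
  symmetric powers directly and the lower ones in transposed form.\<close>

lemma prod_list_lin_form:
  assumes "finite I"
  shows "prod_list (map (lin_form I) vs) =
    (\<Sum>l\<in>{l. set l \<subseteq> I \<and> length l = length vs}. single (mset l) (\<Prod>i<length vs. (vs ! i) (l ! i)))"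
proof (induction vs)
  case Nil
  have "{l. set l \<subseteq> I \<and> length l = 0} = {[]}" by auto
  then show ?case by simp
next
  case (Cons v vs)
  let ?S = "\<lambda>n. {l. set l \<subseteq> I \<and> length l = n}"
  have inj: "inj_on (\<lambda>(l, i). i # l) (?S (length vs) \<times> I)" by (auto simp: inj_on_def)
  have "prod_list (map (lin_form I) (v # vs)) =
      (\<Sum>i\<in>I. \<Sum>l\<in>?S (length vs). single {#i#} (v i) *
        single (mset l) (\<Prod>i<length vs. (vs ! i) (l ! i)))"
    by (simp add: Cons) (simp add: lin_form_def sum_product)
  also have "\<dots> = (\<Sum>i\<in>I. \<Sum>l\<in>?S (length vs).
      single (mset (i # l)) (\<Prod>j<length (v # vs). ((v # vs) ! j) ((i # l) ! j)))"
    by (simp only: mult_single length_Cons prod.lessThan_Suc_shift) simp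
  also have "\<dots> = (\<Sum>(l, i)\<in>?S (length vs) \<times> I.
      single (mset (i # l)) (\<Prod>j<length (v # vs). ((v # vs) ! j) ((i # l) ! j)))"
    by (subst sum.swap) (simp add: sum.cartesian_product)
  also have "\<dots> = (\<Sum>l\<in>(\<lambda>(l, i). i # l) ` (?S (length vs) \<times> I).
      single (mset l) (\<Prod>j<length (v # vs). ((v # vs) ! j) (l ! j)))"
    by (subst sum.reindex[OF inj]) (rule sum.cong, auto)
  also have "(\<lambda>(l, i). i # l) ` (?S (length vs) \<times> I) = ?S (length (v # vs))"
    by (simp add: lists_length_Suc_eq)
  finally show ?case .
qed

lemma free_map_comp: "free_map h (free_map k f) = free_map (h \<circ> k) f"
  by (intro poly_mapping_eqI) (simp add: lookup_free_map lext_free_map o_def)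

lemma lext_cong: "(\<And>x. x \<in> keys f \<Longrightarrow> h x = k x) \<Longrightarrow> lext h f = lext k f"
  unfolding lext_def by (rule sum.cong) auto

lemma free_map_cong: "(\<And>x. x \<in> keys f \<Longrightarrow> h x = k x) \<Longrightarrow> free_map h f = free_map k f"
  unfolding free_map_def by (rule sum.cong) auto

context tensor_coords
begin

lemma bas_eq: "ms \<in> J \<Longrightarrow> T.bas ms = pure_tensor Vs (bs ms)"
  by (intro T.crd_eqI T.bas_mem pure_tensor_mem bs_mem)
    (simp_all add: T.crd_bas crd_pure_tensor bs_mem tc_bs)

text \<open>Elements of a lower symmetric power are in general not pure tensors, so the action is
  needed as a matrix on all coordinates.\<close>

lemma crd_act:
  assumes g: "g \<in> carrier G" and w: "w \<in> carrier (tensor Vs)"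
  shows "crd (act (tensor Vs) g w) l = (\<Sum>l'\<in>J. tc (map2 (\<lambda>V. act V g) Vs (bs l')) l * crd w l')"
  using w
proof (induction rule: T.induct_bas)
  case zero
  then show ?case by (simp add: T.act_zero[OF g] T.crd_zero)
next
  case (add x y)
  then show ?case
    by (simp add: T.act_add[OF g] T.crd_add T.act_mem[OF g] distrib_left sum.distrib)
next
  case (smult c x)
  then show ?case
    by (simp add: T.act_smult[OF g] T.crd_smult T.act_mem[OF g] sum_distrib_left mult_ac)
next
  case (bas l')
  have "(\<Sum>l''\<in>J. tc (map2 (\<lambda>V. act V g) Vs (bs l'')) l * crd (T.bas l') l'') =
      (\<Sum>l''\<in>J. if l'' = l' then tc (map2 (\<lambda>V. act V g) Vs (bs l')) l else 0)"
    by (rule sum.cong) (simp_all add: T.crd_bas[OF bas])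
  also have "\<dots> = tc (map2 (\<lambda>V. act V g) Vs (bs l')) l"
    using bas finite_J by simp
  also have "\<dots> = crd (act (tensor Vs) g (T.bas l')) l"
    by (simp only: bas_eq[OF bas] act_pure_tensor[OF bs_mem[OF bas] g]
        crd_pure_tensor[OF act_map2_mem[OF bs_mem[OF bas] g]])
  finally show ?case by simp
qed

end

locale sym_coords = coord_rep G V I \<phi>
  for G :: "('g, 'm) monoid_scheme" and V :: "('g, 'k::field, 'v) rep"
    and I :: "nat set" and \<phi> :: "'v \<Rightarrow> nat \<Rightarrow> 'k" +
  fixes r :: nat
begin

sublocale tensor_coords G "replicate r V" "\<lambda>_. I" "\<lambda>_. \<phi>"
  by (rule tensor_coords.intro) (simp add: coord_rep_axioms)

abbreviation "TP \<equiv> tensor_power r V"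
abbreviation "K \<equiv> sym_ker r V"

lemma J_eq: "J = {l. set l \<subseteq> I \<and> length l = r}"
  by (auto simp: J_def in_set_conv_nth) (metis in_mono nth_mem)

lemma mem_iff: "xs \<in> listset (replicate r (carrier V)) \<longleftrightarrow> length xs = r \<and> set xs \<subseteq> carrier V"
  by (auto simp: in_listset_nth in_set_conv_nth) (metis in_mono nth_mem)

lemma permute_mem: "\<sigma> permutes {..<r} \<Longrightarrow> mem xs \<Longrightarrow> mem (permute_list \<sigma> xs)"
  by (simp add: mem_iff)

lemma permute_J: "\<sigma> permutes {..<r} \<Longrightarrow> l \<in> J \<Longrightarrow> permute_list \<sigma> l \<in> J"
  by (simp add: J_eq)

lemma permute_inv:
  assumes "\<sigma> permutes {..<length l}"
  shows "permute_list \<sigma> (permute_list (inv_into UNIV \<sigma>) l) = l" "permute_list (inv_into UNIV \<sigma>) (permute_list \<sigma> l) = l"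
  using permute_list_compose[OF assms, of "inv_into UNIV \<sigma>"] permute_list_compose[OF permutes_inv[OF assms], of \<sigma>]
  by (simp_all add: permutes_inv_o[OF assms])

lemma tc_permute:
  assumes s: "\<sigma> permutes {..<r}" and xs: "length xs = r"
  shows "tc (permute_list \<sigma> xs) l = tc xs (permute_list (inv_into UNIV \<sigma>) l)"
proof (cases "length l = r")
  case True
  have "(\<Prod>i<r. \<phi> (xs ! \<sigma> i) (l ! i)) = (\<Prod>i<r. \<phi> (xs ! i) (l ! inv_into UNIV \<sigma> i))"
    by (subst prod.permute[OF permutes_inv[OF s]])
      (simp add: o_def permutes_inverses[OF s])
  then show ?thesis
    using True s xs permutes_inv[OF s] by (simp add: tc_def permute_list_nth)
qed (simp add: tc_def)

lemma permute_F: "\<sigma> permutes {..<r} \<Longrightarrow> f \<in> carrier F \<Longrightarrow> free_map (permute_list \<sigma>) f \<in> carrier F"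
  using keys_free_map[of "permute_list \<sigma>" f] permute_mem[of \<sigma>] unfolding free_tensor_simps by blast

lemma L_permute:
  assumes s: "\<sigma> permutes {..<r}" and f: "f \<in> carrier F"
  shows "L (free_map (permute_list \<sigma>) f) l = L f (permute_list (inv_into UNIV \<sigma>) l)"
  unfolding L_def lext_free_map o_def
proof (rule lext_cong)
  fix xs assume "xs \<in> keys f"
  then have "mem xs" using f by (auto simp: free_tensor_simps)
  then show "tc (permute_list \<sigma> xs) l = tc xs (permute_list (inv_into UNIV \<sigma>) l)"
    by (intro tc_permute[OF s]) (simp add: mem_iff)
qed

lemma permute_N: "\<sigma> permutes {..<r} \<Longrightarrow> f \<in> N \<Longrightarrow> free_map (permute_list \<sigma>) f \<in> N"
  using N_closed(1) by (intro L_ker permute_F) (auto simp: L_permute L_N)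

lemma place_perm_coset:
  assumes "\<sigma> permutes {..<r}" "f \<in> carrier F"
  shows "place_perm r V \<sigma> (N +>\<^bsub>F\<^esub> f) = N +>\<^bsub>F\<^esub> free_map (permute_list \<sigma>) f"
  unfolding place_perm_def
  by (rule quot_setup.coset_map_linear[OF quot assms(2)])
    (simp_all add: permute_F permute_N assms free_tensor_simps(3) free_map_add)

lemma coset_ex: "w \<in> carrier TP \<Longrightarrow> \<exists>f\<in>carrier F. w = N +>\<^bsub>F\<^esub> f"
  by (auto simp: tensor_carrier)

lemma place_perm_mem: "\<sigma> permutes {..<r} \<Longrightarrow> w \<in> carrier TP \<Longrightarrow> place_perm r V \<sigma> w \<in> carrier TP"
  using coset_ex[of w] by (auto simp: place_perm_coset tensor_carrier permute_F)

lemma crd_place_perm: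
  "\<sigma> permutes {..<r} \<Longrightarrow> w \<in> carrier TP \<Longrightarrow> crd (place_perm r V \<sigma> w) l = crd w (permute_list (inv_into UNIV \<sigma>) l)"
  using coset_ex[of w] by (auto simp: place_perm_coset crd_coset permute_F L_permute)

text \<open>The group acts on entries and place permutations on positions, so they commute. This
  makes both the invariants and \<open>sym_ker\<close> stable under the group.\<close>

lemma place_perm_act:
  assumes s: "\<sigma> permutes {..<r}" and g: "g \<in> carrier G" and w: "w \<in> carrier TP"
  shows "place_perm r V \<sigma> (act TP g w) = act TP g (place_perm r V \<sigma> w)"
proof -
  obtain f where f: "f \<in> carrier F" and w: "w = N +>\<^bsub>F\<^esub> f" using coset_ex[OF w] by blast
  let ?a = "map2 (\<lambda>V. act V g) (replicate r V)"
  have act: "act TP g (N +>\<^bsub>F\<^esub> f) = N +>\<^bsub>F\<^esub> free_map ?a f" if "f \<in> carrier F" for f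
    using quot_setup.quot_act[OF quot act_linear_F g act_N[OF g] that]
    by (simp only: tensor_def free_tensor_simps)
  have aF: "free_map ?a f \<in> carrier F"
    using act_linear_F g f by (simp add: act_linear_def free_tensor_simps(5))
  have "permute_list \<sigma> (?a xs) = ?a (permute_list \<sigma> xs)" if "mem xs" for xs
    using that s permutes_in_image[OF s]
    by (intro nth_equalityI) (auto simp: mem_iff permute_list_nth)
  then have "free_map (permute_list \<sigma>) (free_map ?a f) = free_map ?a (free_map (permute_list \<sigma>) f)"
    unfolding free_map_comp o_def using f by (intro free_map_cong) (auto simp: free_tensor_simps(1))
  then show ?thesis
    unfolding w act[OF f] place_perm_coset[OF s aF] place_perm_coset[OF s f] act[OF permute_F[OF s f]]
    by simp
qed

abbreviation "krels \<equiv> {place_perm r V \<sigma> w \<ominus>\<^bsub>TP\<^esub> w | \<sigma> w. \<sigma> permutes {..<r} \<and> w \<in> carrier TP}"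

lemma krels_sub: "krels \<subseteq> carrier TP"
  using T.crd_minus(2) place_perm_mem by blast

lemma quotK: "quot_setup TP K"
  unfolding sym_ker_def by (intro quot_setup.intro submodule_rep_span T.module krels_sub)

lemma K_closed: "K \<subseteq> carrier TP" "\<zero>\<^bsub>TP\<^esub> \<in> K" "x \<in> K \<Longrightarrow> y \<in> K \<Longrightarrow> x \<oplus>\<^bsub>TP\<^esub> y \<in> K"
    "x \<in> K \<Longrightarrow> c \<odot>\<^bsub>TP\<^esub> x \<in> K"
  using quot_setup.sub[OF quotK] unfolding submodule_KR_iff[OF T.module] by blast+

definition M :: "nat multiset set" where
  "M = {m. size m = r \<and> set_mset m \<subseteq> I}"

text \<open>A sum over all rearrangements of a word does not notice place permutations and hence
  kills \<open>sym_ker\<close>; these sums become the coordinates of the coinvariants.\<close>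

definition Lsym :: "('v list \<Rightarrow>\<^sub>0 'k) set \<Rightarrow> nat multiset \<Rightarrow> 'k" where
  "Lsym w m = (\<Sum>l | l \<in> J \<and> mset l = m. crd w l)"

definition scrd :: "('v list \<Rightarrow>\<^sub>0 'k) set set \<Rightarrow> nat multiset \<Rightarrow> 'k" where
  "scrd A = Lsym (SOME a. a \<in> A)"

lemma mset_J: "l \<in> J \<Longrightarrow> mset l \<in> M"
  by (auto simp: J_eq M_def)

lemma sorted_J: "m \<in> M \<Longrightarrow> sorted_list_of_multiset m \<in> J"
  by (simp add: J_eq M_def) (metis mset_sorted_list_of_multiset size_mset)

lemma M_eq: "M = mset ` J"
  using mset_J sorted_J by (auto intro!: image_eqI[where x = "sorted_list_of_multiset x" for x])

lemma finite_M: "finite M"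
  by (simp add: M_eq finite_J)

lemma Lsym_K: "w \<in> K \<Longrightarrow> Lsym w m = 0"
  unfolding sym_ker_def
proof (induction rule: rep_span_induct[OF T.module krels_sub, consumes 1])
  case (1 x)
  then obtain \<sigma> w where s: "\<sigma> permutes {..<r}" and w: "w \<in> carrier TP" and x: "x = place_perm r V \<sigma> w \<ominus>\<^bsub>TP\<^esub> w"
    by blast
  have perm: "permute_list \<tau> l \<in> {l \<in> J. mset l = m}" if "\<tau> permutes {..<r}" "l \<in> {l \<in> J. mset l = m}" for \<tau> l
  proof -
    have "\<tau> permutes {..<length l}" using that by (simp add: J_eq)
    from mset_permute_list[OF this] show ?thesis using permute_J[OF that(1)] that(2) by simp
  qed
  have inv1: "permute_list \<sigma> (permute_list (inv_into UNIV \<sigma>) l) = l"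
    "permute_list (inv_into UNIV \<sigma>) (permute_list \<sigma> l) = l" if "l \<in> J" for l
    using permute_inv[of \<sigma> l] s that by (simp_all add: J_eq)
  have "(\<Sum>l | l \<in> J \<and> mset l = m. crd w (permute_list (inv_into UNIV \<sigma>) l)) = (\<Sum>l | l \<in> J \<and> mset l = m. crd w l)"
    by (rule sum.reindex_bij_witness[where i = "permute_list \<sigma>" and j = "permute_list (inv_into UNIV \<sigma>)"])
      (use perm[OF s] perm[OF permutes_inv[OF s]] inv1 in auto)
  then show ?case
    unfolding x Lsym_def T.crd_minus(1)[OF place_perm_mem[OF s w] w] crd_place_perm[OF s w]
    by (simp add: sum_subtractf)
next
  case 2
  then show ?case by (simp add: Lsym_def T.crd_zero)
next
  case (3 x y)
  then show ?case by (simp add: Lsym_def T.crd_add sum.distrib)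
next
  case (4 c x)
  then show ?case by (simp add: Lsym_def T.crd_smult flip: sum_distrib_left)
qed

text \<open>Tensors with a representative modulo \<open>sym_ker\<close> that is supported on sorted
  words, of which there is one for each multiset.\<close>

definition US :: "('v list \<Rightarrow>\<^sub>0 'k) set set" where
  "US = {w. \<exists>w'\<in>carrier TP. w \<ominus>\<^bsub>TP\<^esub> w' \<in> K \<and> (\<forall>l. crd w' l \<noteq> 0 \<longrightarrow> sorted l)}"

lemma US_all: "w \<in> carrier TP \<Longrightarrow> w \<in> US"
proof (induction rule: T.induct_bas)
  case zero
  have "\<zero>\<^bsub>TP\<^esub> \<ominus>\<^bsub>TP\<^esub> \<zero>\<^bsub>TP\<^esub> = \<zero>\<^bsub>TP\<^esub>"
    by (intro T.crd_eqI T.crd_minus(2) T.zero_mem) (simp add: T.crd_minus(1) T.zero_mem T.crd_zero)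
  then show ?case
    unfolding US_def by (auto intro!: bexI[of _ "\<zero>\<^bsub>TP\<^esub>"] simp: T.zero_mem K_closed(2) T.crd_zero)
next
  case (add x y)
  then obtain x' y' where x': "x' \<in> carrier TP" "x \<ominus>\<^bsub>TP\<^esub> x' \<in> K" "\<forall>l. crd x' l \<noteq> 0 \<longrightarrow> sorted l"
    and y': "y' \<in> carrier TP" "y \<ominus>\<^bsub>TP\<^esub> y' \<in> K" "\<forall>l. crd y' l \<noteq> 0 \<longrightarrow> sorted l"
    unfolding US_def by blast
  have "(x \<oplus>\<^bsub>TP\<^esub> y) \<ominus>\<^bsub>TP\<^esub> (x' \<oplus>\<^bsub>TP\<^esub> y') = (x \<ominus>\<^bsub>TP\<^esub> x') \<oplus>\<^bsub>TP\<^esub> (y \<ominus>\<^bsub>TP\<^esub> y')"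
    using add(1,2) x'(1) y'(1)
    by (intro T.crd_eqI) (simp_all add: T.crd_minus T.crd_add T.add_mem)
  then have "(x \<oplus>\<^bsub>TP\<^esub> y) \<ominus>\<^bsub>TP\<^esub> (x' \<oplus>\<^bsub>TP\<^esub> y') \<in> K" using K_closed(3)[OF x'(2) y'(2)] by simp
  moreover have "sorted l" if "crd (x' \<oplus>\<^bsub>TP\<^esub> y') l \<noteq> 0" for l
    using that x' y' by (cases "crd x' l = 0") (auto simp: T.crd_add)
  ultimately show ?case
    unfolding US_def using T.add_mem[OF x'(1) y'(1)] by blast
next
  case (smult c x)
  then obtain x' where x': "x' \<in> carrier TP" "x \<ominus>\<^bsub>TP\<^esub> x' \<in> K" "\<forall>l. crd x' l \<noteq> 0 \<longrightarrow> sorted l"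
    unfolding US_def by blast
  have "(c \<odot>\<^bsub>TP\<^esub> x) \<ominus>\<^bsub>TP\<^esub> (c \<odot>\<^bsub>TP\<^esub> x') = c \<odot>\<^bsub>TP\<^esub> (x \<ominus>\<^bsub>TP\<^esub> x')"
    using smult(1) x'(1)
    by (intro T.crd_eqI) (simp_all add: T.crd_minus T.crd_smult T.smult_mem right_diff_distrib)
  then have "(c \<odot>\<^bsub>TP\<^esub> x) \<ominus>\<^bsub>TP\<^esub> (c \<odot>\<^bsub>TP\<^esub> x') \<in> K" using K_closed(4)[OF x'(2)] by simp
  moreover have "sorted l" if "crd (c \<odot>\<^bsub>TP\<^esub> x') l \<noteq> 0" for l
    using that x' by (auto simp: T.crd_smult)
  ultimately show ?case
    unfolding US_def using T.smult_mem[OF x'(1)] by blast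
next
  case (bas l)
  let ?s = "sort l"
  have s: "?s \<in> J" using bas by (simp add: J_eq)
  obtain \<sigma> where p: "\<sigma> permutes {..<length ?s}" "permute_list \<sigma> ?s = l"
    using mset_eq_permutation[of l ?s] by auto
  have sr: "\<sigma> permutes {..<r}" using p(1) s by (simp add: J_eq)
  \<comment> \<open>A basis tensor is a rearrangement of the one at the sorted word, so their
    difference is a generator of \<open>sym_ker\<close>.\<close>
  have "T.bas l = place_perm r V \<sigma> (T.bas ?s)"
  proof (rule T.crd_inj[OF T.bas_mem[OF bas] place_perm_mem[OF sr T.bas_mem[OF s]]])
    fix l' assume "l' \<in> J"
    then have "\<sigma> permutes {..<length l'}" using sr by (simp add: J_eq)
    from permute_inv[OF this] permute_inv[OF p(1)] p(2)
    have "permute_list (inv_into UNIV \<sigma>) l' = ?s \<longleftrightarrow> l' = l" by metis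
    then show "crd (T.bas l) l' = crd (place_perm r V \<sigma> (T.bas ?s)) l'"
      by (simp add: crd_place_perm[OF sr T.bas_mem[OF s]] T.crd_bas[OF bas] T.crd_bas[OF s])
  qed
  then have "T.bas l \<ominus>\<^bsub>TP\<^esub> T.bas ?s = place_perm r V \<sigma> (T.bas ?s) \<ominus>\<^bsub>TP\<^esub> T.bas ?s" by simp
  then have "T.bas l \<ominus>\<^bsub>TP\<^esub> T.bas ?s \<in> krels" using sr T.bas_mem[OF s] by blast
  then have "T.bas l \<ominus>\<^bsub>TP\<^esub> T.bas ?s \<in> K"
    unfolding sym_ker_def by (rule subsetD[OF rep_span_superset])
  then show ?case
    unfolding US_def using T.bas_mem[OF s] by (auto intro!: bexI[of _ "T.bas ?s"] simp: T.crd_bas[OF s] split: if_splits)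
qed

lemma Lsym_sorted:
  assumes "\<forall>l. crd w l \<noteq> 0 \<longrightarrow> sorted l" "m \<in> M"
  shows "Lsym w m = crd w (sorted_list_of_multiset m)"
proof -
  have "Lsym w m = (\<Sum>l | l \<in> J \<and> mset l = m. if l = sorted_list_of_multiset m then crd w l else 0)"
    unfolding Lsym_def
  proof (rule sum.cong)
    fix l assume l: "l \<in> {l \<in> J. mset l = m}"
    have "l = sorted_list_of_multiset m" if "sorted l"
      using that l by (metis (mono_tags, lifting) mem_Collect_eq sorted_list_of_multiset_mset sorted_sort_id)
    then show "crd w l = (if l = sorted_list_of_multiset m then crd w l else 0)" using assms(1) by metis
  qed simp
  also have "\<dots> = crd w (sorted_list_of_multiset m)"
    using finite_J sorted_J[OF assms(2)] by (simp add: finite_subset[of _ J])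
  finally show ?thesis .
qed

lemma Lsym_add: "x \<in> carrier TP \<Longrightarrow> y \<in> carrier TP \<Longrightarrow> Lsym (x \<oplus>\<^bsub>TP\<^esub> y) m = Lsym x m + Lsym y m"
  by (simp add: Lsym_def T.crd_add sum.distrib)

lemma Lsym_smult: "x \<in> carrier TP \<Longrightarrow> Lsym (c \<odot>\<^bsub>TP\<^esub> x) m = c * Lsym x m"
  by (simp add: Lsym_def T.crd_smult sum_distrib_left)

lemma Lsym_minus: "x \<in> carrier TP \<Longrightarrow> y \<in> carrier TP \<Longrightarrow> Lsym (x \<ominus>\<^bsub>TP\<^esub> y) m = Lsym x m - Lsym y m"
  by (simp add: Lsym_def T.crd_minus(1) sum_subtractf)

text \<open>On a representative supported on sorted words the sum in \<open>Lsym\<close> has a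
  single term, so vanishing of all these sums kills each coordinate.\<close>

lemma Lsym_ker:
  assumes w: "w \<in> carrier TP" and 0: "\<And>m. Lsym w m = 0"
  shows "w \<in> K"
proof -
  obtain w' where w': "w' \<in> carrier TP" "w \<ominus>\<^bsub>TP\<^esub> w' \<in> K" "\<forall>l. crd w' l \<noteq> 0 \<longrightarrow> sorted l"
    using US_all[OF w] unfolding US_def by blast
  have L0: "Lsym w' m = 0" for m
    using Lsym_K[OF w'(2), of m] Lsym_minus[OF w w'(1)] 0 by simp
  have "crd w' l = 0" for l
  proof (rule ccontr)
    assume nz: "crd w' l \<noteq> 0"
    then have "l \<in> J" "sorted l" using T.crd_off[OF w'(1)] w'(3) by blast+
    then have "sorted_list_of_multiset (mset l) = l"
      by (simp add: sorted_list_of_multiset_mset sorted_sort_id)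
    then show False using Lsym_sorted[OF w'(3) mset_J[OF \<open>l \<in> J\<close>]] L0 nz by simp
  qed
  then have "w = w \<ominus>\<^bsub>TP\<^esub> w'"
    by (intro T.crd_eqI w T.crd_minus(2) w') (simp add: T.crd_minus(1) w w'(1))
  then show ?thesis using w'(2) by simp
qed

lemma act_K:
  assumes g: "g \<in> carrier G" and "w \<in> K"
  shows "act TP g w \<in> K"
  using assms(2) unfolding sym_ker_def
proof (induction rule: rep_span_induct[OF T.module krels_sub, consumes 1])
  case (1 x)
  then obtain \<sigma> w where s: "\<sigma> permutes {..<r}" and w: "w \<in> carrier TP" and x: "x = place_perm r V \<sigma> w \<ominus>\<^bsub>TP\<^esub> w"
    by blast
  have m: "\<And>u v. u \<in> carrier TP \<Longrightarrow> v \<in> carrier TP \<Longrightarrow> u \<ominus>\<^bsub>TP\<^esub> v = u \<oplus>\<^bsub>TP\<^esub> (-1) \<odot>\<^bsub>TP\<^esub> v"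
    by (intro T.crd_eqI T.crd_minus(2) T.add_mem T.smult_mem)
      (simp_all add: T.crd_minus(1) T.crd_add T.crd_smult T.smult_mem)
  have "act TP g x = place_perm r V \<sigma> (act TP g w) \<ominus>\<^bsub>TP\<^esub> act TP g w"
    unfolding x place_perm_act[OF s g w]
    by (simp add: m T.act_add[OF g] T.act_smult[OF g] T.act_mem[OF g] T.smult_mem place_perm_mem[OF s] w)
  then have "act TP g x \<in> krels" using s T.act_mem[OF g w] by blast
  then show ?case by (rule subsetD[OF rep_span_superset])
next
  case 2
  then show ?case using K_closed(2) by (simp add: T.act_zero[OF g] sym_ker_def)
next
  case (3 x y)
  then show ?case using K_closed(3)[unfolded sym_ker_def] by (simp add: T.act_add[OF g])
next
  case (4 c x)
  then show ?case using K_closed(4)[unfolded sym_ker_def] by (simp add: T.act_smult[OF g])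
qed

lemma Lsym_off: "m \<notin> M \<Longrightarrow> Lsym w m = 0"
  unfolding Lsym_def by (rule sum.neutral) (use mset_J in blast)

lemma Lsym_surj:
  assumes "\<And>m. m \<notin> M \<Longrightarrow> H m = 0"
  shows "\<exists>w\<in>carrier TP. Lsym w = H"
proof -
  obtain w where w: "w \<in> carrier TP" "crd w = (\<lambda>l. if sorted l then H (mset l) else 0)"
  proof -
    have "(if sorted l then H (mset l) else 0) = 0" if "l \<notin> J" for l
    proof -
      have "mset l \<notin> M"
      proof
        assume "mset l \<in> M"
        then have "length l = r" "set l \<subseteq> I" by (simp_all add: M_def)
        then show False using that by (simp add: J_eq)
      qed
      with assms show ?thesis by simp
    qed
    from T.crd_surj[of "\<lambda>l. if sorted l then H (mset l) else 0", OF this] that show ?thesis by blast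
  qed
  have "Lsym w m = H m" for m
  proof (cases "m \<in> M")
    case True
    have "\<forall>l. crd w l \<noteq> 0 \<longrightarrow> sorted l" by (simp add: w(2))
    from Lsym_sorted[OF this True] show ?thesis by (simp add: w(2))
  qed (simp add: Lsym_off assms)
  then show ?thesis using w(1) by blast
qed

lemma coord_rep_sym_upper: "coord_rep G (sym_upper r V) M scrd"
  and scrd_coset: "\<And>w. w \<in> carrier TP \<Longrightarrow> scrd (K +>\<^bsub>TP\<^esub> w) = Lsym w"
proof -
  have scrd: "scrd = (\<lambda>A. Lsym (SOME a. a \<in> A))" by (simp add: scrd_def fun_eq_iff)
  note q = quot_setup.coord_rep_quot[OF quotK, where L = Lsym and J = M and G = G,
      OF finite_M Lsym_add Lsym_smult Lsym_off Lsym_surj Lsym_K Lsym_ker T.act_lin act_K]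
  show "coord_rep G (sym_upper r V) M scrd"
    unfolding scrd sym_upper_def by (rule q(1))
  show "\<And>w. w \<in> carrier TP \<Longrightarrow> scrd (K +>\<^bsub>TP\<^esub> w) = Lsym w"
    unfolding scrd by (rule q(2))
qed

lemma sym_prod_mem:
  assumes "set xs \<subseteq> carrier V" "length xs = r"
  shows "sym_prod V xs \<in> carrier (sym_upper r V)"
  using assms pure_tensor_mem[of xs]
  by (simp add: sym_prod_def sym_upper_def quot_setup.quot_carrier[OF quotK] mem_iff)

text \<open>This identifies the upper symmetric power with homogeneous polynomials: products of
  vectors become products of their linear forms.\<close>

lemma scrd_sym_prod:
  assumes "set xs \<subseteq> carrier V" "length xs = r"
  shows "scrd (sym_prod V xs) m = lookup (prod_list (map (\<lambda>x. lin_form I (\<phi> x)) xs)) m"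
proof -
  have xs: "mem xs" using assms by (simp add: mem_iff)
  have "scrd (sym_prod V xs) m = (\<Sum>l | l \<in> J \<and> mset l = m. tc xs l)"
    using scrd_coset[OF pure_tensor_mem[OF xs]] assms(2)
    by (simp add: sym_prod_def Lsym_def crd_pure_tensor[OF xs])
  also have "\<dots> = (\<Sum>l\<in>J. if mset l = m then tc xs l else 0)"
    using finite_J by (simp add: sum.If_cases Int_def)
  also have "\<dots> = lookup (prod_list (map (lin_form I) (map \<phi> xs))) m"
    unfolding prod_list_lin_form[OF fin] lookup_sum using assms(2)
    by (intro sum.cong) (auto simp: J_eq tc_def lookup_single when_def)
  finally show ?thesis by (simp add: o_def)
qed

lemma act_sym_prod:
  assumes "set xs \<subseteq> carrier V" "length xs = r" and g: "g \<in> carrier G"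
  shows "act (sym_upper r V) g (sym_prod V xs) = sym_prod V (map (act V g) xs)"
proof -
  have xs: "mem xs" using assms by (simp add: mem_iff)
  have "map2 (\<lambda>V. act V g) (replicate r V) xs = map (act V g) xs"
    using assms(2) by (intro nth_equalityI) auto
  then show ?thesis
    using assms(2) quot_setup.quot_act[OF quotK T.act_lin g act_K[OF g] pure_tensor_mem[OF xs]]
      act_pure_tensor[OF xs g]
    by (simp add: sym_prod_def sym_upper_def)
qed

text \<open>An invariant tensor has the same coordinate at all rearrangements of a word, so one word
  per multiset suffices. The index set agrees with that of the upper power; only the action
  differs.\<close>

definition lcrd :: "('v list \<Rightarrow>\<^sub>0 'k) set \<Rightarrow> nat multiset \<Rightarrow> 'k" where
  "lcrd w m = (if m \<in> M then crd w (sorted_list_of_multiset m) else 0)"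

lemma sym_lower_simps:
  "carrier (sym_lower r V) = {w \<in> carrier TP. \<forall>\<sigma>. \<sigma> permutes {..<r} \<longrightarrow> place_perm r V \<sigma> w = w}"
  "zero (sym_lower r V) = zero TP" "add (sym_lower r V) = add TP"
  "module.smult (sym_lower r V) = module.smult TP" "act (sym_lower r V) = act TP"
  by (simp_all add: sym_lower_def)

lemma sym_lower_iff:
  assumes w: "w \<in> carrier TP"
  shows "w \<in> carrier (sym_lower r V) \<longleftrightarrow> (\<forall>l\<in>J. \<forall>l'\<in>J. mset l = mset l' \<longrightarrow> crd w l = crd w l')"
proof
  assume *: "w \<in> carrier (sym_lower r V)"
  show "\<forall>l\<in>J. \<forall>l'\<in>J. mset l = mset l' \<longrightarrow> crd w l = crd w l'"
  proof (intro ballI impI)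
    fix l l' assume l: "l \<in> J" "l' \<in> J" "mset l = mset l'"
    obtain \<sigma> where p: "\<sigma> permutes {..<length l'}" "permute_list \<sigma> l' = l"
      using mset_eq_permutation[OF l(3)] by auto
    have s: "\<sigma> permutes {..<r}" using p l by (simp add: J_eq)
    have "crd w l = crd (place_perm r V \<sigma> w) l" using * s by (simp add: sym_lower_simps)
    also have "\<dots> = crd w l'" using crd_place_perm[OF s w] permute_inv[OF p(1)] p(2) by simp
    finally show "crd w l = crd w l'" .
  qed
next
  assume *: "\<forall>l\<in>J. \<forall>l'\<in>J. mset l = mset l' \<longrightarrow> crd w l = crd w l'"
  have "place_perm r V \<sigma> w = w" if s: "\<sigma> permutes {..<r}" for \<sigma>
  proof (rule T.crd_inj[OF place_perm_mem[OF s w] w])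
    fix l assume l: "l \<in> J"
    then have "inv_into UNIV \<sigma> permutes {..<length l}" using permutes_inv[OF s] by (simp add: J_eq)
    from mset_permute_list[OF this] bspec[OF bspec[OF * permute_J[OF permutes_inv[OF s] l]] l]
    show "crd (place_perm r V \<sigma> w) l = crd w l"
      unfolding crd_place_perm[OF s w] by blast
  qed
  then show "w \<in> carrier (sym_lower r V)" using w by (simp add: sym_lower_simps)
qed

lemma lcrd_J: "w \<in> carrier (sym_lower r V) \<Longrightarrow> l \<in> J \<Longrightarrow> crd w l = lcrd w (mset l)"
proof -
  assume w: "w \<in> carrier (sym_lower r V)" and l: "l \<in> J"
  then have "w \<in> carrier TP" by (simp add: sym_lower_simps)
  from sym_lower_iff[OF this] w have "\<forall>l\<in>J. \<forall>l'\<in>J. mset l = mset l' \<longrightarrow> crd w l = crd w l'" by blast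
  from bspec[OF bspec[OF this l] sorted_J[OF mset_J[OF l]]]
  show ?thesis by (simp add: lcrd_def mset_J[OF l])
qed

lemma coord_rep_sym_lower: "coord_rep G (sym_lower r V) M lcrd"
proof
  have sub: "x \<in> carrier TP" if "x \<in> carrier (sym_lower r V)" for x
    using that by (simp add: sym_lower_simps)
  show "\<zero>\<^bsub>sym_lower r V\<^esub> \<in> carrier (sym_lower r V)"
    by (subst sym_lower_iff) (simp_all add: sym_lower_simps T.zero_mem T.crd_zero)
  show "lcrd \<zero>\<^bsub>sym_lower r V\<^esub> m = 0" for m
    by (simp add: lcrd_def sym_lower_simps T.crd_zero)
  show "finite M" by (rule finite_M)
  fix x assume x: "x \<in> carrier (sym_lower r V)"
  note x' = sub[OF x]
  show "c \<odot>\<^bsub>sym_lower r V\<^esub> x \<in> carrier (sym_lower r V)" for c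
    using x by (subst sym_lower_iff)
      (auto simp: sym_lower_simps(4) T.smult_mem x' T.crd_smult lcrd_J)
  show "lcrd (c \<odot>\<^bsub>sym_lower r V\<^esub> x) m = c * lcrd x m" for c m
    by (simp add: lcrd_def sym_lower_simps(4) T.crd_smult x')
  show "m \<notin> M \<Longrightarrow> lcrd x m = 0" for m by (simp add: lcrd_def)
  fix y assume y: "y \<in> carrier (sym_lower r V)"
  note y' = sub[OF y]
  show "x \<oplus>\<^bsub>sym_lower r V\<^esub> y \<in> carrier (sym_lower r V)"
    using x y by (subst sym_lower_iff)
      (auto simp: sym_lower_simps(3) T.add_mem x' y' T.crd_add lcrd_J)
  show "lcrd (x \<oplus>\<^bsub>sym_lower r V\<^esub> y) m = lcrd x m + lcrd y m" for m
    by (simp add: lcrd_def sym_lower_simps(3) T.crd_add x' y')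
  show "x = y" if "\<And>i. i \<in> M \<Longrightarrow> lcrd x i = lcrd y i"
    by (rule T.crd_inj[OF x' y']) (simp add: lcrd_J x y that mset_J)
next
  fix H :: "nat multiset \<Rightarrow> 'k" assume H: "\<And>m. m \<notin> M \<Longrightarrow> H m = 0"
  have "(if l \<in> J then H (mset l) else 0) = 0" if "l \<notin> J" for l using that by simp
  from T.crd_surj[of "\<lambda>l. if l \<in> J then H (mset l) else 0", OF this]
  obtain w where w: "w \<in> carrier TP" "crd w = (\<lambda>l. if l \<in> J then H (mset l) else 0)" by blast
  have "w \<in> carrier (sym_lower r V)" by (subst sym_lower_iff[OF w(1)]) (simp add: w(2))
  moreover have "lcrd w = H"
    by (rule ext) (simp add: lcrd_def w(2) sorted_J H)
  ultimately show "\<exists>x\<in>carrier (sym_lower r V). lcrd x = H" by blast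
next
  show "act_linear G (sym_lower r V)"
    unfolding act_linear_def sym_lower_simps
    by (auto simp: T.act_add T.act_smult T.act_mem place_perm_act)
qed

end

declare One_nat_def [simp del]

subsection \<open>Change of index set, matrices and duals\<close>

text \<open>Serves to replace multisets by the indices \<open>0, ..., l\<close>, and later to
  reverse the order of a basis.\<close>

lemma (in coord_rep) reindex:
  fixes h :: "'j \<Rightarrow> 'i"
  assumes h: "bij_betw h I' I"
  shows "coord_rep G V I' (\<lambda>x i. if i \<in> I' then \<phi> x (h i) else 0)"
proof
  show "finite I'" using h fin bij_betw_finite by blast
next
  fix x y assume "x \<in> carrier V" "y \<in> carrier V"
    and eq: "\<And>i. i \<in> I' \<Longrightarrow> (if i \<in> I' then \<phi> x (h i) else 0) = (if i \<in> I' then \<phi> y (h i) else 0)"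
  then show "x = y"
  proof (rule_tac crd_inj)
    fix i assume "i \<in> I"
    then obtain i' where "i' \<in> I'" "i = h i'" using h by (auto simp: bij_betw_def)
    then show "\<phi> x i = \<phi> y i" using eq[of i'] by simp
  qed
next
  fix H :: "'j \<Rightarrow> 'k" assume H: "\<And>i. i \<notin> I' \<Longrightarrow> H i = 0"
  have "\<exists>x\<in>carrier V. \<phi> x = (\<lambda>i. if i \<in> I then H (the_inv_into I' h i) else 0)"
    by (rule crd_surj) simp
  then obtain x where x: "x \<in> carrier V" "\<phi> x = (\<lambda>i. if i \<in> I then H (the_inv_into I' h i) else 0)" by blast
  have "(\<lambda>i. if i \<in> I' then \<phi> x (h i) else 0) = H"
  proof
    fix i
    show "(if i \<in> I' then \<phi> x (h i) else 0) = H i"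
      using h H[of i] bij_betwE[OF h] by (simp add: x(2) bij_betw_def the_inv_into_f_f)
  qed
  then show "\<exists>x\<in>carrier V. (\<lambda>i. if i \<in> I' then \<phi> x (h i) else 0) = H" using x(1) by blast
qed (simp_all add: zero_mem add_mem smult_mem crd_zero crd_add crd_smult act_lin)

lemma (in coord_rep) linear_expand:
  fixes f :: "'v \<Rightarrow> 'k"
  assumes "x \<in> carrier V"
    and "\<And>x y. x \<in> carrier V \<Longrightarrow> y \<in> carrier V \<Longrightarrow> f (x \<oplus>\<^bsub>V\<^esub> y) = f x + f y"
    and f_smult: "\<And>c x. x \<in> carrier V \<Longrightarrow> f (c \<odot>\<^bsub>V\<^esub> x) = c * f x"
  shows "f x = (\<Sum>i\<in>I. f (bas i) * \<phi> x i)"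
  using assms(1)
proof (induction rule: induct_bas)
  case zero
  have "f \<zero>\<^bsub>V\<^esub> = 0" using f_smult[OF zero_mem, of 0] by (simp add: null zero_mem)
  then show ?case by (simp add: crd_zero)
next
  case (bas j)
  have "(\<Sum>i\<in>I. f (local.bas i) * \<phi> (local.bas j) i) = (\<Sum>i\<in>I. if i = j then f (local.bas j) else 0)"
    by (rule sum.cong) (simp_all add: crd_bas[OF bas])
  then show ?case using bas fin by simp
qed (simp_all add: assms crd_add crd_smult distrib_left sum.distrib sum_distrib_left mult_ac)

lemma (in coord_rep) crd_act_matrix:
  assumes g: "g \<in> carrier G" and x: "x \<in> carrier V"
  shows "\<phi> (act V g x) j = (\<Sum>i\<in>I. \<phi> (act V g (bas i)) j * \<phi> x i)"
  by (rule linear_expand[OF x]) (simp_all add: act_add[OF g] act_smult[OF g] act_mem[OF g] crd_add crd_smult)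

lemma dual_simps:
  "carrier (dual_rep G V) = {\<psi> \<in> carrier V \<rightarrow>\<^sub>E UNIV.
       (\<forall>x\<in>carrier V. \<forall>y\<in>carrier V. \<psi> (x \<oplus>\<^bsub>V\<^esub> y) = \<psi> x + \<psi> y) \<and>
       (\<forall>c. \<forall>x\<in>carrier V. \<psi> (c \<odot>\<^bsub>V\<^esub> x) = c * \<psi> x)}"
  "zero (dual_rep G V) = (\<lambda>x\<in>carrier V. 0)"
  "add (dual_rep G V) = (\<lambda>\<phi> \<psi>. \<lambda>x\<in>carrier V. \<phi> x + \<psi> x)"
  "module.smult (dual_rep G V) = (\<lambda>c \<phi>. \<lambda>x\<in>carrier V. c * \<phi> x)"
  "act (dual_rep G V) = (\<lambda>g \<phi>. \<lambda>x\<in>carrier V. \<phi> (act V (inv\<^bsub>G\<^esub> g) x))"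
  by (simp_all add: dual_rep_def)

lemma dualD:
  assumes "\<psi> \<in> carrier (dual_rep G V)"
  shows "x \<in> carrier V \<Longrightarrow> y \<in> carrier V \<Longrightarrow> \<psi> (x \<oplus>\<^bsub>V\<^esub> y) = \<psi> x + \<psi> y"
    "x \<in> carrier V \<Longrightarrow> \<psi> (c \<odot>\<^bsub>V\<^esub> x) = c * \<psi> x" "\<psi> \<in> extensional (carrier V)"
  using assms by (auto simp: dual_simps PiE_def)

lemma dualI:
  assumes "\<psi> \<in> extensional (carrier V)"
    "\<And>x y. x \<in> carrier V \<Longrightarrow> y \<in> carrier V \<Longrightarrow> \<psi> (x \<oplus>\<^bsub>V\<^esub> y) = \<psi> x + \<psi> y"
    "\<And>c x. x \<in> carrier V \<Longrightarrow> \<psi> (c \<odot>\<^bsub>V\<^esub> x) = c * \<psi> x"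
  shows "\<psi> \<in> carrier (dual_rep G V)"
  using assms by (auto simp: dual_simps PiE_def)

context coord_rep
begin

lemma dual_expand: "\<psi> \<in> carrier (dual_rep G V) \<Longrightarrow> x \<in> carrier V \<Longrightarrow> \<psi> x = (\<Sum>i\<in>I. \<psi> (bas i) * \<phi> x i)"
  by (rule linear_expand) (simp_all add: dualD)

definition dcrd :: "('v \<Rightarrow> 'k) \<Rightarrow> 'i \<Rightarrow> 'k" where
  "dcrd \<psi> i = (if i \<in> I then \<psi> (bas i) else 0)"

lemma coord_rep_dual:
  assumes G: "group G"
  shows "coord_rep G (dual_rep G V) I dcrd"
proof
  show "finite I" by (rule fin)
  show "\<zero>\<^bsub>dual_rep G V\<^esub> \<in> carrier (dual_rep G V)"
    by (rule dualI) (simp_all add: dual_simps add_mem smult_mem)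
  show "dcrd \<zero>\<^bsub>dual_rep G V\<^esub> i = 0" for i
    by (simp add: dcrd_def dual_simps bas_mem)
next
  fix \<psi> \<eta> assume \<psi>: "\<psi> \<in> carrier (dual_rep G V)" and \<eta>: "\<eta> \<in> carrier (dual_rep G V)"
  show "\<psi> \<oplus>\<^bsub>dual_rep G V\<^esub> \<eta> \<in> carrier (dual_rep G V)"
    by (rule dualI) (simp_all add: dual_simps(3) add_mem smult_mem dualD[OF \<psi>] dualD[OF \<eta>] algebra_simps)
  show "dcrd (\<psi> \<oplus>\<^bsub>dual_rep G V\<^esub> \<eta>) i = dcrd \<psi> i + dcrd \<eta> i" for i
    by (simp add: dcrd_def dual_simps(3) bas_mem)
  show "\<psi> = \<eta>" if eq: "\<And>i. i \<in> I \<Longrightarrow> dcrd \<psi> i = dcrd \<eta> i"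
  proof (rule extensionalityI[OF dualD(3)[OF \<psi>] dualD(3)[OF \<eta>]])
    fix x assume x: "x \<in> carrier V"
    show "\<psi> x = \<eta> x"
      unfolding dual_expand[OF \<psi> x] dual_expand[OF \<eta> x]
      by (rule sum.cong) (use eq in \<open>simp_all add: dcrd_def\<close>)
  qed
next
  fix \<psi> c assume \<psi>: "\<psi> \<in> carrier (dual_rep G V)"
  show "c \<odot>\<^bsub>dual_rep G V\<^esub> \<psi> \<in> carrier (dual_rep G V)"
    by (rule dualI) (simp_all add: dual_simps(4) add_mem smult_mem dualD[OF \<psi>] algebra_simps)
  show "dcrd (c \<odot>\<^bsub>dual_rep G V\<^esub> \<psi>) i = c * dcrd \<psi> i" for i
    by (simp add: dcrd_def dual_simps(4) bas_mem)
next
  show "i \<notin> I \<Longrightarrow> dcrd \<psi> i = 0" for \<psi> i by (simp add: dcrd_def)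
next
  fix H :: "'i \<Rightarrow> 'k" assume H: "\<And>i. i \<notin> I \<Longrightarrow> H i = 0"
  define \<psi> where "\<psi> = (\<lambda>x\<in>carrier V. \<Sum>i\<in>I. H i * \<phi> x i)"
  have "\<psi> \<in> carrier (dual_rep G V)"
    by (rule dualI) (simp_all add: \<psi>_def add_mem smult_mem crd_add crd_smult distrib_left sum.distrib
        sum_distrib_left mult_ac)
  moreover have "dcrd \<psi> = H"
  proof
    fix i show "dcrd \<psi> i = H i"
    proof (cases "i \<in> I")
      case True
      have "(\<Sum>j\<in>I. H j * \<phi> (bas i) j) = (\<Sum>j\<in>I. if j = i then H i else 0)"
        by (rule sum.cong) (simp_all add: crd_bas[OF True])
      then show ?thesis using True fin by (simp add: dcrd_def \<psi>_def bas_mem)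
    qed (simp add: dcrd_def H)
  qed
  ultimately show "\<exists>\<psi>\<in>carrier (dual_rep G V). dcrd \<psi> = H" by blast
next
  show "act_linear G (dual_rep G V)"
    unfolding act_linear_def
  proof (intro ballI conjI allI)
    fix g \<psi> assume g: "g \<in> carrier G" and \<psi>: "\<psi> \<in> carrier (dual_rep G V)"
    have g': "inv\<^bsub>G\<^esub> g \<in> carrier G" using G g by (rule group.inv_closed)
    show "act (dual_rep G V) g \<psi> \<in> carrier (dual_rep G V)"
      by (rule dualI)
        (simp_all add: dual_simps(5) add_mem smult_mem act_add[OF g'] act_smult[OF g'] act_mem[OF g'] dualD[OF \<psi>])
    show "act (dual_rep G V) g (c \<odot>\<^bsub>dual_rep G V\<^esub> \<psi>) = c \<odot>\<^bsub>dual_rep G V\<^esub> act (dual_rep G V) g \<psi>" for c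
      by (rule ext) (simp add: dual_simps(4,5) act_mem[OF g'])
    fix \<eta> assume \<eta>: "\<eta> \<in> carrier (dual_rep G V)"
    show "act (dual_rep G V) g (\<psi> \<oplus>\<^bsub>dual_rep G V\<^esub> \<eta>) =
        act (dual_rep G V) g \<psi> \<oplus>\<^bsub>dual_rep G V\<^esub> act (dual_rep G V) g \<eta>"
      by (rule ext) (simp add: dual_simps(3,5) act_mem[OF g'])
  qed
qed

end

subsection \<open>The special linear group and symmetric powers of its natural representation\<close>

text \<open>The lower unipotent element: it sends \<open>e_0\<close> to \<open>e_0 + z e_1\<close>
  and fixes \<open>e_1\<close>, so it lowers weights and raises indices.\<close>

definition low :: "'k::field \<Rightarrow> 'k ^ 2 ^ 2" where
  "low z = (\<chi> i j. if i = j then 1 else if i = 2 then z else 0)"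

definition tor :: "'k::field \<Rightarrow> 'k ^ 2 ^ 2" where
  "tor t = (\<chi> i j. if i = j then if i = 1 then t else inverse t else 0)"

lemma SL2_simps [simp]: "carrier SL2 = {A :: 'k::field ^ 2 ^ 2. Determinants.det A = 1}"
  "mult SL2 = (\<lambda>A B :: 'k::field ^ 2 ^ 2. A ** B)" "one SL2 = (Finite_Cartesian_Product.mat 1 :: 'k::field ^ 2 ^ 2)"
  by (simp_all add: SL2_def)

lemma group_SL2: "group (SL2 :: ('k::field ^ 2 ^ 2) monoid)"
proof (rule groupI)
  fix A :: "'k ^ 2 ^ 2" assume "A \<in> carrier SL2"
  then have d: "Determinants.det A = 1" by simp
  then have "invertible A" by (simp add: invertible_det_nz)
  then obtain B where B: "A ** B = Finite_Cartesian_Product.mat 1" "B ** A = Finite_Cartesian_Product.mat 1"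
    by (auto simp: invertible_def)
  have "Determinants.det B = 1"
    using arg_cong[OF B(1), of Determinants.det] by (simp add: det_mul d)
  with B show "\<exists>B\<in>carrier SL2. B \<otimes>\<^bsub>SL2\<^esub> A = \<one>\<^bsub>SL2\<^esub>" by auto
qed (simp_all add: det_mul matrix_mul_assoc)

lemma low_SL2 [simp]: "Determinants.det (low z) = 1"
  by (simp add: low_def det_2)

lemma tor_SL2 [simp]: "t \<noteq> 0 \<Longrightarrow> Determinants.det (tor t) = 1"
  by (simp add: tor_def det_2)

lemma inv_low: "inv\<^bsub>SL2\<^esub> (low z) = low (- z)"
proof (rule group.inv_equality[OF group_SL2])
  show "low (- z) \<otimes>\<^bsub>SL2\<^esub> low z = \<one>\<^bsub>SL2\<^esub>"
    by (simp add: low_def Finite_Cartesian_Product.vec_eq_iff matrix_matrix_mult_def sum_2 Finite_Cartesian_Product.mat_def forall_2)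
qed simp_all

lemma inv_tor: "t \<noteq> 0 \<Longrightarrow> inv\<^bsub>SL2\<^esub> (tor t) = tor (inverse t)"
proof (rule group.inv_equality[OF group_SL2])
  show "t \<noteq> 0 \<Longrightarrow> tor (inverse t) \<otimes>\<^bsub>SL2\<^esub> tor t = \<one>\<^bsub>SL2\<^esub>"
    by (simp add: tor_def Finite_Cartesian_Product.vec_eq_iff matrix_matrix_mult_def sum_2 Finite_Cartesian_Product.mat_def forall_2)
qed simp_all

definition ncrd :: "'k::field ^ 2 \<Rightarrow> nat \<Rightarrow> 'k" where
  "ncrd x i = (if i = 0 then vec_nth x 1 else if i = 1 then vec_nth x 2 else 0)"

lemma natural_simps:
  "carrier natural_rep = UNIV" "zero natural_rep = 0" "add natural_rep = (+)"
  "module.smult natural_rep = (*s)" "act natural_rep = (*v)"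
  by (simp_all add: natural_rep_def)

lemma coord_rep_natural: "coord_rep SL2 (natural_rep :: ('k::field ^ 2 ^ 2, 'k, 'k ^ 2) rep) {0, 1} ncrd"
proof
  show "act_linear SL2 (natural_rep :: ('k ^ 2 ^ 2, 'k, 'k ^ 2) rep)"
    by (simp add: act_linear_def natural_simps matrix_vector_right_distrib vector_scalar_commute)
  fix x y :: "'k ^ 2" assume "\<And>i. i \<in> {0, 1} \<Longrightarrow> ncrd x i = ncrd y i"
  from this[of 0] this[of 1] show "x = y" by (simp add: ncrd_def Finite_Cartesian_Product.vec_eq_iff forall_2)
next
  fix H :: "nat \<Rightarrow> 'k" assume H: "\<And>i. i \<notin> {0, 1} \<Longrightarrow> H i = 0"
  have "ncrd (\<chi> i. if i = 1 then H 0 else H 1) = H"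
    using H by (auto simp: ncrd_def fun_eq_iff)
  then show "\<exists>x\<in>carrier (natural_rep :: ('k ^ 2 ^ 2, 'k, 'k ^ 2) rep). ncrd x = H"
    by (auto simp: natural_simps)
qed (auto simp: natural_simps ncrd_def)

lemma ncrd_low: "ncrd (act natural_rep (low z) x) i = (if i = 1 then z * ncrd x 0 + ncrd x 1 else ncrd x i)"
  by (simp add: natural_simps ncrd_def low_def matrix_vector_mult_def sum_2)

lemma ncrd_tor: "ncrd (act natural_rep (tor t) x) i = (if i = 0 then t * ncrd x 0 else if i = 1 then inverse t * ncrd x 1 else 0)"
  by (simp add: natural_simps ncrd_def tor_def matrix_vector_mult_def sum_2)

text \<open>A basis of weight vectors \<open>v\<^sub>0, \<dots>, v\<^sub>l\<close> in which \<open>low z\<close> maps \<open>v\<^sub>i\<close> to the sum of the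
  \<open>c i j z\<^bsup>j-i\<^esup> v\<^sub>j\<close>.\<close>

definition wt_model :: "('k::field ^ 2 ^ 2, 'k, 'v) rep \<Rightarrow> nat \<Rightarrow> ('v \<Rightarrow> nat \<Rightarrow> 'k) \<Rightarrow> (nat \<Rightarrow> nat \<Rightarrow> nat) \<Rightarrow> bool" where
  "wt_model V l \<phi> c \<longleftrightarrow> coord_rep SL2 V {..l} \<phi> \<and>
     (\<forall>x\<in>carrier V. \<forall>j\<le>l. (\<forall>t. t \<noteq> 0 \<longrightarrow> \<phi> (act V (tor t) x) j = t ^ (l - j) * inverse t ^ j * \<phi> x j) \<and>
       (\<forall>z. \<phi> (act V (low z) x) j = (\<Sum>i\<le>j. of_nat (c i j) * z ^ (j - i) * \<phi> x i)))"

text \<open>For upper powers this is the coefficient in \<open>(x_0 + z x_1)^(l-i) x_1^i\<close>.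
  For lower powers, \<open>loc i j\<close> counts the ways to choose which \<open>i\<close> of the
  \<open>j\<close> places with index 1 had index 1 before the action.\<close>

abbreviation "upc l i j \<equiv> (l - i) choose (j - i)"
abbreviation "loc i j \<equiv> j choose i"

lemma single_replicate_power: "single {#a#} c ^ k = single (replicate_mset k a) (c ^ k :: 'k::field)"
  by (induction k) (simp_all add: mult_single)

lemma two_var_power:
  "(single {#0#} a + single {#1#} b) ^ n =
    (\<Sum>k\<le>n. single (replicate_mset k (0::nat) + replicate_mset (n - k) 1)
      (of_nat (n choose k) * a ^ k * b ^ (n - k) :: 'k::field))"
proof -
  have "of_nat m * single q c = single q (of_nat m * c :: 'k)" for m c and q :: "nat multiset"
  proof -
    have "of_nat m * single q c = single 0 (of_nat m) * single q c"
      by (simp only: single_of_nat)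
    then show ?thesis by (simp only: mult_single add_0)
  qed
  then show ?thesis
    unfolding binomial_ring by (simp add: single_replicate_power mult_single mult.assoc)
qed

text \<open>The monomial \<open>x_0^(l-i) x_1^i\<close>, which spans the weight
  \<open>l - 2 i\<close>.\<close>

definition bim :: "nat \<Rightarrow> nat \<Rightarrow> nat multiset" where
  "bim l i = replicate_mset (l - i) 0 + replicate_mset i 1"

lemma bij_bim: "bij_betw (bim l) {..l} {m. size m = l \<and> set_mset m \<subseteq> {0, 1}}"
proof (rule bij_betwI[where g = "\<lambda>m. count m 1"])
  have l: "l = count m 0 + count m 1" if m: "m \<in> {m. size m = l \<and> set_mset m \<subseteq> {0, 1}}" for m :: "nat multiset"
  proof -
    have "size m = sum (count m) {0, 1}"
      unfolding size_multiset_overloaded_eq using m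
      by (intro sum.mono_neutral_left) (auto simp: not_in_iff)
    then show ?thesis using m by simp
  qed
  show "(\<lambda>m. count m 1) \<in> {m :: nat multiset. size m = l \<and> set_mset m \<subseteq> {0, 1}} \<rightarrow> {..l}"
  proof
    fix m :: "nat multiset" assume "m \<in> {m. size m = l \<and> set_mset m \<subseteq> {0, 1}}"
    from l[OF this] show "count m 1 \<in> {..l}" by simp
  qed
  fix m :: "nat multiset" assume m: "m \<in> {m. size m = l \<and> set_mset m \<subseteq> {0, 1}}"
  show "bim l (count m 1) = m"
  proof (rule multiset_eqI)
    fix x show "count (bim l (count m 1)) x = count m x"
      using m l[OF m] by (cases "x \<in> {0, 1}") (auto simp: bim_def not_in_iff subset_iff)
  qed
qed (auto simp: bim_def)

lemma lookup_two_var: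
  assumes "i \<le> l" "j \<le> l"
  shows "lookup ((single {#0#} a + single {#1#} b) ^ (l - i) *
      single (replicate_mset i (1::nat)) (c::'k::field)) (bim l j) =
    (if i \<le> j then of_nat (upc l i j) * a ^ (l - j) * b ^ (j - i) * c else 0)"
proof -
  have eq: "replicate_mset k 0 + replicate_mset (l - i - k) 1 + replicate_mset i (1::nat) = bim l j \<longleftrightarrow>
      i \<le> j \<and> k = l - j" if "k \<le> l - i" for k
  proof
    assume "replicate_mset k 0 + replicate_mset (l - i - k) 1 + replicate_mset i (1::nat) = bim l j"
    from arg_cong[OF this, of "\<lambda>m. count m 1"] arg_cong[OF this, of "\<lambda>m. count m 0"]
    show "i \<le> j \<and> k = l - j" using that assms by (simp add: bim_def)
  next
    assume "i \<le> j \<and> k = l - j"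
    then show "replicate_mset k 0 + replicate_mset (l - i - k) 1 + replicate_mset i (1::nat) = bim l j"
      using assms by (intro multiset_eqI) (auto simp: bim_def)
  qed
  have "lookup ((single {#0#} a + single {#1#} b) ^ (l - i) *
      single (replicate_mset i (1::nat)) c) (bim l j) =
    (\<Sum>k\<le>l - i. if k = l - j then if i \<le> j then of_nat ((l - i) choose k) * a ^ k * b ^ (l - i - k) * c else 0 else 0)"
    unfolding two_var_power sum_distrib_right lookup_sum mult_single
  proof (rule sum.cong)
    fix k assume "k \<in> {..l - i}"
    then show "lookup (single (replicate_mset k 0 + replicate_mset (l - i - k) 1 + replicate_mset i 1)
        (of_nat ((l - i) choose k) * a ^ k * b ^ (l - i - k) * c)) (bim l j) =
      (if k = l - j then if i \<le> j then of_nat ((l - i) choose k) * a ^ k * b ^ (l - i - k) * c else 0 else 0)"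
      using eq[of k] by (simp add: lookup_single when_def)
  qed simp
  also have "\<dots> = (if i \<le> j then of_nat ((l - i) choose (l - j)) * a ^ (l - j) * b ^ (l - i - (l - j)) * c else 0)"
    using assms by (auto simp: sum.delta)
  also have "i \<le> j \<Longrightarrow> (l - i) choose (l - j) = upc l i j"
    using assms binomial_symmetric[of "l - j" "l - i"] by simp
  ultimately show ?thesis using assms by (auto split: if_splits)
qed

text \<open>The basis vectors are products of copies of \<open>e_0\<close> and \<open>e_1\<close>,
  so a group element acts by substituting the images of these two vectors.\<close>

lemma wt_model_sym_upper:
  "\<exists>\<phi>. wt_model (sym_upper l (natural_rep :: ('k::field ^ 2 ^ 2, 'k, 'k ^ 2) rep)) l \<phi> (upc l)"
proof -
  interpret E: sym_coords SL2 "natural_rep :: ('k ^ 2 ^ 2, 'k, 'k ^ 2) rep" "{0, 1}" ncrd l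
    by (intro sym_coords.intro coord_rep_natural)
  let ?E = "natural_rep :: ('k ^ 2 ^ 2, 'k, 'k ^ 2) rep"
  let ?V = "sym_upper l ?E"
  interpret S: coord_rep SL2 ?V E.M E.scrd by (rule E.coord_rep_sym_upper)
  have bij: "bij_betw (bim l) {..l} E.M" unfolding E.M_def by (rule bij_bim)
  define \<phi> where "\<phi> = (\<lambda>x i. if i \<in> {..l} then E.scrd x (bim l i) else 0)"
  interpret P: coord_rep SL2 ?V "{..l}" \<phi>
    unfolding \<phi>_def by (rule S.reindex[OF bij])
  define w where "w i = replicate (l - i) (E.bas 0) @ replicate i (E.bas 1)" for i
  have w: "set (w i) \<subseteq> carrier ?E" "i \<le> l \<Longrightarrow> length (w i) = l" for i
    by (auto simp: w_def natural_simps)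
  have lin: "lin_form {0, 1} v = single {#0#} (v 0) + single {#1#} (v 1)" for v :: "nat \<Rightarrow> 'k"
    by (simp add: lin_form_def)
  have e: "ncrd (E.bas 0) i = (if i = 0 then 1 else 0)" "ncrd (E.bas 1) i = (if i = 1 then 1 else 0)" for i
    using E.crd_bas[of 0 i] E.crd_bas[of 1 i] by simp_all
  have prod: "prod_list (map (\<lambda>x. lin_form {0, 1} (ncrd x)) (map h (w i))) =
      lin_form {0, 1} (ncrd (h (E.bas 0))) ^ (l - i) * lin_form {0, 1} (ncrd (h (E.bas 1))) ^ i" for h i
    by (simp add: w_def prod_list_replicate)
  have act_w: "\<phi> (act ?V g (sym_prod ?E (w i))) j = lookup
      (lin_form {0, 1} (ncrd (act ?E g (E.bas 0))) ^ (l - i) * lin_form {0, 1} (ncrd (act ?E g (E.bas 1))) ^ i) (bim l j)"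
    if "g \<in> carrier SL2" "i \<le> l" "j \<le> l" for g i j
  proof -
    have "act ?V g (sym_prod ?E (w i)) = sym_prod ?E (map (act ?E g) (w i))"
      by (rule E.act_sym_prod[OF w(1) w(2)[OF that(2)] that(1)])
    moreover have "set (map (act ?E g) (w i)) \<subseteq> carrier ?E" by (simp add: natural_simps)
    ultimately show ?thesis
      using E.scrd_sym_prod[of "map (act ?E g) (w i)" "bim l j"] w(2)[OF that(2)] that(3) prod[of "act ?E g" i]
      by (simp add: \<phi>_def)
  qed
  have bas: "P.bas i = sym_prod ?E (w i)" if i: "i \<le> l" for i
  proof (rule P.crd_inj[OF P.bas_mem E.sym_prod_mem[OF w(1) w(2)[OF i]]])
    fix j assume "j \<in> {..l}"
    then have j: "j \<le> l" by simp
    have "\<phi> (sym_prod ?E (w i)) j = lookup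
      (lin_form {0, 1} (ncrd (E.bas 0)) ^ (l - i) * lin_form {0, 1} (ncrd (E.bas 1)) ^ i) (bim l j)"
      using E.scrd_sym_prod[OF w(1) w(2)[OF i], of "bim l j"] prod[of id i] j by (simp add: \<phi>_def)
    also have "\<dots> = (if i \<le> j then of_nat (upc l i j) * 1 ^ (l - j) * 0 ^ (j - i) * 1 else 0)"
      using lookup_two_var[OF i j, of 1 0 1] by (simp add: lin e single_replicate_power)
    also have "\<dots> = (if j = i then 1 else 0)" by auto
    finally show "\<phi> (P.bas i) j = \<phi> (sym_prod ?E (w i)) j" using P.crd_bas[of i j] i by simp
  qed (use i in simp)
  have "\<phi> (act ?V (low z) x) j = (\<Sum>i\<le>j. of_nat (upc l i j) * z ^ (j - i) * \<phi> x i)"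
    if x: "x \<in> carrier ?V" and j: "j \<le> l" for x z j
  proof -
    have g: "low z \<in> carrier SL2" by simp
    have "\<phi> (act ?V (low z) (P.bas i)) j = (if i \<le> j then of_nat (upc l i j) * z ^ (j - i) else 0)" if i: "i \<le> l" for i
      using lookup_two_var[OF i j, of 1 z 1]
      by (simp add: bas[OF i] act_w[OF g i j] lin ncrd_low e single_replicate_power)
    then have "\<phi> (act ?V (low z) x) j = (\<Sum>i\<le>l. (if i \<le> j then of_nat (upc l i j) * z ^ (j - i) else 0) * \<phi> x i)"
      unfolding P.crd_act_matrix[OF g x] by (intro sum.cong) simp_all
    also have "\<dots> = (\<Sum>i\<le>j. of_nat (upc l i j) * z ^ (j - i) * \<phi> x i)"
      using j by (intro sum.mono_neutral_cong_right) auto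
    finally show ?thesis .
  qed
  moreover have "\<phi> (act ?V (tor t) x) j = t ^ (l - j) * inverse t ^ j * \<phi> x j"
    if x: "x \<in> carrier ?V" and j: "j \<le> l" and t: "t \<noteq> 0" for x t j
  proof -
    have g: "tor t \<in> carrier SL2" using t by simp
    have "\<phi> (act ?V (tor t) (P.bas i)) j = (if i = j then t ^ (l - j) * inverse t ^ j else 0)" if i: "i \<le> l" for i
      using lookup_two_var[OF i j, of t 0 "inverse t ^ i"]
      by (auto simp: bas[OF i] act_w[OF g i j] lin ncrd_tor e single_replicate_power)
    then have "\<phi> (act ?V (tor t) x) j = (\<Sum>i\<le>l. if i = j then t ^ (l - j) * inverse t ^ j * \<phi> x j else 0)"
      unfolding P.crd_act_matrix[OF g x] by (intro sum.cong) auto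
    then show ?thesis using j by simp
  qed
  ultimately have "wt_model ?V l \<phi> (upc l)"
    unfolding wt_model_def using P.coord_rep_axioms by blast
  then show ?thesis by blast
qed

text \<open>A coordinate of \<open>g x\<close> at a word pairs \<open>x\<close> with the product of
  the linear forms given by the rows of \<open>g\<close>. This is the transpose of the substitution
  for upper powers, whence the other binomial coefficients.\<close>

lemma wt_model_sym_lower:
  "\<exists>\<phi>. wt_model (sym_lower l (natural_rep :: ('k::field ^ 2 ^ 2, 'k, 'k ^ 2) rep)) l \<phi> loc"
proof -
  interpret E: sym_coords SL2 "natural_rep :: ('k ^ 2 ^ 2, 'k, 'k ^ 2) rep" "{0, 1}" ncrd l
    by (intro sym_coords.intro coord_rep_natural)
  let ?E = "natural_rep :: ('k ^ 2 ^ 2, 'k, 'k ^ 2) rep"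
  let ?V = "sym_lower l ?E"
  interpret S: coord_rep SL2 ?V E.M E.lcrd by (rule E.coord_rep_sym_lower)
  have bij: "bij_betw (bim l) {..l} E.M" unfolding E.M_def by (rule bij_bim)
  define \<phi> where "\<phi> = (\<lambda>x i. if i \<in> {..l} then E.lcrd x (bim l i) else 0)"
  interpret P: coord_rep SL2 ?V "{..l}" \<phi>
    unfolding \<phi>_def by (rule S.reindex[OF bij])
  have lin: "lin_form {0, 1} v = single {#0#} (v 0) + single {#1#} (v 1)" for v :: "nat \<Rightarrow> 'k"
    by (simp add: lin_form_def)
  have e: "ncrd (E.bas 0) i = (if i = 0 then 1 else 0)" "ncrd (E.bas 1) i = (if i = 1 then 1 else 0)" for i
    using E.crd_bas[of 0 i] E.crd_bas[of 1 i] by simp_all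
  define s where "s j = replicate (l - j) (0::nat) @ replicate j 1" for j
  have s: "s j \<in> E.J" "mset (s j) = bim l j" if "j \<le> l" for j
    using that by (auto simp: s_def E.J_eq bim_def)
  define row where "row g i = (\<lambda>b. ncrd (act ?E g (E.bas b)) i)" for g and i :: nat
  have act: "\<phi> (act ?V g x) j = lext (E.lcrd x) (lin_form {0, 1} (row g 0) ^ (l - j) * lin_form {0, 1} (row g 1) ^ j)"
    if g: "g \<in> carrier SL2" and x: "x \<in> carrier ?V" and j: "j \<le> l" for g x j
  proof -
    have x': "x \<in> carrier E.TP" using x by (simp add: E.sym_lower_simps)
    have gx: "act E.TP g x \<in> carrier ?V" using S.act_mem[OF g x] by (simp add: E.sym_lower_simps)
    have "\<phi> (act ?V g x) j = E.crd (act E.TP g x) (s j)"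
      using j E.lcrd_J[OF gx s(1)[OF j]] by (simp add: \<phi>_def E.sym_lower_simps s(2))
    also have "\<dots> = (\<Sum>l'\<in>E.J. (\<Prod>k<l. (map (row g) (s j) ! k) (l' ! k)) * E.lcrd x (mset l'))"
      unfolding E.crd_act[OF g x']
    proof (rule sum.cong)
      fix l' assume l': "l' \<in> E.J"
      have "E.tc (map2 (\<lambda>V. act V g) (replicate l ?E) (E.bs l')) (s j) =
          (\<Prod>k<l. (map (row g) (s j) ! k) (l' ! k))"
        using s(1)[OF j] l' by (auto simp: E.tc_def E.bs_def E.J_eq row_def intro!: prod.cong)
      then show "E.tc (map2 (\<lambda>V. act V g) (replicate l ?E) (E.bs l')) (s j) * E.crd x l' =
          (\<Prod>k<l. (map (row g) (s j) ! k) (l' ! k)) * E.lcrd x (mset l')"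
        by (simp add: E.lcrd_J[OF x l'])
    qed simp
    also have "\<dots> = lext (E.lcrd x) (prod_list (map (lin_form {0, 1}) (map (row g) (s j))))"
      using s(1)[OF j] by (subst prod_list_lin_form) (simp_all add: lext_sum E.J_eq)
    also have "prod_list (map (lin_form {0, 1}) (map (row g) (s j))) =
        lin_form {0, 1} (row g 0) ^ (l - j) * lin_form {0, 1} (row g 1) ^ j"
      by (simp add: s_def prod_list_replicate)
    finally show ?thesis .
  qed
  have "\<phi> (act ?V (low z) x) j = (\<Sum>i\<le>j. of_nat (loc i j) * z ^ (j - i) * \<phi> x i)"
    if x: "x \<in> carrier ?V" and j: "j \<le> l" for x z j
  proof -
    have "lin_form {0, 1} (row (low z) 0) ^ (l - j) * lin_form {0, 1} (row (low z) 1) ^ j =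
      (\<Sum>k\<le>j. single (replicate_mset (l - j) 0 + (replicate_mset k (0::nat) + replicate_mset (j - k) 1))
        (of_nat (j choose k) * z ^ k))"
      using two_var_power[of z 1 j]
      by (simp add: lin row_def ncrd_low e single_replicate_power sum_distrib_left mult_single)
    also have "lext (E.lcrd x) \<dots> = (\<Sum>k\<le>j. of_nat (j choose k) * z ^ k * \<phi> x (j - k))"
      unfolding lext_sum lext_single
    proof (rule sum.cong)
      fix k assume k: "k \<in> {..j}"
      have "replicate_mset (l - j) 0 + (replicate_mset k (0::nat) + replicate_mset (j - k) 1) = bim l (j - k)"
        using k j by (intro multiset_eqI) (auto simp: bim_def)
      then show "of_nat (j choose k) * z ^ k * E.lcrd x (replicate_mset (l - j) 0 + (replicate_mset k (0::nat) + replicate_mset (j - k) 1)) =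
          of_nat (j choose k) * z ^ k * \<phi> x (j - k)"
        using j by (simp add: \<phi>_def)
    qed simp
    also have "\<dots> = (\<Sum>i\<le>j. of_nat (loc i j) * z ^ (j - i) * \<phi> x i)"
      by (rule sum.reindex_bij_witness[where i = "\<lambda>i. j - i" and j = "\<lambda>i. j - i"])
        (auto simp: binomial_symmetric[symmetric])
    finally show ?thesis using act[of "low z" x j] x j by simp
  qed
  moreover have "\<phi> (act ?V (tor t) x) j = t ^ (l - j) * inverse t ^ j * \<phi> x j"
    if x: "x \<in> carrier ?V" and j: "j \<le> l" and t: "t \<noteq> 0" for x t j
  proof -
    have "lin_form {0, 1} (row (tor t) 0) ^ (l - j) * lin_form {0, 1} (row (tor t) 1) ^ j =
      single (bim l j) (t ^ (l - j) * inverse t ^ j)"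
      by (simp add: lin row_def ncrd_tor e single_replicate_power mult_single bim_def)
    then show ?thesis using act[of "tor t" x j] x j t by (simp add: \<phi>_def)
  qed
  ultimately have "wt_model ?V l \<phi> loc"
    unfolding wt_model_def using P.coord_rep_axioms by blast
  then show ?thesis by blast
qed

text \<open>The dual basis is reversed so that weights again decrease with the index. The factor
  \<open>(-1) ^ j\<close> absorbs the sign in \<open>low (- z)\<close>, which appears because the
  inverse acts on functionals.\<close>

lemma wt_model_dual:
  fixes V :: "('k::field ^ 2 ^ 2, 'k, 'v) rep"
  assumes "wt_model V l \<phi> c"
  shows "\<exists>\<phi>'. wt_model (dual_rep SL2 V) l \<phi>' (\<lambda>i j. c (l - j) (l - i))"
proof -
  interpret V: coord_rep SL2 V "{..l}" \<phi> using assms by (simp add: wt_model_def)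
  have tor: "\<phi> (act V (tor t) x) j = t ^ (l - j) * inverse t ^ j * \<phi> x j"
    if "x \<in> carrier V" "j \<le> l" "t \<noteq> 0" for x j t
    using assms that unfolding wt_model_def by blast
  have low: "\<phi> (act V (low z) x) j = (\<Sum>i\<le>j. of_nat (c i j) * z ^ (j - i) * \<phi> x i)"
    if "x \<in> carrier V" "j \<le> l" for x j z
    using assms that unfolding wt_model_def by blast
  let ?D = "dual_rep SL2 V"
  interpret D: coord_rep SL2 ?D "{..l}" V.dcrd by (rule V.coord_rep_dual[OF group_SL2])
  have bij: "bij_betw (\<lambda>i. l - i) {..l} {..l}"
    by (rule bij_betwI[where g = "\<lambda>i. l - i"]) auto
  define \<phi>' where "\<phi>' \<psi> j = (-1) ^ j * (if j \<in> {..l} then V.dcrd \<psi> (l - j) else 0)" for \<psi> j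
  interpret R: coord_rep SL2 ?D "{..l}" "\<lambda>\<psi> j. if j \<in> {..l} then V.dcrd \<psi> (l - j) else 0"
    by (rule D.reindex[OF bij])
  have crep: "coord_rep SL2 ?D {..l} \<phi>'"
  proof
    fix \<psi> \<eta> assume p: "\<psi> \<in> carrier ?D" "\<eta> \<in> carrier ?D" and "\<And>i. i \<in> {..l} \<Longrightarrow> \<phi>' \<psi> i = \<phi>' \<eta> i"
    then show "\<psi> = \<eta>" by (intro R.crd_inj[OF p]) (simp add: \<phi>'_def)
  next
    fix H :: "nat \<Rightarrow> 'k" assume H: "\<And>i. i \<notin> {..l} \<Longrightarrow> H i = 0"
    have "\<exists>\<psi>\<in>carrier ?D. (\<lambda>j. if j \<in> {..l} then V.dcrd \<psi> (l - j) else 0) = (\<lambda>j. (-1) ^ j * H j)"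
      by (rule R.crd_surj) (simp add: H)
    then obtain \<psi> where p: "\<psi> \<in> carrier ?D" "(\<lambda>j. if j \<in> {..l} then V.dcrd \<psi> (l - j) else 0) = (\<lambda>j. (-1) ^ j * H j)"
      by blast
    have "\<phi>' \<psi> j = H j" for j
      unfolding \<phi>'_def fun_cong[OF p(2), of j] by (simp flip: power_mult_distrib mult.assoc)
    then show "\<exists>\<psi>\<in>carrier ?D. \<phi>' \<psi> = H" using p(1) by blast
  next
    show "i \<notin> {..l} \<Longrightarrow> \<phi>' \<psi> i = 0" for \<psi> i by (simp add: \<phi>'_def)
  qed (simp_all add: \<phi>'_def R.zero_mem R.add_mem R.smult_mem D.crd_zero D.crd_add D.crd_smult distrib_left R.act_lin)
  have phi: "\<phi>' \<psi> j = (-1) ^ j * \<psi> (V.bas (l - j))" if "j \<le> l" for \<psi> j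
    using that by (simp add: \<phi>'_def V.dcrd_def)
  have "\<phi>' (act ?D (low z) \<psi>) j = (\<Sum>i\<le>j. of_nat (c (l - j) (l - i)) * z ^ (j - i) * \<phi>' \<psi> i)"
    if \<psi>: "\<psi> \<in> carrier ?D" and j: "j \<le> l" for \<psi> j z
  proof -
    have b: "V.bas (l - j) \<in> carrier V" by (rule V.bas_mem) simp
    have "\<phi>' (act ?D (low z) \<psi>) j = (-1) ^ j * \<psi> (act V (low (- z)) (V.bas (l - j)))"
      by (simp add: phi[OF j] dual_simps(5) b inv_low)
    also have "\<psi> (act V (low (- z)) (V.bas (l - j))) =
        (\<Sum>m\<le>l. \<psi> (V.bas m) * \<phi> (act V (low (- z)) (V.bas (l - j))) m)"
      by (rule V.dual_expand[OF \<psi>]) (simp add: V.act_mem b)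
    also have "\<dots> = (\<Sum>m\<le>l. if l - j \<le> m then \<psi> (V.bas m) * (of_nat (c (l - j) m) * (- z) ^ (m - (l - j))) else 0)"
    proof (rule sum.cong)
      fix m assume "m \<in> {..l}"
      then have m: "m \<le> l" by simp
      have "\<phi> (act V (low (- z)) (V.bas (l - j))) m =
          (\<Sum>i\<le>m. if i = l - j then of_nat (c (l - j) m) * (- z) ^ (m - (l - j)) else 0)"
        unfolding low[OF b m] by (rule sum.cong) (simp_all add: V.crd_bas)
      then show "\<psi> (V.bas m) * \<phi> (act V (low (- z)) (V.bas (l - j))) m =
          (if l - j \<le> m then \<psi> (V.bas m) * (of_nat (c (l - j) m) * (- z) ^ (m - (l - j))) else 0)"
        by simp
    qed simp
    also have "\<dots> = (\<Sum>m\<in>{l - j..l}. \<psi> (V.bas m) * (of_nat (c (l - j) m) * (- z) ^ (m - (l - j))))"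
      by (rule sum.mono_neutral_cong_right) auto
    also have "\<dots> = (\<Sum>i\<le>j. \<psi> (V.bas (l - i)) * (of_nat (c (l - j) (l - i)) * (- z) ^ (j - i)))"
      by (rule sum.reindex_bij_witness[where i = "\<lambda>i. l - i" and j = "\<lambda>i. l - i"]) (use j in \<open>auto simp: add.commute\<close>)
    finally have "\<phi>' (act ?D (low z) \<psi>) j =
        (\<Sum>i\<le>j. (-1) ^ j * (\<psi> (V.bas (l - i)) * (of_nat (c (l - j) (l - i)) * (- z) ^ (j - i))))"
      by (simp only: sum_distrib_left)
    also have "\<dots> = (\<Sum>i\<le>j. of_nat (c (l - j) (l - i)) * z ^ (j - i) * \<phi>' \<psi> i)"
    proof (rule sum.cong)
      fix i assume "i \<in> {..j}"
      then have i: "i \<le> j" "i \<le> l" using j by auto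
      obtain d where d: "j = i + d" using i(1) by (auto simp: le_iff_add)
      \<comment> \<open>With \<open>j = i + d\<close> the signs of \<open>(-1) ^ j\<close> and
        \<open>(- z) ^ d\<close> combine to \<open>(-1) ^ i\<close>, the sign in the coordinate of
        index \<open>i\<close>.\<close>
      have one: "(-1) ^ d * (-1) ^ d = (1 :: 'k)" by (simp flip: power_mult_distrib)
      have "(-1) ^ j * (\<psi> (V.bas (l - i)) * (of_nat (c (l - j) (l - i)) * (- z) ^ (j - i))) =
          ((-1) ^ d * (-1) ^ d) * (of_nat (c (l - j) (l - i)) * z ^ (j - i) * ((-1) ^ i * \<psi> (V.bas (l - i))))"
        by (simp only: d add_diff_cancel_left' power_add power_minus[of z d] mult_ac)
      then show "(-1) ^ j * (\<psi> (V.bas (l - i)) * (of_nat (c (l - j) (l - i)) * (- z) ^ (j - i))) =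
          of_nat (c (l - j) (l - i)) * z ^ (j - i) * \<phi>' \<psi> i"
        by (simp only: phi[OF i(2)] one mult_1)
    qed simp
    finally show ?thesis .
  qed
  moreover have "\<phi>' (act ?D (tor t) \<psi>) j = t ^ (l - j) * inverse t ^ j * \<phi>' \<psi> j"
    if \<psi>: "\<psi> \<in> carrier ?D" and j: "j \<le> l" and t: "t \<noteq> 0" for \<psi> j t
  proof -
    have b: "V.bas (l - j) \<in> carrier V" by (rule V.bas_mem) simp
    have t': "inverse t \<noteq> 0" using t by simp
    have m: "act V (tor (inverse t)) (V.bas (l - j)) \<in> carrier V" using t' by (intro V.act_mem b) simp
    have "act V (tor (inverse t)) (V.bas (l - j)) = (t ^ (l - j) * inverse t ^ j) \<odot>\<^bsub>V\<^esub> V.bas (l - j)"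
    proof (rule V.crd_inj[OF m V.smult_mem[OF b]])
      fix i assume "i \<in> {..l}"
      then have i: "i \<le> l" by simp
      show "\<phi> (act V (tor (inverse t)) (V.bas (l - j))) i = \<phi> ((t ^ (l - j) * inverse t ^ j) \<odot>\<^bsub>V\<^esub> V.bas (l - j)) i"
        unfolding tor[OF b i t'] V.crd_smult[OF b] using j i by (auto simp: V.crd_bas mult.commute)
    qed
    then show ?thesis
      using t by (simp add: phi[OF j] dual_simps(5) b inv_tor dualD[OF \<psi>] mult_ac)
  qed
  ultimately have "wt_model ?D l \<phi>' (\<lambda>i j. c (l - j) (l - i))"
    unfolding wt_model_def using crep by blast
  then show ?thesis by blast
qed

subsection \<open>The Schur functor in coordinates\<close>

lemma (in coord_rep) crd_span_finsum:
  assumes "keys c \<subseteq> bas ` I"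
  shows "\<phi> (\<Oplus>\<^bsub>V\<^esub>b\<in>keys c. lookup c b \<odot>\<^bsub>V\<^esub> b) j
    = (if j \<in> I then lookup c (bas j) else 0)"
proof -
  have inj: "inj_on bas I"
  proof (rule inj_onI)
    fix i i' assume "i \<in> I" "i' \<in> I" "bas i = bas i'"
    then show "i = i'" using crd_bas[of i i] crd_bas[of i' i] by (auto split: if_splits)
  qed
  have "\<phi> (\<Oplus>\<^bsub>V\<^esub>b\<in>keys c. lookup c b \<odot>\<^bsub>V\<^esub> b) j
      = (\<Sum>b\<in>keys c. \<phi> (lookup c b \<odot>\<^bsub>V\<^esub> b) j)"
    by (rule crd_finsum) (use assms bas_mem smult_mem in blast)
  also have "\<dots> = (\<Sum>b\<in>keys c. lookup c b * \<phi> b j)"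
    by (rule sum.cong) (use assms bas_mem crd_smult in blast)+
  also have "\<dots> = (\<Sum>b\<in>bas ` I. lookup c b * \<phi> b j)"
    by (rule sum.mono_neutral_left) (use assms fin in \<open>auto simp: in_keys_iff\<close>)
  also have "\<dots> = (\<Sum>i\<in>I. lookup c (bas i) * \<phi> (bas i) j)"
    by (simp add: sum.reindex[OF inj])
  also have "\<dots> = (\<Sum>i\<in>I. if i = j then lookup c (bas j) else 0)"
    by (rule sum.cong) (auto simp: crd_bas)
  finally show ?thesis using fin by simp
qed

text \<open>Guarantees that the choice of a basis in \<open>nabla\<close> has something to choose
  from.\<close>

lemma (in coord_rep) is_basis_bas: "is_basis V (bas ` I)"
  unfolding is_basis_def
proof (intro conjI ballI)
  show "bas ` I \<subseteq> carrier V" using bas_mem by blast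
  interpret M: module KR V by (rule module)
  have mem: "(\<Oplus>\<^bsub>V\<^esub>b\<in>keys c. lookup c b \<odot>\<^bsub>V\<^esub> b) \<in> carrier V"
    if "keys c \<subseteq> bas ` I" for c
    by (rule M.finsum_closed) (use that bas_mem smult_mem in blast)
  fix v assume v: "v \<in> carrier V"
  define c where "c = (\<Sum>i\<in>I. single (bas i) (\<phi> v i))"
  have keys: "keys c \<subseteq> bas ` I"
    using Poly_Mapping.keys_sum[of "\<lambda>i. single (bas i) (\<phi> v i)" I]
    by (auto simp: c_def split: if_splits)
  have ne: "bas i = bas j \<longleftrightarrow> i = j" if "i \<in> I" "j \<in> I" for i j
    using that crd_bas[of i i] crd_bas[of j i] by (auto split: if_splits)
  have lk: "lookup c (bas j) = \<phi> v j" if "j \<in> I" for j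
  proof -
    have "lookup c (bas j) = (\<Sum>i\<in>I. if i = j then \<phi> v j else 0)"
      unfolding c_def lookup_sum by (rule sum.cong) (auto simp: lookup_single when_def ne that)
    then show ?thesis using that fin by simp
  qed
  show "\<exists>!c. keys c \<subseteq> bas ` I \<and>
      v = (\<Oplus>\<^bsub>V\<^esub>b\<in>keys c. lookup c b \<odot>\<^bsub>V\<^esub> b)"
  proof (rule ex1I[of _ c], intro conjI keys)
    show "v = (\<Oplus>\<^bsub>V\<^esub>b\<in>keys c. lookup c b \<odot>\<^bsub>V\<^esub> b)"
      by (rule crd_inj[OF v mem[OF keys]]) (simp add: crd_span_finsum[OF keys] lk)
  next
    fix d assume d: "keys d \<subseteq> bas ` I \<and>
      v = (\<Oplus>\<^bsub>V\<^esub>b\<in>keys d. lookup d b \<odot>\<^bsub>V\<^esub> b)"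
    then have dk: "keys d \<subseteq> bas ` I" by blast
    have ld: "lookup d (bas j) = \<phi> v j" if "j \<in> I" for j
      using crd_span_finsum[OF dk, of j] d that by simp
    show "d = c"
    proof (rule poly_mapping_eqI)
      fix b show "lookup d b = lookup c b"
      proof (cases "b \<in> bas ` I")
        case True
        then show ?thesis using ld lk by auto
      next
        case False
        then have "b \<notin> keys d" "b \<notin> keys c" using dk keys by blast+
        then show ?thesis by (simp add: in_keys_iff)
      qed
    qed
  qed
qed

lemma (in coord_rep) is_basis_span:
  assumes "is_basis V B"
  shows "B \<subseteq> carrier V" and "carrier V \<subseteq> rep_span V B"
proof (rule_tac [2] subsetI)
  interpret M: module KR V by (rule module)
  show B: "B \<subseteq> carrier V" using assms by (simp add: is_basis_def)
  note W = submodule_rep_span[OF module B, unfolded submodule_KR_iff[OF module]]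
  fix v assume "v \<in> carrier V"
  then obtain c where c: "keys c \<subseteq> B"
    "v = (\<Oplus>\<^bsub>V\<^esub>b\<in>keys c. lookup c b \<odot>\<^bsub>V\<^esub> b)"
    using assms unfolding is_basis_def by blast
  have "(\<Oplus>\<^bsub>V\<^esub>b\<in>A. lookup c b \<odot>\<^bsub>V\<^esub> b) \<in> rep_span V B"
    if "finite A" "A \<subseteq> keys c" for A
    using that
  proof (induction A)
    case empty
    show ?case using W by simp
  next
    case (insert x A)
    have x: "x \<in> rep_span V B" using insert.prems c(1) rep_span_superset[of B V] by blast
    have "(\<Oplus>\<^bsub>V\<^esub>b\<in>insert x A. lookup c b \<odot>\<^bsub>V\<^esub> b) =
        lookup c x \<odot>\<^bsub>V\<^esub> x \<oplus>\<^bsub>V\<^esub> (\<Oplus>\<^bsub>V\<^esub>b\<in>A. lookup c b \<odot>\<^bsub>V\<^esub> b)"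
    proof (rule M.finsum_insert)
      show "(\<lambda>b. lookup c b \<odot>\<^bsub>V\<^esub> b) \<in> A \<rightarrow> carrier V"
        using insert.prems c(1) B smult_mem by blast
      show "lookup c x \<odot>\<^bsub>V\<^esub> x \<in> carrier V"
        using insert.prems c(1) B smult_mem by blast
    qed (use insert in blast)+
    moreover have "(\<Oplus>\<^bsub>V\<^esub>b\<in>A. lookup c b \<odot>\<^bsub>V\<^esub> b) \<in> rep_span V B"
      using insert by blast
    moreover have "lookup c x \<odot>\<^bsub>V\<^esub> x \<in> rep_span V B" using W x by blast
    ultimately show ?case using W by (simp only:)
  qed
  from this[of "keys c"] show "v \<in> rep_span V B" using c(2) by simp
qed

lemma (in coord_rep) act_finsum:
  assumes g: "g \<in> carrier G" and f: "f \<in> A \<rightarrow> carrier V"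
  shows "act V g (\<Oplus>\<^bsub>V\<^esub>a\<in>A. f a) = (\<Oplus>\<^bsub>V\<^esub>a\<in>A. act V g (f a))"
proof -
  interpret M: module KR V by (rule module)
  show ?thesis
  proof (cases "finite A")
    case True
    then show ?thesis using f
    proof (induction A)
      case empty
      show ?case by (simp add: act_zero[OF g])
    next
      case (insert x A)
      then have f': "f \<in> A \<rightarrow> carrier V" "f x \<in> carrier V" by auto
      have "act V g (\<Oplus>\<^bsub>V\<^esub>a\<in>insert x A. f a) = act V g (f x \<oplus>\<^bsub>V\<^esub> (\<Oplus>\<^bsub>V\<^esub>a\<in>A. f a))"
        using insert f' by (simp add: M.finsum_insert)
      also have "\<dots> = act V g (f x) \<oplus>\<^bsub>V\<^esub> act V g (\<Oplus>\<^bsub>V\<^esub>a\<in>A. f a)"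
        by (rule act_add[OF g f'(2) M.finsum_closed[OF f'(1)]])
      also have "\<dots> = (\<Oplus>\<^bsub>V\<^esub>a\<in>insert x A. act V g (f a))"
        using insert f' act_mem[OF g] by (subst M.finsum_insert) auto
      finally show ?case .
    qed
  next
    case False
    then show ?thesis by (simp add: M.finsum_infinite act_zero[OF g])
  qed
qed

lemma lin_form_add: "lin_form I (\<lambda>i. u i + v i) = lin_form I u + lin_form I v"
  by (simp add: lin_form_def single_add sum.distrib)

lemma lin_form_smult: "lin_form I (\<lambda>i. c * u i) = single {#} c * lin_form I u"
  by (simp add: lin_form_def sum_distrib_left mult_single)

lemma lookup_const_mult [simp]: "lookup (single {#} c * F) m = c * lookup (F :: ('k::field) mpol) m"
  using lookup_map_mult[of c F m] mult_map_scale_conv_mult[of c F] by simp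

locale schur = coord_rep G V I \<phi>
  for G :: "('g, 'm) monoid_scheme" and V :: "('g, 'k::field, 'v) rep"
    and I :: "nat set" and \<phi> :: "'v \<Rightarrow> nat \<Rightarrow> 'k" +
  fixes lam :: "nat list"
begin

lemma sc: "sym_coords G V I \<phi>"
  by (rule sym_coords.intro) (rule coord_rep_axioms)

abbreviation "Rs \<equiv> map (\<lambda>r. sym_upper r V) lam"
abbreviation "sI i \<equiv> sym_coords.M I (lam ! i)"
abbreviation "s\<phi> i \<equiv> sym_coords.scrd V I \<phi> (lam ! i)"
abbreviation "ST \<equiv> sym_lam lam V"
abbreviation "Di \<equiv> diagram lam"
abbreviation "n \<equiv> length lam"

sublocale S: tensor_coords G Rs sI s\<phi>
  by (rule tensor_coords.intro) (simp add: sym_coords.coord_rep_sym_upper[OF sc])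

definition tabm :: "(nat \<times> nat \<Rightarrow> 'v) \<Rightarrow> bool" where
  "tabm t \<longleftrightarrow> (\<forall>c\<in>Di. t c \<in> carrier V)"

lemma tabmI: "(\<And>c. c \<in> Di \<Longrightarrow> t c \<in> carrier V) \<Longrightarrow> tabm t"
  and tabmD: "tabm t \<Longrightarrow> c \<in> Di \<Longrightarrow> t c \<in> carrier V"
  by (auto simp: tabm_def)

lemma ST: "ST = tensor Rs"
  by (simp add: sym_lam_def)

text \<open>Coordinates of a row tensor in terms of a tableau of coordinate vectors. Rows are
  numbered from 1 in the diagram and from 0 in lists, hence \<open>Suc i\<close>.\<close>

definition rowc :: "(nat \<times> nat \<Rightarrow> nat \<Rightarrow> 'k) \<Rightarrow> nat multiset list \<Rightarrow> 'k" where
  "rowc \<tau> ms = (if length ms = n then \<Prod>i<n.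
     lookup (\<Prod>j\<in>{1..lam ! i}. lin_form I (\<tau> (Suc i, j))) (ms ! i) else 0)"

definition entries :: "(nat \<times> nat \<Rightarrow> 'v) \<Rightarrow> 'v list list" where
  "entries t = map (\<lambda>i. map (\<lambda>j. t (Suc i, j)) [1..<Suc (lam ! i)]) [0..<n]"

lemma row_tensor_eq: "row_tensor lam V t = pure_tensor Rs (map (sym_prod V) (entries t))"
proof -
  have "map (\<lambda>i. sym_prod V (map (\<lambda>j. t (i, j)) [1..<Suc (lam ! (i - 1))])) [1..<Suc n]
      = map (sym_prod V) (entries t)"
  proof (rule nth_equalityI)
    fix i assume "i < length (map (\<lambda>i. sym_prod V (map (\<lambda>j. t (i, j)) [1..<Suc (lam ! (i - 1))])) [1..<Suc n])"
    then have i: "i < n" by (simp del: upt_Suc)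
    then have "[1..<Suc n] ! i = Suc i" by (subst nth_upt) auto
    then show "map (\<lambda>i. sym_prod V (map (\<lambda>j. t (i, j)) [1..<Suc (lam ! (i - 1))])) [1..<Suc n] ! i
        = map (sym_prod V) (entries t) ! i"
      using i by (simp add: entries_def plus_1_eq_Suc del: upt_Suc)
  qed (simp add: entries_def del: upt_Suc)
  then show ?thesis by (simp only: row_tensor_def)
qed

lemma entries_nth:
  assumes "i < n" and t: "tabm t"
  shows "set (entries t ! i) \<subseteq> carrier V" "length (entries t ! i) = lam ! i"
  using assms(1) by (auto simp: entries_def diagram_def intro!: tabmD[OF t] simp del: upt_Suc)

lemma entries_mem:
  assumes t: "tabm t"
  shows "S.mem (map (sym_prod V) (entries t))"
  unfolding in_listset_nth
proof (intro conjI allI impI)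
  fix i assume "i < length (map carrier Rs)"
  then have i: "i < n" by simp
  have len: "length (entries t) = n" by (simp add: entries_def)
  show "map (sym_prod V) (entries t) ! i \<in> map carrier Rs ! i"
    using sym_coords.sym_prod_mem[OF sc entries_nth[OF i t]] i len by simp
qed (simp add: entries_def)

lemma row_tensor_mem:
  assumes "tabm t"
  shows "row_tensor lam V t \<in> carrier ST"
  unfolding row_tensor_eq ST by (rule S.pure_tensor_mem[OF entries_mem[OF assms]])

lemma crd_row_tensor:
  assumes t: "tabm t"
  shows "S.crd (row_tensor lam V t) ms = rowc (\<phi> \<circ> t) ms"
  unfolding row_tensor_eq S.crd_pure_tensor[OF entries_mem[OF t]] S.tc_def rowc_def length_map
proof (intro if_cong refl prod.cong)
  fix i assume "i \<in> {..<n}"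
  then have i: "i < n" by simp
  have "s\<phi> i (map (sym_prod V) (entries t) ! i) (ms ! i)
      = s\<phi> i (sym_prod V (entries t ! i)) (ms ! i)"
    using i by (simp add: entries_def)
  also have "\<dots> = lookup (\<Prod>x\<leftarrow>entries t ! i. lin_form I (\<phi> x)) (ms ! i)"
    by (rule sym_coords.scrd_sym_prod[OF sc entries_nth[OF i t]])
  also have "(\<Prod>x\<leftarrow>entries t ! i. lin_form I (\<phi> x)) = prod_list (map (\<lambda>j. lin_form I (\<phi> (t (Suc i, j)))) [1..<Suc (lam ! i)])"
    using i by (simp add: entries_def o_def del: upt_Suc)
  also have "\<dots> = (\<Prod>j\<in>set [1..<Suc (lam ! i)]. lin_form I (\<phi> (t (Suc i, j))))"
    by (rule prod.distinct_set_conv_list[symmetric]) simp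
  also have "set [1..<Suc (lam ! i)] = {1..lam ! i}" by auto
  finally show "s\<phi> i (map (sym_prod V) (entries t) ! i) (ms ! i) =
      lookup (\<Prod>j\<in>{1..lam ! i}. lin_form I ((\<phi> \<circ> t) (Suc i, j))) (ms ! i)" by simp
qed

lemma act_row_tensor:
  assumes t: "tabm t" and g: "g \<in> carrier G"
  shows "act ST g (row_tensor lam V t) = row_tensor lam V (act V g \<circ> t)"
proof -
  have "map2 (\<lambda>V. act V g) Rs (map (sym_prod V) (entries t)) = map (sym_prod V) (entries (act V g \<circ> t))"
  proof (rule nth_equalityI)
    fix i assume "i < length (map2 (\<lambda>V. act V g) Rs (map (sym_prod V) (entries t)))"
    then have i: "i < n" by simp
    have "map2 (\<lambda>V. act V g) Rs (map (sym_prod V) (entries t)) ! i =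
        act (sym_upper (lam ! i) V) g (sym_prod V (entries t ! i))"
      using i by (simp add: entries_def)
    also have "\<dots> = sym_prod V (map (act V g) (entries t ! i))"
      by (rule sym_coords.act_sym_prod[OF sc entries_nth[OF i t] g])
    finally show "map2 (\<lambda>V. act V g) Rs (map (sym_prod V) (entries t)) ! i = map (sym_prod V) (entries (act V g \<circ> t)) ! i"
      using i by (simp add: entries_def o_def del: upt_Suc)
  qed (simp add: entries_def)
  then show ?thesis
    unfolding row_tensor_eq ST S.act_pure_tensor[OF entries_mem[OF t] g] by simp
qed

text \<open>Stated for a tableau of arbitrary coordinate vectors instead of elements of
  \<open>V\<close>, so that multilinearity in each box can be expressed by updating
  \<open>\<tau>\<close>.\<close>

definition Pc :: "(nat \<times> nat \<Rightarrow> nat \<Rightarrow> 'k) \<Rightarrow> nat multiset list \<Rightarrow> 'k" where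
  "Pc \<tau> ms = (\<Sum>\<sigma>\<in>col_perms lam. of_int (sign \<sigma>) * rowc (\<tau> \<circ> inv_into UNIV \<sigma>) ms)"

lemma finite_diagram: "finite Di"
proof (rule finite_subset)
  show "Di \<subseteq> {..n} \<times> {..sum_list lam}"
  proof
    fix c assume "c \<in> Di"
    then obtain i j where c: "c = (i, j)" "1 \<le> i" "i \<le> n" "j \<le> lam ! (i - 1)" by (auto simp: diagram_def)
    then have "lam ! (i - 1) \<in> set lam" by (intro nth_mem) simp
    from member_le_sum_list[OF this] c show "c \<in> {..n} \<times> {..sum_list lam}" by simp
  qed
qed simp

lemma col_perms_diagram:
  assumes "\<sigma> \<in> col_perms lam" "c \<in> Di"
  shows "inv_into UNIV \<sigma> c \<in> Di" "\<sigma> c \<in> Di"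
  using assms permutes_in_image[OF permutes_inv, of \<sigma> Di c] permutes_in_image[of \<sigma> Di c]
  by (simp_all add: col_perms_def)

lemma crd_polytabloid:
  assumes t: "tabm t"
  shows "polytabloid lam V t \<in> carrier ST" "S.crd (polytabloid lam V t) ms = Pc (\<phi> \<circ> t) ms"
proof -
  interpret M: module KR ST unfolding ST by (rule S.T.module)
  have t': "tabm (t \<circ> inv_into UNIV \<sigma>)" if "\<sigma> \<in> col_perms lam" for \<sigma>
    using col_perms_diagram[OF that] tabmD[OF t] by (intro tabmI) simp
  have mem: "(\<lambda>\<sigma>. of_int (sign \<sigma>) \<odot>\<^bsub>ST\<^esub> row_tensor lam V (t \<circ> inv_into UNIV \<sigma>)) \<in> col_perms lam \<rightarrow> carrier ST"
    using row_tensor_mem t' S.T.smult_mem unfolding ST by blast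
  show "polytabloid lam V t \<in> carrier ST"
    unfolding polytabloid_def by (rule M.finsum_closed[OF mem])
  show "S.crd (polytabloid lam V t) ms = Pc (\<phi> \<circ> t) ms"
    unfolding polytabloid_def Pc_def
    using S.T.crd_finsum[OF mem[unfolded ST], of ms]
  proof (simp only: ST, intro sum.cong refl)
    fix \<sigma> assume s: "\<sigma> \<in> col_perms lam"
    have m: "row_tensor lam V (t \<circ> inv_into UNIV \<sigma>) \<in> carrier (tensor Rs)"
      using row_tensor_mem t'[OF s] unfolding ST by blast
    show "S.crd (of_int (sign \<sigma>) \<odot>\<^bsub>tensor Rs\<^esub> row_tensor lam V (t \<circ> inv_into UNIV \<sigma>)) ms =
        of_int (sign \<sigma>) * rowc (\<phi> \<circ> t \<circ> inv_into UNIV \<sigma>) ms"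
      unfolding S.T.crd_smult[OF m] crd_row_tensor[OF t'[OF s]] by (simp only: o_assoc)
  qed
qed

lemma act_polytabloid:
  assumes t: "tabm t" and g: "g \<in> carrier G"
  shows "act ST g (polytabloid lam V t) = polytabloid lam V (act V g \<circ> t)"
proof -
  interpret M: module KR ST unfolding ST by (rule S.T.module)
  have t': "tabm (t \<circ> inv_into UNIV \<sigma>)" if "\<sigma> \<in> col_perms lam" for \<sigma>
    using col_perms_diagram[OF that] tabmD[OF t] by (intro tabmI) simp
  have mem: "(\<lambda>\<sigma>. of_int (sign \<sigma>) \<odot>\<^bsub>ST\<^esub> row_tensor lam V (t \<circ> inv_into UNIV \<sigma>)) \<in> col_perms lam \<rightarrow> carrier ST"
    using row_tensor_mem t' S.T.smult_mem unfolding ST by blast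
  have "act ST g (polytabloid lam V t) =
      (\<Oplus>\<^bsub>ST\<^esub>\<sigma>\<in>col_perms lam. act ST g (of_int (sign \<sigma>) \<odot>\<^bsub>ST\<^esub> row_tensor lam V (t \<circ> inv_into UNIV \<sigma>)))"
    using S.T.act_finsum[OF g mem[unfolded ST]] by (simp only: polytabloid_def ST)
  also have "\<dots> = polytabloid lam V (act V g \<circ> t)"
    unfolding polytabloid_def
  proof (rule M.finsum_cong'[OF refl])
    show "(\<lambda>\<sigma>. of_int (sign \<sigma>) \<odot>\<^bsub>ST\<^esub> row_tensor lam V (act V g \<circ> t \<circ> inv_into UNIV \<sigma>)) \<in> col_perms lam \<rightarrow> carrier ST"
    proof
      fix \<sigma> assume s: "\<sigma> \<in> col_perms lam"
      have "row_tensor lam V (act V g \<circ> t \<circ> inv_into UNIV \<sigma>) \<in> carrier ST"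
        by (rule row_tensor_mem, rule tabmI) (use act_mem[OF g] tabmD[OF t'[OF s]] in simp)
      then show "of_int (sign \<sigma>) \<odot>\<^bsub>ST\<^esub> row_tensor lam V (act V g \<circ> t \<circ> inv_into UNIV \<sigma>) \<in> carrier ST"
        using S.T.smult_mem unfolding ST by blast
    qed
    fix \<sigma> assume s: "\<sigma> \<in> col_perms lam"
    have m: "row_tensor lam V (t \<circ> inv_into UNIV \<sigma>) \<in> carrier (tensor Rs)"
      using row_tensor_mem t'[OF s] unfolding ST by blast
    show "act ST g (of_int (sign \<sigma>) \<odot>\<^bsub>ST\<^esub> row_tensor lam V (t \<circ> inv_into UNIV \<sigma>)) =
        of_int (sign \<sigma>) \<odot>\<^bsub>ST\<^esub> row_tensor lam V (act V g \<circ> t \<circ> inv_into UNIV \<sigma>)"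
      using S.T.act_smult[OF g m] act_row_tensor[OF t'[OF s] g] by (simp only: ST o_assoc)
  qed
  finally show ?thesis .
qed

text \<open>A box lies in a single row, so with all other boxes fixed the coordinate is a linear
  functional of its entry; \<open>H\<close>, \<open>R\<close> and \<open>m\<close> do not depend on
  \<open>u\<close>.\<close>

lemma rowc_upd:
  assumes "c \<in> Di"
  obtains H R m where "\<And>u. rowc (\<tau>(c := u)) ms = H * lookup (lin_form I u * R) m"
proof -
  obtain i j where c: "c = (Suc i, j)" and i: "i < n" and j: "j \<in> {1..lam ! i}"
    using assms by (cases c; cases "fst c") (auto simp: diagram_def)
  define R where "R = (\<Prod>j\<in>{1..lam ! i} - {j}. lin_form I (\<tau> (Suc i, j)))"
  define H where "H = (if length ms = n then \<Prod>i\<in>{..<n} - {i}.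
     lookup (\<Prod>j\<in>{1..lam ! i}. lin_form I (\<tau> (Suc i, j))) (ms ! i) else 0)"
  have "rowc (\<tau>(c := u)) ms = H * lookup (lin_form I u * R) (ms ! i)" for u
  proof -
    have 1: "(\<Prod>j\<in>{1..lam ! i}. lin_form I ((\<tau>(c := u)) (Suc i, j))) = lin_form I u * R"
    proof -
      have "(\<Prod>j'\<in>{1..lam ! i} - {j}. lin_form I ((\<tau>(c := u)) (Suc i, j'))) = R"
        unfolding R_def by (rule prod.cong) (auto simp: c)
      then show ?thesis using j by (subst prod.remove[of _ j]) (simp_all add: c)
    qed
    have 2: "(\<Prod>i\<in>{..<n} - {i}. lookup (\<Prod>j\<in>{1..lam ! i}. lin_form I ((\<tau>(c := u)) (Suc i, j))) (ms ! i)) =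
       (\<Prod>i\<in>{..<n} - {i}. lookup (\<Prod>j\<in>{1..lam ! i}. lin_form I (\<tau> (Suc i, j))) (ms ! i))"
      by (rule prod.cong) (auto simp: c)
    have "(\<Prod>i<n. lookup (\<Prod>j\<in>{1..lam ! i}. lin_form I ((\<tau>(c := u)) (Suc i, j))) (ms ! i)) =
      lookup (lin_form I u * R) (ms ! i) *
       (\<Prod>i\<in>{..<n} - {i}. lookup (\<Prod>j\<in>{1..lam ! i}. lin_form I (\<tau> (Suc i, j))) (ms ! i))"
      using prod.remove[of "{..<n}" i "\<lambda>i. lookup (\<Prod>j\<in>{1..lam ! i}. lin_form I ((\<tau>(c := u)) (Suc i, j))) (ms ! i)"] i
      by (simp only: 1 2 finite_lessThan lessThan_iff simp_thms)
    then show ?thesis by (simp add: rowc_def H_def mult.commute)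
  qed
  then show ?thesis by (rule that)
qed

lemma upd_comp_inv:
  assumes "\<sigma> \<in> col_perms lam"
  shows "(\<tau>(c := u)) \<circ> inv_into UNIV \<sigma> = (\<tau> \<circ> inv_into UNIV \<sigma>)(\<sigma> c := u)"
proof -
  have "\<sigma> permutes Di" using assms by (simp add: col_perms_def)
  note inv = permutes_inverses[OF this]
  have "inv_into UNIV \<sigma> x = c \<longleftrightarrow> x = \<sigma> c" for x using inv by metis
  then show ?thesis by (auto simp: fun_eq_iff)
qed

lemma Pc_add:
  assumes c: "c \<in> Di"
  shows "Pc (\<tau>(c := \<lambda>i. u i + v i)) ms = Pc (\<tau>(c := u)) ms + Pc (\<tau>(c := v)) ms"
  unfolding Pc_def sum.distrib[symmetric]
proof (rule sum.cong)
  fix \<sigma> assume s: "\<sigma> \<in> col_perms lam"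
  obtain H R m where H: "\<And>u. rowc ((\<tau> \<circ> inv_into UNIV \<sigma>)(\<sigma> c := u)) ms = H * lookup (lin_form I u * R) m"
    using rowc_upd[OF col_perms_diagram(2)[OF s c]] by blast
  show "of_int (sign \<sigma>) * rowc (\<tau>(c := \<lambda>i. u i + v i) \<circ> inv_into UNIV \<sigma>) ms =
      of_int (sign \<sigma>) * rowc (\<tau>(c := u) \<circ> inv_into UNIV \<sigma>) ms + of_int (sign \<sigma>) * rowc (\<tau>(c := v) \<circ> inv_into UNIV \<sigma>) ms"
    unfolding upd_comp_inv[OF s] H lin_form_add distrib_right lookup_add by (simp add: algebra_simps)
qed simp

lemma Pc_smult:
  assumes c: "c \<in> Di"
  shows "Pc (\<tau>(c := \<lambda>i. a * u i)) ms = a * Pc (\<tau>(c := u)) ms"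
  unfolding Pc_def sum_distrib_left
proof (rule sum.cong)
  fix \<sigma> assume s: "\<sigma> \<in> col_perms lam"
  obtain H R m where H: "\<And>u. rowc ((\<tau> \<circ> inv_into UNIV \<sigma>)(\<sigma> c := u)) ms = H * lookup (lin_form I u * R) m"
    using rowc_upd[OF col_perms_diagram(2)[OF s c]] by blast
  show "of_int (sign \<sigma>) * rowc (\<tau>(c := \<lambda>i. a * u i) \<circ> inv_into UNIV \<sigma>) ms =
      a * (of_int (sign \<sigma>) * rowc (\<tau>(c := u) \<circ> inv_into UNIV \<sigma>) ms)"
    unfolding upd_comp_inv[OF s] H lin_form_smult mult.assoc lookup_const_mult by (simp add: algebra_simps)
qed simp

lemma rowc_cong: "(\<And>c. c \<in> Di \<Longrightarrow> \<tau> c = \<tau>' c) \<Longrightarrow> rowc \<tau> ms = rowc \<tau>' ms"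
proof -
  assume eq: "\<And>c. c \<in> Di \<Longrightarrow> \<tau> c = \<tau>' c"
  have "(\<Prod>j\<in>{1..lam ! i}. lin_form I (\<tau> (Suc i, j))) = (\<Prod>j\<in>{1..lam ! i}. lin_form I (\<tau>' (Suc i, j)))"
    if "i < n" for i
    by (rule prod.cong) (use that in \<open>auto simp: diagram_def intro!: arg_cong[of _ _ "lin_form I"] eq\<close>)
  then show ?thesis unfolding rowc_def by (intro if_cong refl prod.cong) (simp_all only: lessThan_iff)
qed

lemma Pc_cong: "(\<And>c. c \<in> Di \<Longrightarrow> \<tau> c = \<tau>' c) \<Longrightarrow> Pc \<tau> ms = Pc \<tau>' ms"
  unfolding Pc_def
  by (intro sum.cong refl arg_cong2[of _ _ _ _ "(*)"] rowc_cong) (simp add: col_perms_diagram(1))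

lemma polytabloid_cong:
  assumes t: "tabm t" and eq: "\<And>c. c \<in> Di \<Longrightarrow> t c = t' c"
  shows "polytabloid lam V t = polytabloid lam V t'"
proof -
  have t': "tabm t'" using tabmD[OF t] eq by (intro tabmI) metis
  have "S.crd (polytabloid lam V t) ms = S.crd (polytabloid lam V t') ms" for ms
    unfolding crd_polytabloid(2)[OF t] crd_polytabloid(2)[OF t'] by (rule Pc_cong) (simp add: eq)
  then show ?thesis
    by (rule S.T.crd_eqI[OF crd_polytabloid(1)[OF t, unfolded ST] crd_polytabloid(1)[OF t', unfolded ST]])
qed

abbreviation "tabs B \<equiv> {polytabloid lam V t | t. t \<in> Di \<rightarrow>\<^sub>E B}"

lemma tabs_sub: "B \<subseteq> carrier V \<Longrightarrow> tabs B \<subseteq> carrier ST"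
proof
  fix x assume B: "B \<subseteq> carrier V" and "x \<in> tabs B"
  then obtain t where t: "t \<in> Di \<rightarrow>\<^sub>E B" "x = polytabloid lam V t" by blast
  have "tabm t" using t(1) B by (intro tabmI) auto
  from crd_polytabloid(1)[OF this] show "x \<in> carrier ST" by (simp only: t(2))
qed

text \<open>Multilinearity in the boxes lets a spanning set replace arbitrary entries. This is what
  makes the span independent of the basis chosen in \<open>nabla\<close>.\<close>

lemma polytabloid_span:
  assumes B: "B \<subseteq> carrier V" "carrier V \<subseteq> rep_span V B"
    and t: "tabm t"
  shows "polytabloid lam V t \<in> rep_span ST (tabs B)"
proof -
  have mod: "module KR ST" unfolding ST by (rule S.T.module)
  note W = submodule_rep_span[OF mod tabs_sub[OF B(1)], unfolded submodule_KR_iff[OF mod]]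
  have Wz: "\<zero>\<^bsub>ST\<^esub> \<in> rep_span ST (tabs B)"
    and Wa: "\<And>x y. x \<in> rep_span ST (tabs B) \<Longrightarrow> y \<in> rep_span ST (tabs B) \<Longrightarrow> x \<oplus>\<^bsub>ST\<^esub> y \<in> rep_span ST (tabs B)"
    and Ws: "\<And>a x. x \<in> rep_span ST (tabs B) \<Longrightarrow> a \<odot>\<^bsub>ST\<^esub> x \<in> rep_span ST (tabs B)"
    using W by blast+
  \<comment> \<open>\<open>Z\<close> is the set of boxes whose entries are still arbitrary; the
    induction adds one such box at a time.\<close>
  have "\<forall>t. tabm t \<longrightarrow> (\<forall>c\<in>Di - Z. t c \<in> B) \<longrightarrow>
      polytabloid lam V t \<in> rep_span ST (tabs B)" if "Z \<subseteq> Di" for Z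
    using finite_subset[OF that finite_diagram] that
  proof (induction Z)
    case empty
    show ?case
    proof (intro allI impI)
      fix t assume t: "tabm t" "\<forall>c\<in>Di - {}. t c \<in> B"
      have "polytabloid lam V t = polytabloid lam V (restrict t Di)"
        using t(1) by (intro polytabloid_cong) auto
      moreover have "restrict t Di \<in> Di \<rightarrow>\<^sub>E B" using t(2) by auto
      ultimately show "polytabloid lam V t \<in> rep_span ST (tabs B)"
        using rep_span_superset[of "tabs B" ST] by blast
    qed
  next
    case (insert c Z)
    show ?case
    proof (intro allI impI)
      fix t assume t: "tabm t" "\<forall>c'\<in>Di - insert c Z. t c' \<in> B"
      have c: "c \<in> Di" using insert by simp
      have tm: "tabm (t(c := x))" if "x \<in> carrier V" for x
        using that tabmD[OF t(1)] by (intro tabmI) simp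
      have "polytabloid lam V (t(c := x)) \<in> rep_span ST (tabs B)" if "x \<in> rep_span V B" for x
        using module B(1) that
      proof (induction rule: rep_span_induct)
        case (base x)
        then have "\<forall>c'\<in>Di - Z. (t(c := x)) c' \<in> B" using t(2) by auto
        moreover have "tabm (t(c := x))" using tm base B(1) by blast
        ultimately show ?case using insert by blast
      next
        case zero
        have "polytabloid lam V (t(c := \<zero>\<^bsub>V\<^esub>)) = \<zero>\<^bsub>ST\<^esub>"
        proof (rule S.T.crd_eqI[OF crd_polytabloid(1)[OF tm[OF zero_mem], unfolded ST] S.T.zero_mem, folded ST])
          fix ms
          have "\<phi> \<circ> t(c := \<zero>\<^bsub>V\<^esub>) = (\<phi> \<circ> t)(c := \<lambda>i. 0 * \<phi> \<zero>\<^bsub>V\<^esub> i)"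
            by (auto simp: fun_eq_iff crd_zero)
          then have "S.crd (polytabloid lam V (t(c := \<zero>\<^bsub>V\<^esub>))) ms = 0"
            using Pc_smult[OF c, of "\<phi> \<circ> t" 0 "\<phi> \<zero>\<^bsub>V\<^esub>" ms]
            unfolding crd_polytabloid(2)[OF tm[OF zero_mem]] by simp
          then show "S.crd (polytabloid lam V (t(c := \<zero>\<^bsub>V\<^esub>))) ms = S.crd \<zero>\<^bsub>ST\<^esub> ms"
            by (simp add: ST S.T.crd_zero)
        qed
        then show ?case by (simp only: Wz)
      next
        case (add x y)
        have "polytabloid lam V (t(c := x \<oplus>\<^bsub>V\<^esub> y)) = polytabloid lam V (t(c := x)) \<oplus>\<^bsub>ST\<^esub> polytabloid lam V (t(c := y))"
        proof (rule S.T.crd_eqI[folded ST])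
          have "\<phi> \<circ> t(c := x \<oplus>\<^bsub>V\<^esub> y) = (\<phi> \<circ> t)(c := \<lambda>i. \<phi> x i + \<phi> y i)"
            by (auto simp: fun_eq_iff crd_add[OF add(1,2)])
          then show "S.crd (polytabloid lam V (t(c := x \<oplus>\<^bsub>V\<^esub> y))) ms =
              S.crd (polytabloid lam V (t(c := x)) \<oplus>\<^bsub>ST\<^esub> polytabloid lam V (t(c := y))) ms" for ms
            using crd_polytabloid[OF tm[OF add(1)]] crd_polytabloid[OF tm[OF add(2)]]
              crd_polytabloid(2)[OF tm[OF add_mem[OF add(1,2)]]]
            by (simp only: ST S.T.crd_add Pc_add[OF c] fun_upd_comp)
          show "polytabloid lam V (t(c := x)) \<oplus>\<^bsub>ST\<^esub> polytabloid lam V (t(c := y)) \<in> carrier ST"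
            unfolding ST by (intro S.T.add_mem crd_polytabloid(1)[unfolded ST] tm add)
        qed (intro crd_polytabloid(1) tm add_mem add)
        then show ?case by (simp only: Wa add)
      next
        case (smult a x)
        have "polytabloid lam V (t(c := a \<odot>\<^bsub>V\<^esub> x)) = a \<odot>\<^bsub>ST\<^esub> polytabloid lam V (t(c := x))"
        proof (rule S.T.crd_eqI[folded ST])
          have "\<phi> \<circ> t(c := a \<odot>\<^bsub>V\<^esub> x) = (\<phi> \<circ> t)(c := \<lambda>i. a * \<phi> x i)"
            by (auto simp: fun_eq_iff crd_smult[OF smult(1)])
          then show "S.crd (polytabloid lam V (t(c := a \<odot>\<^bsub>V\<^esub> x))) ms =
              S.crd (a \<odot>\<^bsub>ST\<^esub> polytabloid lam V (t(c := x))) ms" for ms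
            using crd_polytabloid[OF tm[OF smult(1)]] crd_polytabloid(2)[OF tm[OF smult_mem[OF smult(1)]]]
            by (simp only: ST S.T.crd_smult Pc_smult[OF c] fun_upd_comp)
          show "a \<odot>\<^bsub>ST\<^esub> polytabloid lam V (t(c := x)) \<in> carrier ST"
            unfolding ST by (intro S.T.smult_mem crd_polytabloid(1)[unfolded ST] tm smult)
        qed (intro crd_polytabloid(1) tm smult_mem smult)
        then show ?case by (simp only: Ws smult)
      qed
      from this[OF subsetD[OF B(2), of "t c"]] show "polytabloid lam V t \<in> rep_span ST (tabs B)"
        using tabmD[OF t(1) c] by simp
    qed
  qed
  from this[of Di] t show ?thesis by simp
qed

lemma nabla_simps:
  "zero (nabla lam V) = zero ST" "add (nabla lam V) = add ST"
  "module.smult (nabla lam V) = module.smult ST" "act (nabla lam V) = act ST"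
  by (simp_all add: nabla_def)

text \<open>Frees the carrier from the unspecified basis: any two spanning sets give mutually
  contained spans, so the basis adapted to the coordinates may be used.\<close>

lemma nabla_carrier: "carrier (nabla lam V) = rep_span ST (tabs (bas ` I))"
proof -
  have mod: "module KR ST" unfolding ST by (rule S.T.module)
  define B where "B = (SOME B. is_basis V B)"
  have "is_basis V B" unfolding B_def by (rule someI_ex) (use is_basis_bas in blast)
  note B = is_basis_span[OF this] and B' = is_basis_span[OF is_basis_bas]
  have le: "rep_span ST (tabs Z) \<subseteq> rep_span ST (tabs Y)"
    if Z: "Z \<subseteq> carrier V" and Y: "Y \<subseteq> carrier V" "carrier V \<subseteq> rep_span V Y" for Z Y
  proof
    fix x assume "x \<in> rep_span ST (tabs Z)"
    then show "x \<in> rep_span ST (tabs Y)"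
    proof (rule rep_span_least[OF submodule_rep_span[OF mod tabs_sub[OF Y(1)]], rotated])
      show "tabs Z \<subseteq> rep_span ST (tabs Y)"
      proof
        fix y assume "y \<in> tabs Z"
        then obtain t where t: "t \<in> Di \<rightarrow>\<^sub>E Z" and y: "y = polytabloid lam V t" by blast
        have "tabm t" using t Z by (intro tabmI) auto
        then show "y \<in> rep_span ST (tabs Y)" unfolding y by (rule polytabloid_span[OF Y])
      qed
    qed
  qed
  have "carrier (nabla lam V) = rep_span ST (tabs B)" by (simp add: nabla_def B_def)
  then show ?thesis using le[OF B(1) B'] le[OF B'(1) B] by blast
qed

lemma polytabloid_nabla:
  assumes "tabm t"
  shows "polytabloid lam V t \<in> carrier (nabla lam V)"
  unfolding nabla_carrier by (rule polytabloid_span[OF is_basis_span[OF is_basis_bas] assms])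

lemma nabla_sub: "carrier (nabla lam V) \<subseteq> carrier ST"
proof -
  have mod: "module KR ST" unfolding ST by (rule S.T.module)
  have "bas ` I \<subseteq> carrier V" using bas_mem by blast
  from submodule_rep_span[OF mod tabs_sub[OF this]]
  show ?thesis unfolding nabla_carrier submodule_KR_iff[OF mod] by blast
qed

lemma nabla_induct [consumes 1, case_names base zero add smult]:
  assumes "x \<in> carrier (nabla lam V)"
    and "\<And>t. t \<in> Di \<rightarrow>\<^sub>E bas ` I \<Longrightarrow> P (polytabloid lam V t)"
    and "P \<zero>\<^bsub>ST\<^esub>"
    and "\<And>x y. x \<in> carrier (nabla lam V) \<Longrightarrow> y \<in> carrier (nabla lam V) \<Longrightarrow> P x \<Longrightarrow> P y \<Longrightarrow> P (x \<oplus>\<^bsub>ST\<^esub> y)"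
    and "\<And>c x. x \<in> carrier (nabla lam V) \<Longrightarrow> P x \<Longrightarrow> P (c \<odot>\<^bsub>ST\<^esub> x)"
  shows "P x"
proof -
  have mod: "module KR ST" unfolding ST by (rule S.T.module)
  have B: "bas ` I \<subseteq> carrier V" using bas_mem by blast
  note sub = submodule_rep_span[OF mod tabs_sub[OF B], folded nabla_carrier, unfolded submodule_KR_iff[OF mod]]
  have "x \<in> carrier (nabla lam V) \<and> P x"
    using mod tabs_sub[OF B] assms(1)[unfolded nabla_carrier]
  proof (induction rule: rep_span_induct)
    case (base x)
    then show ?case using assms(2) rep_span_superset[of "tabs (bas ` I)" ST] unfolding nabla_carrier by blast
  next
    case zero
    then show ?case using sub assms(3) by blast
  next
    case (add x y)
    then show ?case using sub assms(4) by blast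
  next
    case (smult c x)
    then show ?case using sub assms(5) by blast
  qed
  then show ?thesis by blast
qed

lemma module_nabla: "module KR (nabla lam V)" and act_linear_nabla: "act_linear G (nabla lam V)"
proof -
  have mod: "module KR ST" unfolding ST by (rule S.T.module)
  interpret M: module KR ST by (rule mod)
  have B: "bas ` I \<subseteq> carrier V" using bas_mem by blast
  note sub = submodule_rep_span[OF mod tabs_sub[OF B], folded nabla_carrier, unfolded submodule_KR_iff[OF mod]]
  note s = subsetD[OF nabla_sub]
  show "module KR (nabla lam V)"
  proof (rule module_KR_I, unfold nabla_simps)
    show "0 \<odot>\<^bsub>ST\<^esub> x = \<zero>\<^bsub>ST\<^esub>" if "x \<in> carrier (nabla lam V)" for x
      using S.T.null s[OF that] by (simp add: ST)
    show "1 \<odot>\<^bsub>ST\<^esub> x = x" if "x \<in> carrier (nabla lam V)" for x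
      using M.smult_one[OF s[OF that]] by simp
    show "(a + b) \<odot>\<^bsub>ST\<^esub> x = a \<odot>\<^bsub>ST\<^esub> x \<oplus>\<^bsub>ST\<^esub> b \<odot>\<^bsub>ST\<^esub> x" if "x \<in> carrier (nabla lam V)" for a b x
      using M.smult_l_distr[of a b, OF _ _ s[OF that]] by simp
    show "(a * b) \<odot>\<^bsub>ST\<^esub> x = a \<odot>\<^bsub>ST\<^esub> (b \<odot>\<^bsub>ST\<^esub> x)" if "x \<in> carrier (nabla lam V)" for a b x
      using M.smult_assoc1[of a b, OF _ _ s[OF that]] by simp
    show "a \<odot>\<^bsub>ST\<^esub> (x \<oplus>\<^bsub>ST\<^esub> y) = a \<odot>\<^bsub>ST\<^esub> x \<oplus>\<^bsub>ST\<^esub> a \<odot>\<^bsub>ST\<^esub> y"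
      if "x \<in> carrier (nabla lam V)" "y \<in> carrier (nabla lam V)" for a x y
      using M.smult_r_distr[of a, OF _ s[OF that(1)] s[OF that(2)]] by simp
    show "x \<oplus>\<^bsub>ST\<^esub> y \<oplus>\<^bsub>ST\<^esub> z = x \<oplus>\<^bsub>ST\<^esub> (y \<oplus>\<^bsub>ST\<^esub> z)"
      if "x \<in> carrier (nabla lam V)" "y \<in> carrier (nabla lam V)" "z \<in> carrier (nabla lam V)" for x y z
      using M.a_assoc s that by blast
    show "x \<oplus>\<^bsub>ST\<^esub> y = y \<oplus>\<^bsub>ST\<^esub> x"
      if "x \<in> carrier (nabla lam V)" "y \<in> carrier (nabla lam V)" for x y
      using M.a_comm s that by blast
    show "\<zero>\<^bsub>ST\<^esub> \<oplus>\<^bsub>ST\<^esub> x = x" if "x \<in> carrier (nabla lam V)" for x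
      using M.l_zero s[OF that] by blast
  qed (use sub in blast)+
  have act: "act ST g x \<in> carrier (nabla lam V)" if g: "g \<in> carrier G" and x: "x \<in> carrier (nabla lam V)" for g x
    using x
  proof (induction rule: nabla_induct)
    case (base t)
    have t: "tabm t" using base B by (intro tabmI) auto
    show ?case unfolding act_polytabloid[OF t g] by (rule polytabloid_nabla, rule tabmI) (simp add: act_mem[OF g] tabmD[OF t])
  next
    case zero
    show ?case using sub by (simp add: ST S.T.act_zero[OF g])
  next
    case (add x y)
    then show ?case using sub S.T.act_add[OF g] s by (simp add: ST)
  next
    case (smult c x)
    then show ?case using sub S.T.act_smult[OF g] s by (simp add: ST)
  qed
  show "act_linear G (nabla lam V)"
    unfolding act_linear_def nabla_simps
  proof (intro ballI conjI allI)
    fix g x assume g: "g \<in> carrier G" and x: "x \<in> carrier (nabla lam V)"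
    show "act ST g x \<in> carrier (nabla lam V)" by (rule act[OF g x])
    show "act ST g (c \<odot>\<^bsub>ST\<^esub> x) = c \<odot>\<^bsub>ST\<^esub> act ST g x" for c
      using S.T.act_smult[OF g] s[OF x] by (simp add: ST)
    fix y assume y: "y \<in> carrier (nabla lam V)"
    show "act ST g (x \<oplus>\<^bsub>ST\<^esub> y) = act ST g x \<oplus>\<^bsub>ST\<^esub> act ST g y"
      using S.T.act_add[OF g] s[OF x] s[OF y] by (simp add: ST)
  qed
qed

end

subsection \<open>Hooks\<close>

text \<open>The polytabloid of a hook with arm entries \<open>\<alpha>\<close> and leg entries \<open>\<kappa>\<close> (including the corner),
  all given by their coordinate vectors. Its first row is kept as a polynomial in variables
  \<open>x\<^sub>i\<close>, whereas the \<open>b\<close> lower rows are replaced by their coordinates with indices \<open>cs\<close>;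
  expanding the determinant is the alternating sum over the column permutations.\<close>

definition hrow :: "nat set \<Rightarrow> nat list \<Rightarrow> nat \<Rightarrow> (nat \<Rightarrow> 'k::field) \<Rightarrow> 'k mpol" where
  "hrow I cs i v = (if i = 0 then lin_form I v else single {#} (v (cs ! (i - 1))))"

definition hookE :: "nat set \<Rightarrow> nat \<Rightarrow> nat \<Rightarrow> (nat \<Rightarrow> nat \<Rightarrow> 'k::field) \<Rightarrow> (nat \<Rightarrow> nat \<Rightarrow> 'k) \<Rightarrow>
    'k mfun" where
  "hookE I a b \<alpha> \<kappa> cs = (if length cs = b \<and> set cs \<subseteq> I
     then Determinant.det (Matrix.mat (Suc b) (Suc b) (\<lambda>(i, j). hrow I cs i (\<kappa> j))) * (\<Prod>j<a. lin_form I (\<alpha> j))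
     else 0)"

definition fscale :: "'k::field \<Rightarrow> ('k mfun) \<Rightarrow> 'k mfun" where
  "fscale c F = (\<lambda>cs. single {#} c * F cs)"

lemma diagram_hook: "(i, j) \<in> diagram (hook a b) \<longleftrightarrow> (i = 1 \<and> 1 \<le> j \<and> j \<le> Suc a) \<or> (j = 1 \<and> 1 \<le> i \<and> i \<le> Suc b)"
  by (auto simp: diagram_def hook_def nth_Cons' split: if_splits)

lemma finite_diagram_hook: "finite (diagram (hook a b))"
proof (rule finite_subset)
  show "diagram (hook a b) \<subseteq> {..Suc b} \<times> {..Suc a}"
  proof
    fix c assume "c \<in> diagram (hook a b)"
    then show "c \<in> {..Suc b} \<times> {..Suc a}" by (cases c) (auto simp: diagram_hook)
  qed
qed simp

text \<open>Turns a permutation of the row numbers \<open>0, ..., b\<close> of a matrix into one of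
  the first column of the diagram, whose rows start at 1.\<close>

definition cperm :: "nat \<Rightarrow> (nat \<Rightarrow> nat) \<Rightarrow> nat \<times> nat \<Rightarrow> nat \<times> nat" where
  "cperm b p c = (if snd c = 1 \<and> 1 \<le> fst c \<and> fst c \<le> Suc b then (Suc (p (fst c - 1)), 1) else c)"

lemma cperm_id: "cperm b id = id"
  by (auto simp: cperm_def fun_eq_iff)

lemma cperm_comp:
  assumes "q permutes {0..<Suc b}"
  shows "cperm b (p \<circ> q) = cperm b p \<circ> cperm b q"
proof (rule ext)
  fix c :: "nat \<times> nat"
  have "q (fst c - 1) < Suc b" if "1 \<le> fst c" "fst c \<le> Suc b"
    using permutes_in_image[OF assms, of "fst c - 1"] that by auto
  then show "cperm b (p \<circ> q) c = (cperm b p \<circ> cperm b q) c"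
    by (auto simp: cperm_def)
qed

lemma cperm_inverse:
  assumes p: "p permutes {0..<Suc b}"
  shows "inv_into UNIV (cperm b p) = cperm b (inv_into UNIV p)" "bij (cperm b p)"
proof -
  have "cperm b p \<circ> cperm b (inv_into UNIV p) = id" "cperm b (inv_into UNIV p) \<circ> cperm b p = id"
    using cperm_comp[OF permutes_inv[OF p], of p] cperm_comp[OF p, of "inv_into UNIV p"]
    by (simp_all add: permutes_inv_o[OF p] cperm_id)
  then show "inv_into UNIV (cperm b p) = cperm b (inv_into UNIV p)" "bij (cperm b p)"
    by (auto intro: inv_unique_comp o_bij)
qed

lemma cperm_permutes:
  assumes p: "p permutes {0..<Suc b}"
  shows "cperm b p permutes diagram (hook a b)"
proof (rule inj_imp_permutes)
  show "inj_on (cperm b p) (diagram (hook a b))"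
    using cperm_inverse(2)[OF p] by (auto simp: bij_def intro: inj_on_subset)
  show "finite (diagram (hook a b))" by (rule finite_diagram_hook)
next
  fix c assume c: "c \<in> diagram (hook a b)"
  have "p (fst c - 1) < Suc b" if "1 \<le> fst c" "fst c \<le> Suc b"
    using permutes_in_image[OF p, of "fst c - 1"] that by auto
  then show "cperm b p c \<in> diagram (hook a b)"
    using c by (cases c) (auto simp: cperm_def diagram_hook)
next
  fix c assume "c \<notin> diagram (hook a b)"
  then show "cperm b p c = c" by (cases c) (auto simp: cperm_def diagram_hook)
qed

text \<open>Both signs are multiplicative, and \<open>cperm\<close> maps transpositions to
  transpositions.\<close>

lemma sign_cperm: "p permutes {0..<Suc b} \<Longrightarrow> sign (cperm b p) = sign p"
proof (induction p rule: permutes_induct[consumes 1, case_names finite id step])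
  case (step x y p)
  let ?s = "Transposition.transpose x y"
  have s: "?s permutes {0..<Suc b}" using step by (intro permutes_swap_id)
  have c: "cperm b ?s = Transposition.transpose (Suc x, 1) (Suc y, 1)"
    using step(1,2) by (auto simp: fun_eq_iff cperm_def Transposition.transpose_def)
  have perm: "permutation q" if "q permutes {0..<Suc b}" for q
    using that by (auto simp: permutation_permutes)
  have cp: "permutation (cperm b q)" if "q permutes {0..<Suc b}" for q
    using cperm_permutes[OF that, of 0] finite_diagram_hook permutation_permutes by blast
  show ?case
    unfolding cperm_comp[OF step(4)] sign_compose[OF cp[OF s] cp[OF step(4)]] sign_compose[OF perm[OF s] perm[OF step(4)]]
    using step(3,5) by (simp add: c sign_swap_id)
next
  case id
  show ?case by (simp only: cperm_id sign_id)
qed simp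

text \<open>All columns of a hook but the first consist of one box, so column permutations are
  permutations of \<open>b + 1\<close> rows. The inverse matches the inverse in
  \<open>polytabloid\<close> and turns its sum into the Leibniz formula.\<close>

lemma col_perms_hook: "bij_betw (\<lambda>p. cperm b (inv_into UNIV p)) {p. p permutes {0..<Suc b}} (col_perms (hook a b))"
proof -
  let ?P = "{p. p permutes {0..<Suc b}}"
  have 1: "bij_betw (inv_into UNIV) ?P ?P"
    by (rule bij_betwI[where g = "inv_into UNIV"]) (auto simp: permutes_inv permutes_inv_inv)
  have 2: "bij_betw (cperm b) ?P (col_perms (hook a b))"
    unfolding bij_betw_def
  proof (intro conjI equalityI subsetI)
    show "inj_on (cperm b) ?P"
    proof (rule inj_onI)
      fix p q assume p: "p \<in> ?P" and q: "q \<in> ?P" and eq: "cperm b p = cperm b q"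
      have "p i = q i" for i
      proof (cases "i < Suc b")
        case True
        then show ?thesis using fun_cong[OF eq, of "(Suc i, 1)"] by (simp add: cperm_def)
      next
        case False
        then show ?thesis using p q permutes_not_in[of p "{0..<Suc b}" i] permutes_not_in[of q "{0..<Suc b}" i] by simp
      qed
      then show "p = q" by blast
    qed
  next
    fix s assume "s \<in> cperm b ` ?P"
    then obtain p where p: "p permutes {0..<Suc b}" "s = cperm b p" by blast
    then show "s \<in> col_perms (hook a b)"
      using cperm_permutes[OF p(1), of a] by (auto simp: col_perms_def cperm_def)
  next
    fix s assume "s \<in> col_perms (hook a b)"
    then have s: "s permutes diagram (hook a b)" and col: "\<And>c. c \<in> diagram (hook a b) \<Longrightarrow> snd (s c) = snd c"
      by (auto simp: col_perms_def)
    have img: "s c \<in> diagram (hook a b) \<longleftrightarrow> c \<in> diagram (hook a b)" for c by (rule permutes_in_image[OF s])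
    define p where "p i = (if i < Suc b then fst (s (Suc i, 1)) - 1 else i)" for i
    have sc: "s (Suc i, 1) = (Suc (p i), 1)" "p i < Suc b" if i: "i < Suc b" for i
    proof -
      have d: "(Suc i, 1) \<in> diagram (hook a b)" using i by (simp add: diagram_hook)
      obtain x y where xy: "s (Suc i, 1) = (x, y)" by fastforce
      have "y = 1" using col[OF d] xy by simp
      moreover have "(x, y) \<in> diagram (hook a b)" using img[of "(Suc i, 1)"] d xy by simp
      ultimately have "1 \<le> x" "x \<le> Suc b" by (auto simp: diagram_hook)
      then show "s (Suc i, 1) = (Suc (p i), 1)" "p i < Suc b"
        using i xy \<open>y = 1\<close> by (simp_all add: p_def)
    qed
    have "p permutes {0..<Suc b}"
    proof (rule inj_imp_permutes)
      show "inj_on p {0..<Suc b}"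
      proof (rule inj_onI)
        fix i j assume ij: "i \<in> {0..<Suc b}" "j \<in> {0..<Suc b}" "p i = p j"
        then have "s (Suc i, 1) = s (Suc j, 1)" using sc(1)[of i] sc(1)[of j] by simp
        then have "(Suc i, 1::nat) = (Suc j, 1)" using permutes_inj[OF s] by (metis injD)
        then show "i = j" by simp
      qed
    qed (use sc in \<open>auto simp: p_def\<close>)
    moreover have "s c = cperm b p c" for c
    proof (cases "snd c = 1 \<and> 1 \<le> fst c \<and> fst c \<le> Suc b")
      case True
      then obtain i where "c = (Suc i, 1)" "i < Suc b" by (cases c; cases "fst c") auto
      then show ?thesis using sc(1)[of i] by (simp add: cperm_def)
    next
      case False
      have "s c = c"
      proof (cases "c \<in> diagram (hook a b)")
        case True
        then obtain j where c: "c = (1, j)" "j \<noteq> 1" using False by (cases c) (auto simp: diagram_hook)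
        have "s c \<in> diagram (hook a b)" "snd (s c) = j" using img[of c] col[of c] True c by auto
        then show ?thesis using c by (cases "s c") (auto simp: diagram_hook)
      qed (rule permutes_not_in[OF s])
      moreover have "cperm b p c = c" unfolding cperm_def by (rule if_not_P) (use False in blast)
      ultimately show ?thesis by simp
    qed
    ultimately show "s \<in> cperm b ` ?P" by (intro image_eqI[of _ _ p]) auto
  qed
  show ?thesis using bij_betw_trans[OF 1 2] by (simp add: o_def)
qed

lemma lookup_lin_form: "finite I \<Longrightarrow> lookup (lin_form I v) {#c#} = (if c \<in> I then v c else 0)"
proof -
  assume fin: "finite I"
  have "lookup (lin_form I v) {#c#} = (\<Sum>i\<in>I. if i = c then v c else 0)"
    unfolding lin_form_def lookup_sum by (rule sum.cong) (auto simp: lookup_single when_def)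
  then show ?thesis using fin by simp
qed

lemma lookup_of_int_mult: "lookup (of_int k * F) m = of_int k * lookup (F :: ('k::field) mpol) m"
proof -
  have "of_int k * F = single 0 (of_int k) * F" by (simp only: single_of_int)
  then show ?thesis by (simp only: lookup_const_mult)
qed

lemma prod_single_const: "(\<Prod>i\<in>A. single {#} (f i)) = single {#} (\<Prod>i\<in>A. f i :: 'k::field)"
  by (induction A rule: infinite_finite_induct) (simp_all add: mult_single)

locale hook_schur = schur G V I \<phi> "hook a b"
  for G :: "('g, 'm) monoid_scheme" and V :: "('g, 'k::field, 'v) rep"
    and I :: "nat set" and \<phi> :: "'v \<Rightarrow> nat \<Rightarrow> 'k" and a b :: nat
begin

abbreviation "sing \<equiv> map (\<lambda>c::nat. {#c#})"

text \<open>The head of a coordinate list is kept as the monomials of a polynomial; the rows of the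
  leg have one box each, so their multisets are flattened to the list \<open>cs\<close>.\<close>

definition \<Psi> :: "(('v list \<Rightarrow>\<^sub>0 'k) set set list \<Rightarrow>\<^sub>0 'k) set \<Rightarrow> 'k mfun" where
  "\<Psi> x cs = (if length cs = b \<and> set cs \<subseteq> I then Abs_poly_mapping (\<lambda>m. S.crd x (m # sing cs)) else 0)"

lemma lookup_\<Psi>:
  assumes x: "x \<in> carrier ST" and cs: "length cs = b" "set cs \<subseteq> I"
  shows "lookup (\<Psi> x cs) m = S.crd x (m # sing cs)"
proof -
  have "{m. S.crd x (m # sing cs) \<noteq> 0} \<subseteq> hd ` S.J"
  proof
    fix m assume "m \<in> {m. S.crd x (m # sing cs) \<noteq> 0}"
    then have "m # sing cs \<in> S.J" using S.T.crd_off[of x] x unfolding ST by blast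
    then show "m \<in> hd ` S.J" by (rule image_eqI[rotated]) simp
  qed
  then have "finite {m. S.crd x (m # sing cs) \<noteq> 0}" using S.finite_J finite_surj by blast
  then show ?thesis using cs by (simp add: \<Psi>_def)
qed

lemma \<Psi>_off: "\<not> (length cs = b \<and> set cs \<subseteq> I) \<Longrightarrow> \<Psi> x cs = 0"
  unfolding \<Psi>_def by (rule if_not_P)

lemma \<Psi>_add:
  assumes x: "x \<in> carrier ST" and y: "y \<in> carrier ST"
  shows "\<Psi> (x \<oplus>\<^bsub>ST\<^esub> y) cs = \<Psi> x cs + \<Psi> y cs"
proof (cases "length cs = b \<and> set cs \<subseteq> I")
  case True
  then have cs: "length cs = b" "set cs \<subseteq> I" by auto
  have xy: "x \<oplus>\<^bsub>ST\<^esub> y \<in> carrier ST" using S.T.add_mem x y unfolding ST by blast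
  show ?thesis
    by (rule poly_mapping_eqI)
      (simp only: lookup_\<Psi>[OF xy cs] lookup_\<Psi>[OF x cs] lookup_\<Psi>[OF y cs] lookup_add
        S.T.crd_add[OF x[unfolded ST] y[unfolded ST], folded ST])
qed (simp add: \<Psi>_off)

lemma \<Psi>_smult:
  assumes x: "x \<in> carrier ST"
  shows "\<Psi> (c \<odot>\<^bsub>ST\<^esub> x) cs = single {#} c * \<Psi> x cs"
proof (cases "length cs = b \<and> set cs \<subseteq> I")
  case True
  then have cs: "length cs = b" "set cs \<subseteq> I" by auto
  have cx: "c \<odot>\<^bsub>ST\<^esub> x \<in> carrier ST" using S.T.smult_mem x unfolding ST by blast
  show ?thesis
    by (rule poly_mapping_eqI)
      (simp only: lookup_\<Psi>[OF cx cs] lookup_\<Psi>[OF x cs] lookup_const_mult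
        S.T.crd_smult[OF x[unfolded ST], folded ST])
qed (simp add: \<Psi>_off)

text \<open>Every row below the first has length 1, so its multiset is a singleton and the
  flattening to \<open>cs\<close> loses nothing.\<close>

lemma \<Psi>_inj:
  assumes x: "x \<in> carrier ST" and y: "y \<in> carrier ST" and eq: "\<Psi> x = \<Psi> y"
  shows "x = y"
proof (rule S.T.crd_inj[OF x[unfolded ST] y[unfolded ST]])
  fix ms assume "ms \<in> S.J"
  then have "length ms = length Rs \<and> (\<forall>i<length Rs. ms ! i \<in> sI i)"
    unfolding S.J_def by (rule CollectD)
  moreover have "length Rs = Suc b" by (simp add: hook_def)
  ultimately have len: "length ms = Suc b" and el: "\<And>i. i < Suc b \<Longrightarrow> ms ! i \<in> sI i"
    by (simp_all only:)
  obtain m ms' where ms: "ms = m # ms'" "length ms' = b" using len by (cases ms) auto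
  have "\<exists>c. c \<in> I \<and> ms' ! i = {#c#}" if "i < b" for i
  proof -
    have "ms' ! i \<in> sI (Suc i)" using el[of "Suc i"] that ms by simp
    then have "size (ms' ! i) = 1" "set_mset (ms' ! i) \<subseteq> I"
      using that by (simp_all add: sym_coords.M_def[OF sc] hook_def)
    then show ?thesis using size_1_singleton_mset by fastforce
  qed
  then obtain c where c: "\<And>i. i < b \<Longrightarrow> c i \<in> I \<and> ms' ! i = {#c i#}" by metis
  define cs where "cs = map c [0..<b]"
  have cs: "length cs = b" "set cs \<subseteq> I" using c by (auto simp: cs_def)
  have "ms = m # sing cs" using ms c by (auto simp: cs_def intro!: nth_equalityI)
  then show "S.crd x ms = S.crd y ms"
    using lookup_\<Psi>[OF x cs, of m] lookup_\<Psi>[OF y cs, of m] eq by simp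
qed

text \<open>The Leibniz formula: a permutation puts the entry of row \<open>p i\<close> of the
  column into row \<open>i\<close>. In row 0 it enters as a linear form multiplying the arm, in the
  other rows as a scalar coordinate.\<close>

lemma Pc_hook:
  assumes supp: "\<And>c i. c \<in> Di \<Longrightarrow> i \<notin> I \<Longrightarrow> \<tau> c i = 0" and cs: "length cs = b" "set cs \<subseteq> I"
  shows "Pc \<tau> (m # sing cs) = lookup (hookE I a b (\<lambda>j. \<tau> (1, j + 2)) (\<lambda>i. \<tau> (Suc i, 1)) cs) m"
proof -
  let ?P = "{p. p permutes {0..<Suc b}}"
  let ?A = "\<Prod>j<a. lin_form I (\<tau> (1, j + 2))"
  let ?k = "\<lambda>i. \<tau> (Suc i, 1)"
  have row: "rowc (\<tau> \<circ> cperm b p) (m # sing cs) =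
      lookup (lin_form I (?k (p 0)) * ?A) m * (\<Prod>i<b. ?k (p (Suc i)) (cs ! i))"
    if p: "p permutes {0..<Suc b}" for p
  proof -
    have first: "(\<Prod>j\<in>{1..Suc a}. lin_form I ((\<tau> \<circ> cperm b p) (1, j))) = lin_form I (?k (p 0)) * ?A"
    proof -
      have "(\<Prod>j\<in>{1..Suc a}. lin_form I ((\<tau> \<circ> cperm b p) (1, j))) =
          (\<Prod>j<Suc a. lin_form I ((\<tau> \<circ> cperm b p) (1, j + 1)))"
        by (rule prod.reindex_bij_witness[where i = "\<lambda>j. j + 1" and j = "\<lambda>j. j - 1"]) auto
      also have "\<dots> = lin_form I ((\<tau> \<circ> cperm b p) (1, 1)) * (\<Prod>j<a. lin_form I ((\<tau> \<circ> cperm b p) (1, Suc j + 1)))"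
        by (subst prod.lessThan_Suc_shift) simp
      also have "(\<Prod>j<a. lin_form I ((\<tau> \<circ> cperm b p) (1, Suc j + 1))) = ?A"
        by (rule prod.cong) (simp_all add: cperm_def numeral_2_eq_2 flip: Suc_eq_plus1)
      moreover have "(\<tau> \<circ> cperm b p) (1, 1) = ?k (p 0)" by (simp add: cperm_def)
      ultimately show ?thesis by (simp only:)
    qed
    have rest: "lookup (\<Prod>j\<in>{1..hook a b ! Suc i}. lin_form I ((\<tau> \<circ> cperm b p) (Suc (Suc i), j))) ((m # sing cs) ! Suc i)
        = ?k (p (Suc i)) (cs ! i)" if i: "i < b" for i
    proof -
      have "cs ! i \<in> I" using cs i by auto
      then show ?thesis
        using i cs by (simp add: hook_def cperm_def lookup_lin_form[OF fin])
    qed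
    have "rowc (\<tau> \<circ> cperm b p) (m # sing cs) = (\<Prod>i<Suc b.
       lookup (\<Prod>j\<in>{1..hook a b ! i}. lin_form I ((\<tau> \<circ> cperm b p) (Suc i, j))) ((m # sing cs) ! i))"
    proof -
      have "n = Suc b" by (simp add: hook_def)
      moreover have "length (m # sing cs) = Suc b" using cs by simp
      ultimately show ?thesis by (simp only: rowc_def if_True simp_thms)
    qed
    also have "\<dots> = lookup (\<Prod>j\<in>{1..Suc a}. lin_form I ((\<tau> \<circ> cperm b p) (1, j))) m *
      (\<Prod>i<b. lookup (\<Prod>j\<in>{1..hook a b ! Suc i}. lin_form I ((\<tau> \<circ> cperm b p) (Suc (Suc i), j))) ((m # sing cs) ! Suc i))"
    proof -
      have "hook a b ! 0 = Suc a" by (simp add: hook_def)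
      then show ?thesis by (simp only: prod.lessThan_Suc_shift nth_Cons_0 One_nat_def[symmetric])
    qed
    also have "\<dots> = lookup (lin_form I (?k (p 0)) * ?A) m * (\<Prod>i<b. ?k (p (Suc i)) (cs ! i))"
      unfolding first by (intro arg_cong2[of _ _ _ _ "(*)"] refl prod.cong) (simp_all only: lessThan_iff rest)
    finally show ?thesis .
  qed
  have "Pc \<tau> (m # sing cs) = (\<Sum>p\<in>?P. of_int (sign (cperm b (inv_into UNIV p))) *
      rowc (\<tau> \<circ> inv_into UNIV (cperm b (inv_into UNIV p))) (m # sing cs))"
    unfolding Pc_def by (rule sum.reindex_bij_betw[OF col_perms_hook, symmetric])
  also have "\<dots> = (\<Sum>p\<in>?P. of_int (sign p) *
      (lookup (lin_form I (?k (p 0)) * ?A) m * (\<Prod>i<b. ?k (p (Suc i)) (cs ! i))))"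
  proof (rule sum.cong)
    fix p assume "p \<in> ?P"
    then have p: "p permutes {0..<Suc b}" by simp
    note p' = permutes_inv[OF p]
    have "sign (cperm b (inv_into UNIV p)) = sign p"
      using sign_cperm[OF p'] sign_inverse[of p] p permutation_permutes by (metis finite_atLeastLessThan)
    moreover have "inv_into UNIV (cperm b (inv_into UNIV p)) = cperm b p"
      by (simp add: cperm_inverse[OF p'] permutes_inv_inv[OF p])
    ultimately show "of_int (sign (cperm b (inv_into UNIV p))) *
      rowc (\<tau> \<circ> inv_into UNIV (cperm b (inv_into UNIV p))) (m # sing cs) = of_int (sign p) *
      (lookup (lin_form I (?k (p 0)) * ?A) m * (\<Prod>i<b. ?k (p (Suc i)) (cs ! i)))"
      by (simp only: row[OF p])
  qed simp
  also have "\<dots> = lookup (\<Sum>p\<in>?P. of_int (sign p) *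
      (single {#} (\<Prod>i<b. ?k (p (Suc i)) (cs ! i)) * (lin_form I (?k (p 0)) * ?A))) m"
    unfolding lookup_sum lookup_of_int_mult lookup_const_mult
    by (intro sum.cong refl) (simp only: mult_ac)
  also have "(\<Sum>p\<in>?P. of_int (sign p) *
      (single {#} (\<Prod>i<b. ?k (p (Suc i)) (cs ! i)) * (lin_form I (?k (p 0)) * ?A))) =
      hookE I a b (\<lambda>j. \<tau> (1, j + 2)) ?k cs"
  proof -
    let ?M = "Matrix.mat (Suc b) (Suc b) (\<lambda>(i, j). hrow I cs i (?k j))"
    have "Determinant.det ?M * ?A = (\<Sum>p\<in>?P. of_int (sign p) * (\<Prod>i = 0..<Suc b. ?M $$ (i, p i)) * ?A)"
      by (subst det_def'[of _ "Suc b"]) (simp_all add: sum_distrib_right)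
    also have "\<dots> = (\<Sum>p\<in>?P. of_int (sign p) *
      (single {#} (\<Prod>i<b. ?k (p (Suc i)) (cs ! i)) * (lin_form I (?k (p 0)) * ?A)))"
    proof (rule sum.cong)
      fix p assume "p \<in> ?P"
      then have p: "p permutes {0..<Suc b}" by simp
      have "(\<Prod>i = 0..<Suc b. ?M $$ (i, p i)) = (\<Prod>i<Suc b. hrow I cs i (?k (p i)))"
        unfolding lessThan_atLeast0
        by (rule prod.cong) (use permutes_in_image[OF p] in auto)
      also have "\<dots> = lin_form I (?k (p 0)) * single {#} (\<Prod>i<b. ?k (p (Suc i)) (cs ! i))"
        by (subst prod.lessThan_Suc_shift) (simp add: hrow_def prod_single_const)
      finally show "of_int (sign p) * (\<Prod>i = 0..<Suc b. ?M $$ (i, p i)) * ?A = of_int (sign p) *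
        (single {#} (\<Prod>i<b. ?k (p (Suc i)) (cs ! i)) * (lin_form I (?k (p 0)) * ?A))"
        by (simp only: mult_ac)
    qed simp
    finally show ?thesis using cs by (simp add: hookE_def)
  qed
  finally show ?thesis .
qed

lemma \<Psi>_polytabloid:
  assumes t: "tabm t"
  shows "\<Psi> (polytabloid (hook a b) V t) = hookE I a b (\<lambda>j. \<phi> (t (1, j + 2))) (\<lambda>i. \<phi> (t (Suc i, 1)))"
proof (rule ext)
  fix cs
  show "\<Psi> (polytabloid (hook a b) V t) cs = hookE I a b (\<lambda>j. \<phi> (t (1, j + 2))) (\<lambda>i. \<phi> (t (Suc i, 1))) cs"
  proof (cases "length cs = b \<and> set cs \<subseteq> I")
    case True
    then have cs: "length cs = b" "set cs \<subseteq> I" by auto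
    have supp: "(\<phi> \<circ> t) c i = 0" if "c \<in> Di" "i \<notin> I" for c i
      using crd_off[OF tabmD[OF t that(1)] that(2)] by simp
    show ?thesis
    proof (rule poly_mapping_eqI)
      fix m
      show "lookup (\<Psi> (polytabloid (hook a b) V t) cs) m =
          lookup (hookE I a b (\<lambda>j. \<phi> (t (1, j + 2))) (\<lambda>i. \<phi> (t (Suc i, 1))) cs) m"
        using Pc_hook[of "\<phi> \<circ> t" cs m, OF supp cs]
        unfolding lookup_\<Psi>[OF crd_polytabloid(1)[OF t] cs] crd_polytabloid(2)[OF t] by simp
    qed
  next
    case False
    show ?thesis unfolding \<Psi>_off[OF False] hookE_def by (rule if_not_P[OF False, symmetric])
  qed
qed

end

declare One_nat_def [simp]

subsection \<open>Isomorphisms, duals and invariants\<close>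

text \<open>Finite-dimensional with a linear action. The type of the index set has to be fixed in
  the definition; the one chosen accommodates a basis of the image of \<open>\<Psi>\<close>, a set
  of hook tensors.\<close>

definition nice :: "('k::field ^ 2 ^ 2, 'k, 'v) rep \<Rightarrow> bool" where
  "nice V \<longleftrightarrow> (\<exists>(I :: ('k mfun) set) \<phi>. coord_rep SL2 V I \<phi>)"

lemma niceD:
  assumes "nice V"
  shows "module KR V" "act_linear SL2 V"
  using assms unfolding nice_def by (auto dest: coord_rep.module coord_rep.act_lin)

lemma nice_dual: "nice V \<Longrightarrow> nice (dual_rep SL2 V)"
  unfolding nice_def using coord_rep.coord_rep_dual[OF _ group_SL2] by blast

lemma rep_isoD:
  assumes "f \<in> rep_iso G V W"
  shows "bij_betw f (carrier V) (carrier W)"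
    "x \<in> carrier V \<Longrightarrow> y \<in> carrier V \<Longrightarrow> f (x \<oplus>\<^bsub>V\<^esub> y) = f x \<oplus>\<^bsub>W\<^esub> f y"
    "x \<in> carrier V \<Longrightarrow> f (c \<odot>\<^bsub>V\<^esub> x) = c \<odot>\<^bsub>W\<^esub> f x"
    "g \<in> carrier G \<Longrightarrow> x \<in> carrier V \<Longrightarrow> f (act V g x) = act W g (f x)"
    "x \<in> carrier V \<Longrightarrow> f x \<in> carrier W"
  using assms by (auto simp: rep_iso_def bij_betw_def)

lemma rep_isoI:
  assumes "bij_betw f (carrier V) (carrier W)"
    "\<And>x y. x \<in> carrier V \<Longrightarrow> y \<in> carrier V \<Longrightarrow> f (x \<oplus>\<^bsub>V\<^esub> y) = f x \<oplus>\<^bsub>W\<^esub> f y"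
    "\<And>c x. x \<in> carrier V \<Longrightarrow> f (c \<odot>\<^bsub>V\<^esub> x) = c \<odot>\<^bsub>W\<^esub> f x"
    "\<And>g x. g \<in> carrier G \<Longrightarrow> x \<in> carrier V \<Longrightarrow> f (act V g x) = act W g (f x)"
  shows "f \<in> rep_iso G V W"
  using assms by (auto simp: rep_iso_def)

lemma act_linearD:
  assumes "act_linear G V" "g \<in> carrier G" "x \<in> carrier V"
  shows "act V g x \<in> carrier V"
  using assms by (simp add: act_linear_def)

lemma module_closed:
  fixes V :: "('g, 'k::field, 'v) rep"
  assumes "module KR V"
  shows "x \<in> carrier V \<Longrightarrow> y \<in> carrier V \<Longrightarrow> x \<oplus>\<^bsub>V\<^esub> y \<in> carrier V"
    "x \<in> carrier V \<Longrightarrow> c \<odot>\<^bsub>V\<^esub> x \<in> carrier V" "\<zero>\<^bsub>V\<^esub> \<in> carrier V" "x \<in> carrier V \<Longrightarrow> 0 \<odot>\<^bsub>V\<^esub> x = \<zero>\<^bsub>V\<^esub>"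
proof -
  interpret M: module KR V by fact
  show "x \<in> carrier V \<Longrightarrow> y \<in> carrier V \<Longrightarrow> x \<oplus>\<^bsub>V\<^esub> y \<in> carrier V" by (rule M.add.m_closed)
  show "x \<in> carrier V \<Longrightarrow> c \<odot>\<^bsub>V\<^esub> x \<in> carrier V" by simp
  show "\<zero>\<^bsub>V\<^esub> \<in> carrier V" by (rule M.zero_closed)
  show "x \<in> carrier V \<Longrightarrow> 0 \<odot>\<^bsub>V\<^esub> x = \<zero>\<^bsub>V\<^esub>" using M.smult_l_null by simp
qed

lemma rep_iso_inv:
  fixes V :: "('g, 'k::field, 'v) rep" and W :: "('g, 'k, 'w) rep"
  assumes f: "f \<in> rep_iso G V W" and V: "module KR V" "act_linear G V"
  shows "inv_into (carrier V) f \<in> rep_iso G W V"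
proof -
  let ?h = "inv_into (carrier V) f"
  note b = rep_isoD(1)[OF f]
  have h: "?h y \<in> carrier V" "f (?h y) = y" if "y \<in> carrier W" for y
    using that b by (auto simp: bij_betw_def inv_into_into f_inv_into_f)
  have hf: "?h (f x) = x" if "x \<in> carrier V" for x
    using that b by (auto simp: bij_betw_def)
  show ?thesis
  proof (rule rep_isoI)
    show "bij_betw ?h (carrier W) (carrier V)" by (rule bij_betw_inv_into[OF b])
  next
    fix x y assume xy: "x \<in> carrier W" "y \<in> carrier W"
    show "?h (x \<oplus>\<^bsub>W\<^esub> y) = ?h x \<oplus>\<^bsub>V\<^esub> ?h y"
      using hf[OF module_closed(1)[OF V(1) h(1)[OF xy(1)] h(1)[OF xy(2)]]]
      by (simp only: rep_isoD(2)[OF f h(1)[OF xy(1)] h(1)[OF xy(2)]] h(2) xy)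
  next
    fix c x assume x: "x \<in> carrier W"
    show "?h (c \<odot>\<^bsub>W\<^esub> x) = c \<odot>\<^bsub>V\<^esub> ?h x"
      using hf[OF module_closed(2)[OF V(1) h(1)[OF x], of c]]
      by (simp only: rep_isoD(3)[OF f h(1)[OF x]] h(2) x)
  next
    fix g x assume g: "g \<in> carrier G" and x: "x \<in> carrier W"
    show "?h (act W g x) = act V g (?h x)"
      using hf[OF act_linearD[OF V(2) g h(1)[OF x]]]
      by (simp only: rep_isoD(4)[OF f g h(1)[OF x]] h(2) x)
  qed
qed

lemma rep_isomorphic_sym:
  assumes "rep_isomorphic SL2 V W" "nice V"
  shows "rep_isomorphic SL2 W V"
  using assms rep_iso_inv[OF _ niceD[OF assms(2)]] unfolding rep_isomorphic_def by blast

lemma rep_isomorphic_trans: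
  assumes "rep_isomorphic G U V" "rep_isomorphic G V W"
  shows "rep_isomorphic G U W"
proof -
  obtain f h where f: "f \<in> rep_iso G U V" and h: "h \<in> rep_iso G V W"
    using assms unfolding rep_isomorphic_def by blast
  have "h \<circ> f \<in> rep_iso G U W"
    by (rule rep_isoI) (simp_all add: bij_betw_trans[OF rep_isoD(1)[OF f] rep_isoD(1)[OF h]]
        rep_isoD(2-)[OF f] rep_isoD(2-)[OF h])
  then show ?thesis unfolding rep_isomorphic_def by blast
qed

lemma dual_pullback:
  fixes V :: "('g, 'k::field, 'v) rep" and W :: "('g, 'k, 'w) rep"
  assumes f: "f \<in> rep_iso G V W" and V: "module KR V" and \<psi>: "\<psi> \<in> carrier (dual_rep G W)"
  shows "(\<lambda>x\<in>carrier V. \<psi> (f x)) \<in> carrier (dual_rep G V)"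
  by (rule dualI)
    (simp_all add: module_closed[OF V] rep_isoD(2,3,5)[OF f] dualD[OF \<psi>])

lemma rep_isomorphic_dual:
  fixes V :: "('k::field ^ 2 ^ 2, 'k, 'v) rep" and W :: "('k ^ 2 ^ 2, 'k, 'w) rep"
  assumes iso: "rep_isomorphic SL2 V W" and "nice V" "nice W"
  shows "rep_isomorphic SL2 (dual_rep SL2 V) (dual_rep SL2 W)"
proof -
  obtain f where f: "f \<in> rep_iso SL2 V W" using iso unfolding rep_isomorphic_def by blast
  note V = niceD[OF \<open>nice V\<close>] and W = niceD[OF \<open>nice W\<close>]
  define h where "h = inv_into (carrier V) f"
  have h: "h \<in> rep_iso SL2 W V" unfolding h_def by (rule rep_iso_inv[OF f V])
  have fh: "f (h y) = y" if "y \<in> carrier W" for y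
    using that rep_isoD(1)[OF f] by (auto simp: bij_betw_def f_inv_into_f h_def)
  have hf: "h (f x) = x" if "x \<in> carrier V" for x
    using that rep_isoD(1)[OF f] by (auto simp: bij_betw_def h_def)
  let ?F = "\<lambda>\<psi>. \<lambda>y\<in>carrier W. \<psi> (h y)" and ?H = "\<lambda>\<psi>. \<lambda>x\<in>carrier V. \<psi> (f x)"
  have "?F \<in> rep_iso SL2 (dual_rep SL2 V) (dual_rep SL2 W)"
  proof (rule rep_isoI)
    show "bij_betw ?F (carrier (dual_rep SL2 V)) (carrier (dual_rep SL2 W))"
    proof (rule bij_betwI[where g = ?H])
      show "?F \<in> carrier (dual_rep SL2 V) \<rightarrow> carrier (dual_rep SL2 W)" using dual_pullback[OF h W(1)] by blast
      show "?H \<in> carrier (dual_rep SL2 W) \<rightarrow> carrier (dual_rep SL2 V)" using dual_pullback[OF f V(1)] by blast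
      show "?H (?F \<psi>) = \<psi>" if p: "\<psi> \<in> carrier (dual_rep SL2 V)" for \<psi>
        by (rule extensionalityI[OF _ dualD(3)[OF p]]) (simp_all add: rep_isoD(5)[OF f] hf)
      show "?F (?H \<psi>) = \<psi>" if p: "\<psi> \<in> carrier (dual_rep SL2 W)" for \<psi>
        by (rule extensionalityI[OF _ dualD(3)[OF p]]) (simp_all add: rep_isoD(5)[OF h] fh)
    qed
  next
    fix g :: "'k ^ 2 ^ 2" and \<psi> assume g: "g \<in> carrier SL2" and "\<psi> \<in> carrier (dual_rep SL2 V)"
    have g': "inv\<^bsub>SL2\<^esub> g \<in> carrier SL2" by (rule group.inv_closed[OF group_SL2 g])
    show "?F (act (dual_rep SL2 V) g \<psi>) = act (dual_rep SL2 W) g (?F \<psi>)"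
      by (rule ext) (simp add: dual_simps(5) rep_isoD(5)[OF h] rep_isoD(4)[OF h g'] act_linearD[OF W(2) g'])
  qed (auto simp: dual_simps(3,4) fun_eq_iff rep_isoD(5)[OF h] module_closed[OF W(1)])
  then show ?thesis unfolding rep_isomorphic_def by blast
qed

text \<open>In the coordinates of the double dual, evaluation at \<open>x\<close> has the
  coordinates of \<open>x\<close> itself, so the map is bijective.\<close>

lemma double_dual_ev:
  fixes V :: "('k::field ^ 2 ^ 2, 'k, 'v) rep"
  assumes "nice V"
  shows "(\<lambda>x. \<lambda>\<psi>\<in>carrier (dual_rep SL2 V). \<psi> x) \<in> rep_iso SL2 V (dual_rep SL2 (dual_rep SL2 V))"
proof -
  obtain I :: "('k mfun) set" and \<phi> where c: "coord_rep SL2 V I \<phi>"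
    using assms unfolding nice_def by blast
  interpret V: coord_rep SL2 V I \<phi> by fact
  interpret D: coord_rep SL2 "dual_rep SL2 V" I V.dcrd by (rule V.coord_rep_dual[OF group_SL2])
  interpret DD: coord_rep SL2 "dual_rep SL2 (dual_rep SL2 V)" I D.dcrd by (rule D.coord_rep_dual[OF group_SL2])
  let ?D = "dual_rep SL2 V" and ?DD = "dual_rep SL2 (dual_rep SL2 V)"
  let ?ev = "\<lambda>x. \<lambda>\<psi>\<in>carrier ?D. \<psi> x"
  have ev: "?ev x \<in> carrier ?DD" if x: "x \<in> carrier V" for x
    by (rule dualI) (simp_all add: D.add_mem D.smult_mem, simp_all add: dual_simps(3,4) x)
  have crd: "D.dcrd (?ev x) i = \<phi> x i" if x: "x \<in> carrier V" for x i
  proof (cases "i \<in> I")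
    case True
    have "D.bas i x = (\<Sum>j\<in>I. D.bas i (V.bas j) * \<phi> x j)"
      by (rule V.dual_expand[OF D.bas_mem[OF True] x])
    also have "\<dots> = (\<Sum>j\<in>I. if j = i then \<phi> x i else 0)"
    proof (rule sum.cong)
      fix j assume j: "j \<in> I"
      then show "D.bas i (V.bas j) * \<phi> x j = (if j = i then \<phi> x i else 0)"
        using D.crd_bas[OF True, of j] by (simp add: V.dcrd_def)
    qed simp
    finally show ?thesis using True V.fin D.bas_mem[OF True] by (simp add: D.dcrd_def)
  qed (simp add: D.dcrd_def V.crd_off x)
  show "?ev \<in> rep_iso SL2 V ?DD"
  proof (rule rep_isoI)
    show "bij_betw ?ev (carrier V) (carrier ?DD)"
      unfolding bij_betw_def
    proof (intro conjI inj_onI equalityI subsetI)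
      fix x y assume x: "x \<in> carrier V" and y: "y \<in> carrier V" and eq: "?ev x = ?ev y"
      show "x = y" using crd[OF x] crd[OF y] eq by (intro V.crd_eqI[OF x y]) metis
    next
      fix \<Lambda> assume \<Lambda>: "\<Lambda> \<in> carrier ?DD"
      have "\<exists>x\<in>carrier V. \<phi> x = D.dcrd \<Lambda>" by (rule V.crd_surj) (simp add: D.dcrd_def)
      then obtain x where x: "x \<in> carrier V" "\<phi> x = D.dcrd \<Lambda>" by blast
      have "\<Lambda> = ?ev x" by (rule DD.crd_eqI[OF \<Lambda> ev[OF x(1)]]) (simp only: crd[OF x(1)] x(2))
      then show "\<Lambda> \<in> ?ev ` carrier V" using x(1) by blast
    qed (use ev in blast)
  next
    fix g :: "'k ^ 2 ^ 2" and x assume g: "g \<in> carrier SL2" and x: "x \<in> carrier V"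
    have g': "inv\<^bsub>SL2\<^esub> g \<in> carrier SL2" by (rule group.inv_closed[OF group_SL2 g])
    have "(act ?D (inv\<^bsub>SL2\<^esub> g) \<psi>) x = \<psi> (act V g x)" for \<psi>
      using x by (simp add: dual_simps(5) group.inv_inv[OF group_SL2 g])
    then show "?ev (act V g x) = act ?DD g (?ev x)"
      by (intro ext) (simp add: dual_simps(5)[of SL2 ?D] D.act_mem[OF g'])
  qed (auto simp: dual_simps(3,4)[of SL2 ?D] fun_eq_iff dualD)
qed

lemma double_dual: "nice V \<Longrightarrow> rep_isomorphic SL2 V (dual_rep SL2 (dual_rep SL2 V))"
  using double_dual_ev unfolding rep_isomorphic_def by blast

lemma dual_dual_eval:
  assumes "nice V" "\<xi> \<in> carrier (dual_rep SL2 (dual_rep SL2 V))"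
  obtains x where "x \<in> carrier V" "\<And>\<psi>. \<psi> \<in> carrier (dual_rep SL2 V) \<Longrightarrow> \<xi> \<psi> = \<psi> x"
proof -
  have "\<xi> \<in> (\<lambda>x. \<lambda>\<psi>\<in>carrier (dual_rep SL2 V). \<psi> x) ` carrier V"
    using rep_isoD(1)[OF double_dual_ev[OF assms(1)]] assms(2) by (simp add: bij_betw_def)
  then show ?thesis using that by auto
qed

lemma dual_dual_mem:
  assumes "nice V" "x \<in> carrier V"
  shows "(\<lambda>\<psi>\<in>carrier (dual_rep SL2 V). \<psi> x) \<in> carrier (dual_rep SL2 (dual_rep SL2 V))"
  by (rule rep_isoD(5)[OF double_dual_ev[OF assms(1)] assms(2)])

text \<open>The two families of isomorphism invariants. For \<open>v\<close> of weight \<open>w\<close> and a functional \<open>\<psi>\<close>, the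
  matrix coefficient \<open>\<psi> (low z v)\<close> is a polynomial in \<open>z\<close>, of bounded degree and hence unique when
  the field is large; \<open>Dinv\<close> says that \<open>z\<^bsup>k\<^esup>\<close> occurs for some \<open>v\<close> and \<open>\<psi>\<close>, and \<open>Kinv\<close> that
  it occurs for no \<open>\<psi>\<close> once some \<open>v \<noteq> 0\<close> is fixed.\<close>

definition wvec :: "('k::field ^ 2 ^ 2, 'k, 'v) rep \<Rightarrow> nat \<Rightarrow> 'v \<Rightarrow> bool" where
  "wvec V w v \<longleftrightarrow> v \<in> carrier V \<and> (\<forall>t. t \<noteq> 0 \<longrightarrow> act V (tor t) v = t ^ w \<odot>\<^bsub>V\<^esub> v)"

definition low_poly :: "('k::field ^ 2 ^ 2, 'k, 'v) rep \<Rightarrow> nat \<Rightarrow> 'v \<Rightarrow> ('v \<Rightarrow> 'k) \<Rightarrow> 'k poly \<Rightarrow> bool" where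
  "low_poly V n v \<psi> P \<longleftrightarrow> \<psi> \<in> carrier (dual_rep SL2 V) \<and> degree P \<le> n \<and>
     (\<forall>z. \<psi> (act V (low z) v) = poly P z)"

definition Dinv :: "('k::field ^ 2 ^ 2, 'k, 'v) rep \<Rightarrow> nat \<Rightarrow> nat \<Rightarrow> nat \<Rightarrow> bool" where
  "Dinv V w n k \<longleftrightarrow> (\<exists>v \<psi> P. wvec V w v \<and> low_poly V n v \<psi> P \<and> coeff P k \<noteq> 0)"

definition Kinv :: "('k::field ^ 2 ^ 2, 'k, 'v) rep \<Rightarrow> nat \<Rightarrow> nat \<Rightarrow> nat \<Rightarrow> bool" where
  "Kinv V w n k \<longleftrightarrow> (\<exists>v. wvec V w v \<and> v \<noteq> \<zero>\<^bsub>V\<^esub> \<and>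
     (\<forall>\<psi> P. low_poly V n v \<psi> P \<longrightarrow> coeff P k = 0))"

lemma wvec_iso: "f \<in> rep_iso SL2 V W \<Longrightarrow> wvec V w v \<Longrightarrow> wvec W w (f v)"
proof -
  assume f: "f \<in> rep_iso SL2 V W" and v: "wvec V w v"
  then have m: "v \<in> carrier V" by (simp add: wvec_def)
  have "act W (tor t) (f v) = t ^ w \<odot>\<^bsub>W\<^esub> f v" if t: "t \<noteq> 0" for t
  proof -
    have "tor t \<in> carrier SL2" using t by simp
    from rep_isoD(4)[OF f this m] rep_isoD(3)[OF f m] v t show ?thesis by (simp add: wvec_def)
  qed
  then show "wvec W w (f v)" using rep_isoD(5)[OF f m] by (simp add: wvec_def)
qed

text \<open>Pulling a functional back along an isomorphism leaves the matrix coefficient, and hence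
  its polynomial, unchanged. Both invariants inherit their invariance from this.\<close>

lemma low_poly_iso:
  fixes V :: "('k::field ^ 2 ^ 2, 'k, 'v) rep" and W :: "('k ^ 2 ^ 2, 'k, 'w) rep"
  assumes f: "f \<in> rep_iso SL2 V W" and V: "module KR V" "act_linear SL2 V" and v: "v \<in> carrier V"
    and P: "low_poly W n (f v) \<psi> P"
  shows "low_poly V n v (\<lambda>x\<in>carrier V. \<psi> (f x)) P"
proof -
  have g: "low z \<in> carrier SL2" for z :: 'k by simp
  have "\<psi> (f (act V (low z) v)) = poly P z" for z
    using P rep_isoD(4)[OF f g v, of z] by (simp add: low_poly_def)
  then show ?thesis
    using P dual_pullback[OF f V(1), of \<psi>] act_linearD[OF V(2) g v] by (simp add: low_poly_def)
qed

lemma Dinv_iso_imp: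
  assumes iso: "rep_isomorphic SL2 V W" and V: "nice V" and W: "nice W" and D: "Dinv V w n k"
  shows "Dinv W w n k"
proof -
  obtain f where f: "f \<in> rep_iso SL2 V W" using iso unfolding rep_isomorphic_def by blast
  define h where "h = inv_into (carrier V) f"
  have h: "h \<in> rep_iso SL2 W V" unfolding h_def by (rule rep_iso_inv[OF f niceD[OF V]])
  obtain v \<psi> P where v: "wvec V w v" "low_poly V n v \<psi> P" "coeff P k \<noteq> 0"
    using D unfolding Dinv_def by blast
  have m: "v \<in> carrier V" using v(1) by (simp add: wvec_def)
  have "h (f v) = v" using m rep_isoD(1)[OF f] by (auto simp: bij_betw_def h_def)
  with v(2) have "low_poly V n (h (f v)) \<psi> P" by simp
  from low_poly_iso[OF h niceD[OF W] rep_isoD(5)[OF f m] this] wvec_iso[OF f v(1)] v(3)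
  show ?thesis unfolding Dinv_def by blast
qed

lemma Dinv_iso:
  assumes "rep_isomorphic SL2 V W" and V: "nice V" and W: "nice W"
  shows "Dinv V w n k \<longleftrightarrow> Dinv W w n k"
  using Dinv_iso_imp[OF assms] Dinv_iso_imp[OF rep_isomorphic_sym[OF assms(1) V] W V] by blast

lemma Kinv_iso:
  assumes "rep_isomorphic SL2 V W" and V: "nice V" and W: "nice W" and K: "Kinv V w n k"
  shows "Kinv W w n k"
proof -
  obtain f where f: "f \<in> rep_iso SL2 V W" using assms(1) unfolding rep_isomorphic_def by blast
  define h where "h = inv_into (carrier V) f"
  have h: "h \<in> rep_iso SL2 W V" unfolding h_def by (rule rep_iso_inv[OF f niceD[OF V]])
  obtain v where v: "wvec V w v" "v \<noteq> \<zero>\<^bsub>V\<^esub>" "\<And>\<psi> P. low_poly V n v \<psi> P \<Longrightarrow> coeff P k = 0"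
    using K unfolding Kinv_def by blast
  have m: "v \<in> carrier V" using v(1) by (simp add: wvec_def)
  have hf: "h (f v) = v" using m rep_isoD(1)[OF f] by (auto simp: bij_betw_def h_def)
  have "f v \<noteq> \<zero>\<^bsub>W\<^esub>"
  proof
    assume "f v = \<zero>\<^bsub>W\<^esub>"
    then have "v = h \<zero>\<^bsub>W\<^esub>" using hf by simp
    also have "h \<zero>\<^bsub>W\<^esub> = h (0 \<odot>\<^bsub>W\<^esub> \<zero>\<^bsub>W\<^esub>)"
      using module_closed(3,4)[OF niceD(1)[OF W]] by simp
    also have "\<dots> = \<zero>\<^bsub>V\<^esub>"
      using rep_isoD(3,5)[OF h module_closed(3)[OF niceD(1)[OF W]]] module_closed(4)[OF niceD(1)[OF V]] by simp
    finally show False using v(2) by blast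
  qed
  moreover have "coeff P k = 0" if P: "low_poly W n (f v) \<psi> P" for \<psi> P
    using low_poly_iso[OF f niceD[OF V] m P] v(3) by blast
  ultimately show ?thesis using wvec_iso[OF f v(1)] unfolding Kinv_def by blast
qed

subsection \<open>A model of the Schur functor of a hook\<close>

interpretation fs: vector_space "fscale :: 'k::field \<Rightarrow> _"
  by unfold_locales (auto simp: fscale_def fun_eq_iff distrib_left distrib_right single_add mult_single
      simp flip: mult.assoc)

definition fn_linear :: "((('k::field) mfun) \<Rightarrow> 'k) \<Rightarrow> bool" where
  "fn_linear \<Lambda> \<longleftrightarrow> (\<forall>F H. \<Lambda> (F + H) = \<Lambda> F + \<Lambda> H) \<and> (\<forall>c F. \<Lambda> (fscale c F) = c * \<Lambda> F)"

text \<open>Prescribe the values on a basis of the subspace and extend linearly. This allows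
  functionals on a representation to be treated as functionals on all hook tensors.\<close>

lemma fn_linear_extend:
  assumes S: "fs.subspace S"
    and add: "\<And>x y. x \<in> S \<Longrightarrow> y \<in> S \<Longrightarrow> f (x + y) = f x + f y"
    and scale: "\<And>c x. x \<in> S \<Longrightarrow> f (fscale c x) = c * f x"
  obtains \<Lambda> where "fn_linear \<Lambda>" "\<And>x. x \<in> S \<Longrightarrow> \<Lambda> x = f x"
proof -
  interpret K: vector_space "(*) :: 'a \<Rightarrow> 'a \<Rightarrow> 'a"
    by unfold_locales (simp_all add: algebra_simps)
  interpret P: vector_space_pair "fscale :: 'a \<Rightarrow> _" "(*) :: 'a \<Rightarrow> 'a \<Rightarrow> 'a" ..
  obtain B where B: "B \<subseteq> S" "fs.independent B" "S \<subseteq> fs.span B"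
    using fs.maximal_independent_subset[of S] by blast
  obtain \<Lambda> where \<Lambda>: "Vector_Spaces.linear fscale (*) \<Lambda>" "\<forall>x\<in>B. \<Lambda> x = f x"
    using P.linear_independent_extend[OF B(2), of f] by blast
  have lin: "\<Lambda> (x + y) = \<Lambda> x + \<Lambda> y" "\<Lambda> (fscale c x) = c * \<Lambda> x" for x y c
    using \<Lambda>(1) by (simp_all add: Vector_Spaces.linear.axioms module_hom.add module_hom.scale
        Vector_Spaces.linear_iff_module_hom)
  have z: "0 \<in> S" using fs.subspace_0[OF S] .
  have sub: "fs.subspace {x \<in> S. \<Lambda> x = f x}"
  proof (rule fs.subspaceI)
    show "0 \<in> {x \<in> S. \<Lambda> x = f x}"
      using lin(2)[of 0 0] scale[OF z, of 0] z by simp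
  qed (use add scale lin fs.subspace_add[OF S] fs.subspace_scale[OF S] in auto)
  have "\<Lambda> x = f x" if "x \<in> S" for x
  proof -
    have "fs.span B \<subseteq> {x \<in> S. \<Lambda> x = f x}"
      by (rule fs.span_minimal[OF _ sub]) (use B(1) \<Lambda>(2) in blast)
    then show ?thesis using B(3) that by blast
  qed
  moreover have "fn_linear \<Lambda>" using lin by (simp add: fn_linear_def)
  ultimately show ?thesis using that by blast
qed

abbreviation "dl (i::nat) \<equiv> (\<lambda>j. if j = i then 1 else 0)"

lemma hookE_cong:
  assumes "\<And>j. j < a \<Longrightarrow> \<alpha> j = \<alpha>' j" "\<And>i. i \<le> b \<Longrightarrow> \<kappa> i = \<kappa>' i"
  shows "hookE I a b \<alpha> \<kappa> = hookE I a b \<alpha>' \<kappa>'"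
proof -
  have "Matrix.mat (Suc b) (Suc b) (\<lambda>(i, j). hrow I cs i (\<kappa> j)) =
      Matrix.mat (Suc b) (Suc b) (\<lambda>(i, j). hrow I cs i (\<kappa>' j))" for cs
    by (rule eq_matI) (simp_all add: assms(2))
  moreover have "(\<Prod>j<a. lin_form I (\<alpha> j)) = (\<Prod>j<a. lin_form I (\<alpha>' j))"
    by (rule prod.cong) (simp_all add: assms(1))
  ultimately show ?thesis by (simp add: hookE_def fun_eq_iff)
qed

definition hidx :: "nat \<Rightarrow> nat \<Rightarrow> nat \<Rightarrow> (nat \<Rightarrow> nat) \<Rightarrow> (nat \<Rightarrow> nat) \<Rightarrow> bool" where
  "hidx l a b \<alpha> \<kappa> \<longleftrightarrow> (\<forall>j<a. \<alpha> j \<le> l) \<and> (\<forall>i\<le>b. \<kappa> i \<le> l)"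

text \<open>The representation \<open>N\<close> is identified through \<open>\<Psi>\<close> with the span of the \<open>hookE\<close> of coordinate
  vectors; \<open>lo\<close> and \<open>to\<close> are the coordinates of the images of the basis vectors under \<open>low z\<close> and
  \<open>tor t\<close>.\<close>

locale hook_mod =
  fixes N :: "('k::field ^ 2 ^ 2, 'k, 'w) rep" and l a b :: nat
    and lo to :: "'k \<Rightarrow> nat \<Rightarrow> nat \<Rightarrow> 'k"
    and \<Psi> :: "'w \<Rightarrow> 'k mfun"
    and el :: "(nat \<Rightarrow> nat) \<Rightarrow> (nat \<Rightarrow> nat) \<Rightarrow> 'w"
  assumes mod: "module KR N" and actl: "act_linear SL2 N"
    and \<Psi>_add: "x \<in> carrier N \<Longrightarrow> y \<in> carrier N \<Longrightarrow> \<Psi> (x \<oplus>\<^bsub>N\<^esub> y) = \<Psi> x + \<Psi> y"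
    and \<Psi>_smult: "x \<in> carrier N \<Longrightarrow> \<Psi> (c \<odot>\<^bsub>N\<^esub> x) = fscale c (\<Psi> x)"
    and \<Psi>_inj: "x \<in> carrier N \<Longrightarrow> y \<in> carrier N \<Longrightarrow> \<Psi> x = \<Psi> y \<Longrightarrow> x = y"
    and el_mem: "hidx l a b \<alpha> \<kappa> \<Longrightarrow> el \<alpha> \<kappa> \<in> carrier N"
    and \<Psi>_el: "hidx l a b \<alpha> \<kappa> \<Longrightarrow> \<Psi> (el \<alpha> \<kappa>) = hookE {..l} a b (\<lambda>j. dl (\<alpha> j)) (\<lambda>i. dl (\<kappa> i))"
    and \<Psi>_low: "hidx l a b \<alpha> \<kappa> \<Longrightarrow> \<Psi> (act N (low z) (el \<alpha> \<kappa>)) = hookE {..l} a b (\<lambda>j. lo z (\<alpha> j)) (\<lambda>i. lo z (\<kappa> i))"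
    and \<Psi>_tor: "hidx l a b \<alpha> \<kappa> \<Longrightarrow> t \<noteq> 0 \<Longrightarrow>
      \<Psi> (act N (tor t) (el \<alpha> \<kappa>)) = hookE {..l} a b (\<lambda>j. to t (\<alpha> j)) (\<lambda>i. to t (\<kappa> i))"
    and el_induct: "x \<in> carrier N \<Longrightarrow> (\<And>\<alpha> \<kappa>. hidx l a b \<alpha> \<kappa> \<Longrightarrow> Q (el \<alpha> \<kappa>)) \<Longrightarrow> Q \<zero>\<^bsub>N\<^esub> \<Longrightarrow>
      (\<And>x y. x \<in> carrier N \<Longrightarrow> y \<in> carrier N \<Longrightarrow> Q x \<Longrightarrow> Q y \<Longrightarrow> Q (x \<oplus>\<^bsub>N\<^esub> y)) \<Longrightarrow>
      (\<And>c x. x \<in> carrier N \<Longrightarrow> Q x \<Longrightarrow> Q (c \<odot>\<^bsub>N\<^esub> x)) \<Longrightarrow> Q x"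

lemma hook_mod_nabla:
  fixes V :: "('k::field ^ 2 ^ 2, 'k, 'v) rep"
  assumes c: "coord_rep SL2 V {..l} \<phi>"
    and low: "\<And>i z. i \<le> l \<Longrightarrow> \<phi> (act V (low z) (coord_rep.bas V \<phi> i)) = lo z i"
    and tor: "\<And>i t. i \<le> l \<Longrightarrow> t \<noteq> 0 \<Longrightarrow> \<phi> (act V (tor t) (coord_rep.bas V \<phi> i)) = to t i"
  shows "\<exists>\<Psi> el. hook_mod (nabla (hook a b) V) l a b lo to \<Psi> el"
proof -
  interpret hook_schur SL2 V "{..l}" \<phi> a b
    by (intro hook_schur.intro schur.intro c)
  \<comment> \<open>The first column takes the leg indices, starting at row 1; the arm starts in
    column 2, whence \<open>j - 2\<close>.\<close>
  define el where "el \<alpha> \<kappa> = polytabloid (hook a b) V (\<lambda>(i, j). if j = 1 then bas (\<kappa> (i - 1)) else bas (\<alpha> (j - 2)))"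
    for \<alpha> \<kappa> :: "nat \<Rightarrow> nat"
  let ?idx = "hidx l a b"
  have tab: "tabm (\<lambda>(i, j). if j = 1 then bas (\<kappa> (i - 1)) else bas (\<alpha> (j - 2)))" if "?idx \<alpha> \<kappa>" for \<alpha> \<kappa>
  proof (rule tabmI)
    fix c assume "c \<in> Di"
    then show "(case c of (i, j) \<Rightarrow> if j = 1 then bas (\<kappa> (i - 1)) else bas (\<alpha> (j - 2))) \<in> carrier V"
      using that by (cases c) (auto simp: diagram_hook hidx_def intro!: bas_mem)
  qed
  have act: "\<Psi> (act ST g (el \<alpha> \<kappa>)) = hookE {..l} a b (\<lambda>j. \<phi> (act V g (bas (\<alpha> j)))) (\<lambda>i. \<phi> (act V g (bas (\<kappa> i))))"
    if i: "?idx \<alpha> \<kappa>" and g: "g \<in> carrier SL2" for \<alpha> \<kappa> g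
  proof -
    have "tabm (act V g \<circ> (\<lambda>(i, j). if j = 1 then bas (\<kappa> (i - 1)) else bas (\<alpha> (j - 2))))"
      using tabmD[OF tab[OF i]] act_mem[OF g] by (intro tabmI) simp
    from \<Psi>_polytabloid[OF this] show ?thesis
      unfolding el_def act_polytabloid[OF tab[OF i] g] by simp
  qed
  have "hook_mod (nabla (hook a b) V) l a b lo to \<Psi> el"
  proof (rule hook_mod.intro, unfold nabla_simps)
    show "module KR (nabla (hook a b) V)" by (rule module_nabla)
    show "act_linear SL2 (nabla (hook a b) V)" by (rule act_linear_nabla)
  next
    fix x y assume x: "x \<in> carrier (nabla (hook a b) V)" and y: "y \<in> carrier (nabla (hook a b) V)"
    note x' = subsetD[OF nabla_sub x] and y' = subsetD[OF nabla_sub y]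
    show "\<Psi> (x \<oplus>\<^bsub>ST\<^esub> y) = \<Psi> x + \<Psi> y" by (rule ext) (simp add: \<Psi>_add[OF x' y'])
    show "\<Psi> (c \<odot>\<^bsub>ST\<^esub> x) = fscale c (\<Psi> x)" for c by (rule ext) (simp add: \<Psi>_smult[OF x'] fscale_def)
    show "\<Psi> x = \<Psi> y \<Longrightarrow> x = y" by (rule \<Psi>_inj[OF x' y'])
  next
    fix \<alpha> \<kappa> assume i: "?idx \<alpha> \<kappa>"
    show "el \<alpha> \<kappa> \<in> carrier (nabla (hook a b) V)"
      unfolding el_def by (rule polytabloid_nabla[OF tab[OF i]])
    have crd: "\<phi> (bas i) = dl i" if "i \<le> l" for i using crd_bas[of i] that by (auto simp: fun_eq_iff)
    show "\<Psi> (el \<alpha> \<kappa>) = hookE {..l} a b (\<lambda>j. dl (\<alpha> j)) (\<lambda>i. dl (\<kappa> i))"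
      unfolding el_def \<Psi>_polytabloid[OF tab[OF i]]
      by (rule hookE_cong) (use i in \<open>simp_all add: hidx_def crd\<close>)
    show "\<Psi> (act ST (low z) (el \<alpha> \<kappa>)) = hookE {..l} a b (\<lambda>j. lo z (\<alpha> j)) (\<lambda>i. lo z (\<kappa> i))" for z
    proof -
      have g: "low z \<in> carrier SL2" by simp
      show ?thesis unfolding act[OF i g]
        by (rule hookE_cong) (use i in \<open>simp_all add: hidx_def low\<close>)
    qed
    show "\<Psi> (act ST (tor t) (el \<alpha> \<kappa>)) = hookE {..l} a b (\<lambda>j. to t (\<alpha> j)) (\<lambda>i. to t (\<kappa> i))" if t: "t \<noteq> 0" for t
    proof -
      have g: "tor t \<in> carrier SL2" using t by simp
      show ?thesis unfolding act[OF i g]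
        by (rule hookE_cong) (use i t in \<open>simp_all add: hidx_def tor\<close>)
    qed
  next
    fix x and Q :: "(('v list \<Rightarrow>\<^sub>0 'k) set set list \<Rightarrow>\<^sub>0 'k) set \<Rightarrow> bool"
    assume x: "x \<in> carrier (nabla (hook a b) V)" and el: "\<And>\<alpha> \<kappa>. ?idx \<alpha> \<kappa> \<Longrightarrow> Q (el \<alpha> \<kappa>)"
      and z: "Q \<zero>\<^bsub>ST\<^esub>"
      and ad: "\<And>x y. x \<in> carrier (nabla (hook a b) V) \<Longrightarrow> y \<in> carrier (nabla (hook a b) V) \<Longrightarrow> Q x \<Longrightarrow> Q y \<Longrightarrow> Q (x \<oplus>\<^bsub>ST\<^esub> y)"
      and sm: "\<And>c x. x \<in> carrier (nabla (hook a b) V) \<Longrightarrow> Q x \<Longrightarrow> Q (c \<odot>\<^bsub>ST\<^esub> x)"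
    show "Q x" using x
    proof (induction rule: nabla_induct)
      case (base t)
      then have "\<forall>c\<in>Di. \<exists>i\<le>l. t c = bas i" by (auto simp: PiE_def Pi_def)
      then obtain h where h: "\<And>c. c \<in> Di \<Longrightarrow> h c \<le> l \<and> t c = bas (h c)" by metis
      have i: "?idx (\<lambda>j. h (1, j + 2)) (\<lambda>i. h (Suc i, 1))"
        using h by (simp add: hidx_def diagram_hook)
      have "polytabloid (hook a b) V t = el (\<lambda>j. h (1, j + 2)) (\<lambda>i. h (Suc i, 1))"
        unfolding el_def
      proof (rule polytabloid_cong)
        show "tabm t" using h by (intro tabmI) (auto intro: bas_mem)
        fix c assume c: "c \<in> Di"
        then have "t c = bas (h c)" using h by blast
        then show "t c = (case c of (i, j) \<Rightarrow> if j = 1 then bas (h (Suc (i - 1), 1)) else bas (h (1, j - 2 + 2)))"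
        proof (cases c)
          case (Pair i j)
          show ?thesis
          proof (cases "j = 1")
            case True
            then have "Suc (i - 1) = i" using c by (auto simp: Pair diagram_hook)
            then show ?thesis using \<open>t c = bas (h c)\<close> True by (simp only: Pair prod.case if_True refl)
          next
            case False
            then have "i = 1" "j - 2 + 2 = j" using c by (auto simp: Pair diagram_hook)
            then show ?thesis using \<open>t c = bas (h c)\<close> False by (simp only: Pair prod.case if_False)
          qed
        qed
      qed
      then show ?case using el[OF i] by simp
    qed (use z ad sm in blast)+
  qed
  then show ?thesis by blast
qed

text \<open>The suffix \<open>up\<close> refers to the reversed basis \<open>v\<^sub>l, \<dots>, v\<^sub>0\<close>, which suits the study of the
  dual: there the functionals of highest weight see the indices \<open>0, \<dots>, b\<close>.\<close>

definition lo_down :: "nat \<Rightarrow> (nat \<Rightarrow> nat \<Rightarrow> nat) \<Rightarrow> 'k::field \<Rightarrow> nat \<Rightarrow> nat \<Rightarrow> 'k" where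
  "lo_down l c z i j = (if i \<le> j \<and> j \<le> l then of_nat (c i j) * z ^ (j - i) else 0)"

definition to_down :: "nat \<Rightarrow> 'k::field \<Rightarrow> nat \<Rightarrow> nat \<Rightarrow> 'k" where
  "to_down l t i j = (if j = i then t ^ (l - i) * inverse t ^ i else 0)"

definition lo_up :: "nat \<Rightarrow> (nat \<Rightarrow> nat \<Rightarrow> nat) \<Rightarrow> 'k::field \<Rightarrow> nat \<Rightarrow> nat \<Rightarrow> 'k" where
  "lo_up l c z i j = (if j \<le> i then of_nat (c (l - i) (l - j)) * z ^ (i - j) else 0)"

definition to_up :: "nat \<Rightarrow> 'k::field \<Rightarrow> nat \<Rightarrow> nat \<Rightarrow> 'k" where
  "to_up l t i j = (if j = i then t ^ i * inverse t ^ (l - i) else 0)"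

lemma hook_mod_down:
  fixes V :: "('k::field ^ 2 ^ 2, 'k, 'v) rep"
  assumes "wt_model V l \<phi> c"
  shows "\<exists>\<Psi> el. hook_mod (nabla (hook a b) V) l a b (lo_down l c) (to_down l) \<Psi> el"
proof (rule hook_mod_nabla)
  show c: "coord_rep SL2 V {..l} \<phi>" using assms by (simp add: wt_model_def)
  interpret V: coord_rep SL2 V "{..l}" \<phi> by (rule c)
  fix i assume i: "i \<le> l"
  have b: "V.bas i \<in> carrier V" using i by (intro V.bas_mem) simp
  show "\<phi> (act V (low z) (V.bas i)) = lo_down l c z i" for z
  proof
    fix j
    have g: "low z \<in> carrier SL2" by simp
    show "\<phi> (act V (low z) (V.bas i)) j = lo_down l c z i j"
    proof (cases "j \<le> l")
      case True
      then have "\<phi> (act V (low z) (V.bas i)) j = (\<Sum>i'\<le>j. of_nat (c i' j) * z ^ (j - i') * \<phi> (V.bas i) i')"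
        using assms b by (simp add: wt_model_def)
      also have "\<dots> = (\<Sum>i'\<le>j. if i' = i then of_nat (c i j) * z ^ (j - i) else 0)"
        by (rule sum.cong) (use i in \<open>simp_all add: V.crd_bas\<close>)
      finally show ?thesis using True by (simp add: lo_down_def)
    qed (simp add: lo_down_def V.crd_off[OF V.act_mem[OF g b]])
  qed
  show "\<phi> (act V (tor t) (V.bas i)) = to_down l t i" if t: "t \<noteq> 0" for t
  proof
    fix j
    have g: "tor t \<in> carrier SL2" using t by simp
    show "\<phi> (act V (tor t) (V.bas i)) j = to_down l t i j"
    proof (cases "j \<le> l")
      case True
      then have "\<phi> (act V (tor t) (V.bas i)) j = t ^ (l - j) * inverse t ^ j * \<phi> (V.bas i) j"
        using assms b t by (simp add: wt_model_def)
      then show ?thesis using i by (simp add: to_down_def V.crd_bas)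
    qed (use i in \<open>simp add: to_down_def V.crd_off[OF V.act_mem[OF g b]]\<close>)
  qed
qed

lemma hook_mod_up:
  fixes V :: "('k::field ^ 2 ^ 2, 'k, 'v) rep"
  assumes w: "wt_model V l \<phi> c"
  shows "\<exists>\<Psi> el. hook_mod (nabla (hook a b) V) l a b (lo_up l c) (to_up l) \<Psi> el"
proof -
  define \<phi>' where "\<phi>' = (\<lambda>x i. if i \<in> {..l} then \<phi> x (l - i) else 0)"
  interpret V: coord_rep SL2 V "{..l}" \<phi> using w by (simp add: wt_model_def)
  have bij: "bij_betw (\<lambda>i. l - i) {..l} {..l}"
    by (rule bij_betwI[where g = "\<lambda>i. l - i"]) auto
  have c: "coord_rep SL2 V {..l} \<phi>'" unfolding \<phi>'_def by (rule V.reindex[OF bij])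
  interpret R: coord_rep SL2 V "{..l}" \<phi>' by (rule c)
  have \<phi>': "\<phi>' x i = (if i \<le> l then \<phi> x (l - i) else 0)" for x i by (simp add: \<phi>'_def)
  show ?thesis
  proof (rule hook_mod_nabla[OF c])
  fix i assume i: "i \<le> l"
  have b: "R.bas i \<in> carrier V" using i by (intro R.bas_mem) simp
  have crd: "\<phi> (R.bas i) j = (if j = l - i then 1 else 0)" if "j \<le> l" for j
    using R.crd_bas[of i "l - j"] i that by (auto simp: \<phi>')
  show "\<phi>' (act V (low z) (R.bas i)) = lo_up l c z i" for z
  proof
    fix j
    show "\<phi>' (act V (low z) (R.bas i)) j = lo_up l c z i j"
    proof (cases "j \<le> l")
      case True
      then have "\<phi> (act V (low z) (R.bas i)) (l - j) =
          (\<Sum>i'\<le>l - j. of_nat (c i' (l - j)) * z ^ (l - j - i') * \<phi> (R.bas i) i')"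
        using w b by (simp add: wt_model_def)
      also have "\<dots> = (\<Sum>i'\<le>l - j. if i' = l - i then of_nat (c (l - i) (l - j)) * z ^ (i - j) else 0)"
        by (rule sum.cong) (use i True in \<open>auto simp: crd\<close>)
      finally show ?thesis using True i by (auto simp: lo_up_def \<phi>')
    qed (use i in \<open>simp add: lo_up_def \<phi>'\<close>)
  qed
  show "\<phi>' (act V (tor t) (R.bas i)) = to_up l t i" if t: "t \<noteq> 0" for t
  proof
    fix j
    show "\<phi>' (act V (tor t) (R.bas i)) j = to_up l t i j"
    proof (cases "j \<le> l")
      case True
      then have "\<phi> (act V (tor t) (R.bas i)) (l - j) = t ^ (l - (l - j)) * inverse t ^ (l - j) * \<phi> (R.bas i) (l - j)"
        using w b t by (simp add: wt_model_def)
      then show ?thesis using True i by (auto simp: to_up_def crd \<phi>')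
    qed (use i in \<open>simp add: to_up_def \<phi>'\<close>)
  qed
qed
qed

context hook_mod
begin

abbreviation "idx \<equiv> hidx l a b"

lemma closed: "x \<in> carrier N \<Longrightarrow> y \<in> carrier N \<Longrightarrow> x \<oplus>\<^bsub>N\<^esub> y \<in> carrier N"
    "x \<in> carrier N \<Longrightarrow> c \<odot>\<^bsub>N\<^esub> x \<in> carrier N" "\<zero>\<^bsub>N\<^esub> \<in> carrier N"
  using module_closed[OF mod] by auto

lemma \<Psi>_zero: "\<Psi> \<zero>\<^bsub>N\<^esub> = 0"
  using \<Psi>_smult[OF closed(3), of 0] module_closed(4)[OF mod closed(3)] by simp

lemma act_closed: "g \<in> carrier SL2 \<Longrightarrow> x \<in> carrier N \<Longrightarrow> act N g x \<in> carrier N"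
  and act_add: "g \<in> carrier SL2 \<Longrightarrow> x \<in> carrier N \<Longrightarrow> y \<in> carrier N \<Longrightarrow> act N g (x \<oplus>\<^bsub>N\<^esub> y) = act N g x \<oplus>\<^bsub>N\<^esub> act N g y"
  and act_smult: "g \<in> carrier SL2 \<Longrightarrow> x \<in> carrier N \<Longrightarrow> act N g (c \<odot>\<^bsub>N\<^esub> x) = c \<odot>\<^bsub>N\<^esub> act N g x"
  using actl unfolding act_linear_def by blast+

lemma act_zero: "g \<in> carrier SL2 \<Longrightarrow> act N g \<zero>\<^bsub>N\<^esub> = \<zero>\<^bsub>N\<^esub>"
  using act_smult[OF _ closed(3), of g 0] module_closed(4)[OF mod] closed(3) act_closed by simp

abbreviation "S \<equiv> \<Psi> ` carrier N"

lemma subspace_S: "fs.subspace S"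
proof (rule fs.subspaceI)
  show "0 \<in> S" using imageI[OF closed(3), of \<Psi>] by (simp only: \<Psi>_zero)
next
  fix F H assume "F \<in> S" "H \<in> S"
  then obtain x y where xy: "x \<in> carrier N" "F = \<Psi> x" "y \<in> carrier N" "H = \<Psi> y" by blast
  have "\<Psi> (x \<oplus>\<^bsub>N\<^esub> y) \<in> S" using closed(1)[OF xy(1,3)] by (rule imageI)
  then show "F + H \<in> S" unfolding \<Psi>_add[OF xy(1,3)] xy(2,4) .
next
  fix F c assume "F \<in> S"
  then obtain x where x: "x \<in> carrier N" "F = \<Psi> x" by blast
  have "\<Psi> (c \<odot>\<^bsub>N\<^esub> x) \<in> S" using closed(2)[OF x(1)] by (rule imageI)
  then show "fscale c F \<in> S" unfolding \<Psi>_smult[OF x(1)] x(2) .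
qed

text \<open>The extension matters because \<open>\<Lambda>\<close> will be applied to single
  coefficients in \<open>z\<close> of an image under \<open>\<Psi>\<close>, which need not
  themselves be images of vectors.\<close>

lemma dual_extend:
  assumes \<psi>: "\<psi> \<in> carrier (dual_rep SL2 N)"
  obtains \<Lambda> where "fn_linear \<Lambda>" "\<And>x. x \<in> carrier N \<Longrightarrow> \<Lambda> (\<Psi> x) = \<psi> x"
proof -
  have inv: "inv_into (carrier N) \<Psi> (\<Psi> x) = x" if "x \<in> carrier N" for x
    using that \<Psi>_inj by (intro inv_into_f_f) (auto intro: inj_onI)
  obtain \<Lambda> where \<Lambda>: "fn_linear \<Lambda>" "\<And>x. x \<in> S \<Longrightarrow> \<Lambda> x = \<psi> (inv_into (carrier N) \<Psi> x)"
  proof (rule fn_linear_extend[OF subspace_S, of "\<lambda>x. \<psi> (inv_into (carrier N) \<Psi> x)"])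
    fix F H assume "F \<in> S" "H \<in> S"
    then obtain x y where xy: "x \<in> carrier N" "y \<in> carrier N" "F = \<Psi> x" "H = \<Psi> y" by blast
    show "\<psi> (inv_into (carrier N) \<Psi> (F + H)) = \<psi> (inv_into (carrier N) \<Psi> F) + \<psi> (inv_into (carrier N) \<Psi> H)"
      using xy by (simp add: inv closed(1) dualD[OF \<psi>] flip: \<Psi>_add)
  next
    fix F c assume "F \<in> S"
    then obtain x where x: "x \<in> carrier N" "F = \<Psi> x" by blast
    show "\<psi> (inv_into (carrier N) \<Psi> (fscale c F)) = c * \<psi> (inv_into (carrier N) \<Psi> F)"
      using x by (simp add: inv closed(2) dualD[OF \<psi>] flip: \<Psi>_smult)
  qed blast
  show ?thesis by (rule that[OF \<Lambda>(1)]) (simp add: \<Lambda>(2) inv)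
qed

lemma dual_restrict:
  assumes "fn_linear \<Lambda>"
  shows "(\<lambda>x\<in>carrier N. \<Lambda> (\<Psi> x)) \<in> carrier (dual_rep SL2 N)"
  using assms by (intro dualI) (simp_all add: closed \<Psi>_add \<Psi>_smult fn_linear_def)

lemma S_span: "S \<subseteq> fs.span {\<Psi> (el \<alpha> \<kappa>) | \<alpha> \<kappa>. idx \<alpha> \<kappa>}"
proof
  fix F assume "F \<in> S"
  then obtain x where x: "x \<in> carrier N" "F = \<Psi> x" by blast
  have "\<Psi> x \<in> fs.span {\<Psi> (el \<alpha> \<kappa>) | \<alpha> \<kappa>. idx \<alpha> \<kappa>}"
  proof (rule el_induct[OF x(1)])
    show "\<Psi> (el \<alpha> \<kappa>) \<in> fs.span {\<Psi> (el \<alpha> \<kappa>) | \<alpha> \<kappa>. idx \<alpha> \<kappa>}" if "idx \<alpha> \<kappa>" for \<alpha> \<kappa>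
      using that by (intro fs.span_base) blast
  qed (simp_all only: \<Psi>_zero \<Psi>_add \<Psi>_smult fs.span_zero fs.span_add fs.span_scale)
  then show "F \<in> fs.span {\<Psi> (el \<alpha> \<kappa>) | \<alpha> \<kappa>. idx \<alpha> \<kappa>}" using x(2) by simp
qed

text \<open>Only the indices at the boxes of the hook matter; after restricting the two index
  functions to them, finitely many remain.\<close>

lemma finite_gens: "finite {\<Psi> (el \<alpha> \<kappa>) | \<alpha> \<kappa>. idx \<alpha> \<kappa>}"
proof (rule finite_subset)
  let ?h = "\<lambda>(\<alpha>, \<kappa>). hookE {..l} a b (\<lambda>j. dl (\<alpha> j)) (\<lambda>i. dl (\<kappa> i)) :: 'k mfun"
  show "finite (?h ` (({..<a} \<rightarrow>\<^sub>E {..l}) \<times> ({..b} \<rightarrow>\<^sub>E {..l})))"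
    by (intro finite_imageI finite_cartesian_product finite_PiE) simp_all
  show "{\<Psi> (el \<alpha> \<kappa>) | \<alpha> \<kappa>. idx \<alpha> \<kappa>} \<subseteq> ?h ` (({..<a} \<rightarrow>\<^sub>E {..l}) \<times> ({..b} \<rightarrow>\<^sub>E {..l}))"
  proof
    fix F assume "F \<in> {\<Psi> (el \<alpha> \<kappa>) | \<alpha> \<kappa>. idx \<alpha> \<kappa>}"
    then obtain \<alpha> \<kappa> where i: "idx \<alpha> \<kappa>" "F = \<Psi> (el \<alpha> \<kappa>)" by blast
    have "F = ?h (restrict \<alpha> {..<a}, restrict \<kappa> {..b})"
      unfolding i(2) \<Psi>_el[OF i(1)] prod.case by (rule hookE_cong) simp_all
    moreover have "(restrict \<alpha> {..<a}, restrict \<kappa> {..b}) \<in> ({..<a} \<rightarrow>\<^sub>E {..l}) \<times> ({..b} \<rightarrow>\<^sub>E {..l})"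
      using i(1) by (auto simp: hidx_def)
    ultimately show "F \<in> ?h ` (({..<a} \<rightarrow>\<^sub>E {..l}) \<times> ({..b} \<rightarrow>\<^sub>E {..l}))" by blast
  qed
qed

text \<open>A maximal independent subset of the finitely many generators is a basis of the image of
  \<open>\<Psi>\<close>, and the representation in it supplies the coordinates.\<close>

lemma nice: "nice N"
proof -
  let ?G = "{\<Psi> (el \<alpha> \<kappa>) | \<alpha> \<kappa>. idx \<alpha> \<kappa>}"
  obtain B where B: "B \<subseteq> ?G" "fs.independent B" "?G \<subseteq> fs.span B"
    using fs.maximal_independent_subset[of ?G] by blast
  have fin: "finite B" using finite_subset[OF B(1) finite_gens] .
  have "fs.span ?G \<subseteq> fs.span B" by (rule fs.span_minimal[OF B(3)]) (rule fs.subspace_span)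
  then have sp: "\<Psi> x \<in> fs.span B" if "x \<in> carrier N" for x using S_span that by blast
  have BS: "B \<subseteq> S" using B(1) el_mem by blast
  have "coord_rep SL2 N B (\<lambda>x. fs.representation B (\<Psi> x))"
  proof
    show "finite B" by (rule fin)
    show "act_linear SL2 N" by (rule actl)
    show "\<zero>\<^bsub>N\<^esub> \<in> carrier N" by (rule closed(3))
    show "fs.representation B (\<Psi> \<zero>\<^bsub>N\<^esub>) i = 0" for i
      by (simp add: \<Psi>_zero fs.representation_zero)
  next
    fix x y assume xy: "x \<in> carrier N" "y \<in> carrier N"
    show "x \<oplus>\<^bsub>N\<^esub> y \<in> carrier N" using closed(1) xy by blast
    show "fs.representation B (\<Psi> (x \<oplus>\<^bsub>N\<^esub> y)) i = fs.representation B (\<Psi> x) i + fs.representation B (\<Psi> y) i" for i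
      by (simp add: \<Psi>_add xy fs.representation_add[OF B(2) sp sp])
    assume eq: "\<And>i. i \<in> B \<Longrightarrow> fs.representation B (\<Psi> x) i = fs.representation B (\<Psi> y) i"
    have "(\<Sum>i\<in>B. fscale (fs.representation B (\<Psi> x) i) i) = (\<Sum>i\<in>B. fscale (fs.representation B (\<Psi> y) i) i)"
      by (rule sum.cong) (simp_all add: eq)
    then have "\<Psi> x = \<Psi> y"
      using fs.sum_representation_eq[OF B(2) sp[OF xy(1)] fin] fs.sum_representation_eq[OF B(2) sp[OF xy(2)] fin] by simp
    then show "x = y" by (rule \<Psi>_inj[OF xy])
  next
    fix x c assume x: "x \<in> carrier N"
    show "c \<odot>\<^bsub>N\<^esub> x \<in> carrier N" using closed(2) x by blast
    show "fs.representation B (\<Psi> (c \<odot>\<^bsub>N\<^esub> x)) i = c * fs.representation B (\<Psi> x) i" for i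
      by (simp add: \<Psi>_smult x fs.representation_scale[OF B(2) sp])
  next
    fix x i assume "i \<notin> B"
    then show "fs.representation B (\<Psi> x) i = 0" using fs.representation_ne_zero by metis
  next
    fix H :: "('k mfun) \<Rightarrow> 'k" assume H: "\<And>i. i \<notin> B \<Longrightarrow> H i = 0"
    let ?v = "\<Sum>b\<in>B. fscale (H b) b"
    have sc: "fscale (H b) b \<in> fs.span B" "fscale (H b) b \<in> S" if "b \<in> B" for b
      using fs.span_scale[OF fs.span_base[OF that]] fs.subspace_scale[OF subspace_S subsetD[OF BS that]] by blast+
    have "?v \<in> S" by (rule fs.subspace_sum[OF subspace_S sc(2)])
    then obtain x where x: "?v = \<Psi> x" "x \<in> carrier N" by (rule imageE)
    have "fs.representation B ?v = H"
    proof
      fix i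
      have "fs.representation B ?v i = (\<Sum>b\<in>B. fs.representation B (fscale (H b) b) i)"
        using fun_cong[OF fs.representation_sum[OF B(2) sc(1)]] .
      also have "\<dots> = (\<Sum>b\<in>B. if b = i then H i else 0)"
        by (rule sum.cong) (simp_all add: fs.representation_scale[OF B(2)] fs.span_base fs.representation_basis[OF B(2)])
      finally show "fs.representation B ?v i = H i" using fin H by simp
    qed
    then have "fs.representation B (\<Psi> x) = H" by (simp only: x(1))
    then show "\<exists>x\<in>carrier N. fs.representation B (\<Psi> x) = H" using x(2) by blast
  qed
  then show ?thesis unfolding nice_def by blast
qed

end

subsection \<open>Polynomial functions on small fields\<close>

lemma poly_eq_0_card:
  fixes P :: "'k::field poly"
  assumes "\<And>z. poly P z = 0" and "finite (UNIV :: 'k set) \<Longrightarrow> degree P < card (UNIV :: 'k set)"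
  shows "P = 0"
proof (rule ccontr)
  assume P: "P \<noteq> 0"
  have U: "{z. poly P z = 0} = UNIV" using assms(1) by simp
  have "finite (UNIV :: 'k set)" using poly_roots_finite[OF P] by (simp only: U)
  from assms(2)[OF this] card_poly_roots_bound[OF P] show False by (simp only: U)
qed

text \<open>Multiplication by the variable adds the missing root 0, at the cost of one degree; hence
  the \<open>Suc\<close>.\<close>

lemma poly_eq_0_units:
  fixes P :: "'k::field poly"
  assumes "\<And>t. t \<noteq> 0 \<Longrightarrow> poly P t = 0"
    and "finite (UNIV :: 'k set) \<Longrightarrow> Suc (degree P) < card (UNIV :: 'k set)"
  shows "P = 0"
proof -
  have "[:0, 1:] * P = 0"
  proof (rule poly_eq_0_card)
    show "poly ([:0, 1:] * P) z = 0" for z using assms(1)[of z] by (cases "z = 0") simp_all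
    show "degree ([:0, 1:] * P) < card (UNIV :: 'k set)" if "finite (UNIV :: 'k set)"
      using assms(2)[OF that] degree_mult_le[of "[:0, 1:]" P] by simp
  qed
  then show ?thesis by simp
qed

text \<open>Over a finite field powers of units determine their exponents only modulo
  \<open>|K| - 1\<close>, so exponents can be compared only within a window of length
  \<open>m\<close>. Cancelling the smaller power leaves a polynomial of degree at most
  \<open>m\<close> vanishing on all units.\<close>

lemma units_power_eq:
  fixes w :: nat
  assumes eq: "\<And>t :: 'k::field. t \<noteq> 0 \<Longrightarrow> t ^ i * inverse t ^ j = t ^ w"
    and "finite (UNIV :: 'k set) \<Longrightarrow> Suc m < card (UNIV :: 'k set)"
    and le: "w + j \<le> m + i" "i \<le> m + (w + j)"
  shows "i = w + j"
proof (rule ccontr)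
  assume ne: "i \<noteq> w + j"
  define k where "k = min i (w + j)"
  let ?P = "monom 1 (i - k) - monom 1 (w + j - k) :: 'k poly"
  have "?P = 0"
  proof (rule poly_eq_0_units)
    fix t :: 'k assume t: "t \<noteq> 0"
    have "t ^ i = t ^ w * t ^ j" using eq[OF t] t by (simp add: field_simps power_inverse)
    then have "t ^ (i - k) = t ^ (w + j - k)" using t by (auto simp: k_def min_def power_add power_diff field_simps)
    then show "poly ?P t = 0" by (simp add: Polynomial.poly_monom)
  next
    assume "finite (UNIV :: 'k set)"
    moreover have "degree ?P \<le> m"
      by (rule degree_diff_le; rule order_trans[OF degree_monom_le]) (use le in \<open>auto simp: k_def\<close>)
    ultimately show "Suc (degree ?P) < card (UNIV :: 'k set)" using assms(2) by linarith
  qed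
  then have "coeff ?P (i - k) = 0" by simp
  moreover have "i - k \<noteq> w + j - k" using ne by (auto simp: k_def)
  ultimately show False by simp
qed

subsection \<open>Determinants\<close>

text \<open>Determinants of index functions: entrywise rewriting and composition with a permutation
  can then be stated without dimension conditions on matrices.\<close>

definition dt :: "nat \<Rightarrow> (nat \<Rightarrow> nat \<Rightarrow> 'a::comm_ring_1) \<Rightarrow> 'a" where
  "dt n f = Determinant.det (Matrix.mat n n (\<lambda>(i, j). f i j))"

lemma dt_cong:
  assumes "\<And>i j. i < n \<Longrightarrow> j < n \<Longrightarrow> f i j = g i j"
  shows "dt n f = dt n g"
  unfolding dt_def by (rule arg_cong[where f = Determinant.det], rule eq_matI) (simp_all add: assms)

lemma dt_leibniz: "dt n f = (\<Sum>p | p permutes {0..<n}. of_int (sign p) * (\<Prod>i = 0..<n. f i (p i)))"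
proof -
  have "dt n f = (\<Sum>p | p permutes {0..<n}. of_int (sign p) * (\<Prod>i = 0..<n. Matrix.mat n n (\<lambda>(i, j). f i j) $$ (i, p i)))"
    unfolding dt_def by (rule det_def') simp
  also have "\<dots> = (\<Sum>p | p permutes {0..<n}. of_int (sign p) * (\<Prod>i = 0..<n. f i (p i)))"
  proof (intro sum.cong refl arg_cong2[where f = "(*)"] prod.cong)
    fix p i assume p: "p \<in> {p. p permutes {0..<n}}" and i: "i \<in> {0..<n}"
    have "p i < n" using permutes_in_image[of p "{0..<n}" i] p i by simp
    then show "Matrix.mat n n (\<lambda>(i, j). f i j) $$ (i, p i) = f i (p i)" using i by simp
  qed
  finally show ?thesis .
qed

text \<open>Used for substitutions \<open>ev\<close> and for evaluation at \<open>z\<close>, which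
  both commute with determinants.\<close>

lemma dt_hom:
  assumes add: "\<And>x y. h (x + y) = h x + h y" and mult: "\<And>x y. h (x * y) = h x * h y"
    and one: "h 1 = 1"
  shows "h (dt n f) = dt n (\<lambda>i j. h (f i j))"
proof -
  have h0: "h 0 = 0" using add[of 0 0] by simp
  interpret comm_ring_hom h by unfold_locales (simp_all add: add mult one h0)
  have "h (dt n f) = Determinant.det (map_mat h (Matrix.mat n n (\<lambda>(i, j). f i j)))"
    unfolding dt_def by (simp only: hom_det)
  also have "map_mat h (Matrix.mat n n (\<lambda>(i, j). f i j)) = Matrix.mat n n (\<lambda>(i, j). h (f i j))"
    by (rule eq_matI) simp_all
  finally show ?thesis by (simp only: dt_def)
qed

lemma dt_transpose: "dt n f = dt n (\<lambda>i j. f j i)"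
proof -
  have "dt n (\<lambda>i j. f j i) = Determinant.det (transpose_mat (Matrix.mat n n (\<lambda>(i, j). f i j)))"
    unfolding dt_def by (rule arg_cong[where f = Determinant.det], rule eq_matI) simp_all
  also have "\<dots> = dt n f" unfolding dt_def by (rule Determinant.det_transpose[where n = n]) simp
  finally show ?thesis ..
qed

lemma dt_lower:
  assumes "\<And>i j. i < j \<Longrightarrow> j < n \<Longrightarrow> f i j = 0"
  shows "dt n f = (\<Prod>i<n. f i i)"
proof -
  have "dt n f = prod_list (diag_mat (Matrix.mat n n (\<lambda>(i, j). f i j)))"
    unfolding dt_def by (rule Determinant.det_lower_triangular[where n = n]) (simp_all add: assms)
  also have "\<dots> = (\<Prod>i = 0..<n. Matrix.mat n n (\<lambda>(i, j). f i j) $$ (i, i))"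
    by (simp only: prod_list_diag_prod dim_row_mat)
  also have "\<dots> = (\<Prod>i = 0..<n. f i i)" by (rule prod.cong) simp_all
  finally show ?thesis by (simp only: atLeast0LessThan)
qed

lemma dt_upper:
  assumes "\<And>i j. i < j \<Longrightarrow> j < n \<Longrightarrow> f j i = 0"
  shows "dt n f = (\<Prod>i<n. f i i)"
  by (subst dt_transpose) (rule dt_lower[OF assms])

lemma dt_mult: "dt n (\<lambda>i j. \<Sum>k<n. f i k * g k j) = dt n f * dt n g"
proof -
  have "dt n f * dt n g = Determinant.det (Matrix.mat n n (\<lambda>(i, j). f i j) * Matrix.mat n n (\<lambda>(i, j). g i j))"
    unfolding dt_def by (rule Determinant.det_mult[where n = n, symmetric]) simp_all
  also have "Matrix.mat n n (\<lambda>(i, j). f i j) * Matrix.mat n n (\<lambda>(i, j). g i j) =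
      Matrix.mat n n (\<lambda>(i, j). \<Sum>k<n. f i k * g k j)"
    by (rule eq_matI) (simp_all add: scalar_prod_def atLeast0LessThan)
  finally show ?thesis by (simp only: dt_def)
qed

lemma dt_perm_col:
  assumes p: "p permutes {0..<n}"
  shows "dt n (\<lambda>i j. f i (p j)) = of_int (sign p) * dt n f"
proof -
  let ?A = "Matrix.mat n n (\<lambda>(i, j). f j i)"
  have "dt n (\<lambda>i j. f i (p j)) = dt n (\<lambda>i j. f j (p i))" by (rule dt_transpose)
  also have "\<dots> = Determinant.det (Matrix.mat n n (\<lambda>(i, j). ?A $$ (p i, j)))"
    unfolding dt_def
  proof (rule arg_cong[where f = Determinant.det], rule eq_matI)
    fix i j assume ij: "i < dim_row (Matrix.mat n n (\<lambda>(i, j). ?A $$ (p i, j)))"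
      "j < dim_col (Matrix.mat n n (\<lambda>(i, j). ?A $$ (p i, j)))"
    then have "p i < n" using permutes_in_image[OF p, of i] by simp
    then show "Matrix.mat n n (\<lambda>(i, j). f j (p i)) $$ (i, j) = Matrix.mat n n (\<lambda>(i, j). ?A $$ (p i, j)) $$ (i, j)"
      using ij by simp
  qed simp_all
  also have "\<dots> = of_int (sign p) * Determinant.det ?A" by (rule Determinant.det_permute_rows[OF _ p]) simp
  also have "Determinant.det ?A = dt n f" unfolding dt_def[symmetric] by (rule dt_transpose)
  finally show ?thesis .
qed

lemma dt_same_col:
  assumes "i \<noteq> j" "i < n" "j < n" and eq: "\<And>r. r < n \<Longrightarrow> f r i = f r j"
  shows "dt n f = 0"
proof -
  have "dt n (\<lambda>i j. f j i) = 0" unfolding dt_def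
    by (rule Determinant.det_identical_rows[OF _ assms(1-3)]) (use assms in \<open>auto intro!: eq_vecI\<close>)
  then show ?thesis by (subst dt_transpose)
qed

text \<open>The first \<open>m + 1\<close> rows are supported on \<open>m\<close> columns, so by the
  pigeonhole principle each Leibniz term contains an entry of the zero block.\<close>

lemma dt_zero_block:
  assumes m: "m < n" and z: "\<And>i j. i \<le> m \<Longrightarrow> m \<le> j \<Longrightarrow> j < n \<Longrightarrow> f i j = 0"
  shows "dt n f = 0"
  unfolding dt_leibniz
proof (rule sum.neutral, rule ballI)
  fix p assume "p \<in> {p. p permutes {0..<n}}"
  then have p: "p permutes {0..<n}" by simp
  have "\<exists>i\<le>m. m \<le> p i"
  proof (rule ccontr)
    assume "\<not> (\<exists>i\<le>m. m \<le> p i)"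
    then have "p ` {..m} \<subseteq> {..<m}" by force
    then have "card (p ` {..m}) \<le> m" using card_mono[of "{..<m}" "p ` {..m}"] by simp
    moreover have "card (p ` {..m}) = Suc m"
      using card_image[OF inj_on_subset[OF permutes_inj[OF p]], of "{..m}"] by simp
    ultimately show False by simp
  qed
  then obtain i where i: "i \<le> m" "m \<le> p i" by blast
  have "p i < n" using permutes_in_image[OF p, of i] i m by simp
  then have "f i (p i) = 0" using z i by blast
  then have "(\<Prod>i = 0..<n. f i (p i)) = 0" using i m by (intro prod_zero) (auto intro!: bexI[of _ i])
  then show "of_int (sign p) * (\<Prod>i = 0..<n. f i (p i)) = 0" by simp
qed

section \<open>Degree bounds and sets of exponents\<close>

definition supp :: "nat \<Rightarrow> nat set \<Rightarrow> 'a::comm_ring_1 poly \<Rightarrow> bool" where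
  "supp m J P \<longleftrightarrow> degree P \<le> m \<and> (\<forall>i. coeff P i \<noteq> 0 \<longrightarrow> i \<in> J)"

lemma supp_monom: "c = 0 \<or> i \<in> J \<and> i \<le> m \<Longrightarrow> supp m J (monom c i)"
  using degree_monom_le[of c i] by (auto simp: supp_def)

lemma supp_0 [simp]: "supp m J 0"
  by (simp add: supp_def)

lemma supp_add: "supp m J P \<Longrightarrow> supp m J Q \<Longrightarrow> supp m J (P + Q)"
  unfolding supp_def
  by (metis Polynomial.coeff_add add.right_neutral degree_add_le)

lemma supp_minus: "supp m J P \<Longrightarrow> supp m J (- P)"
  by (simp add: supp_def)

lemma supp_mono: "supp m J P \<Longrightarrow> m \<le> m' \<Longrightarrow> J \<subseteq> J' \<Longrightarrow> supp m' J' P"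
  by (auto simp: supp_def)

lemma supp_sum: "(\<And>x. x \<in> A \<Longrightarrow> supp m J (f x)) \<Longrightarrow> supp m J (\<Sum>x\<in>A. f x)"
  by (induction A rule: infinite_finite_induct) (simp_all add: supp_add)

lemma supp_mult:
  assumes P: "supp m J P" and Q: "supp m' J' Q" and J: "\<And>i j. i \<in> J \<Longrightarrow> j \<in> J' \<Longrightarrow> i + j \<in> J''"
  shows "supp (m + m') J'' (P * Q)"
  unfolding supp_def
proof (intro conjI allI impI)
  show "degree (P * Q) \<le> m + m'"
    using degree_mult_le[of P Q] P Q by (simp add: supp_def)
  fix k assume "coeff (P * Q) k \<noteq> 0"
  then obtain i where i: "i \<le> k" "coeff P i * coeff Q (k - i) \<noteq> 0"
    by (auto simp: Polynomial.coeff_mult elim!: sum.not_neutral_contains_not_neutral)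
  then have "coeff P i \<noteq> 0" "coeff Q (k - i) \<noteq> 0" by auto
  then have "i \<in> J" "k - i \<in> J'" using P Q unfolding supp_def by blast+
  from J[OF this] i(1) show "k \<in> J''" by simp
qed

lemma supp_prod:
  assumes "\<And>x. x \<in> A \<Longrightarrow> supp m J (f x)" and "finite A" and "0 \<in> J" and J: "\<And>i j. i \<in> J \<Longrightarrow> j \<in> J \<Longrightarrow> i + j \<in> J"
  shows "supp (card A * m) J (\<Prod>x\<in>A. f x)"
  using \<open>finite A\<close> assms(1)
proof (induction A)
  case empty
  then show ?case using \<open>0 \<in> J\<close> by (simp add: supp_def)
next
  case (insert x A)
  have "supp (m + card A * m) J (f x * (\<Prod>x\<in>A. f x))"
    by (rule supp_mult[OF _ _ J]) (use insert in auto)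
  then show ?case using insert by simp
qed

text \<open>A set of exponents containing 0 and closed under addition survives the products in the
  Leibniz formula.\<close>

lemma supp_dt:
  assumes f: "\<And>i j. i < n \<Longrightarrow> j < n \<Longrightarrow> supp m J (f i j)" and J: "0 \<in> J" "\<And>i j. i \<in> J \<Longrightarrow> j \<in> J \<Longrightarrow> i + j \<in> J"
  shows "supp (n * m) J (dt n f)"
  unfolding dt_leibniz
proof (rule supp_sum)
  fix p assume "p \<in> {p. p permutes {0..<n}}"
  then have p: "p permutes {0..<n}" by simp
  have "supp (card {0..<n} * m) J (\<Prod>i = 0..<n. f i (p i))"
  proof (rule supp_prod[OF _ _ J])
    fix i assume "i \<in> {0..<n}"
    then show "supp m J (f i (p i))" using f permutes_in_image[OF p, of i] by simp
  qed simp_all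
  then show "supp (n * m) J (of_int (sign p) * (\<Prod>i = 0..<n. f i (p i)))"
    by (cases "sign p = 1") (auto simp: sign_def intro: supp_minus)
qed

subsection \<open>Evaluation of symmetric tensors\<close>

text \<open>Substitution of polynomials for the variables, a ring homomorphism. The coordinate
  functionals on hook tensors are coefficients or values of such substitutions, so they pass through
  determinants and products.\<close>

definition ev :: "(nat \<Rightarrow> 'k::field poly) \<Rightarrow> ('k mpol) \<Rightarrow> 'k poly" where
  "ev f F = (\<Sum>M\<in>keys F. Polynomial.smult (lookup F M) (\<Prod>i\<in>#M. f i))"

lemma ev_superset:
  "finite A \<Longrightarrow> keys F \<subseteq> A \<Longrightarrow>
    ev f F = (\<Sum>M\<in>A. Polynomial.smult (lookup F M) (\<Prod>i\<in>#M. f i))"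
  unfolding ev_def by (rule sum.mono_neutral_left) (auto simp: in_keys_iff)

lemma ev_add: "ev f (F + H) = ev f F + ev f H"
proof -
  let ?A = "keys F \<union> keys H"
  have "ev f (F + H) = (\<Sum>M\<in>?A. Polynomial.smult (lookup (F + H) M) (\<Prod>i\<in>#M. f i))"
    by (rule ev_superset) (use Poly_Mapping.keys_add[of F H] in auto)
  also have "\<dots> = (\<Sum>M\<in>?A. Polynomial.smult (lookup F M) (\<Prod>i\<in>#M. f i)) +
      (\<Sum>M\<in>?A. Polynomial.smult (lookup H M) (\<Prod>i\<in>#M. f i))"
    by (simp add: lookup_add smult_add_left sum.distrib)
  also have "\<dots> = ev f F + ev f H"
    by (subst (1 2) ev_superset[where A = ?A]) auto
  finally show ?thesis .
qed

lemma ev_0 [simp]: "ev f 0 = 0"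
  by (simp add: ev_def)

lemma ev_single [simp]: "ev f (single M c) = Polynomial.smult c (\<Prod>i\<in>#M. f i)"
  by (subst ev_superset[where A = "{M}"]) auto

lemma ev_sum: "ev f (sum F A) = (\<Sum>x\<in>A. ev f (F x))"
  by (induction A rule: infinite_finite_induct) (simp_all add: ev_add)

lemma ev_mult: "ev f (F * H) = ev f F * ev f H"
proof -
  have "F * H = (\<Sum>M\<in>keys F. \<Sum>M'\<in>keys H.
      single (M + M') (lookup F M * lookup H M'))"
    by (subst (1 2) sum_singles[symmetric]) (simp add: sum_product mult_single)
  then have "ev f (F * H) = (\<Sum>M\<in>keys F. \<Sum>M'\<in>keys H.
      Polynomial.smult (lookup F M * lookup H M') ((\<Prod>i\<in>#M. f i) * (\<Prod>i\<in>#M'. f i)))"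
    by (simp add: ev_sum)
  then show ?thesis by (simp add: ev_def sum_product mult_ac)
qed

lemma ev_one [simp]: "ev f 1 = 1"
  using ev_single[of f 0 1] by (simp add: single_one)

lemma ev_prod: "ev f (\<Prod>x\<in>A. F x) = (\<Prod>x\<in>A. ev f (F x))"
  by (induction A rule: infinite_finite_induct) (simp_all add: ev_mult)

lemma ev_lin_form: "ev f (lin_form I v) = (\<Sum>i\<in>I. Polynomial.smult (v i) (f i))"
  by (simp add: lin_form_def ev_sum)

lemma fn_linear_ev: "fn_linear (\<lambda>F. coeff (ev f (F cs)) i)"
  by (simp add: fn_linear_def ev_add ev_mult fscale_def plus_fun_def)

subsection \<open>Symmetries and coordinates of hook tensors\<close>

lemma hrow_add: "hrow I cs i (\<lambda>c. u c + v c) = hrow I cs i u + hrow I cs i v"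
  by (simp add: hrow_def lin_form_add single_add)

lemma hrow_scale: "hrow I cs i (\<lambda>c. w * v c) = single {#} w * hrow I cs i v"
  by (simp add: hrow_def lin_form_smult mult_single)

lemma hrow_sum: "hrow I cs i (\<lambda>c. \<Sum>k\<in>K. w k * v k c) = (\<Sum>k\<in>K. single {#} (w k) * hrow I cs i (v k))"
proof (induction K rule: infinite_finite_induct)
  case empty
  show ?case using hrow_scale[of I cs i 0 "\<lambda>_. 0"] by simp
next
  case (infinite A)
  then show ?case using hrow_scale[of I cs i 0 "\<lambda>_. 0"] by simp
next
  case (insert x F)
  then show ?case by (simp add: hrow_add hrow_scale)
qed

lemma hrow_cong: "(\<And>c. c \<in> I \<Longrightarrow> u c = v c) \<Longrightarrow> set cs \<subseteq> I \<Longrightarrow> i \<le> length cs \<Longrightarrow> hrow I cs i u = hrow I cs i v"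
proof (cases "i = 0")
  assume eq: "\<And>c. c \<in> I \<Longrightarrow> u c = v c"
  case True
  then show ?thesis by (simp add: hrow_def lin_form_def eq)
next
  assume eq: "\<And>c. c \<in> I \<Longrightarrow> u c = v c" and cs: "set cs \<subseteq> I" "i \<le> length cs"
  case False
  then have "cs ! (i - 1) \<in> I" using cs nth_mem[of "i - 1" cs] by auto
  then show ?thesis by (simp only: hrow_def eq False if_False)
qed

lemma hookE_dt: "hookE I a b \<alpha> \<kappa> cs = (if length cs = b \<and> set cs \<subseteq> I
     then dt (Suc b) (\<lambda>i j. hrow I cs i (\<kappa> j)) * (\<Prod>j<a. lin_form I (\<alpha> j)) else 0)"
  by (simp add: hookE_def dt_def)

lemma single_of_int: "single {#} (of_int k) = (of_int k :: ('k::field) mpol)"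
  by (induction k rule: int_induct[of _ 0]) (simp_all add: single_add single_diff)

lemma dt_scale_col: "dt n (\<lambda>i j. w j * f i j) = (\<Prod>j<n. w j) * dt n f"
  unfolding dt_leibniz sum_distrib_left
proof (rule sum.cong)
  fix p assume "p \<in> {p. p permutes {0..<n}}"
  then have p: "p permutes {0..<n}" by simp
  have "(\<Prod>i = 0..<n. w (p i)) = (\<Prod>i = 0..<n. w i)"
    using prod.permute[OF p, of w] by (simp add: comp_def)
  then show "of_int (sign p) * (\<Prod>i = 0..<n. w (p i) * f i (p i)) =
      (\<Prod>j<n. w j) * (of_int (sign p) * (\<Prod>i = 0..<n. f i (p i)))"
    by (simp add: prod.distrib atLeast0LessThan mult_ac)
qed simp

lemma hookE_scale:
  "hookE I a b (\<lambda>j c. u j * \<alpha> j c) (\<lambda>i c. w i * \<kappa> i c) = fscale ((\<Prod>j<a. u j) * (\<Prod>i\<le>b. w i)) (hookE I a b \<alpha> \<kappa>)"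
proof
  fix cs
  have e1: "(\<Prod>j<a. lin_form I (\<lambda>c. u j * \<alpha> j c)) = single {#} (\<Prod>j<a. u j) * (\<Prod>j<a. lin_form I (\<alpha> j))"
    by (simp only: lin_form_smult prod.distrib prod_single_const)
  have e2: "dt (Suc b) (\<lambda>i j. hrow I cs i (\<lambda>c. w j * \<kappa> j c)) =
      single {#} (\<Prod>i\<le>b. w i) * dt (Suc b) (\<lambda>i j. hrow I cs i (\<kappa> j))"
    by (simp only: hrow_scale dt_scale_col prod_single_const lessThan_Suc_atMost)
  have e3: "single {#} ((\<Prod>j<a. u j) * (\<Prod>i\<le>b. w i)) =
      single {#} (\<Prod>j<a. u j) * single {#} (\<Prod>i\<le>b. w i)"
    by (simp add: mult_single)
  show "hookE I a b (\<lambda>j c. u j * \<alpha> j c) (\<lambda>i c. w i * \<kappa> i c) cs =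
      fscale ((\<Prod>j<a. u j) * (\<Prod>i\<le>b. w i)) (hookE I a b \<alpha> \<kappa>) cs"
    unfolding hookE_dt fscale_def e1 e2 e3 by (simp add: mult_ac)
qed

lemma hookE_same_col: "i \<noteq> j \<Longrightarrow> i \<le> b \<Longrightarrow> j \<le> b \<Longrightarrow> \<kappa> i = \<kappa> j \<Longrightarrow> hookE I a b \<alpha> \<kappa> = 0"
proof -
  assume ij: "i \<noteq> j" "i \<le> b" "j \<le> b" and eq: "\<kappa> i = \<kappa> j"
  have "dt (Suc b) (\<lambda>i j. hrow I cs i (\<kappa> j)) = 0" for cs
    by (rule dt_same_col[of i j]) (use ij in \<open>simp_all only: eq less_Suc_eq_le not_False_eq_True\<close>)
  then show ?thesis by (simp add: fun_eq_iff hookE_dt)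
qed

text \<open>The two tensors differ by a sign. Membership in the span hides that sign, which never
  matters later.\<close>

lemma hookE_perm_span:
  assumes p: "p permutes {0..<Suc b}" and eq: "\<And>i. i \<le> b \<Longrightarrow> \<kappa>' i = \<kappa> (p i)"
  shows "hookE I a b \<alpha> \<kappa>' \<in> fs.span {hookE I a b \<alpha> \<kappa>}"
proof -
  have "dt (Suc b) (\<lambda>i j. hrow I cs i (\<kappa>' j)) = of_int (sign p) * dt (Suc b) (\<lambda>i j. hrow I cs i (\<kappa> j))" for cs
    unfolding dt_perm_col[OF p, symmetric] by (rule dt_cong) (simp add: eq)
  then have "hookE I a b \<alpha> \<kappa>' = fscale (of_int (sign p)) (hookE I a b \<alpha> \<kappa>)"
    by (simp add: hookE_dt fun_eq_iff fscale_def single_of_int mult.assoc)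
  then show ?thesis by (simp add: fs.span_scale fs.span_base)
qed

text \<open>The arm enters through a commutative product, so only the multiset of its indices
  counts.\<close>

lemma hookE_arms:
  fixes \<alpha> \<alpha>' :: "nat \<Rightarrow> nat"
  assumes "image_mset \<alpha> (mset_set {..<a}) = image_mset \<alpha>' (mset_set {..<a})"
  shows "hookE I a b (\<lambda>j. v (\<alpha> j)) \<kappa> = hookE I a b (\<lambda>j. v (\<alpha>' j)) \<kappa>"
proof -
  have "(\<Prod>j<a. lin_form I (v (\<alpha> j))) = (\<Prod>i\<in>#image_mset \<alpha> (mset_set {..<a}). lin_form I (v i))" for \<alpha> :: "nat \<Rightarrow> nat"
    by (simp add: prod_unfold_prod_mset multiset.map_comp comp_def)
  with assms show ?thesis by (simp add: hookE_dt fun_eq_iff)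
qed

lemma ev_hookE:
  assumes "length cs = b" "set cs \<subseteq> I"
  shows "ev f (hookE I a b \<alpha> \<kappa> cs) =
    dt (Suc b) (\<lambda>i j. if i = 0 then (\<Sum>c\<in>I. Polynomial.smult (\<kappa> j c) (f c)) else [:\<kappa> j (cs ! (i - 1)):]) *
    (\<Prod>j<a. \<Sum>c\<in>I. Polynomial.smult (\<alpha> j c) (f c))"
proof -
  have "ev f (dt (Suc b) (\<lambda>i j. hrow I cs i (\<kappa> j))) = dt (Suc b) (\<lambda>i j. ev f (hrow I cs i (\<kappa> j)))"
    by (rule dt_hom[OF ev_add ev_mult ev_one])
  also have "\<dots> = dt (Suc b) (\<lambda>i j. if i = 0 then (\<Sum>c\<in>I. Polynomial.smult (\<kappa> j c) (f c)) else [:\<kappa> j (cs ! (i - 1)):])"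
    by (rule dt_cong) (simp add: hrow_def ev_lin_form)
  finally show ?thesis using assms by (simp add: hookE_dt ev_mult ev_prod ev_lin_form)
qed

text \<open>The coordinate at the monomial \<open>x\<^sub>0\<^bsup>a+1\<^esup>\<close>: set \<open>x\<^sub>0 = 1\<close> and the other variables to 0.\<close>

definition crd0 :: "nat list \<Rightarrow> (('k::field) mfun) \<Rightarrow> 'k" where
  "crd0 cs F = poly (ev (dl 0) (F cs)) 0"

lemma fn_linear_crd0: "fn_linear (crd0 cs)"
  by (simp add: fn_linear_def crd0_def ev_add ev_mult fscale_def plus_fun_def)

lemma crd0_hookE:
  assumes "length cs = b" "set cs \<subseteq> I" "finite I" "0 \<in> I"
  shows "crd0 cs (hookE I a b \<alpha> \<kappa>) = dt (Suc b) (\<lambda>i j. \<kappa> j ((0 # cs) ! i)) * (\<Prod>j<a. \<alpha> j 0)"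
proof -
  have s: "(\<Sum>c\<in>I. Polynomial.smult (v c) (dl 0 c)) = [:v 0:]" for v :: "nat \<Rightarrow> 'a"
    using assms(3,4) by (simp add: if_distrib[of "Polynomial.smult _"] cong: if_cong)
  have "poly (dt (Suc b) (\<lambda>i j. if i = 0 then [:\<kappa> j 0:] else [:\<kappa> j (cs ! (i - 1)):])) 0 =
      dt (Suc b) (\<lambda>i j. poly (if i = 0 then [:\<kappa> j 0:] else [:\<kappa> j (cs ! (i - 1)):]) 0)"
    by (rule dt_hom) simp_all
  also have "\<dots> = dt (Suc b) (\<lambda>i j. \<kappa> j ((0 # cs) ! i))"
    by (rule dt_cong) (simp add: nth_Cons')
  finally show ?thesis unfolding crd0_def ev_hookE[OF assms(1,2)] s by (simp add: poly_prod)
qed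

text \<open>The polynomial of the coordinates at the monomials \<open>x\<^sub>0\<^bsup>a+1-k\<^esup> x\<^sub>y\<^bsup>k\<^esup>\<close>.\<close>

definition crd1 :: "nat \<Rightarrow> nat list \<Rightarrow> (('k::field) mfun) \<Rightarrow> 'k poly" where
  "crd1 y cs F = ev (\<lambda>c. if c = 0 then 1 else if c = y then [:0, 1:] else 0) (F cs)"

lemma fn_linear_crd1: "fn_linear (\<lambda>F. coeff (crd1 y cs F) k)"
  unfolding crd1_def by (rule fn_linear_ev)

text \<open>\<open>D\<close> is the leg determinant; putting its variable equal to 0 leaves the
  determinant seen by \<open>crd0\<close>. Low coefficients can then be read off once the arm
  factors are known to be divisible by the variable.\<close>

lemma crd1_hookE:
  assumes "length cs = b" "set cs \<subseteq> I" "finite I" "0 \<in> I" "y \<in> I" "y \<noteq> 0"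
  obtains D where "crd1 y cs (hookE I a b \<alpha> \<kappa>) = D * (\<Prod>j<a. [:\<alpha> j 0, \<alpha> j y:])"
    "coeff D 0 = dt (Suc b) (\<lambda>i j. \<kappa> j ((0 # cs) ! i))"
proof
  have s: "(\<Sum>c\<in>I. Polynomial.smult (v c) (if c = 0 then 1 else if c = y then [:0, 1:] else 0)) = [:v 0, v y:]"
    for v :: "nat \<Rightarrow> 'a"
  proof -
    have "(\<Sum>c\<in>I. Polynomial.smult (v c) (if c = 0 then 1 else if c = y then [:0, 1:] else 0)) =
       (\<Sum>c\<in>I. (if c = 0 then [:v 0:] else 0) + (if c = y then [:0, v y:] else 0))"
      by (rule sum.cong) (use assms(6) in auto)
    also have "\<dots> = [:v 0, v y:]" using assms(3-5) by (simp add: sum.distrib)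
    finally show ?thesis .
  qed
  let ?D = "dt (Suc b) (\<lambda>i j. if i = 0 then [:\<kappa> j 0, \<kappa> j y:] else [:\<kappa> j (cs ! (i - 1)):])"
  show "crd1 y cs (hookE I a b \<alpha> \<kappa>) = ?D * (\<Prod>j<a. [:\<alpha> j 0, \<alpha> j y:])"
    unfolding crd1_def ev_hookE[OF assms(1,2)] s by simp
  have "poly ?D 0 =
      dt (Suc b) (\<lambda>i j. poly (if i = 0 then [:\<kappa> j 0, \<kappa> j y:] else [:\<kappa> j (cs ! (i - 1)):]) 0)"
    by (rule dt_hom) simp_all
  also have "\<dots> = dt (Suc b) (\<lambda>i j. \<kappa> j ((0 # cs) ! i))"
    by (rule dt_cong) (simp add: nth_Cons')
  finally show "coeff ?D 0 = dt (Suc b) (\<lambda>i j. \<kappa> j ((0 # cs) ! i))"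
    by (simp add: poly_0_coeff_0)
qed

subsection \<open>Sets of natural numbers with small sum\<close>

text \<open>Drives the inductions below: \<open>n\<close> distinct smaller numbers force the maximum
  to be at least \<open>n\<close>.\<close>

lemma remove_Max:
  fixes S :: "nat set"
  assumes "finite S" "card S = Suc n"
  obtains m T where "S = insert m T" "finite T" "card T = n" "\<And>x. x \<in> T \<Longrightarrow> x < m" "n \<le> m" "\<Sum>S = m + \<Sum>T" "m \<notin> T"
proof -
  define m where "m = Max S"
  have "S \<noteq> {}" using assms by auto
  then have m: "m \<in> S" "\<And>x. x \<in> S \<Longrightarrow> x \<le> m" using assms by (auto simp: m_def)
  let ?T = "S - {m}"
  have lt: "x < m" if "x \<in> ?T" for x using m(2)[of x] that by auto
  have T: "finite ?T" "card ?T = n" using assms m by auto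
  then have "n \<le> m" using card_mono[of "{..<m}" ?T] lt by auto
  moreover have "\<Sum>S = m + \<Sum>?T" using assms m by (simp add: sum.remove)
  ultimately show ?thesis using that[of m ?T] T lt m by auto
qed

text \<open>The leg entries of a nonzero tableau are distinct, so these sets describe which legs
  occur at the minimal index sum and just above it.\<close>

lemma sum_ge_base:
  fixes S :: "nat set"
  assumes "finite S" "card S = n"
  shows "\<Sum>{..<n} \<le> \<Sum>S"
  using assms
proof (induction n arbitrary: S)
  case (Suc n)
  obtain m T where "finite T" "card T = n" "n \<le> m" "\<Sum>S = m + \<Sum>T" by (rule remove_Max[OF Suc.prems])
  then show ?case using Suc.IH[of T] by simp
qed simp

lemma sum_eq_base:
  fixes S :: "nat set"
  assumes "finite S" "card S = n" "\<Sum>S = \<Sum>{..<n}"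
  shows "S = {..<n}"
  using assms
proof (induction n arbitrary: S)
  case (Suc n)
  obtain m T where T: "S = insert m T" "finite T" "card T = n" "n \<le> m" "\<Sum>S = m + \<Sum>T"
    by (rule remove_Max[OF Suc.prems(1,2)])
  then have "m = n" "\<Sum>T = \<Sum>{..<n}" using sum_ge_base[of T n] Suc.prems by auto
  then show ?case using Suc.IH[of T] T by auto
qed simp

lemma sum_eq_base_1:
  fixes S :: "nat set"
  assumes "finite S" "card S = Suc n" "\<Sum>S = Suc (\<Sum>{..<Suc n})"
  shows "S = insert (Suc n) {..<n}"
  using assms
proof (induction n arbitrary: S)
  case (Suc n)
  obtain m T where T: "S = insert m T" "finite T" "card T = Suc n" "Suc n \<le> m" "\<Sum>S = m + \<Sum>T" "\<And>x. x \<in> T \<Longrightarrow> x < m"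
    using remove_Max[OF Suc.prems(1,2)] by metis
  then consider "m = Suc n" "\<Sum>T = Suc (\<Sum>{..<Suc n})" | "m = Suc (Suc n)" "\<Sum>T = \<Sum>{..<Suc n}"
    using sum_ge_base[of T "Suc n"] Suc.prems by force
  then show ?case
  proof cases
    case 1
    then have "Suc n \<in> T" using Suc.IH[of T] T by auto
    then show ?thesis using T(6) 1 by blast
  next
    case 2
    then show ?thesis using sum_eq_base[of T "Suc n"] T by auto
  qed
next
  case 0
  then obtain x where "S = {x}" by (auto simp: card_Suc_eq)
  then show ?case using 0 by simp
qed

text \<open>The excess 2 either raises the largest element by 2 or raises each of the two largest by
  1.\<close>

lemma sum_eq_base_2:
  fixes S :: "nat set"
  assumes "finite S" "card S = Suc n" "\<Sum>S = \<Sum>{..<Suc n} + 2" "0 < n"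
  shows "S = insert (n + 2) {..<n} \<or> S = insert (Suc n) (insert n {..<n - 1})"
proof -
  obtain m T where T: "S = insert m T" "finite T" "card T = n" "n \<le> m" "\<Sum>S = m + \<Sum>T" "\<And>x. x \<in> T \<Longrightarrow> x < m"
    using remove_Max[OF assms(1,2)] by metis
  obtain k where k: "n = Suc k" using assms(4) by (cases n) auto
  have "m \<le> n + 2" "\<Sum>T + m = \<Sum>{..<n} + n + 2" using sum_ge_base[of T n] T assms by auto
  with T(4) consider "m = n + 2" "\<Sum>T = \<Sum>{..<n}" | "m = Suc n" "\<Sum>T = Suc (\<Sum>{..<n})" | "m = n" by linarith
  then show ?thesis
  proof cases
    case 1
    then show ?thesis using sum_eq_base[of T n] T by simp
  next
    case 2
    then show ?thesis using sum_eq_base_1[of T k] T k by simp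
  next
    case 3
    then have "T \<subseteq> {..<n}" using T(6) by auto
    then have "T = {..<n}" using T(3) by (simp add: card_subset_eq)
    then show ?thesis using 3 T(5) assms(3) by simp
  qed
qed

lemma enumerations_perm:
  assumes "inj_on \<kappa> {..b::nat}" "inj_on \<kappa>' {..b}" "\<kappa>' ` {..b} = \<kappa> ` {..b}"
  obtains p where "p permutes {0..<Suc b}" "\<And>i. i \<le> b \<Longrightarrow> \<kappa>' i = \<kappa> (p i)"
proof -
  define p where "p i = (if i \<le> b then inv_into {..b} \<kappa> (\<kappa>' i) else i)" for i
  have img: "\<kappa>' i \<in> \<kappa> ` {..b}" if "i \<le> b" for i using assms(3) that by blast
  have eq: "\<kappa>' i = \<kappa> (p i)" "p i \<le> b" if "i \<le> b" for i
    using f_inv_into_f[OF img[OF that]] inv_into_into[OF img[OF that]] that by (auto simp: p_def)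
  have "p permutes {0..<Suc b}"
  proof (rule inj_imp_permutes)
    show "inj_on p {0..<Suc b}"
    proof (rule inj_onI)
      fix i j assume "i \<in> {0..<Suc b}" "j \<in> {0..<Suc b}" "p i = p j"
      then show "i = j" using eq(1)[of i] eq(1)[of j] inj_onD[OF assms(2), of i j] by auto
    qed
    show "p i \<in> {0..<Suc b}" if "i \<in> {0..<Suc b}" for i using eq(2)[of i] that by simp
    show "p i = i" if "i \<notin> {0..<Suc b}" for i using that by (simp add: p_def)
  qed simp
  then show ?thesis using that[of p] eq(1) by blast
qed

lemma hookE_enum_span:
  assumes "inj_on \<kappa> {..b}" "inj_on \<kappa>' {..b}" "\<kappa>' ` {..b} = \<kappa> ` {..b}"
  shows "hookE I a b \<alpha> (\<lambda>i. v (\<kappa>' i)) \<in> fs.span {hookE I a b \<alpha> (\<lambda>i. v (\<kappa> i))}"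
proof -
  obtain p where p: "p permutes {0..<Suc b}" "\<And>i. i \<le> b \<Longrightarrow> \<kappa>' i = \<kappa> (p i)"
    using enumerations_perm[OF assms] by blast
  show ?thesis by (rule hookE_perm_span[OF p(1)]) (simp add: p(2))
qed

subsection \<open>Weights of a hook\<close>

text \<open>Each unit of this sum lowers the weight by 2, so a tableau has weight
  \<open>l (a + b + 1)\<close> minus twice its index sum.\<close>

definition tsum :: "nat \<Rightarrow> nat \<Rightarrow> (nat \<Rightarrow> nat) \<Rightarrow> (nat \<Rightarrow> nat) \<Rightarrow> nat" where
  "tsum a b \<alpha> \<kappa> = (\<Sum>j<a. \<alpha> j) + (\<Sum>i\<le>b. \<kappa> i)"

abbreviation hookD :: "nat \<Rightarrow> nat \<Rightarrow> nat \<Rightarrow> (nat \<Rightarrow> nat) \<Rightarrow> (nat \<Rightarrow> nat) \<Rightarrow> ('k::field) mfun" where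
  "hookD l a b \<alpha> \<kappa> \<equiv> hookE {..l} a b (\<lambda>j. dl (\<alpha> j)) (\<lambda>i. dl (\<kappa> i))"

lemma hookD_inj: "hookD l a b \<alpha> \<kappa> \<noteq> (0 :: ('k::field) mfun) \<Longrightarrow> inj_on \<kappa> {..b}"
proof (rule inj_onI, rule ccontr)
  fix i j assume ne: "hookD l a b \<alpha> \<kappa> \<noteq> (0 :: 'k mfun)"
    and ij: "i \<in> {..b}" "j \<in> {..b}" "\<kappa> i = \<kappa> j" "i \<noteq> j"
  have "hookD l a b \<alpha> \<kappa> = (0 :: 'k mfun)"
    by (rule hookE_same_col[OF ij(4)]) (use ij in auto)
  with ne show False by contradiction
qed

text \<open>Distinct leg entries have at least the sum of \<open>0, ..., b\<close>. The reflected
  entries \<open>l - \<kappa> i\<close> are distinct as well, which gives the upper bound.\<close>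

lemma hookD_tsum_bounds:
  assumes ne: "hookD l a b \<alpha> \<kappa> \<noteq> (0 :: ('k::field) mfun)" and i: "hidx l a b \<alpha> \<kappa>"
  shows "\<Sum>{..b} \<le> (\<Sum>i\<le>b. \<kappa> i)" "tsum a b \<alpha> \<kappa> + \<Sum>{..b} \<le> l * (a + b + 1)"
proof -
  note inj = hookD_inj[OF ne]
  show "\<Sum>{..b} \<le> (\<Sum>i\<le>b. \<kappa> i)"
    using sum_ge_base[of "\<kappa> ` {..b}" "Suc b"] card_image[OF inj] sum.reindex[OF inj, of "\<lambda>x. x"]
    by (simp add: lessThan_Suc_atMost)
  have inj': "inj_on (\<lambda>i. l - \<kappa> i) {..b}"
  proof (rule inj_onI)
    fix x y assume xy: "x \<in> {..b}" "y \<in> {..b}" "l - \<kappa> x = l - \<kappa> y"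
    then have "\<kappa> x \<le> l" "\<kappa> y \<le> l" using i by (simp_all add: hidx_def)
    then have "\<kappa> x = \<kappa> y" using xy(3) by linarith
    then show "x = y" using inj_onD[OF inj] xy by blast
  qed
  have "\<Sum>{..b} \<le> (\<Sum>i\<le>b. l - \<kappa> i)"
    using sum_ge_base[of "(\<lambda>i. l - \<kappa> i) ` {..b}" "Suc b"] card_image[OF inj'] sum.reindex[OF inj', of "\<lambda>x. x"]
    by (simp add: lessThan_Suc_atMost)
  moreover have "(\<Sum>i\<le>b. l - \<kappa> i) + (\<Sum>i\<le>b. \<kappa> i) = (\<Sum>i\<le>b. l)"
    unfolding sum.distrib[symmetric] by (rule sum.cong) (use i in \<open>auto simp: hidx_def\<close>)
  moreover have "(\<Sum>j<a. \<alpha> j) \<le> (\<Sum>j<a. l)" by (rule sum_mono) (use i in \<open>auto simp: hidx_def\<close>)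
  ultimately show "tsum a b \<alpha> \<kappa> + \<Sum>{..b} \<le> l * (a + b + 1)" by (simp add: tsum_def algebra_simps)
qed

lemma hookD_weight:
  assumes i: "hidx l a b \<alpha> \<kappa>"
  shows "hookE {..l} a b (\<lambda>j. to_down l t (\<alpha> j)) (\<lambda>i. to_down l t (\<kappa> i)) =
    fscale (t ^ (l * (a + b + 1) - tsum a b \<alpha> \<kappa>) * inverse t ^ tsum a b \<alpha> \<kappa>) (hookD l a b \<alpha> \<kappa>)"
    and "hookE {..l} a b (\<lambda>j. to_up l t (\<alpha> j)) (\<lambda>i. to_up l t (\<kappa> i)) =
    fscale (t ^ tsum a b \<alpha> \<kappa> * inverse t ^ (l * (a + b + 1) - tsum a b \<alpha> \<kappa>)) (hookD l a b \<alpha> \<kappa>)"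
proof -
  have l: "(\<Sum>j<a. l - \<alpha> j) + (\<Sum>i\<le>b. l - \<kappa> i) = l * (a + b + 1) - tsum a b \<alpha> \<kappa>"
  proof -
    have "(\<Sum>i\<le>b. l - \<kappa> i) + (\<Sum>i\<le>b. \<kappa> i) = (\<Sum>i\<le>b. l)"
      unfolding sum.distrib[symmetric] by (rule sum.cong) (use i in \<open>auto simp: hidx_def\<close>)
    moreover have "(\<Sum>i<a. l - \<alpha> i) + (\<Sum>i<a. \<alpha> i) = (\<Sum>i<a. l)"
      unfolding sum.distrib[symmetric] by (rule sum.cong) (use i in \<open>auto simp: hidx_def\<close>)
    ultimately show ?thesis by (simp add: tsum_def algebra_simps)
  qed
  have d: "to_down l t i = (\<lambda>c. (t ^ (l - i) * inverse t ^ i) * dl i c)"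
    "to_up l t i = (\<lambda>c. (t ^ i * inverse t ^ (l - i)) * dl i c)" for i
    by (simp_all add: to_down_def to_up_def fun_eq_iff)
  show "hookE {..l} a b (\<lambda>j. to_down l t (\<alpha> j)) (\<lambda>i. to_down l t (\<kappa> i)) =
    fscale (t ^ (l * (a + b + 1) - tsum a b \<alpha> \<kappa>) * inverse t ^ tsum a b \<alpha> \<kappa>) (hookD l a b \<alpha> \<kappa>)"
    unfolding d hookE_scale prod.distrib power_sum[symmetric] l[symmetric]
    by (simp only: tsum_def power_add mult_ac)
  show "hookE {..l} a b (\<lambda>j. to_up l t (\<alpha> j)) (\<lambda>i. to_up l t (\<kappa> i)) =
    fscale (t ^ tsum a b \<alpha> \<kappa> * inverse t ^ (l * (a + b + 1) - tsum a b \<alpha> \<kappa>)) (hookD l a b \<alpha> \<kappa>)"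
    unfolding d hookE_scale prod.distrib power_sum[symmetric] l[symmetric]
    by (simp only: tsum_def power_add mult_ac)
qed

subsection \<open>Weight vectors\<close>

lemma fn_linearD:
  assumes "fn_linear \<Lambda>"
  shows "\<Lambda> (F + H) = \<Lambda> F + \<Lambda> H" "\<Lambda> (fscale c F) = c * \<Lambda> F"
  using assms unfolding fn_linear_def by blast+

lemma tsum_le: "hidx l a b \<alpha> \<kappa> \<Longrightarrow> tsum a b \<alpha> \<kappa> \<le> l * (a + b + 1)"
  using sum_mono[of "{..<a}" \<alpha> "\<lambda>_. l"] sum_mono[of "{..b}" \<kappa> "\<lambda>_. l"]
  by (auto simp: hidx_def tsum_def algebra_simps)

text \<open>The minimal index sum forces the arm to be 0 and the leg to enumerate
  \<open>0, ..., b\<close>, so the highest weight space is at most a line.\<close>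

lemma hookD_top_span:
  assumes i: "hidx l a b \<alpha> \<kappa>" and s: "tsum a b \<alpha> \<kappa> = \<Sum>{..b}"
  shows "hookD l a b \<alpha> \<kappa> \<in> fs.span {hookD l a b (\<lambda>_. 0) (\<lambda>i. i) :: ('k::field) mfun}"
proof (cases "hookD l a b \<alpha> \<kappa> = (0 :: 'k mfun)")
  case False
  note inj = hookD_inj[OF False]
  have "\<Sum>{..b} \<le> (\<Sum>i\<le>b. \<kappa> i)" by (rule hookD_tsum_bounds(1)[OF False i])
  then have "(\<Sum>i\<le>b. \<kappa> i) = \<Sum>{..b} \<and> (\<Sum>j<a. \<alpha> j) = 0" using s unfolding tsum_def by linarith
  then have z: "(\<Sum>i\<le>b. \<kappa> i) = \<Sum>{..b}" "(\<Sum>j<a. \<alpha> j) = 0" by blast+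
  have "\<kappa> ` {..b} = {..<Suc b}"
    using sum_eq_base[of "\<kappa> ` {..b}" "Suc b"] card_image[OF inj] sum.reindex[OF inj, of "\<lambda>x. x"] z(1)
    by (simp add: lessThan_Suc_atMost)
  then have "hookD l a b \<alpha> \<kappa> \<in> fs.span {hookD l a b \<alpha> (\<lambda>i. i) :: 'k mfun}"
    by (intro hookE_enum_span[where v = dl and \<kappa> = "\<lambda>i. i"] inj) (simp_all add: lessThan_Suc_atMost)
  also have "hookD l a b \<alpha> (\<lambda>i. i) = (hookD l a b (\<lambda>_. 0) (\<lambda>i. i) :: 'k mfun)"
    by (rule hookE_cong) (use z(2) in simp_all)
  finally show ?thesis .
qed (simp add: fs.span_zero)

lemma crd0_hookD:
  assumes "b \<le> l"
  shows "crd0 [1..<Suc b] (hookD l a b \<alpha> \<kappa>) = dt (Suc b) (\<lambda>i j. dl (\<kappa> j) i) * (\<Prod>j<a. dl (\<alpha> j) 0)"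
proof -
  have "crd0 [1..<Suc b] (hookD l a b \<alpha> \<kappa>) =
      dt (Suc b) (\<lambda>i j. dl (\<kappa> j) ((0 # [1..<Suc b]) ! i)) * (\<Prod>j<a. dl (\<alpha> j) 0)"
    by (rule crd0_hookE) (use assms in auto)
  also have "dt (Suc b) (\<lambda>i j. dl (\<kappa> j) ((0 # [1..<Suc b]) ! i)) = dt (Suc b) (\<lambda>i j. dl (\<kappa> j) i)"
    by (rule dt_cong) (simp add: nth_Cons' del: upt_Suc)
  finally show ?thesis .
qed

lemma crd0_hookD_0:
  assumes "b \<le> l"
  shows "crd0 [1..<Suc b] (hookD l a b (\<lambda>_. 0) (\<lambda>i. i)) = 1"
  unfolding crd0_hookD[OF assms] by (subst dt_upper) simp_all

text \<open>A nonzero Leibniz term exhibits the leg as a rearrangement of \<open>0, ..., b\<close>,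
  and a nonzero arm product means that all arm entries are 0.\<close>

lemma crd0_hookD_tsum:
  assumes "b \<le> l" and ne: "crd0 [1..<Suc b] (hookD l a b \<alpha> \<kappa>) \<noteq> (0 :: 'k::field)"
  shows "tsum a b \<alpha> \<kappa> = \<Sum>{..b}"
proof -
  have "(\<Prod>j<a. dl (\<alpha> j) 0) \<noteq> (0 :: 'k)" and d: "dt (Suc b) (\<lambda>i j. dl (\<kappa> j) i) \<noteq> (0 :: 'k)"
    using ne unfolding crd0_hookD[OF assms(1)] by auto
  then have z: "\<alpha> j = 0" if "j < a" for j using that by (auto split: if_splits)
  obtain p where p: "p permutes {0..<Suc b}" "(\<Prod>i = 0..<Suc b. dl (\<kappa> (p i)) i) \<noteq> (0 :: 'k)"
    using d unfolding dt_leibniz by (auto elim!: sum.not_neutral_contains_not_neutral)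
  have k: "\<kappa> (p i) = i" if "i \<le> b" for i
  proof (rule ccontr)
    assume "\<kappa> (p i) \<noteq> i"
    then have "(\<Prod>i = 0..<Suc b. dl (\<kappa> (p i)) i) = (0 :: 'k)" using that by (intro prod_zero) (auto intro!: bexI[of _ i])
    with p(2) show False by contradiction
  qed
  have "(\<Sum>i = 0..<Suc b. \<kappa> i) = (\<Sum>i = 0..<Suc b. \<kappa> (p i))"
    using sum.permute[OF p(1), of \<kappa>] by (simp add: comp_def)
  also have "\<dots> = (\<Sum>i = 0..<Suc b. i)" by (rule sum.cong) (simp_all add: k)
  finally show ?thesis using z by (simp add: tsum_def atLeast0LessThan lessThan_Suc_atMost)
qed

locale hook_down = hook_mod N l a b lo "to_down l" \<Psi> el
  for N :: "('k::field ^ 2 ^ 2, 'k, 'w) rep" and l a b lo \<Psi> el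

locale hook_up = hook_mod N l a b lo "to_up l" \<Psi> el
  for N :: "('k::field ^ 2 ^ 2, 'k, 'w) rep" and l a b lo \<Psi> el

context hook_down
begin

abbreviation "L \<equiv> l * (a + b + 1)"
abbreviation "T s \<equiv> {\<Psi> (el \<alpha> \<kappa>) | \<alpha> \<kappa>. idx \<alpha> \<kappa> \<and> tsum a b \<alpha> \<kappa> = s}"

lemma tor_mem: "t \<noteq> 0 \<Longrightarrow> tor t \<in> carrier SL2" by simp

text \<open>The component \<open>y s\<close> collects the generators of index sum \<open>s\<close>;
  they all share one character of the torus.\<close>

lemma weight_decomposition:
  assumes "x \<in> carrier N"
  shows "\<exists>y. (\<forall>s. y s \<in> fs.span (T s)) \<and> \<Psi> x = (\<Sum>s\<le>L. y s) \<and>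
    (\<forall>t. t \<noteq> 0 \<longrightarrow> \<Psi> (act N (tor t) x) = (\<Sum>s\<le>L. fscale (t ^ (L - s) * inverse t ^ s) (y s)))"
    (is "?P x")
proof (rule el_induct[OF assms])
  fix \<alpha> \<kappa> assume i: "idx \<alpha> \<kappa>"
  let ?s = "tsum a b \<alpha> \<kappa>"
  have s: "?s \<in> {..L}" using tsum_le[OF i] by simp
  define y where "y s = (if s = ?s then \<Psi> (el \<alpha> \<kappa>) else 0)" for s
  have "y s \<in> fs.span (T s)" for s
    unfolding y_def using i by (cases "s = ?s") (auto intro!: fs.span_base fs.span_zero)
  moreover have "\<Psi> (el \<alpha> \<kappa>) = (\<Sum>s\<le>L. y s)" unfolding y_def using s by (simp only: sum.delta finite_atMost if_True)
  moreover have "\<Psi> (act N (tor t) (el \<alpha> \<kappa>)) = (\<Sum>s\<le>L. fscale (t ^ (L - s) * inverse t ^ s) (y s))" if t: "t \<noteq> 0" for t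
  proof -
    have "(\<Sum>s\<le>L. fscale (t ^ (L - s) * inverse t ^ s) (y s)) =
        (\<Sum>s\<le>L. if s = ?s then fscale (t ^ (L - ?s) * inverse t ^ ?s) (\<Psi> (el \<alpha> \<kappa>)) else 0)"
      by (rule sum.cong) (simp_all add: y_def)
    also have "\<dots> = fscale (t ^ (L - ?s) * inverse t ^ ?s) (\<Psi> (el \<alpha> \<kappa>))"
      using s by (simp only: sum.delta finite_atMost if_True)
    finally show ?thesis by (simp only: \<Psi>_tor[OF i t] hookD_weight(1)[OF i] \<Psi>_el[OF i])
  qed
  ultimately show "?P (el \<alpha> \<kappa>)" by blast
next
  have "\<Psi> (act N (tor t) \<zero>\<^bsub>N\<^esub>) = 0" if "t \<noteq> 0" for t by (simp only: act_zero[OF tor_mem[OF that]] \<Psi>_zero)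
  then show "?P \<zero>\<^bsub>N\<^esub>"
    by (intro exI[of _ "\<lambda>_. 0"] conjI allI impI) (simp_all only: \<Psi>_zero fs.span_zero fs.scale_zero_right sum.neutral_const)
next
  fix x x' assume x: "x \<in> carrier N" "x' \<in> carrier N" and "?P x" "?P x'"
  then obtain y y' where y: "\<forall>s. y s \<in> fs.span (T s)" "\<Psi> x = (\<Sum>s\<le>L. y s)"
      "\<And>t. t \<noteq> 0 \<Longrightarrow> \<Psi> (act N (tor t) x) = (\<Sum>s\<le>L. fscale (t ^ (L - s) * inverse t ^ s) (y s))"
    and y': "\<forall>s. y' s \<in> fs.span (T s)" "\<Psi> x' = (\<Sum>s\<le>L. y' s)"
      "\<And>t. t \<noteq> 0 \<Longrightarrow> \<Psi> (act N (tor t) x') = (\<Sum>s\<le>L. fscale (t ^ (L - s) * inverse t ^ s) (y' s))"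
    by blast
  have 1: "y s + y' s \<in> fs.span (T s)" for s using y(1) y'(1) by (intro fs.span_add) blast+
  have 2: "\<Psi> (x \<oplus>\<^bsub>N\<^esub> x') = (\<Sum>s\<le>L. y s + y' s)" by (simp only: \<Psi>_add[OF x] y(2) y'(2) sum.distrib)
  have 3: "\<Psi> (act N (tor t) (x \<oplus>\<^bsub>N\<^esub> x')) = (\<Sum>s\<le>L. fscale (t ^ (L - s) * inverse t ^ s) (y s + y' s))"
    if t: "t \<noteq> 0" for t
    by (simp only: act_add[OF tor_mem[OF t] x] \<Psi>_add[OF act_closed[OF tor_mem[OF t] x(1)] act_closed[OF tor_mem[OF t] x(2)]]
      y(3)[OF t] y'(3)[OF t] fs.scale_right_distrib sum.distrib)
  show "?P (x \<oplus>\<^bsub>N\<^esub> x')" by (rule exI[of _ "\<lambda>s. y s + y' s"]) (use 1 2 3 in blast)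
next
  fix c x assume x: "x \<in> carrier N" and "?P x"
  then obtain y where y: "\<forall>s. y s \<in> fs.span (T s)" "\<Psi> x = (\<Sum>s\<le>L. y s)"
      "\<And>t. t \<noteq> 0 \<Longrightarrow> \<Psi> (act N (tor t) x) = (\<Sum>s\<le>L. fscale (t ^ (L - s) * inverse t ^ s) (y s))"
    by blast
  have 1: "fscale c (y s) \<in> fs.span (T s)" for s using y(1) by (intro fs.span_scale) blast
  have 2: "\<Psi> (c \<odot>\<^bsub>N\<^esub> x) = (\<Sum>s\<le>L. fscale c (y s))" by (simp only: \<Psi>_smult[OF x] y(2) fs.scale_sum_right)
  have 3: "\<Psi> (act N (tor t) (c \<odot>\<^bsub>N\<^esub> x)) = (\<Sum>s\<le>L. fscale (t ^ (L - s) * inverse t ^ s) (fscale c (y s)))"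
    if t: "t \<noteq> 0" for t
    by (simp only: act_smult[OF tor_mem[OF t] x] \<Psi>_smult[OF act_closed[OF tor_mem[OF t] x]]
      y(3)[OF t] fs.scale_sum_right fs.scale_scale mult.commute[of c])
  show "?P (c \<odot>\<^bsub>N\<^esub> x)" by (rule exI[of _ "\<lambda>s. fscale c (y s)"]) (use 1 2 3 in blast)
qed

lemma span_T_trivial:
  assumes "y \<in> fs.span (T s)" and "s < \<Sum>{..b} \<or> L < s + \<Sum>{..b}"
  shows "y = 0"
proof -
  have "T s \<subseteq> {0}"
  proof
    fix F assume "F \<in> T s"
    then obtain \<alpha> \<kappa> where F: "F = \<Psi> (el \<alpha> \<kappa>)" "idx \<alpha> \<kappa>" "tsum a b \<alpha> \<kappa> = s" by blast
    show "F \<in> {0}"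
    proof (rule ccontr)
      assume "F \<notin> {0}"
      then have "hookD l a b \<alpha> \<kappa> \<noteq> (0 :: 'k mfun)" using F by (simp add: \<Psi>_el)
      from hookD_tsum_bounds[OF this F(2)] F(3) assms(2) show False by (auto simp: tsum_def)
    qed
  qed
  then have "fs.span (T s) \<subseteq> {0}" by (rule fs.span_minimal) (rule fs.subspace_single_0)
  then show ?thesis using assms(1) by blast
qed

text \<open>Over a finite field an eigenvector of the torus might mix weights congruent modulo
  \<open>|K| - 1\<close>. Nonzero components have weights between \<open>-h\<close> and
  \<open>h\<close>, a window that the field is large enough to separate.\<close>

lemma wvec_span:
  assumes v: "wvec N w v" and h: "h + 2 * \<Sum>{..b} = L" "w + 2 * e = h"
    and small: "finite (UNIV :: 'k set) \<Longrightarrow> Suc (2 * h) < card (UNIV :: 'k set)"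
  shows "\<Psi> v \<in> fs.span (T (\<Sum>{..b} + e))"
proof -
  let ?B = "\<Sum>{..b}"
  let ?s = "?B + e" and ?R = "{?B..L - ?B}"
  have m: "v \<in> carrier N" using v by (simp add: wvec_def)
  obtain y where y: "\<And>s. y s \<in> fs.span (T s)" "\<Psi> v = (\<Sum>s\<le>L. y s)"
      "\<And>t. t \<noteq> 0 \<Longrightarrow> \<Psi> (act N (tor t) v) = (\<Sum>s\<le>L. fscale (t ^ (L - s) * inverse t ^ s) (y s))"
    using weight_decomposition[OF m] by blast
  have y0: "y s = 0" if "s \<notin> ?R" for s
    
  proof (rule span_T_trivial[OF y(1)])
    have "?B \<le> L" using h(1) by linarith
    then show "s < ?B \<or> L < s + ?B" using that unfolding atLeastAtMost_iff by linarith
  qed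
  have z: "y s = 0" if ne: "s \<noteq> ?s" for s
  proof (cases "s \<in> ?R")
    case True
    have "lookup (y s cs) M = 0" for cs M
    proof -
      define c where "c s = lookup (y s cs) M" for s
      define Y where "Y = lookup (\<Psi> v cs) M"
      have lk: "lookup (sum F A cs) M = (\<Sum>x\<in>A. lookup (F x cs) M)" for F :: "nat \<Rightarrow> 'k mfun" and A
        by (induction A rule: infinite_finite_induct) (simp_all add: lookup_add)
      have R: "(\<Sum>s\<le>L. f s * c s) = (\<Sum>s\<in>?R. f s * c s)" for f
        by (rule sum.mono_neutral_right) (use y0 in \<open>auto simp: c_def\<close>)
      \<comment> \<open>After multiplication by \<open>t ^ h\<close>, component \<open>s\<close>
        carries the exponent \<open>2 (L - \<Sum>{..b} - s)\<close>. The eigenvector equation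
        becomes, coefficient by coefficient, a polynomial identity of degree at most
        \<open>2 h\<close>.\<close>
      let ?P = "(\<Sum>s\<in>?R. monom (c s) (2 * (L - ?B - s))) - monom Y (w + h)"
      have "?P = 0"
      proof (rule poly_eq_0_units)
        fix t :: 'k assume t: "t \<noteq> 0"
        have g: "t ^ w * Y = (\<Sum>s\<in>?R. t ^ (L - s) * inverse t ^ s * c s)"
        proof -
          have "t ^ w * Y = lookup (fscale (t ^ w) (\<Psi> v) cs) M"
            by (simp add: fscale_def lookup_const_mult Y_def)
          also have "fscale (t ^ w) (\<Psi> v) = \<Psi> (act N (tor t) v)"
            using v t by (simp add: wvec_def \<Psi>_smult[OF m])
          also have "lookup (\<Psi> (act N (tor t) v) cs) M = (\<Sum>s\<le>L. t ^ (L - s) * inverse t ^ s * c s)"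
            unfolding y(3)[OF t] lk by (simp add: fscale_def lookup_const_mult c_def)
          finally show ?thesis by (simp only: R)
        qed
        have "(\<Sum>s\<in>?R. t ^ (2 * (L - ?B - s)) * c s) = t ^ h * (\<Sum>s\<in>?R. t ^ (L - s) * inverse t ^ s * c s)"
          unfolding sum_distrib_left
        proof (rule sum.cong)
          fix s assume s: "s \<in> ?R"
          then have "2 * (L - ?B - s) + s = h + (L - s)" using h by auto
          then have "t ^ (2 * (L - ?B - s)) * t ^ s = t ^ h * t ^ (L - s)" by (simp only: power_add[symmetric])
          then show "t ^ (2 * (L - ?B - s)) * c s = t ^ h * (t ^ (L - s) * inverse t ^ s * c s)"
            using t by (simp add: power_inverse field_simps)
        qed simp
        then show "poly ?P t = 0"
          unfolding g[symmetric] by (simp add: Polynomial.poly_monom poly_sum power_add mult_ac)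
      next
        assume "finite (UNIV :: 'k set)"
        moreover have "degree ?P \<le> 2 * h"
        proof (rule degree_diff_le)
          show "degree (\<Sum>s\<in>?R. monom (c s) (2 * (L - ?B - s))) \<le> 2 * h"
            by (rule degree_sum_le[OF finite_atLeastAtMost], rule order_trans[OF degree_monom_le]) (use h in auto)
          show "degree (monom Y (w + h)) \<le> 2 * h"
            by (rule order_trans[OF degree_monom_le]) (use h in auto)
        qed
        ultimately show "Suc (degree ?P) < card (UNIV :: 'k set)" using small by linarith
      qed
      then have "coeff ?P (2 * (L - ?B - s)) = 0" by simp
      moreover have "2 * (L - ?B - s) \<noteq> w + h" using True ne h by auto
      moreover have "(\<Sum>s'\<in>?R. coeff (monom (c s') (2 * (L - ?B - s'))) (2 * (L - ?B - s))) =
          (\<Sum>s'\<in>?R. if s' = s then c s else 0)"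
        by (rule sum.cong) (use True in auto)
      ultimately show ?thesis using True by (simp add: Polynomial.coeff_sum c_def)
    qed
    then show ?thesis by (auto simp: fun_eq_iff intro: poly_mapping_eqI)
  qed (rule y0)
  have "\<Psi> v = (\<Sum>s\<le>L. if s = ?s then y ?s else 0)"
    unfolding y(2) by (rule sum.cong) (use z in auto)
  also have "\<dots> = y ?s" using h by (simp add: sum.delta)
  finally show ?thesis using y(1) by simp
qed

text \<open>The case of excess 0: the highest weight space is spanned by the tableau with zero arm
  and leg \<open>0, ..., b\<close>, so matrix coefficients need to be computed on this one vector
  only.\<close>

lemma wvec_top:
  assumes v: "wvec N h v" and h: "h + 2 * \<Sum>{..b} = L"
    and small: "finite (UNIV :: 'k set) \<Longrightarrow> Suc (2 * h) < card (UNIV :: 'k set)"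
    and "b \<le> l"
  obtains c where "v = c \<odot>\<^bsub>N\<^esub> el (\<lambda>_. 0) (\<lambda>i. i)"
proof -
  let ?E = "el (\<lambda>_. 0) (\<lambda>i. i)"
  have i0: "idx (\<lambda>_. 0) (\<lambda>i. i)" using \<open>b \<le> l\<close> by (simp add: hidx_def)
  have m: "v \<in> carrier N" using v by (simp add: wvec_def)
  have "\<Psi> v \<in> fs.span (T (\<Sum>{..b} + 0))" by (rule wvec_span[OF v h _ small]) simp
  moreover have "T (\<Sum>{..b} + 0) \<subseteq> fs.span {\<Psi> ?E}"
    using hookD_top_span by (auto simp: \<Psi>_el i0)
  then have "fs.span (T (\<Sum>{..b} + 0)) \<subseteq> fs.span {\<Psi> ?E}"
    by (rule fs.span_minimal) (rule fs.subspace_span)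
  ultimately have "\<Psi> v \<in> fs.span {\<Psi> ?E}" by blast
  then obtain c where "\<Psi> v = fscale c (\<Psi> ?E)" by (auto simp: fs.span_singleton)
  then have "\<Psi> v = \<Psi> (c \<odot>\<^bsub>N\<^esub> ?E)" by (simp only: \<Psi>_smult[OF el_mem[OF i0]])
  then have "v = c \<odot>\<^bsub>N\<^esub> ?E" by (rule \<Psi>_inj[OF m closed(2)[OF el_mem[OF i0]]])
  then show ?thesis by (rule that)
qed

lemma wvec_el:
  assumes i: "idx \<alpha> \<kappa>" and w: "w + 2 * tsum a b \<alpha> \<kappa> = L"
  shows "wvec N w (el \<alpha> \<kappa>)"
  unfolding wvec_def
proof (intro conjI allI impI)
  show m: "el \<alpha> \<kappa> \<in> carrier N" by (rule el_mem[OF i])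
  fix t :: 'k assume t: "t \<noteq> 0"
  have "L - tsum a b \<alpha> \<kappa> = w + tsum a b \<alpha> \<kappa>" using w by simp
  then have p: "t ^ (L - tsum a b \<alpha> \<kappa>) * inverse t ^ tsum a b \<alpha> \<kappa> = t ^ w"
    using t by (simp add: power_add power_inverse)
  show "act N (tor t) (el \<alpha> \<kappa>) = t ^ w \<odot>\<^bsub>N\<^esub> el \<alpha> \<kappa>"
  proof (rule \<Psi>_inj)
    show "\<Psi> (act N (tor t) (el \<alpha> \<kappa>)) = \<Psi> (t ^ w \<odot>\<^bsub>N\<^esub> el \<alpha> \<kappa>)"
      unfolding \<Psi>_tor[OF i t] hookD_weight(1)[OF i] \<Psi>_smult[OF m] \<Psi>_el[OF i] p ..
  qed (rule act_closed[OF tor_mem[OF t] m], rule closed(2)[OF m])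
qed

end

context hook_up
begin

abbreviation "L \<equiv> l * (a + b + 1)"

lemma tor_inv: "t \<noteq> 0 \<Longrightarrow> tor (inverse t) \<in> carrier SL2" by simp

text \<open>Stated for the inverse of \<open>t\<close> because a functional is moved by the inverse
  group element.\<close>

lemma tor_el:
  assumes i: "idx \<alpha> \<kappa>" and t: "t \<noteq> 0"
  shows "act N (tor (inverse t)) (el \<alpha> \<kappa>) = (t ^ (L - tsum a b \<alpha> \<kappa>) * inverse t ^ tsum a b \<alpha> \<kappa>) \<odot>\<^bsub>N\<^esub> el \<alpha> \<kappa>"
proof (rule \<Psi>_inj)
  note m = el_mem[OF i]
  have "inverse t \<noteq> 0" using t by simp
  from \<Psi>_tor[OF i this] show "\<Psi> (act N (tor (inverse t)) (el \<alpha> \<kappa>)) =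
      \<Psi> ((t ^ (L - tsum a b \<alpha> \<kappa>) * inverse t ^ tsum a b \<alpha> \<kappa>) \<odot>\<^bsub>N\<^esub> el \<alpha> \<kappa>)"
    by (simp only: hookD_weight(2)[OF i] \<Psi>_smult[OF m] \<Psi>_el[OF i] inverse_inverse_eq mult.commute)
qed (rule act_closed[OF tor_inv[OF t] el_mem[OF i]], rule closed(2)[OF el_mem[OF i]])

lemma dual_act: "x \<in> carrier N \<Longrightarrow> t \<noteq> 0 \<Longrightarrow> act (dual_rep SL2 N) (tor t) \<psi> x = \<psi> (act N (tor (inverse t)) x)"
  by (simp add: dual_simps(5) inv_tor)

lemma dual_low: "x \<in> carrier N \<Longrightarrow> act (dual_rep SL2 N) (low z) \<psi> x = \<psi> (act N (low (- z)) x)"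
  by (simp add: dual_simps(5) inv_low)

text \<open>A functional of weight \<open>h\<close> vanishes on generators with another character,
  and generators of minimal index sum are multiples of a single one. So it is a multiple of the
  coordinate \<open>crd0\<close>.\<close>

lemma top_functional:
  assumes \<psi>: "wvec (dual_rep SL2 N) h \<psi>" and h: "h + 2 * \<Sum>{..b} = L"
    and small: "finite (UNIV :: 'k set) \<Longrightarrow> Suc (2 * h) < card (UNIV :: 'k set)"
    and bl: "b \<le> l" and x: "x \<in> carrier N"
  shows "\<psi> x = \<psi> (el (\<lambda>_. 0) (\<lambda>i. i)) * crd0 [1..<Suc b] (\<Psi> x)"
proof (rule el_induct[OF x])
  have c: "\<psi> \<in> carrier (dual_rep SL2 N)" using \<psi> by (simp add: wvec_def)
  let ?E = "el (\<lambda>_. 0) (\<lambda>i. i)"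
  have i0: "idx (\<lambda>_. 0) (\<lambda>i. i)" using bl by (simp add: hidx_def)
  note lin = fn_linearD[OF fn_linear_crd0[of "[1..<Suc b]"]]
  {
    fix \<alpha> \<kappa> assume i: "idx \<alpha> \<kappa>"
    note m = el_mem[OF i]
    show "\<psi> (el \<alpha> \<kappa>) = \<psi> ?E * crd0 [1..<Suc b] (\<Psi> (el \<alpha> \<kappa>))"
    proof (cases "tsum a b \<alpha> \<kappa> = \<Sum>{..b}")
      case True
      obtain c where "\<Psi> (el \<alpha> \<kappa>) = fscale c (\<Psi> ?E)"
        using hookD_top_span[OF i True] by (auto simp: fs.span_singleton \<Psi>_el i i0)
      then have e: "\<Psi> (el \<alpha> \<kappa>) = \<Psi> (c \<odot>\<^bsub>N\<^esub> ?E)" by (simp only: \<Psi>_smult[OF el_mem[OF i0]])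
      then have "el \<alpha> \<kappa> = c \<odot>\<^bsub>N\<^esub> ?E" by (rule \<Psi>_inj[OF m closed(2)[OF el_mem[OF i0]]])
      then have "\<psi> (el \<alpha> \<kappa>) = c * \<psi> ?E" by (simp only: dualD(2)[OF \<open>\<psi> \<in> carrier _\<close> el_mem[OF i0]])
      moreover have "crd0 [1..<Suc b] (\<Psi> (el \<alpha> \<kappa>)) = c"
        unfolding e \<Psi>_smult[OF el_mem[OF i0]] lin(2) \<Psi>_el[OF i0] crd0_hookD_0[OF bl] by simp
      ultimately show ?thesis by simp
    next
      case False
      then have "crd0 [1..<Suc b] (\<Psi> (el \<alpha> \<kappa>)) = 0"
        using crd0_hookD_tsum[OF bl, of a \<alpha> \<kappa>, where 'k = 'k] unfolding \<Psi>_el[OF i] by blast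
      moreover have "\<psi> (el \<alpha> \<kappa>) = 0"
      proof (rule ccontr)
        assume ne: "\<psi> (el \<alpha> \<kappa>) \<noteq> 0"
        have "el \<alpha> \<kappa> \<noteq> \<zero>\<^bsub>N\<^esub>"
        proof
          assume "el \<alpha> \<kappa> = \<zero>\<^bsub>N\<^esub>"
          then have "el \<alpha> \<kappa> = 0 \<odot>\<^bsub>N\<^esub> el \<alpha> \<kappa>" using module_closed(4)[OF mod m] by simp
          then have "\<psi> (el \<alpha> \<kappa>) = 0 * \<psi> (el \<alpha> \<kappa>)" using dualD(2)[OF c m, of 0] by simp
          then show False using ne by simp
        qed
        then have "hookD l a b \<alpha> \<kappa> \<noteq> (0 :: 'k mfun)"
          using \<Psi>_inj[OF m closed(3)] by (auto simp: \<Psi>_el[OF i] \<Psi>_zero)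
        note bd = hookD_tsum_bounds[OF this i]
        have "L - tsum a b \<alpha> \<kappa> = h + tsum a b \<alpha> \<kappa>"
        proof (rule units_power_eq[where m = "2 * h" and 'k = 'k])
          fix t :: 'k assume t: "t \<noteq> 0"
          have "t ^ h * \<psi> (el \<alpha> \<kappa>) = (t ^ h \<odot>\<^bsub>dual_rep SL2 N\<^esub> \<psi>) (el \<alpha> \<kappa>)" using m by (simp add: dual_simps(4))
          also have "\<dots> = act (dual_rep SL2 N) (tor t) \<psi> (el \<alpha> \<kappa>)" using \<psi> t by (simp add: wvec_def)
          also have "\<dots> = (t ^ (L - tsum a b \<alpha> \<kappa>) * inverse t ^ tsum a b \<alpha> \<kappa>) * \<psi> (el \<alpha> \<kappa>)"
            by (simp only: dual_act[OF m t] tor_el[OF i t] dualD(2)[OF c m])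
          finally show "t ^ (L - tsum a b \<alpha> \<kappa>) * inverse t ^ tsum a b \<alpha> \<kappa> = t ^ h" using ne by simp
        next
          show "h + tsum a b \<alpha> \<kappa> \<le> 2 * h + (L - tsum a b \<alpha> \<kappa>)" using bd(2) h by linarith
          have "\<Sum>{..b} \<le> tsum a b \<alpha> \<kappa>" using bd(1) by (simp add: tsum_def)
          then show "L - tsum a b \<alpha> \<kappa> \<le> 2 * h + (h + tsum a b \<alpha> \<kappa>)" using h by linarith
        qed (rule small)
        then show False using False h bd(2) by linarith
      qed
      ultimately show ?thesis by simp
    qed
  next
    have "\<psi> \<zero>\<^bsub>N\<^esub> = 0" using dualD(2)[OF c closed(3), of 0] module_closed(4)[OF mod closed(3)] by simp
    then show "\<psi> \<zero>\<^bsub>N\<^esub> = \<psi> ?E * crd0 [1..<Suc b] (\<Psi> \<zero>\<^bsub>N\<^esub>)"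
      using lin(2)[of "0 :: 'k" 0] by (simp add: \<Psi>_zero del: upt_Suc)
  next
    fix x y assume xy: "x \<in> carrier N" "y \<in> carrier N"
      and "\<psi> x = \<psi> ?E * crd0 [1..<Suc b] (\<Psi> x)" "\<psi> y = \<psi> ?E * crd0 [1..<Suc b] (\<Psi> y)"
    then show "\<psi> (x \<oplus>\<^bsub>N\<^esub> y) = \<psi> ?E * crd0 [1..<Suc b] (\<Psi> (x \<oplus>\<^bsub>N\<^esub> y))"
      unfolding dualD(1)[OF c xy] \<Psi>_add[OF xy] lin(1) by (simp only: distrib_left)
  next
    fix k x assume x: "x \<in> carrier N" and "\<psi> x = \<psi> ?E * crd0 [1..<Suc b] (\<Psi> x)"
    then show "\<psi> (k \<odot>\<^bsub>N\<^esub> x) = \<psi> ?E * crd0 [1..<Suc b] (\<Psi> (k \<odot>\<^bsub>N\<^esub> x))"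
      unfolding dualD(2)[OF c x] \<Psi>_smult[OF x] lin(2) by (simp only: mult.left_commute)
  }
qed

text \<open>\<open>crd0\<close> vanishes on all generators except those of minimal index sum, and
  these share the character that gives weight \<open>h\<close> in the dual.\<close>

lemma crd0_wvec:
  assumes h: "h + 2 * \<Sum>{..b} = L" and bl: "b \<le> l"
  shows "wvec (dual_rep SL2 N) h (\<lambda>x\<in>carrier N. crd0 [1..<Suc b] (\<Psi> x))" (is "wvec _ _ ?\<psi>")
  unfolding wvec_def
proof (intro conjI allI impI)
  show c: "?\<psi> \<in> carrier (dual_rep SL2 N)" by (rule dual_restrict[OF fn_linear_crd0])
  note lin = fn_linearD[OF fn_linear_crd0[of "[1..<Suc b]"]]
  fix t :: 'k assume t: "t \<noteq> 0"
  note g = tor_inv[OF t]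
  have eq: "?\<psi> (act N (tor (inverse t)) x) = t ^ h * ?\<psi> x" if x: "x \<in> carrier N" for x
  proof (rule el_induct[OF x])
    fix \<alpha> \<kappa> assume i: "idx \<alpha> \<kappa>"
    note m = el_mem[OF i]
    show "?\<psi> (act N (tor (inverse t)) (el \<alpha> \<kappa>)) = t ^ h * ?\<psi> (el \<alpha> \<kappa>)"
    proof (cases "tsum a b \<alpha> \<kappa> = \<Sum>{..b}")
      case True
      then have "L - tsum a b \<alpha> \<kappa> = h + tsum a b \<alpha> \<kappa>" using h by simp
      then have "t ^ (L - tsum a b \<alpha> \<kappa>) * inverse t ^ tsum a b \<alpha> \<kappa> = t ^ h"
        using t by (simp add: power_add power_inverse)
      then show ?thesis by (simp only: tor_el[OF i t] dualD(2)[OF c m])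
    next
      case False
      then have "crd0 [1..<Suc b] (\<Psi> (el \<alpha> \<kappa>)) = 0"
        using crd0_hookD_tsum[OF bl, of a \<alpha> \<kappa>, where 'k = 'k] unfolding \<Psi>_el[OF i] by blast
      then have "?\<psi> (el \<alpha> \<kappa>) = 0" using m by simp
      then show ?thesis by (simp only: tor_el[OF i t] dualD(2)[OF c m] mult_zero_right)
    qed
  next
    have "?\<psi> \<zero>\<^bsub>N\<^esub> = 0" using lin(2)[of "0 :: 'k" 0] by (simp add: \<Psi>_zero closed(3) del: upt_Suc)
    then show "?\<psi> (act N (tor (inverse t)) \<zero>\<^bsub>N\<^esub>) = t ^ h * ?\<psi> \<zero>\<^bsub>N\<^esub>" by (simp only: act_zero[OF g] mult_zero_right)
  next
    fix x y assume xy: "x \<in> carrier N" "y \<in> carrier N"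
      and "?\<psi> (act N (tor (inverse t)) x) = t ^ h * ?\<psi> x" "?\<psi> (act N (tor (inverse t)) y) = t ^ h * ?\<psi> y"
    then show "?\<psi> (act N (tor (inverse t)) (x \<oplus>\<^bsub>N\<^esub> y)) = t ^ h * ?\<psi> (x \<oplus>\<^bsub>N\<^esub> y)"
      unfolding act_add[OF g xy] dualD(1)[OF c act_closed[OF g xy(1)] act_closed[OF g xy(2)]] dualD(1)[OF c xy]
      by (simp only: distrib_left)
  next
    fix k x assume x: "x \<in> carrier N" and "?\<psi> (act N (tor (inverse t)) x) = t ^ h * ?\<psi> x"
    then show "?\<psi> (act N (tor (inverse t)) (k \<odot>\<^bsub>N\<^esub> x)) = t ^ h * ?\<psi> (k \<odot>\<^bsub>N\<^esub> x)"
      unfolding act_smult[OF g x] dualD(2)[OF c act_closed[OF g x]] dualD(2)[OF c x]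
      by (simp only: mult.left_commute)
  qed
  have "act (dual_rep SL2 N) (tor t) ?\<psi> = (\<lambda>x\<in>carrier N. ?\<psi> (act N (tor (inverse t)) x))"
    by (simp only: dual_simps(5) inv_tor[OF t])
  also have "\<dots> = (\<lambda>x\<in>carrier N. t ^ h * ?\<psi> x)"
    by (rule restrict_ext) (rule eq)
  finally show "act (dual_rep SL2 N) (tor t) ?\<psi> = t ^ h \<odot>\<^bsub>dual_rep SL2 N\<^esub> ?\<psi>"
    by (simp only: dual_simps(4))
qed

end

subsection \<open>Binomial coefficients in characteristic \<open>p\<close>\<close>

text \<open>Frobenius is applied to polynomials in \<open>z\<close> whose coefficients are
  polynomials in the \<open>x_i\<close>, so the characteristic of the coefficient ring is
  needed.\<close>

lemma CHAR_sym: "CHAR(('k::field) mpol) = CHAR('k)"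
proof (rule CHAR_eqI)
  have s: "(of_nat m :: 'k mpol) = single {#} (of_nat m)" for m
    using single_of_int[of "int m", where 'k = 'k] by simp
  show "(of_nat CHAR('k) :: 'k mpol) = 0" by (simp only: s of_nat_CHAR single_zero)
  fix m assume "(of_nat m :: 'k mpol) = 0"
  then have "lookup (single {#} (of_nat m) :: 'k mpol) {#} = 0" by (simp only: s lookup_zero)
  then have "(of_nat m :: 'k) = 0" by (simp only: lookup_single_eq)
  then show "CHAR('k) dvd m" by (simp only: of_nat_eq_0_iff_char_dvd)
qed

lemma coeff_one_plus_power: "coeff ([:1, 1:] ^ m) k = (of_nat (m choose k) :: 'k::field)"
proof (cases "k \<le> m")
  case False
  then have "degree ([:1, 1 :: 'k:] ^ m) < k" using degree_power_le[of "[:1, 1 :: 'k:]" m] by simp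
  then show ?thesis using False by (simp add: Polynomial.coeff_eq_0 binomial_eq_0)
qed (simp add: coeff_linear_poly_power)

text \<open>Compare coefficients in \<open>(1 + X)^(Q+m) = (1 + X^Q) (1 + X)^m\<close>.\<close>

lemma binomial_char:
  assumes "prime p" "CHAR('k::field) = p" and Q: "Q = p ^ e"
  shows "(of_nat ((Q + m) choose k) :: 'k) = of_nat (m choose k) + (if Q \<le> k then of_nat (m choose (k - Q)) else 0)"
proof -
  have "[:1, 1 :: 'k:] ^ Q = (1 + monom 1 1) ^ Q" by (simp add: monom_altdef one_pCons)
  also have "\<dots> = 1 ^ Q + monom 1 1 ^ Q" by (rule freshmans_dream'[where n = e]) (use assms in simp_all)
  also have "\<dots> = 1 + monom 1 Q" by (simp add: Polynomial.monom_power)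
  finally have "[:1, 1 :: 'k:] ^ (Q + m) = [:1, 1:] ^ m + monom 1 Q * [:1, 1:] ^ m"
    by (simp add: power_add distrib_right)
  then have "coeff ([:1, 1 :: 'k:] ^ (Q + m)) k =
      coeff ([:1, 1:] ^ m) k + coeff (monom 1 Q * [:1, 1:] ^ m) k" by simp
  then show ?thesis by (simp add: coeff_one_plus_power Polynomial.coeff_monom_mult)
qed

lemma binomial_char_power:
  assumes "prime p" "CHAR('k::field) = p" "Q = p ^ e"
  shows "(of_nat (Q choose k) :: 'k) = (if k = 0 \<or> k = Q then 1 else 0)"
proof -
  have "Q > 0" using assms by (simp add: prime_gt_0_nat)
  with binomial_char[OF assms, of 0 k] show ?thesis by (cases "k = Q") (auto simp: binomial_eq_0)
qed

subsection \<open>Models of the four families\<close>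

text \<open>The matrices of \<open>low z\<close> on upper (\<open>gm\<close>) and lower (\<open>bm\<close>) symmetric powers. Reversing the
  basis of a lower symmetric power transposes \<open>bm\<close> into \<open>gm\<close>, and dualising exchanges the two.\<close>

definition gm :: "nat \<Rightarrow> 'k::field \<Rightarrow> nat \<Rightarrow> nat \<Rightarrow> 'k" where
  "gm l z i c = (if i \<le> c \<and> c \<le> l then of_nat ((l - i) choose (c - i)) * z ^ (c - i) else 0)"

definition bm :: "nat \<Rightarrow> 'k::field \<Rightarrow> nat \<Rightarrow> nat \<Rightarrow> 'k" where
  "bm l z i c = (if i \<le> c \<and> c \<le> l then of_nat (c choose i) * z ^ (c - i) else 0)"

lemma hook_mod_cong:
  assumes "hook_mod N l a b lo to \<Psi> el" and eq: "\<And>z i. i \<le> l \<Longrightarrow> lo z i = lo' z i"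
  shows "hook_mod N l a b lo' to \<Psi> el"
proof -
  interpret hook_mod N l a b lo to \<Psi> el by fact
  have low: "\<Psi> (act N (low z) (el \<alpha> \<kappa>)) = hookE {..l} a b (\<lambda>j. lo' z (\<alpha> j)) (\<lambda>i. lo' z (\<kappa> i))"
    if "hidx l a b \<alpha> \<kappa>" for z \<alpha> \<kappa>
    unfolding \<Psi>_low[OF that] by (rule hookE_cong) (use that in \<open>auto simp: hidx_def eq\<close>)
  show ?thesis
    by (rule hook_mod.intro) (fact mod actl \<Psi>_add \<Psi>_smult \<Psi>_inj el_mem \<Psi>_el low \<Psi>_tor el_induct)+
qed

locale nabla_upper = hook_down N l a b "gm l" \<Psi> el
  for N :: "('k::field ^ 2 ^ 2, 'k, 'w) rep" and l a b \<Psi> el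

locale nabla_lower = hook_down N l a b "bm l" \<Psi> el
  for N :: "('k::field ^ 2 ^ 2, 'k, 'w) rep" and l a b \<Psi> el

locale nabla_dual_upper = hook_up N l a b "\<lambda>z i j. gm l z j i" \<Psi> el
  for N :: "('k::field ^ 2 ^ 2, 'k, 'w) rep" and l a b \<Psi> el

locale nabla_dual_lower = hook_up N l a b "\<lambda>z i j. bm l z j i" \<Psi> el
  for N :: "('k::field ^ 2 ^ 2, 'k, 'w) rep" and l a b \<Psi> el

lemma choose_diff: "i \<le> j \<Longrightarrow> j \<le> l \<Longrightarrow> (l - i) choose (l - j) = (l - i) choose (j - i)"
  using binomial_symmetric[of "l - j" "l - i"] by simp

lemma nabla_upperI:
  fixes V :: "('k::field ^ 2 ^ 2, 'k, 'v) rep"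
  assumes w: "\<exists>\<phi>. wt_model V l \<phi> c" and c: "\<And>i j. i \<le> j \<Longrightarrow> j \<le> l \<Longrightarrow> c i j = upc l i j"
  shows "\<exists>\<Psi> el. nabla_upper (nabla (hook a b) V) l a b \<Psi> el"
proof -
  obtain \<phi> where "wt_model V l \<phi> c" using w by blast
  from hook_mod_down[OF this] obtain \<Psi> el where
    m: "hook_mod (nabla (hook a b) V) l a b (lo_down l c) (to_down l) \<Psi> el" by blast
  show ?thesis
    by (rule exI, rule exI, intro nabla_upper.intro hook_down.intro, rule hook_mod_cong[OF m])
      (simp add: fun_eq_iff lo_down_def gm_def c)
qed

lemma nabla_lowerI:
  fixes V :: "('k::field ^ 2 ^ 2, 'k, 'v) rep"
  assumes w: "\<exists>\<phi>. wt_model V l \<phi> c" and c: "\<And>i j. i \<le> j \<Longrightarrow> j \<le> l \<Longrightarrow> c i j = loc i j"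
  shows "\<exists>\<Psi> el. nabla_lower (nabla (hook a b) V) l a b \<Psi> el"
proof -
  obtain \<phi> where "wt_model V l \<phi> c" using w by blast
  from hook_mod_down[OF this] obtain \<Psi> el where
    m: "hook_mod (nabla (hook a b) V) l a b (lo_down l c) (to_down l) \<Psi> el" by blast
  show ?thesis
    by (rule exI, rule exI, intro nabla_lower.intro hook_down.intro, rule hook_mod_cong[OF m])
      (simp add: fun_eq_iff lo_down_def bm_def c)
qed

lemma nabla_dual_upperI:
  fixes V :: "('k::field ^ 2 ^ 2, 'k, 'v) rep"
  assumes w: "\<exists>\<phi>. wt_model V l \<phi> c" and c: "\<And>i j. i \<le> j \<Longrightarrow> j \<le> l \<Longrightarrow> c i j = loc i j"
  shows "\<exists>\<Psi> el. nabla_dual_upper (nabla (hook a b) V) l a b \<Psi> el"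
proof -
  obtain \<phi> where "wt_model V l \<phi> c" using w by blast
  from hook_mod_up[OF this] obtain \<Psi> el where
    m: "hook_mod (nabla (hook a b) V) l a b (lo_up l c) (to_up l) \<Psi> el" by blast
  show ?thesis
    by (rule exI, rule exI, intro nabla_dual_upper.intro hook_up.intro, rule hook_mod_cong[OF m])
      (simp add: fun_eq_iff lo_up_def gm_def c choose_diff)
qed

lemma nabla_dual_lowerI:
  fixes V :: "('k::field ^ 2 ^ 2, 'k, 'v) rep"
  assumes w: "\<exists>\<phi>. wt_model V l \<phi> c" and c: "\<And>i j. i \<le> j \<Longrightarrow> j \<le> l \<Longrightarrow> c i j = upc l i j"
  shows "\<exists>\<Psi> el. nabla_dual_lower (nabla (hook a b) V) l a b \<Psi> el"
proof -
  obtain \<phi> where "wt_model V l \<phi> c" using w by blast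
  from hook_mod_up[OF this] obtain \<Psi> el where
    m: "hook_mod (nabla (hook a b) V) l a b (lo_up l c) (to_up l) \<Psi> el" by blast
  have e: "i choose (i - j) = i choose j" if "j \<le> i" for i j :: nat
    using binomial_symmetric[OF that] by simp
  show ?thesis
    by (rule exI, rule exI, intro nabla_dual_lower.intro hook_up.intro, rule hook_mod_cong[OF m])
      (simp add: fun_eq_iff lo_up_def bm_def c e)
qed

subsection \<open>The invariants of the lower symmetric powers\<close>

text \<open>The function \<open>f\<close> selects which leg coordinates are observed. Its value at 0
  is tied to the corner box, which shares the variable \<open>x_0\<close> with the arm.\<close>

lemma crd0_map:
  assumes "f 0 = 0" "\<And>i. i \<le> b \<Longrightarrow> f i \<le> l"
  shows "crd0 (map f [1..<Suc b]) (hookE {..l} a b \<alpha> \<kappa>) = dt (Suc b) (\<lambda>i j. \<kappa> j (f i)) * (\<Prod>j<a. \<alpha> j 0)"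
proof -
  have "crd0 (map f [1..<Suc b]) (hookE {..l} a b \<alpha> \<kappa>) =
      dt (Suc b) (\<lambda>i j. \<kappa> j ((0 # map f [1..<Suc b]) ! i)) * (\<Prod>j<a. \<alpha> j 0)"
    by (rule crd0_hookE) (use assms(2) in \<open>auto simp: less_Suc_eq_le simp del: upt_Suc\<close>)
  also have "dt (Suc b) (\<lambda>i j. \<kappa> j ((0 # map f [1..<Suc b]) ! i)) = dt (Suc b) (\<lambda>i j. \<kappa> j (f i))"
    by (rule dt_cong) (use assms(1) in \<open>simp add: nth_Cons' del: upt_Suc\<close>)
  finally show ?thesis .
qed

lemma crd0_upt:
  assumes "b \<le> l"
  shows "crd0 [1..<Suc b] (hookE {..l} a b \<alpha> \<kappa>) = dt (Suc b) (\<lambda>i j. \<kappa> j i) * (\<Prod>j<a. \<alpha> j 0)"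
  using crd0_map[of "\<lambda>i. i" b l a \<alpha> \<kappa>] assms by simp

lemma DinvI:
  assumes "wvec V w v" "\<psi> \<in> carrier (dual_rep SL2 V)" "\<And>z. \<psi> (act V (low z) v) = c * z ^ k" "c \<noteq> 0" "k \<le> n"
  shows "Dinv V w n k"
  unfolding Dinv_def low_poly_def
  by (intro exI[of _ v] exI[of _ \<psi>] exI[of _ "monom c k"])
    (use assms degree_monom_le[of c k] in \<open>auto simp: Polynomial.poly_monom\<close>)

context hook_mod
begin

lemma low_mem: "low z \<in> carrier SL2" by simp

lemma idx_top: "b \<le> l \<Longrightarrow> idx (\<lambda>_. 0) (\<lambda>i. i)"
  by (simp add: hidx_def)

end

lemma tsum_top: "tsum a b (\<lambda>_. 0) (\<lambda>i. i) = \<Sum>{..b}"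
  by (simp add: tsum_def)

text \<open>Observing \<open>b + 1\<close> in place of the last leg index \<open>b\<close> keeps the
  determinant triangular. Its last diagonal entry is \<open>(b + 1) z\<close>, which equals
  \<open>z\<close> because \<open>p\<close> divides \<open>b\<close>.\<close>

lemma (in nabla_lower) Dinv_1:
  assumes "prime p" "CHAR('k) = p" "b = p ^ j" "0 < j" and bl: "Suc b \<le> l" and h: "h + 2 * \<Sum>{..b} = L" and "1 \<le> n"
  shows "Dinv N h n 1"
proof (rule DinvI)
  let ?E = "el (\<lambda>_. 0) (\<lambda>i. i)" and ?f = "\<lambda>i. if i = b then Suc b else i"
  let ?cs = "map ?f [1..<Suc b]"
  have b: "0 < b" "(of_nat b :: 'k) = 0" using assms by (auto simp: of_nat_eq_0_iff_char_dvd prime_gt_0_nat)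
  have i: "idx (\<lambda>_. 0) (\<lambda>i. i)" using bl by (intro idx_top) simp
  show "wvec N h ?E" by (rule wvec_el[OF i]) (use h tsum_top in simp)
  show "(\<lambda>x\<in>carrier N. crd0 ?cs (\<Psi> x)) \<in> carrier (dual_rep SL2 N)" by (rule dual_restrict[OF fn_linear_crd0])
  fix z :: 'k
  have "crd0 ?cs (\<Psi> (act N (low z) ?E)) = dt (Suc b) (\<lambda>i j. bm l z j (?f i)) * (\<Prod>j<a. bm l z 0 0)"
    unfolding \<Psi>_low[OF i] by (rule crd0_map) (use b bl in auto)
  also have "dt (Suc b) (\<lambda>i j. bm l z j (?f i)) = (\<Prod>i<Suc b. bm l z i (?f i))"
    by (rule dt_lower) (auto simp: bm_def)
  also have "\<dots> = z" using bl b(2) by (simp add: bm_def prod.neutral)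
  also have "z * (\<Prod>j<a. bm l z 0 0) = 1 * z ^ 1" by (simp add: bm_def)
  finally show "(\<lambda>x\<in>carrier N. crd0 ?cs (\<Psi> x)) (act N (low z) ?E) = 1 * z ^ 1"
    using act_closed[OF low_mem el_mem[OF i]] by simp
qed (use assms in auto)

text \<open>In the dual, the highest weight vector is the functional \<open>crd0\<close>, and
  evaluation at a generator serves as the functional. The inverse turns \<open>z\<close> into
  \<open>- z\<close>, which only affects the sign of the coefficient.\<close>

lemma (in hook_up) Dinv_dualI:
  assumes i: "idx \<alpha> \<kappa>" and bl: "b \<le> l" and h: "h + 2 * \<Sum>{..b} = L"
    and eq: "\<And>z. dt (Suc b) (\<lambda>i j. lo z (\<kappa> j) i) * (\<Prod>j<a. lo z (\<alpha> j) 0) = c * z ^ k" "c \<noteq> 0" "k \<le> n"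
  shows "Dinv (dual_rep SL2 N) h n k"
proof (rule DinvI)
  let ?\<psi> = "\<lambda>x\<in>carrier N. crd0 [1..<Suc b] (\<Psi> x)"
  note m = el_mem[OF i]
  show w: "wvec (dual_rep SL2 N) h ?\<psi>" by (rule crd0_wvec[OF h bl])
  show "(\<lambda>\<psi>\<in>carrier (dual_rep SL2 N). \<psi> (el \<alpha> \<kappa>)) \<in> carrier (dual_rep SL2 (dual_rep SL2 N))"
    by (rule dual_dual_mem[OF nice m])
  fix z :: 'k
  have "act (dual_rep SL2 N) (low z) ?\<psi> \<in> carrier (dual_rep SL2 N)"
    by (rule act_linearD[OF niceD(2)[OF nice_dual[OF nice]] low_mem]) (use w in \<open>simp add: wvec_def\<close>)
  then have "(\<lambda>\<psi>\<in>carrier (dual_rep SL2 N). \<psi> (el \<alpha> \<kappa>)) (act (dual_rep SL2 N) (low z) ?\<psi>) =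
      ?\<psi> (act N (low (- z)) (el \<alpha> \<kappa>))"
    by (simp only: restrict_apply if_True dual_low[OF m])
  also have "\<dots> = crd0 [1..<Suc b] (\<Psi> (act N (low (- z)) (el \<alpha> \<kappa>)))"
    using act_closed[OF low_mem m] by simp
  also have "\<dots> = c * (- z) ^ k"
    unfolding \<Psi>_low[OF i] crd0_upt[OF bl] by (rule eq)
  also have "\<dots> = (c * (- 1) ^ k) * z ^ k" by (simp add: power_minus[of z])
  finally show "(\<lambda>\<psi>\<in>carrier (dual_rep SL2 N). \<psi> (el \<alpha> \<kappa>)) (act (dual_rep SL2 N) (low z) ?\<psi>) = (c * (- 1) ^ k) * z ^ k" .
  show "c * (- 1) ^ k \<noteq> 0" using eq(2) by simp
qed (rule eq(3))

text \<open>The transposed computation: now the generator has \<open>b + 1\<close> as its last leg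
  entry, while the observed coordinates remain \<open>0, ..., b\<close>.\<close>

lemma (in nabla_dual_lower) Dinv_1:
  assumes "prime p" "CHAR('k) = p" "b = p ^ j" "0 < j" and bl: "Suc b \<le> l" and h: "h + 2 * \<Sum>{..b} = L" and n: "1 \<le> n"
  shows "Dinv (dual_rep SL2 N) h n 1"
proof (rule Dinv_dualI[where \<alpha> = "\<lambda>_. 0" and \<kappa> = "\<lambda>i. if i = b then Suc b else i" and c = 1])
  have b: "0 < b" "(of_nat b :: 'k) = 0" using assms by (auto simp: of_nat_eq_0_iff_char_dvd prime_gt_0_nat)
  show "idx (\<lambda>_. 0) (\<lambda>i. if i = b then Suc b else i)" using bl by (auto simp: hidx_def)
  fix z :: 'k
  have "dt (Suc b) (\<lambda>i j. bm l z i (if j = b then Suc b else j)) = (\<Prod>i<Suc b. bm l z i (if i = b then Suc b else i))"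
    by (rule dt_upper) (auto simp: bm_def)
  also have "\<dots> = z" using bl b(2) by (simp add: bm_def prod.neutral)
  finally show "dt (Suc b) (\<lambda>i j. bm l z i (if j = b then Suc b else j)) * (\<Prod>j<a. bm l z 0 0) = 1 * z ^ 1"
    by (simp add: bm_def)
qed (use bl h n in auto)

subsection \<open>The invariants of the upper symmetric powers\<close>

text \<open>A single arm entry \<open>b\<close> that moves to index 0 contributes
  \<open>C(Q + b, b) z^b\<close>, and this binomial coefficient is 1 modulo \<open>p\<close>. The
  leg determinant is unitriangular.\<close>

lemma (in nabla_dual_upper) Dinv_legs:
  assumes p: "prime p" "CHAR('k) = p" "Q = p ^ e" and l: "l = Q + b" "0 < b" "b < Q" "0 < a"
    and h: "h + 2 * \<Sum>{..b} = L" and "b \<le> n"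
  shows "Dinv (dual_rep SL2 N) h n b"
proof (rule Dinv_dualI[where \<alpha> = "\<lambda>j. if j = 0 then b else 0" and \<kappa> = "\<lambda>i. i" and c = 1])
  show "idx (\<lambda>j. if j = 0 then b else 0) (\<lambda>i. i)" using l by (auto simp: hidx_def)
  fix z :: 'k
  have "dt (Suc b) (\<lambda>i j. gm l z i j) = (\<Prod>i<Suc b. gm l z i i)"
    by (rule dt_upper) (simp add: gm_def)
  also have "\<dots> = 1" using l by (intro prod.neutral) (simp add: gm_def)
  finally have d: "dt (Suc b) (\<lambda>i j. gm l z i j) = 1" .
  have "(\<Prod>j<a. gm l z 0 (if j = 0 then b else 0)) = (\<Prod>j<a. if j = 0 then gm l z 0 b else 1)"
    by (rule prod.cong) (auto simp: gm_def)
  also have "\<dots> = gm l z 0 b" using l by simp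
  also have "\<dots> = z ^ b" using l binomial_char[OF p, of b b] by (simp add: gm_def)
  finally show "dt (Suc b) (\<lambda>i j. gm l z i j) * (\<Prod>j<a. gm l z 0 (if j = 0 then b else 0)) = 1 * z ^ b"
    using d by simp
qed (use assms in auto)

text \<open>On the columns \<open>0, \<dots>, b\<close> the action of \<open>low z\<close> factors through the unitriangular
  matrix \<open>pm\<close>, which leaves a matrix with entries in \<open>{0, 1, z\<^bsup>Q\<^esup>}\<close>.\<close>

definition pm :: "nat \<Rightarrow> 'k::field \<Rightarrow> nat \<Rightarrow> nat \<Rightarrow> 'k" where
  "pm b z i k = (if i \<le> k then of_nat ((b - i) choose (k - i)) * z ^ (k - i) else 0)"

definition hm :: "nat \<Rightarrow> 'k::field \<Rightarrow> nat \<Rightarrow> nat \<Rightarrow> 'k" where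
  "hm Q z k c = dl k c + z ^ Q * dl (k + Q) c"

lemma dt_pm: "dt (Suc b) (pm b z) = (1 :: 'k::field)"
  by (subst dt_upper) (simp_all add: pm_def prod.neutral)

text \<open>The two summands of the binomial identity are the entries of \<open>pm\<close> in
  columns \<open>c\<close> and \<open>c - Q\<close>, the second with the factor \<open>z^Q\<close>
  split off.\<close>

lemma gm_factor:
  assumes p: "prime p" "CHAR('k::field) = p" "Q = p ^ e" and l: "l = Q + b" "b < Q" and i: "i \<le> b"
  shows "gm l z i c = (\<Sum>k<Suc b. pm b z i k * (hm Q z k c :: 'k))"
proof -
  have "(\<Sum>k<Suc b. pm b z i k * hm Q z k c) =
      (\<Sum>k<Suc b. if k = c then pm b z i c else 0) + (\<Sum>k<Suc b. if k = c - Q \<and> Q \<le> c then pm b z i (c - Q) * z ^ Q else 0)"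
    unfolding sum.distrib[symmetric] by (rule sum.cong) (auto simp: hm_def distrib_left)
  also have "(\<Sum>k<Suc b. if k = c then pm b z i c else 0) = (if c \<le> b then pm b z i c else 0)" by simp
  also have "(\<Sum>k<Suc b. if k = c - Q \<and> Q \<le> c then pm b z i (c - Q) * z ^ Q else 0) =
      (if Q \<le> c \<and> c \<le> l then pm b z i (c - Q) * z ^ Q else 0)"
    using l by (cases "Q \<le> c") auto
  finally have R: "(\<Sum>k<Suc b. pm b z i k * hm Q z k c) =
    (if c \<le> b then pm b z i c else 0) + (if Q \<le> c \<and> c \<le> l then pm b z i (c - Q) * z ^ Q else 0)" .
  have C: "(of_nat ((l - i) choose (c - i)) :: 'k) = of_nat ((b - i) choose (c - i)) +
      (if Q \<le> c - i then of_nat ((b - i) choose (c - i - Q)) else 0)"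
    using binomial_char[OF p, of "b - i" "c - i"] l i by simp
  show ?thesis
  proof (cases "i \<le> c \<and> c \<le> l")
    case False
    then show ?thesis unfolding R using i l by (auto simp: gm_def pm_def)
  next
    case True
    show ?thesis
    proof (cases "c < Q")
      case c: True
      then have "\<not> Q \<le> c - i" by simp
      moreover have "(b - i) choose (c - i) = 0" if "\<not> c \<le> b" using that i by (intro binomial_eq_0) simp
      ultimately show ?thesis unfolding R using True c C by (cases "c \<le> b") (simp_all add: gm_def pm_def binomial_eq_0)
    next
      \<comment> \<open>Since \<open>b < Q \<le> c\<close>, the unshifted summand vanishes; the
        shifted one survives only if \<open>c - Q\<close> is at least \<open>i\<close>.\<close>
      case c: False
      have cb: "\<not> c \<le> b" using c l by simp
      have z: "(b - i) choose (c - i) = 0" using c l i by (intro binomial_eq_0) simp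
      show ?thesis
      proof (cases "Q + i \<le> c")
        case qc: True
        then have e: "c - i = (c - Q - i) + Q" "c - i - Q = c - Q - i" "Q \<le> c - i" "i \<le> c - Q" "Q \<le> c" by simp_all
        then have "z ^ (c - i) = z ^ (c - Q - i) * z ^ Q" by (simp only: power_add[symmetric])
        then show ?thesis unfolding R using True cb C[unfolded z] e by (simp only: gm_def pm_def e(2) if_True if_False simp_thms of_nat_0 add_0 mult.assoc)
      next
        case qc: False
        then have "\<not> Q \<le> c - i" "\<not> i \<le> c - Q" using c True by auto
        then show ?thesis unfolding R using True c cb C z by (simp add: gm_def pm_def)
      qed
    qed
  qed
qed

text \<open>Modulo \<open>p\<close> one has \<open>(1 + X)^(Q+b) = (1 + X^Q) (1 + X^b)\<close>, a
  sum of four monomials.\<close>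

lemma gm_0_nonzero:
  assumes p: "prime p" "CHAR('k::field) = p" "Q = p ^ e" "b = p ^ j" and l: "l = Q + b"
    and "(of_nat (l choose c) :: 'k) \<noteq> 0"
  shows "c \<in> {0, b, Q, Q + b}"
  using assms(6) binomial_char[OF p(1-3), of b c] binomial_char_power[OF p(1,2,4)]
  by (auto simp: l split: if_splits)

text \<open>The difference of two such polynomials vanishes at every point of a field with more than
  \<open>n\<close> elements. So explicit calculations determine the polynomial quantified in
  \<open>Dinv\<close> and \<open>Kinv\<close>.\<close>

lemma low_poly_unique:
  fixes V :: "('k::field ^ 2 ^ 2, 'k, 'v) rep"
  assumes P: "low_poly V n v \<psi> P" and R: "\<And>z. \<psi> (act V (low z) v) = poly R z" "degree R \<le> n"
    and n: "finite (UNIV :: 'k set) \<Longrightarrow> n < card (UNIV :: 'k set)"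
  shows "P = R"
proof -
  have "P - R = 0"
  proof (rule poly_eq_0_card)
    show "poly (P - R) z = 0" for z using P R(1)[of z] by (simp add: low_poly_def)
    have "degree (P - R) \<le> n" using P R(2) by (intro degree_diff_le) (auto simp: low_poly_def)
    then show "finite (UNIV :: 'k set) \<Longrightarrow> degree (P - R) < card (UNIV :: 'k set)" using n by linarith
  qed
  then show ?thesis by simp
qed

lemma supp_smult: "supp m J P \<Longrightarrow> supp m J (Polynomial.smult c P)"
  using order_trans[OF degree_smult_le, of P m c] unfolding supp_def by (metis Polynomial.coeff_smult mult_zero_right)

text \<open>The reduced leg determinant has exponents that are multiples of \<open>Q\<close>, an arm
  entry moving to index 0 has exponent \<open>0\<close>, \<open>b\<close>, \<open>Q\<close> or
  \<open>Q + b\<close>, and \<open>b\<close> divides \<open>Q\<close>.\<close>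

lemma (in nabla_dual_upper) crd0_low_supp:
  assumes p: "prime p" "CHAR('k) = p" "Q = p ^ e" "b = p ^ j" "j < e" and l: "l = Q + b" and x: "x \<in> carrier N"
  shows "\<exists>R. supp L {i. b dvd i} R \<and> (\<forall>z. crd0 [1..<Suc b] (\<Psi> (act N (low (- z)) x)) = poly R z)"
proof (rule el_induct[OF x])
  have bQ: "b < Q" using p prime_gt_1_nat[OF p(1)] by simp
  have dQ: "b dvd Q" using p by (simp add: le_imp_power_dvd)
  have bl: "b \<le> l" using l by simp
  note lin = fn_linearD[OF fn_linear_crd0[of "[1..<Suc b]"]]
  {
    fix \<alpha> \<kappa> assume i: "idx \<alpha> \<kappa>"
    \<comment> \<open>The signs in \<open>S\<close> and \<open>M\<close> come from
      \<open>low (- z)\<close>, the inverse acting on functionals.\<close>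
    define S where "S k j = [:dl k (\<kappa> j) :: 'k:] + monom ((- 1) ^ Q * dl (k + Q) (\<kappa> j)) Q" for k j :: nat
    define M where "M j = monom ((- 1) ^ \<alpha> j * of_nat (l choose \<alpha> j) :: 'k) (\<alpha> j)" for j
    have "supp (Suc b * Q) {i. b dvd i} (dt (Suc b) S)"
    proof (rule supp_dt)
      fix k j
      have "supp Q {i. b dvd i} [:dl k (\<kappa> j) :: 'k:]" unfolding monom_0[symmetric] by (rule supp_monom) simp
      then show "supp Q {i. b dvd i} (S k j)" unfolding S_def by (intro supp_add supp_monom) (use dQ in simp_all)
    qed simp_all
    moreover have "supp (card {..<a} * l) {i. b dvd i} (\<Prod>j<a. M j)"
    proof (rule supp_prod)
      fix j assume j: "j \<in> {..<a}"
      show "supp l {i. b dvd i} (M j)" unfolding M_def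
      proof (rule supp_monom)
        show "(- 1) ^ \<alpha> j * of_nat (l choose \<alpha> j) = (0 :: 'k) \<or> \<alpha> j \<in> {i. b dvd i} \<and> \<alpha> j \<le> l"
        proof (cases "of_nat (l choose \<alpha> j) = (0 :: 'k)")
          case False
          from gm_0_nonzero[OF p(1-4) l False] show ?thesis using dQ j i by (auto simp: hidx_def)
        qed simp
      qed
    qed simp_all
    ultimately have "supp (Suc b * Q + card {..<a} * l) {i. b dvd i} (dt (Suc b) S * (\<Prod>j<a. M j))"
      by (rule supp_mult) simp
    then have 1: "supp L {i. b dvd i} (dt (Suc b) S * (\<Prod>j<a. M j))"
      by (rule supp_mono) (simp_all add: l algebra_simps)
    have 2: "crd0 [1..<Suc b] (\<Psi> (act N (low (- z)) (el \<alpha> \<kappa>))) = poly (dt (Suc b) S * (\<Prod>j<a. M j)) z" for z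
    proof -
      have "dt (Suc b) (\<lambda>i j. gm l (- z) i (\<kappa> j)) = dt (Suc b) (\<lambda>i j. \<Sum>k<Suc b. pm b (- z) i k * hm Q (- z) k (\<kappa> j))"
        by (rule dt_cong) (rule gm_factor[OF p(1-3) l bQ], simp)
      also have "\<dots> = dt (Suc b) (\<lambda>k j. hm Q (- z) k (\<kappa> j))" by (simp only: dt_mult dt_pm mult_1)
      also have "\<dots> = dt (Suc b) (\<lambda>k j. poly (S k j) z)"
        by (rule dt_cong) (simp add: S_def hm_def Polynomial.poly_monom power_minus[of z])
      also have "\<dots> = poly (dt (Suc b) S) z"
        by (rule dt_hom[where h = "\<lambda>P. poly P z", symmetric]) simp_all
      finally have d: "dt (Suc b) (\<lambda>i j. gm l (- z) i (\<kappa> j)) = poly (dt (Suc b) S) z" .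
      have "(\<Prod>j<a. gm l (- z) 0 (\<alpha> j)) = (\<Prod>j<a. poly (M j) z)"
        by (rule prod.cong) (use i in \<open>simp_all add: M_def gm_def hidx_def Polynomial.poly_monom power_minus[of z]\<close>)
      then show ?thesis
        unfolding \<Psi>_low[OF i] crd0_upt[OF bl] d by (simp only: poly_mult poly_prod)
    qed
    show "\<exists>R. supp L {i. b dvd i} R \<and> (\<forall>z. crd0 [1..<Suc b] (\<Psi> (act N (low (- z)) (el \<alpha> \<kappa>))) = poly R z)"
      using 1 2 by blast
  next
    have "crd0 [1..<Suc b] (0 :: 'k mfun) = 0" using lin(2)[of "0 :: 'k" 0] by simp
    then have "crd0 [1..<Suc b] (\<Psi> (act N (low (- z)) \<zero>\<^bsub>N\<^esub>)) = poly 0 z" for z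
      by (simp only: act_zero[OF low_mem] \<Psi>_zero poly_0)
    then show "\<exists>R. supp L {i. b dvd i} R \<and> (\<forall>z. crd0 [1..<Suc b] (\<Psi> (act N (low (- z)) \<zero>\<^bsub>N\<^esub>)) = poly R z)"
      using supp_0 by blast
  next
    fix x y assume xy: "x \<in> carrier N" "y \<in> carrier N"
      and "\<exists>R. supp L {i. b dvd i} R \<and> (\<forall>z. crd0 [1..<Suc b] (\<Psi> (act N (low (- z)) x)) = poly R z)"
        "\<exists>R. supp L {i. b dvd i} R \<and> (\<forall>z. crd0 [1..<Suc b] (\<Psi> (act N (low (- z)) y)) = poly R z)"
    then obtain R R' where R: "supp L {i. b dvd i} R" "\<And>z. crd0 [1..<Suc b] (\<Psi> (act N (low (- z)) x)) = poly R z"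
        "supp L {i. b dvd i} R'" "\<And>z. crd0 [1..<Suc b] (\<Psi> (act N (low (- z)) y)) = poly R' z" by blast
    have "crd0 [1..<Suc b] (\<Psi> (act N (low (- z)) (x \<oplus>\<^bsub>N\<^esub> y))) = poly (R + R') z" for z
      by (simp only: act_add[OF low_mem xy] \<Psi>_add[OF act_closed[OF low_mem xy(1)] act_closed[OF low_mem xy(2)]]
        lin(1) R(2,4) poly_add)
    then show "\<exists>R. supp L {i. b dvd i} R \<and> (\<forall>z. crd0 [1..<Suc b] (\<Psi> (act N (low (- z)) (x \<oplus>\<^bsub>N\<^esub> y))) = poly R z)"
      using supp_add[OF R(1,3)] by blast
  next
    fix c x assume x: "x \<in> carrier N"
      and "\<exists>R. supp L {i. b dvd i} R \<and> (\<forall>z. crd0 [1..<Suc b] (\<Psi> (act N (low (- z)) x)) = poly R z)"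
    then obtain R where R: "supp L {i. b dvd i} R" "\<And>z. crd0 [1..<Suc b] (\<Psi> (act N (low (- z)) x)) = poly R z" by blast
    have "crd0 [1..<Suc b] (\<Psi> (act N (low (- z)) (c \<odot>\<^bsub>N\<^esub> x))) = poly (Polynomial.smult c R) z" for z
      by (simp only: act_smult[OF low_mem x] \<Psi>_smult[OF act_closed[OF low_mem x]] lin(2) R(2) poly_smult)
    then show "\<exists>R. supp L {i. b dvd i} R \<and> (\<forall>z. crd0 [1..<Suc b] (\<Psi> (act N (low (- z)) (c \<odot>\<^bsub>N\<^esub> x))) = poly R z)"
      using supp_smult[OF R(1)] by blast
  }
qed

text \<open>Every highest weight vector of the dual is a multiple of \<open>crd0\<close> and every
  functional on the dual is an evaluation, so the exponents found for \<open>crd0\<close> are all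
  there are.\<close>

lemma (in nabla_dual_upper) Dinv_dvd:
  assumes p: "prime p" "CHAR('k) = p" "Q = p ^ e" "b = p ^ j" "j < e" and l: "l = Q + b"
    and h: "h + 2 * \<Sum>{..b} = L" and small: "finite (UNIV :: 'k set) \<Longrightarrow> Suc (2 * h) < card (UNIV :: 'k set)"
    and n: "L \<le> n" "finite (UNIV :: 'k set) \<Longrightarrow> n < card (UNIV :: 'k set)"
    and D: "Dinv (dual_rep SL2 N) h n k"
  shows "b dvd k"
proof -
  obtain \<psi> \<xi> P where \<psi>: "wvec (dual_rep SL2 N) h \<psi>" and P: "low_poly (dual_rep SL2 N) n \<psi> \<xi> P" and k: "coeff P k \<noteq> 0"
    using D unfolding Dinv_def by blast
  have bl: "b \<le> l" using l by simp
  have \<psi>c: "\<psi> \<in> carrier (dual_rep SL2 N)" using \<psi> by (simp add: wvec_def)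
  have "\<xi> \<in> carrier (dual_rep SL2 (dual_rep SL2 N))" using P by (simp add: low_poly_def)
  then obtain x where x: "x \<in> carrier N" "\<And>\<psi>. \<psi> \<in> carrier (dual_rep SL2 N) \<Longrightarrow> \<xi> \<psi> = \<psi> x"
    using dual_dual_eval[OF nice] by blast
  obtain R where R: "supp L {i. b dvd i} R" "\<And>z. crd0 [1..<Suc b] (\<Psi> (act N (low (- z)) x)) = poly R z"
    using crd0_low_supp[OF p l x(1)] by blast
  have "P = Polynomial.smult (\<psi> (el (\<lambda>_. 0) (\<lambda>i. i))) R"
  proof (rule low_poly_unique[OF P _ _ n(2)])
    fix z :: 'k
    have "act (dual_rep SL2 N) (low z) \<psi> \<in> carrier (dual_rep SL2 N)"
      by (rule act_linearD[OF niceD(2)[OF nice_dual[OF nice]] low_mem \<psi>c])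
    then have "\<xi> (act (dual_rep SL2 N) (low z) \<psi>) = \<psi> (act N (low (- z)) x)"
      by (simp only: x(2) dual_low[OF x(1)])
    also have "\<dots> = \<psi> (el (\<lambda>_. 0) (\<lambda>i. i)) * crd0 [1..<Suc b] (\<Psi> (act N (low (- z)) x))"
      by (rule top_functional[OF \<psi> h small bl act_closed[OF low_mem x(1)]])
    finally show "\<xi> (act (dual_rep SL2 N) (low z) \<psi>) = poly (Polynomial.smult (\<psi> (el (\<lambda>_. 0) (\<lambda>i. i))) R) z"
      by (simp only: R(2) poly_smult)
  next
    have "degree R \<le> L" using R(1) by (simp add: supp_def)
    then show "degree (Polynomial.smult (\<psi> (el (\<lambda>_. 0) (\<lambda>i. i))) R) \<le> n"
      using degree_smult_le[of "\<psi> (el (\<lambda>_. 0) (\<lambda>i. i))" R] n(1) by linarith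
  qed
  then show ?thesis using k R(1) by (auto simp: supp_def)
qed

section \<open>Frobenius powers, and functionals applied to polynomials in \<open>z\<close>\<close>

lemma supp_restrict: "supp m J P \<Longrightarrow> supp m (J \<inter> {..m}) P"
  unfolding supp_def using le_degree by fastforce

lemma supp_power:
  assumes "supp m J P" and "0 \<in> J" and "\<And>i j. i \<in> J \<Longrightarrow> j \<in> J \<Longrightarrow> i + j \<in> J"
  shows "supp (k * m) J (P ^ k)"
  using supp_prod[of "{..<k}" m J "\<lambda>_. P"] assms by simp

text \<open>In characteristic \<open>p\<close> raising to a power of \<open>p\<close> is additive,
  so it acts on each monomial separately and multiplies the exponents by \<open>a\<close>.\<close>

lemma frobenius_poly:
  fixes P :: "'a::comm_ring_1 poly"
  assumes "prime p" "CHAR('a) = p" "a = p ^ i"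
  shows "P ^ a = (\<Sum>k\<le>degree P. monom (coeff P k ^ a) (a * k))"
proof -
  have "P ^ a = (\<Sum>k\<le>degree P. monom (coeff P k) k) ^ a"
    by (simp only: poly_as_sum_of_monoms)
  also have "\<dots> = (\<Sum>k\<le>degree P. monom (coeff P k) k ^ a)"
    by (rule freshmans_dream_sum'[where n = i]) (use assms in simp_all)
  finally show ?thesis by (simp add: Polynomial.monom_power mult.commute)
qed

lemma supp_frobenius:
  fixes P :: "'a::comm_ring_1 poly"
  assumes p: "prime p" "CHAR('a) = p" "a = p ^ i" and P: "supp m J P"
  shows "supp (a * m) ((*) a ` J) (P ^ a)"
  unfolding frobenius_poly[OF p]
proof (rule supp_sum, rule supp_monom)
  fix k assume "k \<in> {..degree P}"
  then have "k \<le> m" using P by (simp add: supp_def)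
  moreover have "a > 0" using p by (simp add: prime_gt_0_nat)
  ultimately show "coeff P k ^ a = 0 \<or> a * k \<in> (*) a ` J \<and> a * k \<le> a * m"
    using P by (cases "coeff P k = 0") (auto simp: supp_def zero_power)
qed

lemma coeff_square_char_2:
  fixes P :: "'a::comm_ring_1 poly"
  assumes "CHAR('a) = 2"
  shows "coeff (P ^ 2) (2 * m) = coeff P m ^ 2"
proof -
  have "P ^ 2 = (\<Sum>k\<le>degree P. monom (coeff P k ^ 2) (2 * k))"
    by (rule frobenius_poly[of 2 _ 1]) (use assms in simp_all)
  then have "coeff (P ^ 2) (2 * m) = (\<Sum>k\<le>degree P. if k = m then coeff P m ^ 2 else 0)"
    by (simp add: Polynomial.coeff_sum if_distrib cong: if_cong)
  then show ?thesis by (cases "m \<le> degree P") (simp_all add: Polynomial.coeff_eq_0)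
qed

lemma single_power: "(single {#} z :: ('k::field) mpol) ^ i = single {#} (z ^ i)"
  using prod_single_const[of "\<lambda>_. z" "{..<i}"] by simp

lemma fn_linear_sum:
  assumes "fn_linear \<Lambda>"
  shows "\<Lambda> (\<Sum>i\<in>A. fscale (c i) (F i)) = (\<Sum>i\<in>A. c i * \<Lambda> (F i))"
proof -
  have z: "\<Lambda> 0 = 0" using fn_linearD(2)[OF assms, of 0 0] by simp
  show ?thesis
    by (induction A rule: infinite_finite_induct) (simp_all only: sum.infinite sum.empty sum.insert z fn_linearD[OF assms] not_False_eq_True)
qed

context hook_mod
begin

text \<open>Write the image of \<open>x\<close> as a polynomial in \<open>z\<close> with hook
  tensors \<open>F i\<close> as coefficients and apply the extended functional to each
  \<open>F i\<close>. Exponents absent from all components stay absent for every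
  \<open>\<psi>\<close>.\<close>

lemma functional_supp:
  assumes \<psi>: "\<psi> \<in> carrier (dual_rep SL2 N)" and x: "x \<in> carrier N"
    and \<Phi>: "\<And>z cs. \<Psi> (act N (low z) x) cs = poly (\<Phi> cs) (single {#} z)"
    and s: "\<And>cs. supp m J (\<Phi> cs)"
  shows "\<exists>R. supp m J R \<and> (\<forall>z. \<psi> (act N (low z) x) = poly R z)"
proof -
  obtain \<Lambda> where \<Lambda>: "fn_linear \<Lambda>" "\<And>x. x \<in> carrier N \<Longrightarrow> \<Lambda> (\<Psi> x) = \<psi> x" using dual_extend[OF \<psi>] by blast
  define F where "F i = (\<lambda>cs. coeff (\<Phi> cs) i)" for i
  let ?R = "\<Sum>i\<le>m. monom (\<Lambda> (F i)) i"
  have "supp m J ?R"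
  proof (rule supp_sum, rule supp_monom)
    fix i assume i: "i \<in> {..m}"
    show "\<Lambda> (F i) = 0 \<or> i \<in> J \<and> i \<le> m"
    proof (cases "i \<in> J")
      case False
      then have "F i = fscale 0 (F i)" using s by (auto simp: F_def supp_def fun_eq_iff fscale_def)
      then have "\<Lambda> (F i) = 0 * \<Lambda> (F i)" using fn_linearD(2)[OF \<Lambda>(1), of 0 "F i"] by simp
      then show ?thesis by simp
    qed (use i in simp)
  qed
  moreover have "\<psi> (act N (low z) x) = poly ?R z" for z
  proof -
    have sm: "(\<Sum>i\<in>A. fscale (z ^ i) (F i)) cs = (\<Sum>i\<in>A. F i cs * single {#} z ^ i)" for A :: "nat set" and cs
      by (induction A rule: infinite_finite_induct) (simp_all add: fscale_def single_power mult.commute)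
    have "\<Psi> (act N (low z) x) = (\<Sum>i\<le>m. fscale (z ^ i) (F i))"
    proof
      fix cs
      have "degree (\<Phi> cs) \<le> m" using s[of cs] by (simp add: supp_def)
      then have "poly (\<Phi> cs) (single {#} z) =
          (\<Sum>i\<le>m. coeff (\<Phi> cs) i * single {#} z ^ i)"
        unfolding poly_altdef by (intro sum.mono_neutral_left) (auto simp: Polynomial.coeff_eq_0)
      then show "\<Psi> (act N (low z) x) cs = (\<Sum>i\<le>m. fscale (z ^ i) (F i)) cs"
        unfolding \<Phi> sm by (simp only: F_def)
    qed
    then have "\<Lambda> (\<Psi> (act N (low z) x)) = (\<Sum>i\<le>m. z ^ i * \<Lambda> (F i))" by (simp only: fn_linear_sum[OF \<Lambda>(1)])
    then show ?thesis
      using \<Lambda>(2)[OF act_closed[OF low_mem x]] by (simp add: poly_sum Polynomial.poly_monom mult.commute)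
  qed
  ultimately show ?thesis by blast
qed

text \<open>Acting by \<open>low z\<close> and then applying \<open>\<Lambda>\<close> is a
  functional on \<open>N\<close>, so it respects every linear relation among images under
  \<open>\<Psi>\<close>.\<close>

lemma functional_combination:
  assumes \<Lambda>: "fn_linear \<Lambda>" and x: "x \<in> carrier N" "\<Psi> x = (\<Sum>i\<in>A. fscale (y i) (\<Psi> (E i)))"
    and E: "\<And>i. i \<in> A \<Longrightarrow> E i \<in> carrier N"
  shows "\<Lambda> (\<Psi> (act N (low z) x)) = (\<Sum>i\<in>A. y i * \<Lambda> (\<Psi> (act N (low z) (E i))))"
proof -
  let ?\<psi> = "\<lambda>x\<in>carrier N. \<Lambda> (\<Psi> (act N (low z) x))"
  have "?\<psi> \<in> carrier (dual_rep SL2 N)"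
    by (rule dualI) (simp_all only: restrict_extensional restrict_apply closed if_True act_add[OF low_mem] act_smult[OF low_mem]
        act_closed[OF low_mem] \<Psi>_add \<Psi>_smult fn_linearD[OF \<Lambda>])
  then obtain \<Lambda>' where \<Lambda>': "fn_linear \<Lambda>'" "\<And>x. x \<in> carrier N \<Longrightarrow> \<Lambda>' (\<Psi> x) = ?\<psi> x" using dual_extend by blast
  have "?\<psi> x = (\<Sum>i\<in>A. y i * ?\<psi> (E i))"
    unfolding \<Lambda>'(2)[OF x(1), symmetric] x(2) fn_linear_sum[OF \<Lambda>'(1)] by (rule sum.cong) (simp_all only: \<Lambda>'(2) E)
  also have "\<dots> = (\<Sum>i\<in>A. y i * \<Lambda> (\<Psi> (act N (low z) (E i))))" by (rule sum.cong) (simp_all add: E)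
  finally show ?thesis using x(1) by simp
qed

end

subsection \<open>Polynomials describing the action on upper symmetric powers\<close>

text \<open>The linear form of the image of basis vector \<open>i\<close> under
  \<open>low z\<close>, with \<open>z\<close> made the variable of an outer polynomial ring over the
  polynomials in the \<open>x_c\<close>.\<close>

definition armP :: "nat \<Rightarrow> nat \<Rightarrow> (('k::field) mpol) poly" where
  "armP l i = (\<Sum>c\<in>{i..l}. monom (single {#c#} (of_nat ((l - i) choose (c - i)))) (c - i))"

lemma poly_armP: "poly (armP l i) (single {#} z) = lin_form {..l} (gm l z i)"
proof -
  have "lin_form {..l} (gm l z i) = (\<Sum>c\<in>{i..l}. single {#c#} (gm l z i c))"
    unfolding lin_form_def by (rule sum.mono_neutral_right) (auto simp: gm_def)
  also have "\<dots> = (\<Sum>c\<in>{i..l}. single {#c#} (of_nat ((l - i) choose (c - i))) * single {#} z ^ (c - i))"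
    by (rule sum.cong) (simp_all add: gm_def single_power mult_single)
  finally show ?thesis by (simp add: armP_def poly_sum Polynomial.poly_monom)
qed

lemma coeff_armP:
  "coeff (armP l i) m = (if m + i \<le> l then single {#m + i#} (of_nat ((l - i) choose m)) else 0)"
proof -
  have "coeff (armP l i) m =
      (\<Sum>c\<in>{i..l}. if c = m + i then single {#m + i#} (of_nat ((l - i) choose m)) else 0)"
    unfolding armP_def Polynomial.coeff_sum by (rule sum.cong) auto
  then show ?thesis by simp
qed

lemma supp_armP: "supp l UNIV (armP l i)"
  unfolding armP_def by (intro supp_sum supp_monom) auto

lemma supp_armP_0:
  assumes "prime p" "CHAR('k::field) = p" "Q = p ^ e" "b = p ^ j" and l: "l = Q + b"
  shows "supp l {0, b, Q, Q + b} (armP l 0 :: ('k mpol) poly)"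
  unfolding armP_def
proof (intro supp_sum supp_monom)
  fix c assume c: "c \<in> {0..l}"
  show "single {#c#} (of_nat ((l - 0) choose (c - 0))) = (0 :: 'k mpol) \<or>
      c - 0 \<in> {0, b, Q, Q + b} \<and> c - 0 \<le> l"
  proof (cases "of_nat (l choose c) = (0 :: 'k)")
    case False
    from gm_0_nonzero[OF assms False] show ?thesis using c by simp
  qed simp
qed

text \<open>The leg determinant after the unitriangular factor \<open>pm\<close> has been removed:
  column \<open>k\<close> stands for the vector \<open>v_k + z^Q v_(k+Q)\<close>. It depends on
  \<open>z\<close> only through \<open>z^Q\<close>.\<close>

definition colP :: "nat \<Rightarrow> nat \<Rightarrow> nat \<Rightarrow> nat list \<Rightarrow> (('k::field) mpol) poly" where
  "colP Q l b cs = dt (Suc b) (\<lambda>i k. [:hrow {..l} cs i (dl k):] + monom (hrow {..l} cs i (dl (k + Q))) Q)"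

text \<open>Each \<open>hrow\<close> is linear in the vector, so the factorisation of
  \<open>gm\<close> lifts to the rows of the determinant, and multiplicativity leaves the factor
  \<open>dt (pm)\<close>, which is 1.\<close>

lemma poly_colP:
  assumes p: "prime p" "CHAR('k::field) = p" "Q = p ^ e" and l: "l = Q + b" "b < Q"
    and cs: "length cs = b" "set cs \<subseteq> {..l}"
  shows "dt (Suc b) (\<lambda>i j. hrow {..l} cs i (gm l (z :: 'k) j)) = poly (colP Q l b cs) (single {#} z)"
proof -
  have "dt (Suc b) (\<lambda>i j. hrow {..l} cs i (gm l z j)) =
      dt (Suc b) (\<lambda>i j. \<Sum>k<Suc b. hrow {..l} cs i (hm Q z k) * single {#} (pm b z j k))"
  proof (rule dt_cong)
    fix i j assume ij: "i < Suc b" "j < Suc b"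
    have "hrow {..l} cs i (gm l z j) = hrow {..l} cs i (\<lambda>c. \<Sum>k<Suc b. pm b z j k * hm Q z k c)"
      by (rule hrow_cong[OF _ cs(2)]) (use gm_factor[OF p l, of j z] ij cs(1) in simp_all)
    then show "hrow {..l} cs i (gm l z j) = (\<Sum>k<Suc b. hrow {..l} cs i (hm Q z k) * single {#} (pm b z j k))"
      unfolding hrow_sum by (simp add: mult.commute)
  qed
  also have "\<dots> = dt (Suc b) (\<lambda>i k. hrow {..l} cs i (hm Q z k)) * dt (Suc b) (\<lambda>k j. single {#} (pm b z j k))"
    by (rule dt_mult)
  also have "dt (Suc b) (\<lambda>k j. single {#} (pm b z j k)) = (1 :: 'k mpol)"
    by (subst dt_lower) (simp_all add: pm_def prod.neutral single_one)
  also have "dt (Suc b) (\<lambda>i k. hrow {..l} cs i (hm Q z k)) = dt (Suc b) (\<lambda>i k. poly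
      ([:hrow {..l} cs i (dl k):] + monom (hrow {..l} cs i (dl (k + Q))) Q) (single {#} z))"
  proof (rule dt_cong)
    fix i k
    have "hrow {..l} cs i (hm Q z k) = hrow {..l} cs i (dl k) + single {#} (z ^ Q) * hrow {..l} cs i (dl (k + Q))"
      unfolding hm_def hrow_add hrow_scale ..
    then show "hrow {..l} cs i (hm Q z k) = poly
      ([:hrow {..l} cs i (dl k):] + monom (hrow {..l} cs i (dl (k + Q))) Q) (single {#} z)"
      by (simp add: Polynomial.poly_monom single_power mult.commute)
  qed
  also have "\<dots> = poly (colP Q l b cs) (single {#} z)"
    unfolding colP_def by (rule dt_hom[where h = "\<lambda>P. poly P (single {#} z)", symmetric]) simp_all
  finally show ?thesis by simp
qed

lemma supp_colP: "supp (Suc b * Q) {i. Q dvd i} (colP Q l b cs)"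
  unfolding colP_def
proof (rule supp_dt)
  fix i k
  show "supp Q {i. Q dvd i} ([:hrow {..l} cs i (dl k):] + monom (hrow {..l} cs i (dl (k + Q))) Q)"
    unfolding monom_0[symmetric] by (intro supp_add supp_monom) simp_all
qed simp_all

context nabla_upper
begin

text \<open>\<open>P\<close> is the product of the arm polynomials. Lists \<open>cs\<close> of the
  wrong shape give 0, as in \<open>hookE\<close>.\<close>

definition actP :: "nat \<Rightarrow> ('k mpol) poly \<Rightarrow> nat list \<Rightarrow> ('k mpol) poly" where
  "actP Q P cs = (if length cs = b \<and> set cs \<subseteq> {..l} then colP Q l b cs * P else 0)"

lemma low_el:
  assumes p: "prime p" "CHAR('k) = p" "Q = p ^ e" and l: "l = Q + b" "b < Q" and \<alpha>: "\<And>j. j < a \<Longrightarrow> \<alpha> j \<le> l"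
  shows "\<Psi> (act N (low z) (el \<alpha> (\<lambda>i. i))) cs =
    poly (actP Q (\<Prod>j<a. armP l (\<alpha> j)) cs) (single {#} z)"
proof -
  have i: "idx \<alpha> (\<lambda>i. i)" using \<alpha> l by (simp add: hidx_def)
  show ?thesis unfolding \<Psi>_low[OF i]
    by (cases "length cs = b \<and> set cs \<subseteq> {..l}")
      (simp_all only: hookE_dt actP_def if_True if_False poly_0 poly_mult poly_prod poly_armP poly_colP[OF p l] simp_thms)
qed

lemma supp_actP:
  assumes "supp m J P" and "\<And>i j. Q dvd i \<Longrightarrow> i \<le> Suc b * Q \<Longrightarrow> j \<in> J \<Longrightarrow> i + j \<in> J'"
  shows "supp (Suc b * Q + m) J' (actP Q P cs)"
  using supp_mult[OF supp_restrict[OF supp_colP[of b Q l cs]] assms(1), of J'] assms(2)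
  by (auto simp: actP_def)

text \<open>The arm of the top vector is the \<open>a\<close>-th power of \<open>armP l 0\<close>,
  whose exponents \<open>0, b, Q, Q + b\<close> Frobenius multiplies by \<open>a\<close>. The leg
  determinant has size \<open>b + 1\<close> and contributes \<open>c Q\<close> with
  \<open>c \<le> b + 1\<close>.\<close>

lemma Dinv_exponent:
  assumes p: "prime p" "CHAR('k) = p" "Q = p ^ e" "b = p ^ j" "a = p ^ i" "j < e" and l: "l = Q + b"
    and h: "h + 2 * \<Sum>{..b} = L" and small: "finite (UNIV :: 'k set) \<Longrightarrow> Suc (2 * h) < card (UNIV :: 'k set)"
    and n: "L \<le> n" "finite (UNIV :: 'k set) \<Longrightarrow> n < card (UNIV :: 'k set)"
    and D: "Dinv N h n k"
  obtains c d where "k = c * Q + d" "c \<le> Suc b" "d \<in> {0, a * b, a * Q, a * (Q + b)}"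
proof -
  have bQ: "b < Q" using p prime_gt_1_nat[OF p(1)] by simp
  have bl: "b \<le> l" and Q0: "Q > 0" using l bQ by simp_all
  let ?E = "el (\<lambda>_. 0) (\<lambda>i. i)" and ?D = "{0, a * b, a * Q, a * (Q + b)}"
  let ?J = "{c * Q + d | c d. c \<le> Suc b \<and> d \<in> ?D}"
  note m = el_mem[OF idx_top[OF bl]]
  obtain v \<psi> P where v: "wvec N h v" and P: "low_poly N n v \<psi> P" and k: "coeff P k \<noteq> 0"
    using D unfolding Dinv_def by blast
  obtain c where c: "v = c \<odot>\<^bsub>N\<^esub> ?E" using wvec_top[OF v h small bl] by blast
  have \<psi>: "\<psi> \<in> carrier (dual_rep SL2 N)" using P by (simp add: low_poly_def)
  have s: "supp L ?J (actP Q (\<Prod>j<a. armP l 0) cs)" for cs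
  proof -
    have "supp (a * l) ((*) a ` {0, b, Q, Q + b}) ((armP l 0 :: ('k mpol) poly) ^ a)"
      by (rule supp_frobenius[OF p(1) _ p(5) supp_armP_0[OF p(1-4) l]]) (simp add: CHAR_sym p(2))
    then have "supp (a * l) ?D (\<Prod>j<a. armP l 0 :: ('k mpol) poly)" by simp
    then have "supp (Suc b * Q + a * l) ?J (actP Q (\<Prod>j<a. armP l 0) cs)"
    proof (rule supp_actP)
      fix i' j' assume i: "Q dvd i'" "i' \<le> Suc b * Q" and j: "j' \<in> ?D"
      obtain c' where c': "i' = Q * c'" using i(1) by blast
      have "c' * Q \<le> Suc b * Q" using i(2) unfolding c' by (simp only: mult.commute)
      then have "c' \<le> Suc b" using Q0 by (rule mult_right_le_imp_le)
      then show "i' + j' \<in> ?J" using c' j by (intro CollectI exI[of _ c'] exI[of _ j']) (simp only: mult.commute simp_thms)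
    qed
    moreover have "Suc b * Q + a * l \<le> L" using l by (simp add: algebra_simps)
    ultimately show ?thesis using supp_mono by blast
  qed
  obtain R where R: "supp L ?J R" "\<And>z. \<psi> (act N (low z) ?E) = poly R z"
    using functional_supp[OF \<psi> m low_el[OF p(1-3) l bQ] s] by blast
  have "P = Polynomial.smult c R"
  proof (rule low_poly_unique[OF P _ _ n(2)])
    show "\<psi> (act N (low z) v) = poly (Polynomial.smult c R) z" for z
      by (simp only: c act_smult[OF low_mem m] dualD(2)[OF \<psi> act_closed[OF low_mem m]] R(2) poly_smult)
    have "degree R \<le> L" using R(1) by (simp add: supp_def)
    then show "degree (Polynomial.smult c R) \<le> n" using degree_smult_le[of c R] n(1) by linarith
  qed
  then have "coeff R k \<noteq> 0" using k by auto
  then have "k \<in> ?J" using R(1) by (auto simp: supp_def)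
  then show ?thesis using that by blast
qed

text \<open>Observing the leg coordinates \<open>0, 1, Q + 2, ..., Q + b\<close> makes the reduced
  determinant triangular with \<open>b - 1\<close> diagonal entries \<open>z^Q\<close>. Leaving
  index 1 unshifted keeps the exponent below \<open>b Q\<close>, which is admissible for the swapped
  hook, whose arm is \<open>b\<close>.\<close>

lemma Dinv_legs:
  assumes p: "prime p" "CHAR('k) = p" "Q = p ^ e" and l: "l = Q + b" "b < Q" "1 \<le> b"
    and h: "h + 2 * \<Sum>{..b} = L" and n: "(b - 1) * Q \<le> n"
  shows "Dinv N h n ((b - 1) * Q)"
proof (rule DinvI)
  let ?E = "el (\<lambda>_. 0) (\<lambda>i. i)" and ?f = "\<lambda>i. if i \<le> 1 then i else Q + i"
  let ?cs = "map ?f [1..<Suc b]"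
  have i: "idx (\<lambda>_. 0) (\<lambda>i. i)" using l by (intro idx_top) simp
  show "wvec N h ?E" by (rule wvec_el[OF i]) (use h tsum_top in simp)
  show "(\<lambda>x\<in>carrier N. crd0 ?cs (\<Psi> x)) \<in> carrier (dual_rep SL2 N)" by (rule dual_restrict[OF fn_linear_crd0])
  fix z :: 'k
  have "crd0 ?cs (\<Psi> (act N (low z) ?E)) = dt (Suc b) (\<lambda>i j. gm l z j (?f i)) * (\<Prod>j<a. gm l z 0 0)"
    unfolding \<Psi>_low[OF i] by (rule crd0_map) (use l in auto)
  also have "dt (Suc b) (\<lambda>i j. gm l z j (?f i)) = dt (Suc b) (\<lambda>i j. \<Sum>k<Suc b. hm Q z k (?f i) * pm b z j k)"
    by (rule dt_cong) (simp only: gm_factor[OF p l(1,2)] less_Suc_eq_le mult.commute)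
  also have "\<dots> = dt (Suc b) (\<lambda>i k. hm Q z k (?f i)) * dt (Suc b) (\<lambda>k j. pm b z j k)" by (rule dt_mult)
  also have "dt (Suc b) (\<lambda>k j. pm b z j k) = 1" unfolding dt_transpose[of _ "\<lambda>k j. pm b z j k"] by (rule dt_pm)
  also have "dt (Suc b) (\<lambda>i k. hm Q z k (?f i)) = (\<Prod>i<Suc b. hm Q z i (?f i))"
    by (rule dt_lower) (use l in \<open>auto simp: hm_def\<close>)
  also have "\<dots> = (\<Prod>i<Suc b. if i \<le> 1 then 1 else z ^ Q)"
    by (rule prod.cong) (use l in \<open>auto simp: hm_def\<close>)
  also have "\<dots> = z ^ ((b - 1) * Q)"
  proof -
    obtain m where m: "b = Suc m" using l(3) by (cases b) auto
    have "(\<Prod>i<Suc (Suc m). if i \<le> 1 then 1 else z ^ Q) = (\<Prod>i<m. z ^ Q)"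
      unfolding prod.lessThan_Suc_shift by simp
    then show ?thesis using m by (simp add: power_mult[symmetric] mult.commute)
  qed
  finally have "crd0 ?cs (\<Psi> (act N (low z) ?E)) = 1 * z ^ ((b - 1) * Q)" by (simp add: gm_def)
  then show "(\<lambda>x\<in>carrier N. crd0 ?cs (\<Psi> x)) (act N (low z) ?E) = 1 * z ^ ((b - 1) * Q)"
    using act_closed[OF low_mem el_mem[OF i]] by simp
qed (use n in auto)

end

subsection \<open>The exceptional characteristic 2\<close>

text \<open>Neighbouring entries of row \<open>Q - 1\<close> of Pascal's triangle add up to an inner
  entry of row \<open>Q\<close>, which is even, so all of them are odd.\<close>

lemma binomial_2_pred:
  assumes c: "CHAR('k::field) = 2" "Q = 2 ^ e" and k: "k < Q"
  shows "(of_nat ((Q - 1) choose k) :: 'k) = 1"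
  using k
proof (induction k)
  case (Suc k)
  have "Q = Suc (Q - 1)" using c by simp
  then have "Q choose Suc k = ((Q - 1) choose k) + ((Q - 1) choose Suc k)" by (metis binomial_Suc_Suc)
  then have "(of_nat ((Q - 1) choose k) :: 'k) + of_nat ((Q - 1) choose Suc k) = of_nat (Q choose Suc k)" by simp
  also have "\<dots> = 0" using binomial_char_power[of 2 Q e "Suc k", where 'k = 'k] c Suc.prems by simp
  finally have "1 + (of_nat ((Q - 1) choose Suc k) :: 'k) = 0" using Suc by simp
  moreover have "(1 :: 'k) + 1 = 0" using of_nat_CHAR[where 'a = 'k] c by simp
  ultimately show ?case by (metis add_left_cancel)
qed simp

text \<open>Neighbouring entries of row \<open>Q - 2\<close> add up to an odd entry of row
  \<open>Q - 1\<close>, so parities alternate.\<close>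

lemma binomial_2_pred2:
  assumes c: "CHAR('k::field) = 2" "Q = 2 ^ e" and k: "k + 2 \<le> Q"
  shows "(of_nat ((Q - 2) choose k) :: 'k) = (if even k then 1 else 0)"
  using k
proof (induction k)
  case (Suc k)
  have "Q - 1 = Suc (Q - 2)" using Suc.prems by simp
  then have "(Q - 1) choose Suc k = ((Q - 2) choose k) + ((Q - 2) choose Suc k)" by (metis binomial_Suc_Suc)
  then have "(of_nat ((Q - 2) choose k) :: 'k) + of_nat ((Q - 2) choose Suc k) = of_nat ((Q - 1) choose Suc k)" by simp
  also have "\<dots> = 1" by (rule binomial_2_pred[OF c]) (use Suc.prems in simp)
  finally have "(of_nat ((Q - 2) choose k) :: 'k) + of_nat ((Q - 2) choose Suc k) = 1" .
  moreover have "(1 :: 'k) + 1 = 0" using of_nat_CHAR[where 'a = 'k] c by simp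
  ultimately show ?case using Suc by (auto split: if_splits)
qed simp

text \<open>Below \<open>Q\<close> the shifted summand is absent, so coefficients of the large
  symmetric power agree with those of the small one.\<close>

lemma binomial_2_shift:
  assumes c: "CHAR('k::field) = 2" "Q = 2 ^ e" and "k < Q" "d \<le> b"
  shows "(of_nat ((Q + b - d) choose k) :: 'k) = of_nat ((b - d) choose k)"
  using binomial_char[of 2 Q e "b - d" k, where 'k = 'k] assms by simp

text \<open>The arms and legs of the five hook tableaux that span the second weight space below the top.\<close>

definition arm :: "nat \<Rightarrow> nat \<Rightarrow> nat" where
  "arm k = (if k = 1 then (\<lambda>j. if j = 0 then 2 else 0) else if k = 2 then (\<lambda>j. if j < 2 then 1 else 0)
     else if k = 3 then (\<lambda>j. if j = 0 then 1 else 0) else (\<lambda>_. 0))"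

definition col :: "nat \<Rightarrow> nat \<Rightarrow> nat \<Rightarrow> nat" where
  "col b k = (if k = 3 then (\<lambda>i. if i = b then Suc b else i) else if k = 4 then (\<lambda>i. if i = b then b + 2 else i)
     else if k = 5 then (\<lambda>i. if b \<le> Suc i then Suc i else i) else (\<lambda>i. i))"

lemma prod_arm_1: "0 < a \<Longrightarrow> (\<Prod>j<a. if j = 0 then u else w) = u * (w :: 'a::comm_monoid_mult) ^ (a - 1)"
  by (cases a) (simp_all add: prod.lessThan_Suc_shift del: prod.lessThan_Suc)

lemma prod_arm_2: "2 \<le> a \<Longrightarrow> (\<Prod>j<a. if j < 2 then u else w) = u ^ 2 * (w :: 'a::comm_monoid_mult) ^ (a - 2)"
proof -
  assume "2 \<le> a"
  then obtain m where m: "a = Suc (Suc m)" by (metis Suc_le_D numeral_2_eq_2 Suc_le_mono)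
  show ?thesis unfolding m by (simp add: prod.lessThan_Suc_shift power2_eq_square mult.assoc del: prod.lessThan_Suc)
qed

lemma prod_arms:
  assumes "2 \<le> a"
  shows "(\<Prod>j<a. f (arm 1 j)) = f 2 * (f 0 :: 'a::comm_monoid_mult) ^ (a - 1)"
    "(\<Prod>j<a. f (arm 2 j)) = f 1 ^ 2 * f 0 ^ (a - 2)"
    "(\<Prod>j<a. f (arm 3 j)) = f 1 * f 0 ^ (a - 1)"
    "(\<Prod>j<a. f (arm 4 j)) = f 0 ^ a" "(\<Prod>j<a. f (arm 5 j)) = f 0 ^ a"
  using assms prod_arm_1[of a "f 2" "f 0"] prod_arm_2[of a "f 1" "f 0"] prod_arm_1[of a "f 1" "f 0"]
  by (simp_all add: arm_def if_distrib[of f] cong: if_cong)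

text \<open>An excess of 2 in the index sum lowers the weight by 4, from \<open>h\<close> to
  \<open>h - 4\<close>.\<close>

lemma tsum_arm_col:
  assumes "2 \<le> a"
  shows "tsum a b (arm 1) (\<lambda>i. i) = \<Sum>{..b} + 2" "tsum a b (arm 2) (\<lambda>i. i) = \<Sum>{..b} + 2"
proof -
  obtain m where m: "a = Suc (Suc m)" using assms by (metis Suc_le_D numeral_2_eq_2 Suc_le_mono)
  show "tsum a b (arm 1) (\<lambda>i. i) = \<Sum>{..b} + 2" "tsum a b (arm 2) (\<lambda>i. i) = \<Sum>{..b} + 2"
    unfolding tsum_def m by (simp_all add: arm_def sum.lessThan_Suc_shift del: sum.lessThan_Suc)
qed

lemma crd1_map:
  assumes "f 0 = 0" "\<And>i. i \<le> b \<Longrightarrow> f i \<le> l" "y \<le> l" "y \<noteq> 0"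
  obtains D where "crd1 y (map f [1..<Suc b]) (hookE {..l} a b \<alpha> \<kappa>) = D * (\<Prod>j<a. [:\<alpha> j 0, \<alpha> j y:])"
    "coeff D 0 = dt (Suc b) (\<lambda>i j. \<kappa> j (f i))"
proof -
  obtain D where D: "crd1 y (map f [1..<Suc b]) (hookE {..l} a b \<alpha> \<kappa>) = D * (\<Prod>j<a. [:\<alpha> j 0, \<alpha> j y:])"
    "coeff D 0 = dt (Suc b) (\<lambda>i j. \<kappa> j ((0 # map f [1..<Suc b]) ! i))"
    by (rule crd1_hookE[of "map f [1..<Suc b]" b "{..l}" y]) (use assms in \<open>auto simp: less_Suc_eq_le simp del: upt_Suc\<close>)
  have "dt (Suc b) (\<lambda>i j. \<kappa> j ((0 # map f [1..<Suc b]) ! i)) = dt (Suc b) (\<lambda>i j. \<kappa> j (f i))"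
    by (rule dt_cong) (use assms(1) in \<open>simp add: nth_Cons' del: upt_Suc\<close>)
  with D(2) have "coeff D 0 = dt (Suc b) (\<lambda>i j. \<kappa> j (f i))" by (rule trans)
  with D(1) show ?thesis by (rule that)
qed

lemma pCons_0_monom: "[:0, c:] = monom c 1"
  by (simp add: One_nat_def monom_Suc monom_0)

context nabla_upper
begin

lemma wvec_minus:
  assumes x: "wvec N w x" and y: "wvec N w y"
  shows "wvec N w (x \<oplus>\<^bsub>N\<^esub> (c \<odot>\<^bsub>N\<^esub> y))"
proof -
  have m: "x \<in> carrier N" "y \<in> carrier N" using x y by (simp_all add: wvec_def)
  note cm = closed(2)[OF m(2), of c]
  have "act N (tor t) (x \<oplus>\<^bsub>N\<^esub> (c \<odot>\<^bsub>N\<^esub> y)) = t ^ w \<odot>\<^bsub>N\<^esub> (x \<oplus>\<^bsub>N\<^esub> (c \<odot>\<^bsub>N\<^esub> y))" if t: "t \<noteq> 0" for t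
  proof (rule \<Psi>_inj)
    have "act N (tor t) x = t ^ w \<odot>\<^bsub>N\<^esub> x" "act N (tor t) y = t ^ w \<odot>\<^bsub>N\<^esub> y" using x y t by (simp_all add: wvec_def)
    then show "\<Psi> (act N (tor t) (x \<oplus>\<^bsub>N\<^esub> (c \<odot>\<^bsub>N\<^esub> y))) = \<Psi> (t ^ w \<odot>\<^bsub>N\<^esub> (x \<oplus>\<^bsub>N\<^esub> (c \<odot>\<^bsub>N\<^esub> y)))"
      by (simp only: act_add[OF tor_mem[OF t] m(1) cm] act_smult[OF tor_mem[OF t] m(2)] \<Psi>_add \<Psi>_smult closed m cm
        fs.scale_right_distrib fs.scale_scale mult.commute[of c])
  qed (use act_closed[OF tor_mem[OF t]] closed m cm in blast)+
  then show ?thesis using closed(1)[OF m(1) cm] by (simp add: wvec_def)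
qed

text \<open>The coefficients at \<open>z\<^bsup>2b-2\<^esup>\<close> of the two tableaux \<open>arm 1\<close> and \<open>arm 2\<close> are both
  \<open>x\<^sub>0\<^bsup>a-2\<^esup> x\<^sub>b\<^sup>2\<close>, hence cancel in the difference.\<close>

lemma Kinv_char_2:
  assumes p: "CHAR('k) = 2" "Q = 2 ^ e" "b = 2 ^ j" "a = 2 ^ i" and j: "0 < j" "j < i" "i < e" and l: "l = Q + b"
    and h: "h + 2 * \<Sum>{..b} = L" "4 \<le> h" and n: "L \<le> n" "finite (UNIV :: 'k set) \<Longrightarrow> n < card (UNIV :: 'k set)"
  shows "Kinv N (h - 4) n (2 * b - 2)"
proof -
  have "(2::nat) ^ 1 \<le> 2 ^ j" "2 ^ Suc j \<le> (2::nat) ^ i" "2 ^ Suc j \<le> (2::nat) ^ e"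
    using j by (intro power_increasing; simp)+
  then have bb: "2 \<le> b" "2 * b \<le> a" "2 * b \<le> Q" unfolding p(2-4) by simp_all
  then have "b < Q" "2 \<le> a" by linarith+
  note bb = bb this
  have p2: "prime (2::nat)" by simp
  have dQ: "b dvd Q" using p j by (simp add: le_imp_power_dvd)
  let ?x = "el (arm 1) (\<lambda>i. i)" and ?y = "el (arm 2) (\<lambda>i. i)"
  let ?v = "?x \<oplus>\<^bsub>N\<^esub> ((- 1) \<odot>\<^bsub>N\<^esub> ?y)"
  have arm: "arm k j \<le> l" for k j using l bb by (simp add: arm_def)
  have ix: "idx (arm k) (\<lambda>i. i)" for k using l arm by (simp add: hidx_def)
  note m = el_mem[OF ix[of 1]] el_mem[OF ix[of 2]]
  note ym = closed(2)[OF m(2), of "- 1"]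
  have wv: "wvec N (h - 4) ?v"
    by (intro wvec_minus wvec_el ix) (use tsum_arm_col[OF bb(5)] h in simp_all)
  have vm: "?v \<in> carrier N" using wv by (simp add: wvec_def)
  \<comment> \<open>The coefficient linear in \<open>x_2\<close>, at leg coordinates
    \<open>1, ..., b\<close>, separates the two tableaux: \<open>arm 1\<close> contains the entry 2
    once, \<open>arm 2\<close> not at all.\<close>
  have ne: "?v \<noteq> \<zero>\<^bsub>N\<^esub>"
  proof
    assume "?v = \<zero>\<^bsub>N\<^esub>"
    then have "\<Psi> ?x + fscale (- 1) (\<Psi> ?y) = 0" using \<Psi>_zero by (simp only: \<Psi>_add[OF m(1) ym, symmetric] \<Psi>_smult[OF m(2), symmetric])
    moreover note lin = fn_linearD[OF fn_linear_crd1[of 2 "map (\<lambda>i. i) [1..<Suc b]" 1]]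
    have v: "coeff (crd1 2 (map (\<lambda>i. i) [1..<Suc b]) (\<Psi> (el (arm k) (\<lambda>i. i)))) 1 = (if k = 1 then 1 else 0 :: 'k)"
      if k: "k \<in> {1, 2}" for k
    proof -
      obtain D where D: "crd1 2 (map (\<lambda>i. i) [1..<Suc b]) (hookD l a b (arm k) (\<lambda>i. i)) =
          D * (\<Prod>j<a. [:dl (arm k j) 0, dl (arm k j) 2:])"
        "coeff D 0 = dt (Suc b) (\<lambda>i j. dl j i :: 'k)"
        by (rule crd1_map[of "\<lambda>i. i" b l 2 a "\<lambda>j. dl (arm k j)" dl]) (use l bb in auto)
      have "dt (Suc b) (\<lambda>i j. dl j i) = (1 :: 'k)" by (subst dt_upper) simp_all
      then have D1: "coeff D 0 = 1" using D(2) by simp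
      have "k = 1 \<or> k = 2" using k by blast
      then show ?thesis
      proof
        assume k: "k = 1"
        have z: "(\<Prod>j<a. [:dl (arm 1 j) 0, dl (arm 1 j) 2:]) = ([:0, 1:] :: 'k poly)"
          using prod_arms(1)[OF bb(5), of "\<lambda>x. [:dl x 0, dl x 2:] :: 'k poly"] by (simp add: one_pCons[symmetric])
        show ?thesis unfolding k \<Psi>_el[OF ix] D(1)[unfolded k] z by (simp add: D1 One_nat_def)
      next
        assume k: "k = 2"
        have z: "(\<Prod>j<a. [:dl (arm 2 j) 0, dl (arm 2 j) 2:]) = (0 :: 'k poly)"
          using prod_arms(2)[OF bb(5), of "\<lambda>x. [:dl x 0, dl x 2:] :: 'k poly"] by simp
        show ?thesis unfolding k \<Psi>_el[OF ix] D(1)[unfolded k] z by simp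
      qed
    qed
    moreover have "coeff (crd1 2 (map (\<lambda>i. i) [1..<Suc b]) (\<Psi> ?x + fscale (- 1) (\<Psi> ?y))) 1 = (1 :: 'k)"
      unfolding lin by (simp only: v insert_iff refl simp_thms) simp
    moreover have "coeff (crd1 2 (map (\<lambda>i. i) [1..<Suc b]) (0 :: 'k mfun)) 1 = (0 :: 'k)"
      using lin(2)[of "0 :: 'k" 0] by simp
    ultimately show False by simp
  qed
  \<comment> \<open>Leg exponents are multiples of \<open>Q\<close>, and \<open>Q \<ge> 2 b\<close>.
    As \<open>a - 2\<close> is even, \<open>A 0 ^ (a - 2)\<close> is a power of a square and has
    exponents 0 or at least \<open>2 b\<close>. So \<open>z^(2b-2)\<close> could only come from
    \<open>?D\<close>, what remains of the two arm products after their common factor is split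
    off.\<close>
  let ?J = "{k. k \<noteq> 2 * b - 2}" and ?K = "{0} \<union> {2 * b..}"
  define A :: "nat \<Rightarrow> ('k mpol) poly" where "A = armP l"
  let ?D = "A 0 * A 2 - A 1 ^ 2"
  have C2: "CHAR('k mpol) = 2" using CHAR_sym[where 'k = 'k] p(1) by simp
  have D: "supp (2 * l) ?J ?D"
  proof -
    have "degree (A k) \<le> l" for k using supp_armP[of l k] by (simp add: A_def supp_def)
    then have d: "degree ?D \<le> 2 * l"
      by (intro degree_diff_le order_trans[OF degree_mult_le] order_trans[OF degree_power_le])
        (simp_all add: add_mono mult_2 mult.commute[of _ 2])
    have c0: "coeff (A 0) k = (if k = 0 \<or> k = b then single {#k#} 1 else 0)" if "k \<le> 2 * b - 2" for k
    proof -
      have k: "k < Q" "k \<le> l" using that bb l by auto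
      have "(of_nat (l choose k) :: 'k) = of_nat (b choose k)"
        using binomial_2_shift[OF p(1,2) k(1), of 0 b] l by simp
      then show ?thesis
        using k binomial_char_power[OF p2 p(1,3), of k] by (simp add: A_def coeff_armP del: One_nat_def)
    qed
    \<comment> \<open>Up to \<open>2 b - 2\<close> the polynomial \<open>A 0\<close> has terms only
      at 0 and at \<open>b\<close>. The first meets \<open>C(b - 2, 2 b - 2) = 0\<close>, and the
      second gives the square of \<open>x_b\<close>, the same as the coefficient of
      \<open>A 1 ^ 2\<close>.\<close>
    have "coeff (A 0 * A 2) (2 * b - 2) =
        (\<Sum>k\<le>2 * b - 2. coeff (A 0) k * coeff (A 2) (2 * b - 2 - k))"
      by (rule Polynomial.coeff_mult)
    also have "\<dots> = (\<Sum>k\<le>2 * b - 2. if k = b then single {#b#} 1 * single {#b#} 1 else 0)"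
    proof (rule sum.cong)
      fix k assume k: "k \<in> {..2 * b - 2}"
      have t: "coeff (A 2) (2 * b - 2) = 0"
        using binomial_2_shift[OF p(1,2), of "2 * b - 2" 2 b] bb l by (simp add: A_def coeff_armP binomial_eq_0)
      have u: "coeff (A 2) (2 * b - 2 - b) = single {#b#} 1"
      proof -
        have e: "2 * b - 2 - b = b - 2" "b - 2 + 2 = b" using bb by simp_all
        show ?thesis using binomial_2_shift[OF p(1,2), of "b - 2" 2 b] bb l
          unfolding e(1) A_def coeff_armP e(2) by simp
      qed
      have c: "coeff (A 0) k = (if k = 0 \<or> k = b then single {#k#} 1 else 0)"
        using k by (intro c0) simp
      consider "k = 0" | "k = b" | "k \<noteq> 0" "k \<noteq> b" by blast
      then show "coeff (A 0) k * coeff (A 2) (2 * b - 2 - k) =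
          (if k = b then single {#b#} 1 * single {#b#} 1 else 0)"
      proof cases
        case 1
        then have "k \<noteq> b" using bb(1) by simp
        then show ?thesis using 1 by (simp only: t diff_zero mult_zero_right if_False)
      next
        case 2
        then show ?thesis unfolding c by (simp only: u if_True simp_thms)
      qed (simp add: c)
    qed simp
    also have "\<dots> = single {#b#} 1 * single {#b#} 1" using bb by simp
    finally have 1: "coeff (A 0 * A 2) (2 * b - 2) = single {#b#} 1 * single {#b#} 1" .
    have "coeff (A 1) (b - 1) = single {#b#} 1"
    proof -
      have e: "b - 1 + 1 = b" using bb by simp
      show ?thesis using binomial_2_shift[OF p(1,2), of "b - 1" 1 b] bb l unfolding A_def coeff_armP e by simp
    qed
    then have "coeff (A 1 ^ 2) (2 * b - 2) = single {#b#} 1 ^ 2"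
      using coeff_square_char_2[OF C2, of "A 1" "b - 1"] by (simp add: right_diff_distrib')
    with 1 have "coeff ?D (2 * b - 2) = 0" by (simp add: power2_eq_square)
    then show ?thesis using d unfolding supp_def by blast
  qed
  have K0: "supp ((a - 2) * l) ?K (A 0 ^ (a - 2))"
  proof -
    have s2: "supp (2 * l) ((*) 2 ` {0, b, Q, Q + b}) (A 0 ^ 2)" unfolding A_def
      by (rule supp_frobenius[of 2 2 1, OF _ C2 _ supp_armP_0[OF p2 p(1-3) l]]) simp_all
    have "supp (2 * l) ?K (A 0 ^ 2)" by (rule supp_mono[OF s2]) (use bb in auto)
    then have "supp ((a - 2) div 2 * (2 * l)) ?K ((A 0 ^ 2) ^ ((a - 2) div 2))"
      by (rule supp_power) auto
    moreover have "even a" using p(4) j by simp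
    then have h2: "2 * ((a - 2) div 2) = a - 2" "(a - 2) div 2 * 2 = a - 2" by simp_all
    have "(a - 2) div 2 * (2 * l) = (a - 2) * l" by (simp only: mult.assoc[symmetric] h2(2))
    moreover have "(A 0 ^ 2) ^ ((a - 2) div 2) = A 0 ^ (a - 2)" by (simp only: power_mult[symmetric] h2(1))
    ultimately show ?thesis by simp
  qed
  have "supp ((a - 2) * l + 2 * l) ?J (A 0 ^ (a - 2) * ?D)"
    by (rule supp_mult[OF K0 D]) (use bb in auto)
  then have "supp (Suc b * Q + ((a - 2) * l + 2 * l)) ?J (actP Q (A 0 ^ (a - 2) * ?D) cs)" for cs
  proof (rule supp_actP)
    fix c d assume c: "Q dvd c" and d: "d \<in> ?J"
    show "c + d \<in> ?J"
    proof (cases "c = 0")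
      case False
      then have "Q \<le> c" using dvd_imp_le[OF c] by simp
      then show ?thesis using bb by simp
    qed (use d in simp)
  qed
  moreover have "Suc b * Q + ((a - 2) * l + 2 * l) \<le> L"
  proof -
    have "a - 2 + 2 = a" using bb by simp
    then have "(a - 2) * l + 2 * l = a * l" by (simp only: distrib_right[symmetric])
    then show ?thesis using l by (simp add: algebra_simps)
  qed
  ultimately have s: "supp L ?J (actP Q (A 0 ^ (a - 2) * ?D) cs)" for cs using supp_mono by blast
  have vP: "\<Psi> (act N (low z) ?v) cs = poly (actP Q (A 0 ^ (a - 2) * ?D) cs) (single {#} z)" for z cs
  proof -
    have "\<Psi> (act N (low z) ?v) = \<Psi> (act N (low z) ?x) + fscale (- 1) (\<Psi> (act N (low z) ?y))"
      by (simp only: act_add[OF low_mem m(1) ym] act_smult[OF low_mem m(2)] \<Psi>_add[OF act_closed[OF low_mem m(1)]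
        closed(2)[OF act_closed[OF low_mem m(2)]]] \<Psi>_smult[OF act_closed[OF low_mem m(2)]])
    then have "\<Psi> (act N (low z) ?v) cs = \<Psi> (act N (low z) ?x) cs - \<Psi> (act N (low z) ?y) cs"
      by (simp add: fscale_def single_uminus single_one)
    also have "\<Psi> (act N (low z) ?x) cs = poly (actP Q (A 2 * A 0 ^ (a - 1)) cs) (single {#} z)"
      unfolding low_el[OF p2 p(1,2) l bb(4) arm] prod_arms[OF bb(5)] A_def ..
    also have "\<Psi> (act N (low z) ?y) cs = poly (actP Q (A 1 ^ 2 * A 0 ^ (a - 2)) cs) (single {#} z)"
      unfolding low_el[OF p2 p(1,2) l bb(4) arm] prod_arms[OF bb(5)] A_def ..
    also have "A 2 * A 0 ^ (a - 1) = A 0 ^ (a - 2) * (A 0 * A 2)"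
    proof -
      have "a - 1 = Suc (a - 2)" using bb by simp
      then show ?thesis by (simp add: mult_ac)
    qed
    finally have e: "\<Psi> (act N (low z) ?v) cs = poly (actP Q (A 0 ^ (a - 2) * (A 0 * A 2)) cs) (single {#} z) -
        poly (actP Q (A 1 ^ 2 * A 0 ^ (a - 2)) cs) (single {#} z)" .
    show ?thesis unfolding e by (simp add: actP_def algebra_simps)
  qed
  have "coeff P (2 * b - 2) = 0" if P: "low_poly N n ?v \<psi> P" for \<psi> P
  proof -
    have \<psi>: "\<psi> \<in> carrier (dual_rep SL2 N)" using P by (simp add: low_poly_def)
    obtain R where R: "supp L ?J R" "\<And>z. \<psi> (act N (low z) ?v) = poly R z"
      using functional_supp[OF \<psi> vm vP s] by blast
    have "degree R \<le> n" using R(1) n(1) by (simp add: supp_def)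
    then have "P = R" using low_poly_unique[OF P R(2) _ n(2)] by blast
    then show ?thesis using R(1) unfolding supp_def by blast
  qed
  then show ?thesis using wv ne unfolding Kinv_def by blast
qed

end

section \<open>Classification of the tableaux in the second weight space below the top\<close>

lemma arms_mset:
  assumes U: "U \<subseteq> {..<a}" and \<alpha>: "\<And>j. j < a \<Longrightarrow> \<alpha> j = (if j \<in> U then c else 0)"
  shows "image_mset \<alpha> (mset_set {..<a}) = replicate_mset (card U) c + replicate_mset (a - card U) (0 :: nat)"
proof -
  have fin: "finite U" using U finite_subset by blast
  have "mset_set {..<a} = mset_set U + mset_set ({..<a} - U)"
    using mset_set_Union[of U "{..<a} - U"] fin U by (simp add: Un_absorb1)
  moreover have "image_mset \<alpha> (mset_set U) = image_mset (\<lambda>_. c) (mset_set U)"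
    using U fin by (intro image_mset_cong) (auto simp: \<alpha>)
  moreover have "image_mset \<alpha> (mset_set ({..<a} - U)) = image_mset (\<lambda>_. 0) (mset_set ({..<a} - U))"
    by (intro image_mset_cong) (auto simp: \<alpha>)
  ultimately show ?thesis using U fin by (simp add: image_mset_const_eq card_Diff_subset)
qed

lemma arms_mset_cong:
  fixes \<alpha> \<alpha>' :: "nat \<Rightarrow> nat"
  assumes "U \<subseteq> {..<a}" "\<And>j. j < a \<Longrightarrow> \<alpha> j = (if j \<in> U then c else 0)"
    and "U' \<subseteq> {..<a}" "\<And>j. j < a \<Longrightarrow> \<alpha>' j = (if j \<in> U' then c else 0)" and "card U = card U'"
  shows "image_mset \<alpha> (mset_set {..<a}) = image_mset \<alpha>' (mset_set {..<a})"
proof -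
  have "image_mset \<alpha> (mset_set {..<a}) = replicate_mset (card U) c + replicate_mset (a - card U) 0"
    by (rule arms_mset) (use assms in auto)
  also have "\<dots> = image_mset \<alpha>' (mset_set {..<a})"
    unfolding assms(5) by (rule arms_mset[symmetric]) (use assms in auto)
  finally show ?thesis .
qed

lemma arms_sum_1:
  fixes \<alpha> :: "nat \<Rightarrow> nat"
  assumes s: "(\<Sum>j<a. \<alpha> j) = 1"
  shows "image_mset \<alpha> (mset_set {..<a}) = image_mset (arm 3) (mset_set {..<a})"
proof -
  have "\<exists>j\<in>{..<a}. \<alpha> j \<noteq> 0" using s by (metis sum.neutral zero_neq_one)
  then obtain i where i: "i < a" "\<alpha> i \<noteq> 0" by blast
  have "(\<Sum>j<a. \<alpha> j) = \<alpha> i + (\<Sum>j\<in>{..<a} - {i}. \<alpha> j)" using i by (intro sum.remove) auto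
  then have "\<alpha> i + (\<Sum>j\<in>{..<a} - {i}. \<alpha> j) = 1" using s by simp
  then have "\<alpha> i = 1" "(\<Sum>j\<in>{..<a} - {i}. \<alpha> j) = 0" using i(2) by linarith+
  then have \<alpha>: "\<alpha> j = (if j \<in> {i} then 1 else 0)" if "j < a" for j using that by (auto simp: sum_eq_0_iff)
  show ?thesis by (rule arms_mset_cong[of "{i}" a \<alpha> 1 "{0}"]) (use i(1) \<alpha> in \<open>auto simp: arm_def\<close>)
qed

lemma arms_sum_2:
  fixes \<alpha> :: "nat \<Rightarrow> nat"
  assumes s: "(\<Sum>j<a. \<alpha> j) = 2"
  shows "image_mset \<alpha> (mset_set {..<a}) = image_mset (arm 1) (mset_set {..<a}) \<or>
    image_mset \<alpha> (mset_set {..<a}) = image_mset (arm 2) (mset_set {..<a})"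
proof -
  have "\<exists>j\<in>{..<a}. \<alpha> j \<noteq> 0" using s by (metis sum.neutral zero_neq_numeral)
  then obtain i where i: "i < a" "\<alpha> i \<noteq> 0" by blast
  have "(\<Sum>j<a. \<alpha> j) = \<alpha> i + (\<Sum>j\<in>{..<a} - {i}. \<alpha> j)" using i by (intro sum.remove) auto
  then have si: "\<alpha> i + (\<Sum>j\<in>{..<a} - {i}. \<alpha> j) = 2" using s by simp
  then consider "\<alpha> i = 2" "(\<Sum>j\<in>{..<a} - {i}. \<alpha> j) = 0" | "\<alpha> i = 1" "(\<Sum>j\<in>{..<a} - {i}. \<alpha> j) = 1"
    using i(2) by linarith
  then show ?thesis
  proof cases
    case 1
    then have \<alpha>: "\<alpha> j = (if j \<in> {i} then 2 else 0)" if "j < a" for j using that by (auto simp: sum_eq_0_iff)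
    have "image_mset \<alpha> (mset_set {..<a}) = image_mset (arm 1) (mset_set {..<a})"
      by (rule arms_mset_cong[of "{i}" a \<alpha> 2 "{0}"]) (use i(1) \<alpha> in \<open>auto simp: arm_def\<close>)
    then show ?thesis ..
  next
    case 2
    have "\<exists>j\<in>{..<a} - {i}. \<alpha> j \<noteq> 0" using 2(2) by (metis sum.neutral zero_neq_one)
    then obtain k where k: "k < a" "k \<noteq> i" "\<alpha> k \<noteq> 0" by blast
    have "(\<Sum>j\<in>{..<a} - {i}. \<alpha> j) = \<alpha> k + (\<Sum>j\<in>{..<a} - {i} - {k}. \<alpha> j)" using k by (intro sum.remove) auto
    then have "\<alpha> k + (\<Sum>j\<in>{..<a} - {i} - {k}. \<alpha> j) = 1" using 2(2) by simp
    then have "\<alpha> k = 1" "(\<Sum>j\<in>{..<a} - {i} - {k}. \<alpha> j) = 0" using k(3) by linarith+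
    then have \<alpha>: "\<alpha> j = (if j \<in> {i, k} then 1 else 0)" if "j < a" for j using that 2(1) by (auto simp: sum_eq_0_iff)
    have "image_mset \<alpha> (mset_set {..<a}) = image_mset (arm 2) (mset_set {..<a})"
    proof (rule arms_mset_cong[of "{i, k}" a \<alpha> 1 "{0, 1}"])
      show "{0, 1} \<subseteq> {..<a}" using i(1) k(1,2) by auto
      show "arm 2 j = (if j \<in> {0, 1} then 1 else 0)" for j by (auto simp: arm_def)
    qed (use i(1) k(1,2) \<alpha> in auto)
    then show ?thesis ..
  qed
qed

lemma col_inj: "inj_on (col b k) {..b}"
  by (auto simp: inj_on_def col_def split: if_splits)

lemma col_image:
  "col b 3 ` {..b} = insert (Suc b) {..<b}" "col b 4 ` {..b} = insert (b + 2) {..<b}"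
  "0 < b \<Longrightarrow> col b 5 ` {..b} = insert (Suc b) (insert b {..<b - 1})"
proof -
  have e: "{..b} = insert b {..<b}" by auto
  show "col b 3 ` {..b} = insert (Suc b) {..<b}" "col b 4 ` {..b} = insert (b + 2) {..<b}"
    unfolding e image_insert by (auto simp: col_def image_def)
  assume "0 < b"
  then have "{..b} = insert b (insert (b - 1) {..<b - 1})" by auto
  then show "col b 5 ` {..b} = insert (Suc b) (insert b {..<b - 1})"
    using \<open>0 < b\<close> by (auto simp: col_def image_def)
qed

text \<open>The excess 2 splits between arm and leg as 2+0, 1+1 or 0+2. The arm realises 2 in two
  ways, as does the leg, and the mixed case is unique: five tableaux up to symmetry.\<close>

lemma hookD_second_span:
  assumes i: "hidx l a b \<alpha> \<kappa>" and s: "tsum a b \<alpha> \<kappa> = \<Sum>{..b} + 2" and b: "0 < b"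
  shows "\<exists>k\<in>{1..5::nat}. hookD l a b \<alpha> \<kappa> \<in>
    fs.span {hookD l a b (arm k) (col b k) :: ('k::field) mfun}"
proof (cases "hookD l a b \<alpha> \<kappa> = (0 :: 'k mfun)")
  case True
  then show ?thesis by (intro bexI[of _ 1]) (simp_all add: fs.span_zero)
next
  case False
  note inj = hookD_inj[OF False]
  have S: "finite (\<kappa> ` {..b})" "card (\<kappa> ` {..b}) = Suc b" "\<Sum>(\<kappa> ` {..b}) = (\<Sum>i\<le>b. \<kappa> i)"
    using card_image[OF inj] sum.reindex[OF inj, of "\<lambda>x. x"] by simp_all
  have ge: "\<Sum>{..b} \<le> (\<Sum>i\<le>b. \<kappa> i)" by (rule hookD_tsum_bounds(1)[OF False i])
  have fin: "hookD l a b \<alpha> \<kappa> \<in> fs.span {hookD l a b (arm k) (col b k) :: 'k mfun}"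
    if "\<kappa> ` {..b} = col b k ` {..b}" and "image_mset \<alpha> (mset_set {..<a}) = image_mset (arm k) (mset_set {..<a})" for k
  proof -
    have "hookD l a b (arm k) \<kappa> \<in> fs.span {hookD l a b (arm k) (col b k) :: 'k mfun}"
      by (rule hookE_enum_span[where v = dl, OF col_inj inj that(1)])
    then show ?thesis using hookE_arms[OF that(2), of "{..l}" b "dl :: nat \<Rightarrow> nat \<Rightarrow> 'k" "\<lambda>i. dl (\<kappa> i)"] by (simp only:)
  qed
  let ?A = "\<Sum>j<a. \<alpha> j" and ?B = "\<Sum>i\<le>b. \<kappa> i"
  have "?A + ?B = \<Sum>{..b} + 2" using s by (simp add: tsum_def)
  with ge consider "?A = 2" "?B = \<Sum>{..b}" | "?A = 1" "?B = Suc (\<Sum>{..b})" | "?A = 0" "?B = \<Sum>{..b} + 2" by linarith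
  then show ?thesis
  proof cases
    case 1
    have "\<kappa> ` {..b} = {..b}" using sum_eq_base[OF S(1,2)] S(3) 1(2) by (simp add: lessThan_Suc_atMost)
    then have "\<kappa> ` {..b} = col b 1 ` {..b}" "\<kappa> ` {..b} = col b 2 ` {..b}" by (simp_all add: col_def)
    then show ?thesis using arms_sum_2[OF 1(1)] fin[of 1] fin[of 2] by auto
  next
    case 2
    have "\<kappa> ` {..b} = col b 3 ` {..b}"
      using sum_eq_base_1[OF S(1,2)] S(3) 2(2) by (simp add: lessThan_Suc_atMost col_image)
    then show ?thesis using arms_sum_1[OF 2(1)] fin[of 3] by (intro bexI[of _ 3]) auto
  next
    case 3
    have "\<kappa> ` {..b} = col b 4 ` {..b} \<or> \<kappa> ` {..b} = col b 5 ` {..b}"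
      using sum_eq_base_2[OF S(1,2) _ b] S(3) 3(2) by (simp add: lessThan_Suc_atMost col_image b)
    moreover have "image_mset \<alpha> (mset_set {..<a}) = image_mset (arm k) (mset_set {..<a})" if "k \<in> {4, 5}" for k
      using 3(1) that by (intro image_mset_cong) (auto simp: arm_def)
    ultimately consider "hookD l a b \<alpha> \<kappa> \<in> fs.span {hookD l a b (arm 4) (col b 4) :: 'k mfun}"
      | "hookD l a b \<alpha> \<kappa> \<in> fs.span {hookD l a b (arm 5) (col b 5) :: 'k mfun}"
      using fin[of 4] fin[of 5] by blast
    then show ?thesis
    proof cases
      case 1
      then show ?thesis by (intro bexI[of _ 4]) auto
    next
      case 2
      then show ?thesis by (intro bexI[of _ 5]) auto
    qed
  qed
qed

lemma span_image_combination:
  assumes "finite A" "x \<in> fs.span (f ` A)"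
  shows "\<exists>y. x = (\<Sum>i\<in>A. fscale (y i) (f i))"
  using assms
proof (induction A arbitrary: x)
  case (insert i A)
  obtain k where "x - fscale k (f i) \<in> fs.span (f ` A)"
    using insert.prems fs.span_breakdown_eq[of x "f i" "f ` A"] by auto
  then obtain y where y: "x - fscale k (f i) = (\<Sum>i\<in>A. fscale (y i) (f i))" using insert.IH by blast
  have "x = fscale k (f i) + (\<Sum>i\<in>A. fscale (y i) (f i))" unfolding y[symmetric] by simp
  also have "\<dots> = fscale ((y(i := k)) i) (f i) + (\<Sum>j\<in>A. fscale ((y(i := k)) j) (f j))"
    using insert.hyps by (intro arg_cong2[where f = "(+)"] sum.cong) auto
  also have "\<dots> = (\<Sum>j\<in>insert i A. fscale ((y(i := k)) j) (f j))"
    by (rule sum.insert[symmetric, OF insert.hyps])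
  finally show ?case by blast
qed simp

lemma gm_add: "i + d \<le> l \<Longrightarrow> gm l z i (i + d) = of_nat ((l - i) choose d) * z ^ d"
  by (simp add: gm_def)

context nabla_upper
begin

text \<open>The coordinates of \<open>v\<close> vanish one after the other (4, 5, 3, 1, 2), each time by a functional
  that sees only this tableau among those not yet excluded.\<close>

lemma not_Kinv_char_2:
  assumes p: "CHAR('k) = 2" "Q = 2 ^ e" "b = 2 ^ j" "a = 2 ^ i" and ij: "0 < i" "i < j" "j < e" and l: "l = Q + b"
    and h: "h + 2 * \<Sum>{..b} = L" "4 \<le> h" and n: "2 * a - 2 \<le> n"
    and small: "finite (UNIV :: 'k set) \<Longrightarrow> Suc (2 * h) < card (UNIV :: 'k set)"
  shows "\<not> Kinv N (h - 4) n (2 * a - 2)"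
proof
  assume "Kinv N (h - 4) n (2 * a - 2)"
  then obtain v where v: "wvec N (h - 4) v" "v \<noteq> \<zero>\<^bsub>N\<^esub>"
    and K: "\<And>\<psi> P. low_poly N n v \<psi> P \<Longrightarrow> coeff P (2 * a - 2) = 0" unfolding Kinv_def by blast
  have "(2::nat) ^ 1 \<le> 2 ^ i" "2 ^ Suc i \<le> (2::nat) ^ j" "2 ^ Suc j \<le> (2::nat) ^ e"
    using ij by (intro power_increasing; simp)+
  then have bb: "2 \<le> a" "2 * a \<le> b" "2 * b \<le> Q" unfolding p(2-4) by simp_all
  then have bb2: "b < Q" "4 \<le> b" "0 < b" "b \<le> l" by (simp_all add: l)
  let ?d = "2 * a - 2"
  have p2: "prime (2::nat)" by simp
  have vm: "v \<in> carrier N" using v(1) by (simp add: wvec_def)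
  define E where "E k = el (arm k) (col b k)" for k
  have ix: "idx (arm k) (col b k)" for k using bb bb2 by (auto simp: hidx_def arm_def col_def l)
  have Em: "E k \<in> carrier N" for k unfolding E_def by (rule el_mem[OF ix])
  obtain y where y: "\<Psi> v = (\<Sum>k\<in>{1..5}. fscale (y k) (\<Psi> (E k)))"
  proof -
    have "T (\<Sum>{..b} + 2) \<subseteq> fs.span ((\<lambda>k. \<Psi> (E k)) ` {1..5})"
    proof
      fix F assume "F \<in> T (\<Sum>{..b} + 2)"
      then obtain \<alpha> \<kappa> where F: "F = \<Psi> (el \<alpha> \<kappa>)" "idx \<alpha> \<kappa>" "tsum a b \<alpha> \<kappa> = \<Sum>{..b} + 2" by blast
      obtain k where k: "k \<in> {1..5}" "hookD l a b \<alpha> \<kappa> \<in> fs.span {hookD l a b (arm k) (col b k) :: 'k mfun}"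
        using hookD_second_span[OF F(2,3) bb2(3)] by blast
      then have F': "F \<in> fs.span {\<Psi> (E k)}" by (simp only: F(1) E_def \<Psi>_el[OF F(2)] \<Psi>_el[OF ix])
      have "{\<Psi> (E k)} \<subseteq> (\<lambda>k. \<Psi> (E k)) ` {1..5}" using imageI[OF k(1)] by simp
      then show "F \<in> fs.span ((\<lambda>k. \<Psi> (E k)) ` {1..5})" using subsetD[OF fs.span_mono F'] by blast
    qed
    then have "fs.span (T (\<Sum>{..b} + 2)) \<subseteq> fs.span ((\<lambda>k. \<Psi> (E k)) ` {1..5})"
      by (rule fs.span_minimal) (rule fs.subspace_span)
    moreover have "\<Psi> v \<in> fs.span (T (\<Sum>{..b} + 2))" by (rule wvec_span[OF v(1) h(1) _ small]) (use h(2) in simp)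
    ultimately have "\<Psi> v \<in> fs.span ((\<lambda>k. \<Psi> (E k)) ` {1..5})" by (rule subsetD)
    with span_image_combination[of "{1..5}" "\<Psi> v" "\<lambda>k. \<Psi> (E k)"]
    obtain y where "\<Psi> v = (\<Sum>k\<in>{1..5}. fscale (y k) (\<Psi> (E k)))" by auto
    then show ?thesis by (rule that)
  qed
  \<comment> \<open>A functional whose matrix coefficient on \<open>v\<close> is a multiple of
    \<open>z^(2a-2)\<close> forces this multiple to be 0. The five claims below only have to provide
    such functionals.\<close>
  have step: "c = 0" if \<Lambda>: "fn_linear \<Lambda>" and eq: "\<And>z. (\<Sum>k\<in>{1..5}. y k * \<Lambda> (\<Psi> (act N (low z) (E k)))) = c * z ^ ?d" for \<Lambda> c
  proof -
    let ?\<psi> = "\<lambda>x\<in>carrier N. \<Lambda> (\<Psi> x)"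
    have "low_poly N n v ?\<psi> (monom c ?d)"
      unfolding low_poly_def
    proof (intro conjI allI)
      show "?\<psi> \<in> carrier (dual_rep SL2 N)" by (rule dual_restrict[OF \<Lambda>])
      show "degree (monom c ?d) \<le> n" using degree_monom_le[of c ?d] n by linarith
      show "?\<psi> (act N (low z) v) = poly (monom c ?d) z" for z
        using functional_combination[OF \<Lambda> vm y Em, of z] eq[of z] act_closed[OF low_mem vm] by (simp add: Polynomial.poly_monom)
    qed
    from K[OF this] show ?thesis by simp
  qed
  have S5: "(\<Sum>k\<in>{1..5::nat}. f k) = f 1 + f 2 + f 3 + f 4 + f 5" for f :: "nat \<Rightarrow> 'k"
    by (simp add: numeral_eq_Suc One_nat_def)
  have c0: "crd0 (map f [1..<Suc b]) (\<Psi> (act N (low z) (E k))) = dt (Suc b) (\<lambda>i j. gm l z (col b k j) (f i)) * (\<Prod>j<a. gm l z (arm k j) 0)"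
    if "f 0 = 0" "\<And>i. i \<le> b \<Longrightarrow> f i \<le> l" for f z k
    unfolding E_def \<Psi>_low[OF ix] by (rule crd0_map) (use that in auto)
  have g0: "gm l z 0 0 = 1" "gm l z 1 0 = 0" "gm l z 2 0 = 0" for z :: 'k by (simp_all add: gm_def)
  have arms0: "(\<Prod>j<a. gm l z (arm k j) 0) = (if k \<in> {4, 5} then 1 else 0)" if "k \<in> {1, 2, 3, 4, 5}" for k and z :: 'k
    using that prod_arms[OF bb(1), of "\<lambda>i. gm l z i 0"] by (elim insertE emptyE) (simp_all only: g0, simp_all)
  \<comment> \<open>\<open>low z\<close> never lowers an index, so observing index 0 throughout the
    arm leaves tableaux 4 and 5. The last leg coordinate lies \<open>2 a - 2\<close> beyond the
    entry \<open>b + 2\<close> of tableau 4, and \<open>C(Q - 2, 2 a - 2)\<close> is odd.\<close>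
  have y4: "y 4 = 0"
  proof (rule step[OF fn_linear_crd0])
    let ?f = "\<lambda>i. if i = b then b + 2 + ?d else i"
    have f: "?f 0 = 0" "\<And>i. i \<le> b \<Longrightarrow> ?f i \<le> l" using bb bb2 by (auto simp: l)
    fix z :: 'k
    have "dt (Suc b) (\<lambda>i j. gm l z (col b 4 j) (?f i)) = (\<Prod>i<Suc b. gm l z (col b 4 i) (?f i))"
      by (rule dt_lower) (auto simp: gm_def col_def)
    also have "\<dots> = gm l z (b + 2) (b + 2 + ?d)" using bb2 by (simp add: col_def gm_def prod.neutral)
    also have "\<dots> = of_nat ((l - (b + 2)) choose ?d) * z ^ ?d" by (rule gm_add) (use bb l in arith)
    also have "l - (b + 2) = Q - 2" using l by simp
    also have "of_nat ((Q - 2) choose ?d) = (1 :: 'k)"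
      by (subst binomial_2_pred2[OF p(1,2)]) (use bb in auto)
    also have "1 * z ^ ?d = z ^ ?d" by simp
    finally have d4: "dt (Suc b) (\<lambda>i j. gm l z (col b 4 j) (?f i)) = z ^ ?d" .
    \<comment> \<open>The rows observing \<open>0, ..., b - 1\<close> vanish on the last two
      columns, which hold the entries \<open>b\<close> and \<open>b + 1\<close>.\<close>
    have d5: "dt (Suc b) (\<lambda>i j. gm l z (col b 5 j) (?f i)) = 0"
      by (rule dt_zero_block[of "b - 1"]) (use bb2 in \<open>auto simp: gm_def col_def\<close>)
    have cf: "crd0 (map ?f [1..<Suc b]) (\<Psi> (act N (low z) (E k))) =
        dt (Suc b) (\<lambda>i j. gm l z (col b k j) (?f i)) * (\<Prod>j<a. gm l z (arm k j) 0)" for k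
      by (rule c0) (use f in auto)
    show "(\<Sum>k\<in>{1..5}. y k * crd0 (map ?f [1..<Suc b]) (\<Psi> (act N (low z) (E k)))) = y 4 * z ^ ?d"
      unfolding S5 cf by (simp add: arms0 d4 d5)
  qed
  \<comment> \<open>The observed coordinates are the leg entries of tableau 5, with the last one
    moved up by \<open>2 a - 2\<close>; the binomial coefficient \<open>C(Q - 1, 2 a - 2)\<close> is
    odd. Tableau 4 is already excluded.\<close>
  have y5: "y 5 = 0"
  proof (rule step[OF fn_linear_crd0])
    let ?f = "\<lambda>i. if i = b then b + 1 + ?d else if Suc i = b then b else i"
    have f: "?f 0 = 0" "\<And>i. i \<le> b \<Longrightarrow> ?f i \<le> l" using bb bb2 by (auto simp: l)
    fix z :: 'k
    have "dt (Suc b) (\<lambda>i j. gm l z (col b 5 j) (?f i)) = (\<Prod>i<Suc b. gm l z (col b 5 i) (?f i))"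
      by (rule dt_lower) (auto simp: gm_def col_def)
    also have "\<dots> = (\<Prod>i<b. gm l z (col b 5 i) (?f i)) * gm l z (b + 1) (b + 1 + ?d)" by (simp add: col_def)
    also have "(\<Prod>i<b. gm l z (col b 5 i) (?f i)) = 1"
      by (rule prod.neutral) (use bb2 in \<open>auto simp: col_def gm_def\<close>)
    also have "gm l z (b + 1) (b + 1 + ?d) = of_nat ((l - (b + 1)) choose ?d) * z ^ ?d" by (rule gm_add) (use bb l in arith)
    also have "l - (b + 1) = Q - 1" using l by simp
    also have "of_nat ((Q - 1) choose ?d) = (1 :: 'k)" by (rule binomial_2_pred[OF p(1,2)]) (use bb in arith)
    also have "1 * (1 * z ^ ?d) = z ^ ?d" by simp
    finally have d5: "dt (Suc b) (\<lambda>i j. gm l z (col b 5 j) (?f i)) = z ^ ?d" .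
    have cf: "crd0 (map ?f [1..<Suc b]) (\<Psi> (act N (low z) (E k))) =
        dt (Suc b) (\<lambda>i j. gm l z (col b k j) (?f i)) * (\<Prod>j<a. gm l z (arm k j) 0)" for k
      by (rule c0) (use f in auto)
    show "(\<Sum>k\<in>{1..5}. y k * crd0 (map ?f [1..<Suc b]) (\<Psi> (act N (low z) (E k)))) = y 5 * z ^ ?d"
      unfolding S5 cf by (simp add: arms0 d5 y4)
  qed
  have id: "dt (Suc b) (\<lambda>i j. gm l z j i) = 1" for z :: 'k
    by (subst dt_lower) (use bb2 in \<open>simp_all add: gm_def prod.neutral l\<close>)
  have nb: "(of_nat (l choose c) :: 'k) = 0" if "c \<notin> {0, b, Q, Q + b}" for c
    using gm_0_nonzero[OF p2 p(1-3) l, of c] that by blast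
  have gA: "gm l z i (i + d) = of_nat ((b - i) choose d) * z ^ d" if "i \<le> b" "d < Q" "i + d \<le> l" for i d and z :: 'k
    using gm_add[OF that(3), of z] binomial_2_shift[OF p(1,2) that(2,1)] by (simp add: l)
  \<comment> \<open>For \<open>y = 2 a - 1\<close> an arm entry 1 reaches \<open>y\<close> with
    coefficient \<open>z^(2a-2)\<close>, while 0 and 2 do not, since
    \<open>C(Q + b, 2 a - 1)\<close> and \<open>C(b - 2, 2 a - 3)\<close> are even. Tableau 2
    contributes only to the square of \<open>x_y\<close>, hence not to the linear term.\<close>
  have y3: "y 3 = 0"
  proof (rule step[OF fn_linear_crd1])
    let ?f = "col b 3" and ?y = "2 * a - 1"
    have f: "?f 0 = 0" "\<And>i. i \<le> b \<Longrightarrow> ?f i \<le> l" "?y \<le> l" "?y \<noteq> 0" using bb bb2 by (auto simp: l col_def)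
    fix z :: 'k
    have "0 < ?y" "?y < b" using bb by arith+
    then have "?y \<notin> {0, b, Q, Q + b}" using bb2 by auto
    then have g0: "gm l z 0 ?y = 0" using nb[of ?y] by (simp add: gm_def)
    have e1: "1 + ?d = ?y" and e2: "2 + (2 * a - 3) = ?y" "odd (2 * a - 3)" using bb(1) by auto
    have g1: "gm l z 1 ?y = z ^ ?d"
    proof -
      have "gm l z 1 (1 + ?d) = of_nat ((b - 1) choose ?d) * z ^ ?d" by (rule gA) (use bb l in arith)+
      also have "of_nat ((b - 1) choose ?d) = (1 :: 'k)" by (rule binomial_2_pred[OF p(1,3)]) (use bb in arith)
      finally show ?thesis unfolding e1 by simp
    qed
    have g2: "gm l z 2 ?y = 0"
    proof -
      have "gm l z 2 (2 + (2 * a - 3)) = of_nat ((b - 2) choose (2 * a - 3)) * z ^ (2 * a - 3)" by (rule gA) (use bb l in arith)+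
      also have "of_nat ((b - 2) choose (2 * a - 3)) = (0 :: 'k)"
        by (subst binomial_2_pred2[OF p(1,3)]) (use bb e2(2) in auto)
      finally show ?thesis unfolding e2(1) by simp
    qed
    have g: "gm l z 0 0 = 1" "gm l z 1 0 = 0" "gm l z 2 0 = 0" by (simp_all add: gm_def)
    have "dt (Suc b) (\<lambda>i j. gm l z (col b 3 j) (?f i)) = (\<Prod>i<Suc b. gm l z (?f i) (?f i))"
      by (rule dt_lower) (auto simp: gm_def col_def)
    also have "\<dots> = 1" by (rule prod.neutral) (use f in \<open>auto simp: gm_def\<close>)
    finally have d3: "dt (Suc b) (\<lambda>i j. gm l z (col b 3 j) (?f i)) = 1" .
    have v: "coeff (crd1 ?y (map ?f [1..<Suc b]) (\<Psi> (act N (low z) (E k)))) 1 = (if k = 3 then z ^ ?d else 0)"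
      if k: "k \<in> {1, 2, 3}" for k
    proof -
      obtain D where D: "crd1 ?y (map ?f [1..<Suc b]) (hookE {..l} a b (\<lambda>j. gm l z (arm k j)) (\<lambda>i. gm l z (col b k i))) =
          D * (\<Prod>j<a. [:gm l z (arm k j) 0, gm l z (arm k j) ?y:])"
        "coeff D 0 = dt (Suc b) (\<lambda>i j. gm l z (col b k j) (?f i))"
        by (rule crd1_map[of ?f b l ?y a "\<lambda>j. gm l z (arm k j)" "\<lambda>i. gm l z (col b k i)"]) (use f in blast)+
      note pr = prod_arms[OF bb(1), of "\<lambda>x. [:gm l z x 0, gm l z x ?y:]", unfolded g g0 g1 g2]
      have "coeff (D * (\<Prod>j<a. [:gm l z (arm k j) 0, gm l z (arm k j) ?y:])) 1 = (if k = 3 then z ^ ?d else 0)"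
        using k
      proof (elim insertE emptyE)
        assume k: "k = 3"
        have "coeff D 0 = 1" using D(2) unfolding k d3 .
        then show ?thesis unfolding k pr
          by (simp add: pCons_0_monom Polynomial.coeff_monom_mult mult.commute[of D] mult.assoc one_pCons[symmetric])
      next
        assume k: "k = 1"
        show ?thesis unfolding k pr
          by (simp add: pCons_0_monom Polynomial.coeff_monom_mult mult.commute[of D] mult.assoc power2_eq_square mult.assoc)
      next
        assume k: "k = 2"
        show ?thesis unfolding k pr
          by (simp add: pCons_0_monom Polynomial.coeff_monom_mult mult.commute[of D] mult.assoc power2_eq_square mult.assoc)
      qed
      then show ?thesis unfolding E_def \<Psi>_low[OF ix] D(1) .
    qed
    show "(\<Sum>k\<in>{1..5}. y k * coeff (crd1 ?y (map ?f [1..<Suc b]) (\<Psi> (act N (low z) (E k)))) 1) = y 3 * z ^ ?d"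
      unfolding S5 by (simp add: v y4 y5 del: upt_Suc One_nat_def map_ident list.map_ident)
  qed
  \<comment> \<open>An entry 2 reaches \<open>y = 2 a\<close> with coefficient
    \<open>z^(2a-2)\<close>. The entries 1 of tableau 2 yield only multiples of the square of
    \<open>x_y\<close>. If \<open>2 a = b\<close> the entries 0 reach \<open>y\<close> too, but
    their constant term is 1, so the linear coefficient is unaffected.\<close>
  have y1: "y 1 = 0"
  proof (rule step[OF fn_linear_crd1])
    let ?f = "\<lambda>i::nat. i" and ?y = "2 * a"
    have f: "?f 0 = 0" "\<And>i. i \<le> b \<Longrightarrow> ?f i \<le> l" "?y \<le> l" "?y \<noteq> 0" using bb bb2 by (auto simp: l)
    fix z :: 'k
    have g2: "gm l z 2 ?y = z ^ ?d"
    proof -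
      have "gm l z 2 (2 + ?d) = of_nat ((b - 2) choose ?d) * z ^ ?d" by (rule gA) (use bb l in arith)+
      also have "of_nat ((b - 2) choose ?d) = (1 :: 'k)"
        by (subst binomial_2_pred2[OF p(1,3)]) (use bb in auto)
      also have "2 + ?d = ?y" using bb by simp
      finally show ?thesis by simp
    qed
    have g: "gm l z 0 0 = 1" "gm l z 1 0 = 0" "gm l z 2 0 = 0" by (simp_all add: gm_def)
    have pw: "coeff ([:1, u:] ^ m) 0 = 1" for u :: 'k and m by (simp add: coeff_0_power)
    have v: "coeff (crd1 ?y (map ?f [1..<Suc b]) (\<Psi> (act N (low z) (E k)))) 1 = (if k = 1 then z ^ ?d else 0)"
      if k: "k \<in> {1, 2}" for k
    proof -
      obtain D where D: "crd1 ?y (map ?f [1..<Suc b]) (hookE {..l} a b (\<lambda>j. gm l z (arm k j)) (\<lambda>i. gm l z (col b k i))) =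
          D * (\<Prod>j<a. [:gm l z (arm k j) 0, gm l z (arm k j) ?y:])"
        "coeff D 0 = dt (Suc b) (\<lambda>i j. gm l z (col b k j) (?f i))"
        by (rule crd1_map[of ?f b l ?y a "\<lambda>j. gm l z (arm k j)" "\<lambda>i. gm l z (col b k i)"]) (use f in blast)+
      note pr = prod_arms[OF bb(1), of "\<lambda>x. [:gm l z x 0, gm l z x ?y:]", unfolded g g2]
      have "coeff (D * (\<Prod>j<a. [:gm l z (arm k j) 0, gm l z (arm k j) ?y:])) 1 = (if k = 1 then z ^ ?d else 0)"
        using k
      proof (elim insertE emptyE)
        assume k: "k = 1"
        have "coeff D 0 = 1" using D(2) id unfolding k by (simp add: col_def)
        then show ?thesis unfolding k pr
          by (simp add: pCons_0_monom Polynomial.coeff_monom_mult mult.commute[of D] mult.assoc Polynomial.coeff_mult_0 pw)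
      next
        assume k: "k = 2"
        show ?thesis unfolding k pr
          by (simp add: pCons_0_monom Polynomial.coeff_monom_mult mult.commute[of D] mult.assoc power2_eq_square mult.assoc)
      qed
      then show ?thesis unfolding E_def \<Psi>_low[OF ix] D(1) .
    qed
    show "(\<Sum>k\<in>{1..5}. y k * coeff (crd1 ?y (map ?f [1..<Suc b]) (\<Psi> (act N (low z) (E k)))) 1) = y 1 * z ^ ?d"
      unfolding S5 by (simp add: v y3 y4 y5 del: upt_Suc One_nat_def map_ident list.map_ident)
  qed
  \<comment> \<open>Both entries 1 reach \<open>y = a\<close> with coefficient
    \<open>z^(a-1)\<close>, and the entries 0 do not reach it; the quadratic coefficient is
    therefore \<open>z^(2a-2)\<close>.\<close>
  have y2: "y 2 = 0"
  proof (rule step[OF fn_linear_crd1])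
    let ?f = "\<lambda>i::nat. i" and ?y = a
    have f: "?f 0 = 0" "\<And>i. i \<le> b \<Longrightarrow> ?f i \<le> l" "?y \<le> l" "?y \<noteq> 0" using bb bb2 by (auto simp: l)
    fix z :: 'k
    have "a \<notin> {0, b, Q, Q + b}" using bb bb2 by auto
    then have g0: "gm l z 0 ?y = 0" using nb[of a] by (simp add: gm_def)
    have g1: "gm l z 1 ?y = z ^ (a - 1)"
    proof -
      have "gm l z 1 (1 + (a - 1)) = of_nat ((b - 1) choose (a - 1)) * z ^ (a - 1)" by (rule gA) (use bb l in arith)+
      also have "of_nat ((b - 1) choose (a - 1)) = (1 :: 'k)" by (rule binomial_2_pred[OF p(1,3)]) (use bb in arith)
      also have "1 + (a - 1) = a" using bb by simp
      finally show ?thesis by simp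
    qed
    have g: "gm l z 0 0 = 1" "gm l z 1 0 = 0" by (simp_all add: gm_def)
    obtain D where D: "crd1 ?y (map ?f [1..<Suc b]) (hookE {..l} a b (\<lambda>j. gm l z (arm 2 j)) (\<lambda>i. gm l z (col b 2 i))) =
        D * (\<Prod>j<a. [:gm l z (arm 2 j) 0, gm l z (arm 2 j) ?y:])"
      "coeff D 0 = dt (Suc b) (\<lambda>i j. gm l z (col b 2 j) (?f i))"
      by (rule crd1_map[of ?f b l ?y a "\<lambda>j. gm l z (arm 2 j)" "\<lambda>i. gm l z (col b 2 i)"]) (use f in blast)+
    have pr: "(\<Prod>j<a. [:gm l z (arm 2 j) 0, gm l z (arm 2 j) ?y:]) = monom (z ^ (a - 1)) 1 ^ 2"
      using prod_arms(2)[OF bb(1), of "\<lambda>x. [:gm l z x 0, gm l z x ?y:]", unfolded g g0 g1]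
      by (simp add: pCons_0_monom one_pCons[symmetric])
    have "(z ^ (a - 1)) ^ 2 = z ^ ?d" by (simp add: power_mult[symmetric] diff_mult_distrib mult.commute[of a])
    then have pr2: "(\<Prod>j<a. [:gm l z (arm 2 j) 0, gm l z (arm 2 j) ?y:]) = monom (z ^ ?d) 2"
      unfolding pr Polynomial.monom_power by simp
    have "coeff D 0 = 1" using D(2) id by (simp add: col_def)
    then have "coeff (crd1 ?y (map ?f [1..<Suc b]) (\<Psi> (act N (low z) (E 2)))) 2 = z ^ ?d"
      unfolding E_def \<Psi>_low[OF ix] D(1) pr2 by (simp add: mult.commute[of D] Polynomial.coeff_monom_mult)
    then show "(\<Sum>k\<in>{1..5}. y k * coeff (crd1 ?y (map ?f [1..<Suc b]) (\<Psi> (act N (low z) (E k)))) 2) = y 2 * z ^ ?d"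
      unfolding S5 by (simp add: y1 y3 y4 y5 del: upt_Suc One_nat_def map_ident list.map_ident)
  qed
  have "\<Psi> v = \<Psi> \<zero>\<^bsub>N\<^esub>"
  proof -
    have "k = 1 \<or> k = 2 \<or> k = 3 \<or> k = 4 \<or> k = 5" if "k \<in> {1..5::nat}" for k using that by auto
    then have "y k = 0" if "k \<in> {1..5}" for k using that y1 y2 y3 y4 y5 by blast
    then have "fscale (y k) (\<Psi> (E k)) = 0" if "k \<in> {1..5}" for k using that by (simp only: fs.scale_zero_left)
    then show ?thesis unfolding y \<Psi>_zero by (rule sum.neutral[OF ballI])
  qed
  then have "v = \<zero>\<^bsub>N\<^esub>" by (rule \<Psi>_inj[OF vm closed(3)])
  with v(2) show False by contradiction
qed

end

subsection \<open>Separating the eight representations\<close>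

lemma wt_model_dual_ex:
  fixes V :: "('k::field ^ 2 ^ 2, 'k, 'v) rep"
  shows "\<exists>\<phi>. wt_model V l \<phi> c \<Longrightarrow> \<exists>\<phi>. wt_model (dual_rep SL2 V) l \<phi> (\<lambda>i j. c (l - j) (l - i))"
  using wt_model_dual by blast

text \<open>\<open>h\<close> is the common highest weight and \<open>n\<close> the value of
  \<open>L\<close> for the longer leg, which bounds degrees in \<open>z\<close> for both legs. The
  two parts of \<open>small\<close> separate weights and make polynomials unique.\<close>

locale hook_params =
  fixes p \<alpha> \<beta> \<epsilon> h n :: nat and K :: "'k::field itself"
  assumes \<alpha>: "0 < \<alpha>" "\<alpha> < \<beta>" "\<beta> < \<epsilon>" and p: "prime p" "CHAR('k) = p"
    and h_def: "h = p ^ \<epsilon> * (p ^ \<alpha> + p ^ \<beta> + 1) + p ^ \<alpha> * p ^ \<beta>"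
    and n_def: "n = (p ^ \<epsilon> + p ^ \<beta>) * (p ^ \<alpha> + p ^ \<beta> + 1)"
    and small: "finite (UNIV :: 'k set) \<Longrightarrow> Suc (2 * h) < card (UNIV :: 'k set)"
      "finite (UNIV :: 'k set) \<Longrightarrow> n < card (UNIV :: 'k set)"
begin

abbreviation "prs \<equiv> {(\<alpha>, \<beta>), (\<beta>, \<alpha>)}"

text \<open>Records only the coordinates, so that \<open>nabla\<close> of an upper power and
  \<open>nabla\<close> of the dual of a lower power, which are representations on different types,
  can be treated alike. The pair gives the exponents of arm and leg.\<close>

definition uprep :: "('k ^ 2 ^ 2, 'k, 'w) rep \<Rightarrow> nat \<times> nat \<Rightarrow> bool" where
  "uprep N x \<longleftrightarrow> (\<exists>\<Psi> el. nabla_upper N (p ^ \<epsilon> + p ^ snd x) (p ^ fst x) (p ^ snd x) \<Psi> el)"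

text \<open>The counterpart shared by lower powers and duals of upper powers. The basis is reversed,
  because it is the dual of \<open>N\<close> whose invariants are computed.\<close>

definition dprep :: "('k ^ 2 ^ 2, 'k, 'w) rep \<Rightarrow> nat \<times> nat \<Rightarrow> bool" where
  "dprep N x \<longleftrightarrow> (\<exists>\<Psi> el. nabla_dual_upper N (p ^ \<epsilon> + p ^ snd x) (p ^ fst x) (p ^ snd x) \<Psi> el)"

lemma nice_uprep: "uprep N x \<Longrightarrow> nice N"
  unfolding uprep_def nabla_upper_def hook_down_def using hook_mod.nice by blast

lemma nice_dprep: "dprep N x \<Longrightarrow> nice N"
  unfolding dprep_def nabla_dual_upper_def hook_up_def using hook_mod.nice by blast

lemma powers: "2 \<le> p ^ \<alpha>" "p * p ^ \<alpha> \<le> p ^ \<beta>" "p * p ^ \<beta> \<le> p ^ \<epsilon>" "2 \<le> p"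
proof -
  show p2: "2 \<le> p" using p(1) by (rule prime_ge_2_nat)
  have "p ^ 1 \<le> p ^ \<alpha>" "p ^ Suc \<alpha> \<le> p ^ \<beta>" "p ^ Suc \<beta> \<le> p ^ \<epsilon>"
    using \<alpha> p2 by (intro power_increasing; simp)+
  then show "2 \<le> p ^ \<alpha>" "p * p ^ \<alpha> \<le> p ^ \<beta>" "p * p ^ \<beta> \<le> p ^ \<epsilon>" using p2 by simp_all
qed

lemma bounds: "p ^ \<alpha> < p ^ \<beta>" "p ^ \<beta> < p ^ \<epsilon>" "4 \<le> h" "1 \<le> n" "p ^ \<beta> \<le> n"
proof -
  show "p ^ \<alpha> < p ^ \<beta>" "p ^ \<beta> < p ^ \<epsilon>" using \<alpha> powers(4) by simp_all
  have "2 * 2 \<le> p ^ \<alpha> * p ^ \<beta>" using powers(1) \<open>p ^ \<alpha> < p ^ \<beta>\<close> by (intro mult_le_mono) linarith+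
  then show "4 \<le> h" unfolding h_def by linarith
  show "p ^ \<beta> \<le> n" unfolding n_def by (simp add: algebra_simps)
  then show "1 \<le> n" using powers(1) \<open>p ^ \<alpha> < p ^ \<beta>\<close> by linarith
qed

lemma snd_pr:
  assumes "x \<in> prs"
  shows "0 < snd x" "snd x < \<epsilon>" "2 \<le> p ^ snd x" "p ^ snd x < p ^ \<epsilon>" "p ^ snd x \<le> n" "0 < p ^ fst x" "p ^ snd x < p ^ fst x * p ^ snd x"
    "p ^ snd x < p ^ \<alpha> * p ^ \<beta>"
proof -
  show "0 < snd x" "snd x < \<epsilon>" using assms \<alpha> by auto
  have ge: "2 \<le> p ^ \<beta>" "p ^ \<alpha> < p ^ \<epsilon>" "p ^ \<alpha> \<le> n" using powers(1) bounds by linarith+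
  consider "snd x = \<alpha>" | "snd x = \<beta>" using assms by auto
  then show "2 \<le> p ^ snd x" "p ^ snd x < p ^ \<epsilon>" "p ^ snd x \<le> n"
    using powers(1) bounds(2,5) ge by (cases; simp only:)+
  show "0 < p ^ fst x" using powers(4) by simp
  have "1 < p ^ fst x" using assms powers(1) bounds(1) by auto
  then have "1 * p ^ snd x < p ^ fst x * p ^ snd x" using \<open>2 \<le> p ^ snd x\<close> by (intro mult_strict_right_mono) linarith+
  then show "p ^ snd x < p ^ fst x * p ^ snd x" by simp
  then show "p ^ snd x < p ^ \<alpha> * p ^ \<beta>" using assms by (auto simp: mult.commute)
qed

text \<open>Subtracting \<open>b (b + 1)\<close>, twice the minimal index sum, from
  \<open>(Q + b)(a + b + 1)\<close> leaves \<open>Q (a + b + 1) + a b\<close>, which does not change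
  when \<open>a\<close> and \<open>b\<close> are swapped.\<close>

lemma weight:
  assumes "x \<in> prs"
  shows "h + 2 * \<Sum>{..p ^ snd x} = (p ^ \<epsilon> + p ^ snd x) * (p ^ fst x + p ^ snd x + 1)"
    "(p ^ \<epsilon> + p ^ snd x) * (p ^ fst x + p ^ snd x + 1) \<le> n"
proof -
  have g: "2 * \<Sum>{..m} = m * (m + 1)" for m :: nat by (induction m) simp_all
  show "h + 2 * \<Sum>{..p ^ snd x} = (p ^ \<epsilon> + p ^ snd x) * (p ^ fst x + p ^ snd x + 1)"
    unfolding g h_def using assms by (auto simp: algebra_simps)
  have "p ^ snd x \<le> p ^ \<beta>" "p ^ fst x + p ^ snd x + 1 = p ^ \<alpha> + p ^ \<beta> + 1" using assms bounds(1) by auto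
  then show "(p ^ \<epsilon> + p ^ snd x) * (p ^ fst x + p ^ snd x + 1) \<le> n"
    unfolding n_def by (simp del: One_nat_def)
qed

lemma Dinv_uprep:
  assumes "uprep N x" and x: "x \<in> prs" and D: "Dinv N h n k"
  obtains c d where "k = c * p ^ \<epsilon> + d" "c \<le> Suc (p ^ snd x)"
    "d \<in> {0, p ^ fst x * p ^ snd x, p ^ fst x * p ^ \<epsilon>, p ^ fst x * (p ^ \<epsilon> + p ^ snd x)}"
proof -
  obtain \<Psi> el where "nabla_upper N (p ^ \<epsilon> + p ^ snd x) (p ^ fst x) (p ^ snd x) \<Psi> el"
    using assms(1) unfolding uprep_def by blast
  then interpret nabla_upper N "p ^ \<epsilon> + p ^ snd x" "p ^ fst x" "p ^ snd x" \<Psi> el .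
  show ?thesis
    using Dinv_exponent[OF p refl refl refl snd_pr(2)[OF x] refl weight(1)[OF x] small(1) weight(2)[OF x] small(2) D] that
    by blast
qed

text \<open>An exponent below \<open>Q\<close> uses no leg term, and the least nonzero arm exponents
  are \<open>a b\<close> and multiples of at least \<open>Q\<close>.\<close>

lemma not_Dinv_uprep:
  assumes "uprep N x" and x: "x \<in> prs" and k: "0 < k" "k < p ^ \<alpha> * p ^ \<beta>" "k < p ^ \<epsilon>"
  shows "\<not> Dinv N h n k"
proof
  assume "Dinv N h n k"
  from Dinv_uprep[OF assms(1,2) this] obtain c d where cd: "k = c * p ^ \<epsilon> + d"
    "d \<in> {0, p ^ fst x * p ^ snd x, p ^ fst x * p ^ \<epsilon>, p ^ fst x * (p ^ \<epsilon> + p ^ snd x)}" by blast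
  have "c = 0" using cd(1) k(3) by (cases c) simp_all
  moreover have "p ^ fst x * p ^ snd x = p ^ \<alpha> * p ^ \<beta>" using x by (auto simp: mult.commute)
  moreover have "1 * p ^ \<epsilon> \<le> p ^ fst x * p ^ \<epsilon>" using snd_pr(6)[OF x] by (intro mult_le_mono) linarith+
  moreover have "p ^ fst x * p ^ \<epsilon> \<le> p ^ fst x * (p ^ \<epsilon> + p ^ snd x)" by simp
  moreover have "d = k" using cd(1) \<open>c = 0\<close> by simp
  ultimately show False using cd(2) k unfolding insert_iff empty_iff by linarith
qed

lemma Dinv_dprep:
  assumes "dprep N x" and x: "x \<in> prs"
  shows "Dinv (dual_rep SL2 N) h n (p ^ snd x)" "Dinv (dual_rep SL2 N) h n k \<Longrightarrow> p ^ snd x dvd k"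
proof -
  obtain \<Psi> el where "nabla_dual_upper N (p ^ \<epsilon> + p ^ snd x) (p ^ fst x) (p ^ snd x) \<Psi> el"
    using assms(1) unfolding dprep_def by blast
  then interpret nabla_dual_upper N "p ^ \<epsilon> + p ^ snd x" "p ^ fst x" "p ^ snd x" \<Psi> el .
  have "0 < p ^ snd x" using snd_pr(3)[OF x] by linarith
  then show "Dinv (dual_rep SL2 N) h n (p ^ snd x)"
    by (rule Dinv_legs[OF p refl refl _ snd_pr(4)[OF x] snd_pr(6)[OF x] weight(1)[OF x] snd_pr(5)[OF x]])
  show "p ^ snd x dvd k" if "Dinv (dual_rep SL2 N) h n k"
    by (rule Dinv_dvd[OF p refl refl snd_pr(2)[OF x] refl weight(1)[OF x] small(1) weight(2)[OF x] small(2) that])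
qed

lemma not_iso_dual_uprep:
  assumes N: "dprep N x" "x \<in> prs" and N': "uprep N' y" "y \<in> prs"
  shows "\<not> rep_isomorphic SL2 (dual_rep SL2 N) N'" "\<not> rep_isomorphic SL2 N' (dual_rep SL2 N)"
proof -
  note nice = nice_dual[OF nice_dprep[OF N(1)]] nice_uprep[OF N'(1)]
  have "Dinv (dual_rep SL2 N) h n (p ^ snd x)" by (rule Dinv_dprep(1)[OF N])
  moreover have "\<not> Dinv N' h n (p ^ snd x)"
    using snd_pr(3,4,8)[OF N(2)] by (intro not_Dinv_uprep[OF N']) linarith+
  ultimately show "\<not> rep_isomorphic SL2 (dual_rep SL2 N) N'" "\<not> rep_isomorphic SL2 N' (dual_rep SL2 N)"
    using Dinv_iso[OF _ nice] Dinv_iso[OF _ nice(2,1)] by blast+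
qed

text \<open>Each leg length is itself an exponent and divides all exponents of its representation,
  so an isomorphism would make the two lengths divide each other.\<close>

lemma not_iso_dual_dual:
  assumes N: "dprep N x" "x \<in> prs" and N': "dprep N' y" "y \<in> prs" and "x \<noteq> y"
  shows "\<not> rep_isomorphic SL2 (dual_rep SL2 N) (dual_rep SL2 N')"
proof
  assume iso: "rep_isomorphic SL2 (dual_rep SL2 N) (dual_rep SL2 N')"
  note eq = Dinv_iso[OF iso nice_dual[OF nice_dprep[OF N(1)]] nice_dual[OF nice_dprep[OF N'(1)]]]
  have "p ^ snd y dvd p ^ snd x" "p ^ snd x dvd p ^ snd y"
    using Dinv_dprep[OF N] Dinv_dprep[OF N'] eq by blast+
  then have "p ^ snd x = p ^ snd y" by (rule dvd_antisym[rotated])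
  then show False using bounds(1) assms by auto
qed

text \<open>For odd \<open>p\<close> the powers are so far apart (\<open>B \<ge> 3 A\<close>,
  \<open>Q \<ge> 3 B\<close>) that top weight exponents decide. In characteristic 2 these gaps may
  close, and the nonexistence of a special vector of weight \<open>h - 4\<close> is used
  instead.\<close>

lemma not_iso_uprep_swap:
  assumes N: "uprep N (\<alpha>, \<beta>)" and N': "uprep N' (\<beta>, \<alpha>)"
  shows "\<not> rep_isomorphic SL2 N N'"
proof
  assume iso: "rep_isomorphic SL2 N N'"
  note nice = nice_uprep[OF N] nice_uprep[OF N']
  have x: "(\<alpha>, \<beta>) \<in> prs" "(\<beta>, \<alpha>) \<in> prs" by simp_all
  obtain \<Psi> el where M: "nabla_upper N (p ^ \<epsilon> + p ^ \<beta>) (p ^ \<alpha>) (p ^ \<beta>) \<Psi> el"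
    using N unfolding uprep_def by auto
  obtain \<Psi>' el' where M': "nabla_upper N' (p ^ \<epsilon> + p ^ \<alpha>) (p ^ \<beta>) (p ^ \<alpha>) \<Psi>' el'"
    using N' unfolding uprep_def by auto
  note w = weight[OF x(1), simplified fst_conv snd_conv] and w' = weight[OF x(2), simplified fst_conv snd_conv]
  show False
  proof (cases "p = 2")
    case True
    have c: "CHAR('k) = 2" using p True by simp
    have "4 \<le> h" by (rule bounds)
    \<comment> \<open>The exponent \<open>2 A - 2\<close> serves on both sides, since
      \<open>A\<close> is the leg of \<open>N'\<close> and the arm of \<open>N\<close>.\<close>
    have "Kinv N' (h - 4) n (2 * p ^ \<alpha> - 2)"
      by (rule nabla_upper.Kinv_char_2[OF M' c _ _ _ \<alpha>(1) \<alpha>(2) _ refl w'(1) \<open>4 \<le> h\<close> w'(2) small(2)])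
        (use True \<alpha> in simp_all)
    moreover have "\<not> Kinv N (h - 4) n (2 * p ^ \<alpha> - 2)"
    proof (rule nabla_upper.not_Kinv_char_2[OF M c _ _ _ \<alpha> refl w(1) \<open>4 \<le> h\<close> _ small(1)])
      have "2 * p ^ \<alpha> \<le> n" using powers(2,4) bounds(5) order_trans[OF mult_le_mono1[OF powers(4)] powers(2)] by linarith
      then show "2 * p ^ \<alpha> - 2 \<le> n" by linarith
    qed (use True in simp_all)
    ultimately show False using Kinv_iso[OF rep_isomorphic_sym[OF iso nice(1)] nice(2,1)] by blast
  next
    case False
    let ?A = "p ^ \<alpha>" and ?B = "p ^ \<beta>" and ?Q = "p ^ \<epsilon>"
    have p3: "3 \<le> p" using False powers(4) by linarith
    have "p ^ 1 \<le> p ^ \<alpha>" using \<alpha> p3 by (intro power_increasing) simp_all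
    then have A: "3 \<le> ?A" using p3 by simp
    have B: "3 * ?A \<le> ?B" using order_trans[OF mult_le_mono1[OF p3] powers(2)] .
    have Q: "3 * ?B \<le> ?Q" using order_trans[OF mult_le_mono1[OF p3] powers(3)] .
    have "Dinv N h n ((?B - 1) * ?Q)"
    proof (rule nabla_upper.Dinv_legs[OF M p refl refl bounds(2) _ w(1)])
      show "1 \<le> ?B" using A B by linarith
      have "(?B - 1) * ?Q \<le> (?A + ?B + 1) * (?Q + ?B)" by (intro mult_le_mono) simp_all
      then show "(?B - 1) * ?Q \<le> n" unfolding n_def by (simp only: mult.commute)
    qed
    then have "Dinv N' h n ((?B - 1) * ?Q)" using Dinv_iso[OF iso nice] by blast
    from Dinv_uprep[OF N' x(2) this, simplified fst_conv snd_conv]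
    obtain c d where cd: "(?B - 1) * ?Q = c * ?Q + d" "c \<le> Suc ?A" "d \<in> {0, ?B * ?A, ?B * ?Q, ?B * (?Q + ?A)}" by blast
    have less: "(?B - 1) * ?Q < ?B * ?Q" 
  proof (rule mult_strict_right_mono)
      show "?B - 1 < ?B" "0 < ?Q" using A B Q by linarith+
    qed
    \<comment> \<open>If the exponent occurred for the shorter leg, its arm part would be
      \<open>m Q\<close> with \<open>m \<ge> 2 A - 2\<close>. This lies strictly between
      \<open>A B\<close> and \<open>B Q\<close>, where no arm exponent is available.\<close>
    define m where "m = ?B - 1 - c"
    have m: "?B - 1 = c + m" "2 * ?A - 2 \<le> m" using cd(2) A B by (simp_all add: m_def)
    have d: "d = m * ?Q" using cd(1) unfolding m(1) by (simp add: distrib_right)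
    have "0 < m" using m(2) A by linarith
    have "?B * ?A < m * (3 * ?B)"
    proof -
      have "?A < m * 3" using m(2) A by linarith
      then have "?B * ?A < ?B * (m * 3)" using A B by (intro mult_strict_left_mono) linarith+
      then show ?thesis by (simp only: mult_ac)
    qed
    also have "\<dots> \<le> m * ?Q" using Q by (intro mult_le_mono2)
    finally have "?B * ?A < d" by (simp only: d)
    moreover have "d < ?B * ?Q" using cd(1) less by linarith
    moreover have "?B * ?Q \<le> ?B * (?Q + ?A)" by simp
    moreover have "0 \<le> ?B * ?A" by simp
    ultimately show False using cd(3) unfolding insert_iff empty_iff by linarith
  qed
qed

lemma not_iso_uprep:
  assumes N: "uprep N x" "x \<in> prs" and N': "uprep N' y" "y \<in> prs" and "x \<noteq> y"
  shows "\<not> rep_isomorphic SL2 N N'"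
proof -
  consider "x = (\<alpha>, \<beta>)" "y = (\<beta>, \<alpha>)" | "x = (\<beta>, \<alpha>)" "y = (\<alpha>, \<beta>)" using assms by auto
  then show ?thesis
  proof cases
    case 1
    then show ?thesis using not_iso_uprep_swap N N' by blast
  next
    case 2
    then show ?thesis
      using not_iso_uprep_swap[of N' N] rep_isomorphic_sym[OF _ nice_uprep[OF N(1)], of N'] N N' by blast
  qed
qed

abbreviation "SU x \<equiv> sym_upper (p ^ \<epsilon> + p ^ snd x) (natural_rep :: ('k ^ 2 ^ 2, 'k, 'k ^ 2) rep)"
abbreviation "SL x \<equiv> sym_lower (p ^ \<epsilon> + p ^ snd x) (natural_rep :: ('k ^ 2 ^ 2, 'k, 'k ^ 2) rep)"
abbreviation "hk x \<equiv> hook (p ^ fst x) (p ^ snd x)"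

text \<open>Dualising and reversing turns \<open>loc\<close> into
  \<open>(l - i) choose (l - j)\<close>, which is \<open>upc\<close> by the symmetry of binomial
  coefficients.\<close>

lemma uprep_upper: "uprep (nabla (hk x) (SU x)) x" and uprep_dual_lower: "uprep (nabla (hk x) (dual_rep SL2 (SL x))) x"
  unfolding uprep_def
  by (rule nabla_upperI[OF wt_model_sym_upper refl])
    (rule nabla_upperI[OF wt_model_dual_ex[OF wt_model_sym_lower] choose_diff])

text \<open>Conversely \<open>upc\<close> becomes \<open>j choose (j - i)\<close>, which equals
  \<open>loc\<close>.\<close>

lemma dprep_dual_upper: "dprep (nabla (hk x) (dual_rep SL2 (SU x))) x" and dprep_lower: "dprep (nabla (hk x) (SL x)) x"
  unfolding dprep_def
  by (rule nabla_dual_upperI[OF wt_model_dual_ex[OF wt_model_sym_upper]], simp add: binomial_symmetric[symmetric])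
    (rule nabla_dual_upperI[OF wt_model_sym_lower refl])

lemma Dinv_1_lower:
  assumes x: "x \<in> prs"
  shows "Dinv (nabla (hk x) (SL x)) h n 1" "Dinv (Delta SL2 (hk x) (SL x)) h n 1"
proof -
  have l: "Suc (p ^ snd x) \<le> p ^ \<epsilon> + p ^ snd x" using snd_pr(4)[OF x] by linarith
  obtain \<Psi> el where "nabla_lower (nabla (hk x) (SL x)) (p ^ \<epsilon> + p ^ snd x) (p ^ fst x) (p ^ snd x) \<Psi> el"
    using nabla_lowerI[OF wt_model_sym_lower refl] by blast
  then show "Dinv (nabla (hk x) (SL x)) h n 1"
    by (rule nabla_lower.Dinv_1[OF _ p refl snd_pr(1)[OF x] l weight(1)[OF x] bounds(4)])
  obtain \<Psi> el where "nabla_dual_lower (nabla (hk x) (dual_rep SL2 (SL x))) (p ^ \<epsilon> + p ^ snd x) (p ^ fst x) (p ^ snd x) \<Psi> el"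
    using nabla_dual_lowerI[OF wt_model_dual_ex[OF wt_model_sym_lower] choose_diff] by blast
  then show "Dinv (Delta SL2 (hk x) (SL x)) h n 1" unfolding Delta_def
    by (rule nabla_dual_lower.Dinv_1[OF _ p refl snd_pr(1)[OF x] l weight(1)[OF x] bounds(4)])
qed

lemma not_Dinv_1_upper:
  assumes x: "x \<in> prs"
  shows "\<not> Dinv (nabla (hk x) (SU x)) h n 1" "\<not> Dinv (Delta SL2 (hk x) (SU x)) h n 1"
proof -
  have "1 < p ^ \<alpha> * p ^ \<beta>" "1 < p ^ \<epsilon>" using snd_pr(3,4,8)[OF x] by linarith+
  then show "\<not> Dinv (nabla (hk x) (SU x)) h n 1" by (intro not_Dinv_uprep[OF uprep_upper x]) simp_all
  show "\<not> Dinv (Delta SL2 (hk x) (SU x)) h n 1"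
    \<comment> \<open>For the dual all exponents are multiples of the leg length, which is at least
      2.\<close>
    using Dinv_dprep(2)[OF dprep_dual_upper x, of 1] snd_pr(3)[OF x] by (auto simp: Delta_def)
qed

lemma nice_all:
  "nice (nabla (hk x) (SU x))" "nice (nabla (hk x) (SL x))" "nice (Delta SL2 (hk x) (SU x))" "nice (Delta SL2 (hk x) (SL x))"
  unfolding Delta_def
  by (rule nice_uprep[OF uprep_upper] nice_dprep[OF dprep_lower] nice_dual[OF nice_dprep[OF dprep_dual_upper]]
      nice_dual[OF nice_uprep[OF uprep_dual_lower]])+

text \<open>Passing to duals turns \<open>\<nabla>\<close> and \<open>\<Delta>\<close> of lower symmetric powers into \<open>\<Delta>\<close> and \<open>\<nabla>\<close> of
  representations with the coordinates of upper symmetric powers.\<close>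

lemma dual_Delta_lower: "rep_isomorphic SL2 (nabla (hk x) (dual_rep SL2 (SL x))) (dual_rep SL2 (Delta SL2 (hk x) (SL x)))"
  unfolding Delta_def by (rule double_dual[OF nice_uprep[OF uprep_dual_lower]])

lemma pairwise_not_isomorphic:
  assumes x: "x \<in> prs" and y: "y \<in> prs"
  shows "(x \<noteq> y \<longrightarrow> \<not> rep_isomorphic SL2 (Delta SL2 (hk x) (SU x)) (Delta SL2 (hk y) (SU y)) \<and>
      \<not> rep_isomorphic SL2 (Delta SL2 (hk x) (SL x)) (Delta SL2 (hk y) (SL y)) \<and>
      \<not> rep_isomorphic SL2 (nabla (hk x) (SU x)) (nabla (hk y) (SU y)) \<and>
      \<not> rep_isomorphic SL2 (nabla (hk x) (SL x)) (nabla (hk y) (SL y))) \<and>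
    \<not> rep_isomorphic SL2 (Delta SL2 (hk x) (SU x)) (Delta SL2 (hk y) (SL y)) \<and>
    \<not> rep_isomorphic SL2 (Delta SL2 (hk x) (SU x)) (nabla (hk y) (SU y)) \<and>
    \<not> rep_isomorphic SL2 (Delta SL2 (hk x) (SU x)) (nabla (hk y) (SL y)) \<and>
    \<not> rep_isomorphic SL2 (Delta SL2 (hk x) (SL x)) (nabla (hk y) (SU y)) \<and>
    \<not> rep_isomorphic SL2 (Delta SL2 (hk x) (SL x)) (nabla (hk y) (SL y)) \<and>
    \<not> rep_isomorphic SL2 (nabla (hk x) (SU x)) (nabla (hk y) (SL y))"
proof (intro conjI impI)
  note one = Dinv_1_lower not_Dinv_1_upper
  show "\<not> rep_isomorphic SL2 (Delta SL2 (hk x) (SU x)) (Delta SL2 (hk y) (SL y))"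
    using Dinv_iso[OF _ nice_all(3,4)] one(2)[OF y] one(4)[OF x] by blast
  show "\<not> rep_isomorphic SL2 (Delta SL2 (hk x) (SU x)) (nabla (hk y) (SL y))"
    using Dinv_iso[OF _ nice_all(3,2)] one(1)[OF y] one(4)[OF x] by blast
  show "\<not> rep_isomorphic SL2 (Delta SL2 (hk x) (SL x)) (nabla (hk y) (SU y))"
    using Dinv_iso[OF _ nice_all(4,1)] one(2)[OF x] one(3)[OF y] by blast
  show "\<not> rep_isomorphic SL2 (nabla (hk x) (SU x)) (nabla (hk y) (SL y))"
    using Dinv_iso[OF _ nice_all(1,2)] one(1)[OF y] one(3)[OF x] by blast
  show "\<not> rep_isomorphic SL2 (Delta SL2 (hk x) (SU x)) (nabla (hk y) (SU y))"
    unfolding Delta_def by (rule not_iso_dual_uprep(1)[OF dprep_dual_upper x uprep_upper y])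
  show "\<not> rep_isomorphic SL2 (Delta SL2 (hk x) (SL x)) (nabla (hk y) (SL y))"
  proof
    assume "rep_isomorphic SL2 (Delta SL2 (hk x) (SL x)) (nabla (hk y) (SL y))"
    \<comment> \<open>Dualising both sides yields a representation with upper coordinates on the
      left and the dual of one with lower coordinates on the right, a pair already separated by the
      leg length.\<close>
    from rep_isomorphic_dual[OF this nice_all(4,2)] rep_isomorphic_trans[OF dual_Delta_lower]
    have "rep_isomorphic SL2 (nabla (hk x) (dual_rep SL2 (SL x))) (dual_rep SL2 (nabla (hk y) (SL y)))" by blast
    then show False using not_iso_dual_uprep(2)[OF dprep_lower y uprep_dual_lower x] by contradiction
  qed
  assume xy: "x \<noteq> y"
  show "\<not> rep_isomorphic SL2 (Delta SL2 (hk x) (SU x)) (Delta SL2 (hk y) (SU y))"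
    unfolding Delta_def by (rule not_iso_dual_dual[OF dprep_dual_upper x dprep_dual_upper y xy])
  show "\<not> rep_isomorphic SL2 (nabla (hk x) (SU x)) (nabla (hk y) (SU y))"
    by (rule not_iso_uprep[OF uprep_upper x uprep_upper y xy])
  show "\<not> rep_isomorphic SL2 (nabla (hk x) (SL x)) (nabla (hk y) (SL y))"
    using rep_isomorphic_dual[OF _ nice_all(2,2)] not_iso_dual_dual[OF dprep_lower x dprep_lower y xy] by blast
  show "\<not> rep_isomorphic SL2 (Delta SL2 (hk x) (SL x)) (Delta SL2 (hk y) (SL y))"
  proof
    assume "rep_isomorphic SL2 (Delta SL2 (hk x) (SL x)) (Delta SL2 (hk y) (SL y))"
    \<comment> \<open>The duals of the two \<open>Delta\<close> are the \<open>nabla\<close> of dual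
      lower powers, which have the coordinates of upper powers, so the swap of arm and leg has been
      settled for them.\<close>
    from rep_isomorphic_trans[OF dual_Delta_lower rep_isomorphic_dual[OF this nice_all(4,4)]]
      rep_isomorphic_sym[OF dual_Delta_lower nice_uprep[OF uprep_dual_lower]]
    have "rep_isomorphic SL2 (nabla (hk x) (dual_rep SL2 (SL x))) (nabla (hk y) (dual_rep SL2 (SL y)))"
      by (rule rep_isomorphic_trans)
    then show False using not_iso_uprep[OF uprep_dual_lower x uprep_dual_lower y xy] by contradiction
  qed
qed

end

theorem theorem1p6:
  fixes p \<alpha> \<beta> \<epsilon> :: nat
  assumes "0 < \<alpha>" and "\<alpha> < \<beta>" and "\<beta> < \<epsilon>"
    and "prime p" and "CHAR('k::field) = p"
    and "finite (UNIV :: 'k set) \<Longrightarrow>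
      int (card (UNIV :: 'k set)) >
        1 + 2 * (int p ^ \<epsilon> + int p ^ \<beta>) * (int p ^ \<alpha> + int p ^ \<beta> + 1) - int p ^ \<alpha> * (int p ^ \<alpha> + 1)"
  shows "let E = natural_rep :: ('k ^ 2 ^ 2, 'k, 'k ^ 2) rep;
      DU = \<lambda>(a, b). Delta SL2 (hook (p ^ a) (p ^ b)) (sym_upper (p ^ \<epsilon> + p ^ b) E);
      DL = \<lambda>(a, b). Delta SL2 (hook (p ^ a) (p ^ b)) (sym_lower (p ^ \<epsilon> + p ^ b) E);
      NU = \<lambda>(a, b). nabla (hook (p ^ a) (p ^ b)) (sym_upper (p ^ \<epsilon> + p ^ b) E);
      NL = \<lambda>(a, b). nabla (hook (p ^ a) (p ^ b)) (sym_lower (p ^ \<epsilon> + p ^ b) E)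
    in \<forall>x \<in> {(\<alpha>, \<beta>), (\<beta>, \<alpha>)}. \<forall>y \<in> {(\<alpha>, \<beta>), (\<beta>, \<alpha>)}.
      (x \<noteq> y \<longrightarrow> \<not> rep_isomorphic SL2 (DU x) (DU y) \<and> \<not> rep_isomorphic SL2 (DL x) (DL y) \<and>
                \<not> rep_isomorphic SL2 (NU x) (NU y) \<and> \<not> rep_isomorphic SL2 (NL x) (NL y)) \<and>
      \<not> rep_isomorphic SL2 (DU x) (DL y) \<and> \<not> rep_isomorphic SL2 (DU x) (NU y) \<and>
      \<not> rep_isomorphic SL2 (DU x) (NL y) \<and> \<not> rep_isomorphic SL2 (DL x) (NU y) \<and>
      \<not> rep_isomorphic SL2 (DL x) (NL y) \<and> \<not> rep_isomorphic SL2 (NU x) (NL y)"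
proof -
  define h where "h = p ^ \<epsilon> * (p ^ \<alpha> + p ^ \<beta> + 1) + p ^ \<alpha> * p ^ \<beta>"
  define n where "n = (p ^ \<epsilon> + p ^ \<beta>) * (p ^ \<alpha> + p ^ \<beta> + 1)"
  have AB: "p ^ \<alpha> \<le> p ^ \<beta>" using assms(2) prime_gt_0_nat[OF assms(4)] by (intro power_increasing) simp_all
  have hn: "h + p ^ \<beta> * (p ^ \<beta> + 1) = n" by (simp add: h_def n_def algebra_simps)
  have A: "p ^ \<alpha> * (p ^ \<alpha> + 1) \<le> p ^ \<beta> * (p ^ \<beta> + 1)" using AB by (intro mult_le_mono) simp_all
  \<comment> \<open>The subtraction in the integer bound is moved to the other side, after which
    everything can be read in natural numbers.\<close>
  have card: "1 + 2 * n < card (UNIV :: 'k set) + p ^ \<alpha> * (p ^ \<alpha> + 1)" if "finite (UNIV :: 'k set)"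
  proof -
    have "int (1 + 2 * n) < int (card (UNIV :: 'k set) + p ^ \<alpha> * (p ^ \<alpha> + 1))"
      using assms(6)[OF that] by (simp add: n_def algebra_simps)
    then show ?thesis by (simp only: of_nat_less_iff)
  qed
  interpret hook_params p \<alpha> \<beta> \<epsilon> h n "TYPE('k)"
  proof (unfold_locales)
    \<comment> \<open>With \<open>A \<le> B\<close> for the two powers,
      \<open>n - h = B (B + 1)\<close> is at least \<open>A (A + 1)\<close>. Hence
      \<open>2 h + 1\<close> and \<open>n\<close> are both at most
      \<open>1 + 2 n - A (A + 1)\<close>.\<close>
    show "Suc (2 * h) < card (UNIV :: 'k set)" "n < card (UNIV :: 'k set)" if "finite (UNIV :: 'k set)"
      using card[OF that] hn A by linarith+
  qed (use assms h_def n_def in auto)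
  show ?thesis
    unfolding Let_def case_prod_beta using pairwise_not_isomorphic by blast
qed

end
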